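(* For fixed $d\in\mathbb{N}$, $\Delta\ge 2$ and $p\in[1,2]$, there is a data structure supporting the following: (i) Maintenance: it maintains a set $\Omega\subset[\Delta]^d$ of $m$ vectors, together with a random rooted weighted tree $T$ (whose distribution depends on $\Omega$) and a non-contracting embedding $\varphi:(\Omega,\ell_p)\to T$ (i.e. $d_T(\varphi(x),\varphi(y))\ge\|x-y\|_p$ for $x,y\in\Omega$) such that for any $x,y\in\Omega$, $$\mathbb{E}_T\big[d_T(\varphi(x),\varphi(y))\big]\le\tilde O(\log(md\Delta))\cdot\|x-y\|_p;$$ (ii) Query: in time $O(d\log(d\Delta))$, given $x\in\Omega$ it returns the weighted path from the root of $T$ to $\varphi(x)$; (iii) Insertions/Deletions: in expected time $O(d\log(d\Delta)+\log^2(d\Delta))$ it adds a vector to or removes a vector from $\Omega$, and (within this time) also returns the updated weighted root-to-leaf paths of every vector of $\Omega$ whose path changed as a result of the update.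
   Context: $[\Delta]=\{1,\dots,\Delta\}$. A rooted weighted tree $T$ induces the tree metric $d_T(u,v)$ = total edge weight of the unique path between nodes $u,v$. $\tilde O(f)$ hides factors polylogarithmic in $f$. *)

theory Defs
  imports "HOL-Probability.Probability"
begin

section \<open>Vectors\<close>

definition grid :: "nat \<Rightarrow> nat \<Rightarrow> nat list set" where
  "grid d \<Delta> = {x. length x = d \<and> set x \<subseteq> {1..\<Delta>}}"

definition lp_dist :: "real \<Rightarrow> nat list \<Rightarrow> nat list \<Rightarrow> real" where
  "lp_dist p x y = (\<Sum>i<length x. \<bar>real (x ! i) - real (y ! i)\<bar> powr p) powr (1 / p)"


section \<open>Rooted weighted trees\<close>

text \<open>The predicate \<open>tree\<close> of the AFP entry \<open>Graph_Theory\<close> only excludes directed cycles, so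
  it does not give unique (undirected) paths; trees are therefore introduced here as undirected
  graphs, an edge being the set of its two endpoints.\<close>

record wtree =
  nodes :: "nat set"
  root :: nat
  edges :: "nat set set"
  weight :: "nat set \<Rightarrow> real"

definition is_path :: "wtree \<Rightarrow> nat \<Rightarrow> nat \<Rightarrow> nat list \<Rightarrow> bool" where
  "is_path T u v p \<longleftrightarrow>
     p \<noteq> [] \<and> hd p = u \<and> last p = v \<and> distinct p \<and> set p \<subseteq> nodes T \<and>
     successively (\<lambda>a b. {a, b} \<in> edges T) p"

definition rooted_weighted_tree :: "wtree \<Rightarrow> bool" where
  "rooted_weighted_tree T \<longleftrightarrow>
     finite (nodes T) \<and> root T \<in> nodes T \<and>
     edges T \<subseteq> {{u, v} |u v. u \<in> nodes T \<and> v \<in> nodes T \<and> u \<noteq> v} \<and>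
     (\<forall>e\<in>edges T. 0 \<le> weight T e) \<and>
     (\<forall>u\<in>nodes T. \<forall>v\<in>nodes T. \<exists>!p. is_path T u v p)"

definition the_path :: "wtree \<Rightarrow> nat \<Rightarrow> nat \<Rightarrow> nat list" where
  "the_path T u v = (THE p. is_path T u v p)"

definition path_steps :: "wtree \<Rightarrow> nat list \<Rightarrow> (nat \<times> real) list" where
  "path_steps T p = map (\<lambda>(a, b). (b, weight T {a, b})) (zip p (tl p))"

definition tree_dist :: "wtree \<Rightarrow> nat \<Rightarrow> nat \<Rightarrow> real" where
  "tree_dist T u v = sum_list (map snd (path_steps T (the_path T u v)))"

definition leaf :: "wtree \<Rightarrow> nat \<Rightarrow> bool" where
  "leaf T v \<longleftrightarrow> v \<in> nodes T \<and> (\<forall>u\<in>nodes T. v \<in> set (the_path T (root T) u) \<longrightarrow> u = v)"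

text \<open>A weighted root-to-node path: the root, followed by each further node together with the
  weight of the edge leading to it.\<close>

type_synonym wpath = "nat \<times> (nat \<times> real) list"

definition weighted_path :: "wtree \<Rightarrow> nat \<Rightarrow> wpath" where
  "weighted_path T v = (root T, path_steps T (the_path T (root T) v))"

definition non_contracting :: "real \<Rightarrow> nat list set \<Rightarrow> wtree \<Rightarrow> (nat list \<Rightarrow> nat) \<Rightarrow> bool" where
  "non_contracting p \<Omega> T \<phi> \<longleftrightarrow>
     (\<forall>x\<in>\<Omega>. \<forall>y\<in>\<Omega>. lp_dist p x y \<le> tree_dist T (\<phi> x) (\<phi> y))"

text \<open>The names of the nodes (memory addresses, say) may depend on the history of the data
  structure, so the law of the tree and its embedding is only considered up to isomorphism.\<close>

definition embedding_iso ::
  "nat list set \<Rightarrow> wtree \<times> (nat list \<Rightarrow> nat) \<Rightarrow> wtree \<times> (nat list \<Rightarrow> nat) \<Rightarrow> bool" where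
  "embedding_iso \<Omega> A B \<longleftrightarrow>
     (case A of (T, \<phi>) \<Rightarrow> case B of (T', \<phi>') \<Rightarrow>
       \<exists>f. bij_betw f (nodes T) (nodes T') \<and> f (root T) = root T' \<and>
           (\<forall>u\<in>nodes T. \<forall>v\<in>nodes T. {u, v} \<in> edges T \<longleftrightarrow> {f u, f v} \<in> edges T') \<and>
           (\<forall>e\<in>edges T. weight T' (f ` e) = weight T e) \<and>
           (\<forall>x\<in>\<Omega>. f (\<phi> x) = \<phi>' x))"

definition iso_class ::
  "nat list set \<Rightarrow> wtree \<times> (nat list \<Rightarrow> nat) \<Rightarrow> (wtree \<times> (nat list \<Rightarrow> nat)) set" where
  "iso_class \<Omega> A = {B. embedding_iso \<Omega> A B}"


section \<open>A randomized word RAM\<close>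

text \<open>Programs of a word RAM with words of \<open>w\<close> bits: finitely many registers (those occurring in
  the program), a memory of \<open>2 ^ w\<close> words, unit-cost word arithmetic, comparison and bit
  operations, indirect addressing, uniformly random words, a read-once input and an append-only
  output.\<close>

datatype binop = Plus | Minus | Times | Div | Mod | Less | Equal | And | Or | Xor | Shl | Shr

datatype com =
    Skip
  | Const nat nat
  | Bin binop nat nat nat
  | Load nat nat
  | Store nat nat
  | Rand nat
  | Read nat
  | Write nat
  | Seq com com
  | Cond nat com com
  | While nat com

record state =
  reg :: "nat \<Rightarrow> nat"
  mem :: "nat \<Rightarrow> nat"
  inp :: "nat list"
  out :: "nat list"
  time :: nat

definition tick :: "state \<Rightarrow> state" where
  "tick s = s\<lparr>time := Suc (time s)\<rparr>"

definition set_reg :: "nat \<Rightarrow> nat \<Rightarrow> state \<Rightarrow> state" where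
  "set_reg r a s = s\<lparr>reg := (reg s)(r := a)\<rparr>"

text \<open>Words are natural numbers below \<open>2 ^ w\<close>; arithmetic is modulo \<open>2 ^ w\<close>.\<close>

fun binop_word :: "nat \<Rightarrow> binop \<Rightarrow> nat \<Rightarrow> nat \<Rightarrow> nat" where
  "binop_word w Plus a b = (a + b) mod 2 ^ w"
| "binop_word w Minus a b = (a + (2 ^ w - b)) mod 2 ^ w"
| "binop_word w Times a b = (a * b) mod 2 ^ w"
| "binop_word w Div a b = a div b"
| "binop_word w Mod a b = a mod b"
| "binop_word w Less a b = (if a < b then 1 else 0) mod 2 ^ w"
| "binop_word w Equal a b = (if a = b then 1 else 0) mod 2 ^ w"
| "binop_word w And a b = Bit_Operations.and a b"
| "binop_word w Or a b = Bit_Operations.or a b"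
| "binop_word w Xor a b = Bit_Operations.xor a b"
| "binop_word w Shl a b = (a * 2 ^ b) mod 2 ^ w"
| "binop_word w Shr a b = a div 2 ^ b"

partial_function (spmf) loop ::
  "(state \<Rightarrow> bool) \<Rightarrow> (state \<Rightarrow> state spmf) \<Rightarrow> state \<Rightarrow> state spmf" where
  "loop g b s = (if g s then bind_spmf (b s) (loop g b) else return_spmf s)"

text \<open>Every instruction and every test of a branch or loop costs one time unit. Mass missing from
  the resulting subprobability distribution is the probability of divergence.\<close>

primrec exec :: "nat \<Rightarrow> com \<Rightarrow> state \<Rightarrow> state spmf" where
  "exec w Skip s = return_spmf (tick s)"
| "exec w (Const r n) s = return_spmf (tick (set_reg r (n mod 2 ^ w) s))"
| "exec w (Bin f r a b) s =
     return_spmf (tick (set_reg r (binop_word w f (reg s a) (reg s b)) s))"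
| "exec w (Load r a) s = return_spmf (tick (set_reg r (mem s (reg s a)) s))"
| "exec w (Store a r) s = return_spmf (tick (s\<lparr>mem := (mem s)(reg s a := reg s r)\<rparr>))"
| "exec w (Rand r) s = map_spmf (\<lambda>n. tick (set_reg r n s)) (spmf_of_set {..<2 ^ w})"
| "exec w (Read r) s = return_spmf (tick (case inp s of
       [] \<Rightarrow> set_reg r 0 s
     | n # ns \<Rightarrow> set_reg r (n mod 2 ^ w) (s\<lparr>inp := ns\<rparr>)))"
| "exec w (Write r) s = return_spmf (tick (s\<lparr>out := out s @ [reg s r]\<rparr>))"
| "exec w (Seq c1 c2) s = bind_spmf (exec w c1 s) (exec w c2)"
| "exec w (Cond r c1 c2) s = (if reg s r \<noteq> 0 then exec w c1 (tick s) else exec w c2 (tick s))"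
| "exec w (While r c) s =
     map_spmf tick (loop (\<lambda>s. reg s r \<noteq> 0) (\<lambda>s. exec w c (tick s)) s)"


section \<open>Dynamic data structures\<close>

record data_structure =
  init_prog :: com
  query_prog :: com
  insert_prog :: com
  delete_prog :: com

datatype operation = Query "nat list" | Insert "nat list" | Delete "nat list"

fun prog_of :: "data_structure \<Rightarrow> operation \<Rightarrow> com" where
  "prog_of D (Query x) = query_prog D"
| "prog_of D (Insert x) = insert_prog D"
| "prog_of D (Delete x) = delete_prog D"

fun arg_of :: "operation \<Rightarrow> nat list" where
  "arg_of (Query x) = x"
| "arg_of (Insert x) = x"
| "arg_of (Delete x) = x"

definition init_state :: state where
  "init_state = \<lparr>reg = \<lambda>_. 0, mem = \<lambda>_. 0, inp = [], out = [], time = 0\<rparr>"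

text \<open>An operation starts with the memory and registers left by its predecessor, so that the
  \<open>out\<close> and \<open>time\<close> components of its final states are its own output and running time.\<close>

definition run_op :: "nat \<Rightarrow> data_structure \<Rightarrow> operation \<Rightarrow> state \<Rightarrow> state spmf" where
  "run_op w D u s = exec w (prog_of D u) (s\<lparr>inp := arg_of u, out := [], time := 0\<rparr>)"

definition run_ops :: "nat \<Rightarrow> data_structure \<Rightarrow> operation list \<Rightarrow> state spmf" where
  "run_ops w D us =
     foldl (\<lambda>L u. bind_spmf L (run_op w D u)) (exec w (init_prog D) init_state) us"

fun apply_op :: "operation \<Rightarrow> nat list set \<Rightarrow> nat list set" where
  "apply_op (Query x) \<Omega> = \<Omega>"
| "apply_op (Insert x) \<Omega> = insert x \<Omega>"
| "apply_op (Delete x) \<Omega> = \<Omega> - {x}"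

definition contents :: "operation list \<Rightarrow> nat list set" where
  "contents us = fold apply_op us {}"

text \<open>The histories for which words of \<open>w\<close> bits are long enough: \<open>w\<close> is at least \<open>c\<close> times the
  binary logarithm of \<open>m d \<Delta>\<close>, for every size \<open>m\<close> that the set attains. A history is fixed in
  advance, i.e. it does not depend on the random choices of the data structure.\<close>

definition admissible :: "nat \<Rightarrow> nat \<Rightarrow> nat \<Rightarrow> nat \<Rightarrow> operation list \<Rightarrow> bool" where
  "admissible c w d \<Delta> us \<longleftrightarrow>
     (\<forall>n<length us. arg_of (us ! n) \<in> grid d \<Delta> \<and>
        (\<forall>x. us ! n = Query x \<longrightarrow> x \<in> contents (take n us))) \<and>
     (\<forall>n\<le>length us. (max 1 (card (contents (take n us))) * d * \<Delta>) ^ c \<le> 2 ^ w)"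


section \<open>Output formats\<close>

text \<open>A weighted path is written as its number of edges, its first node and, for every further
  node, three words: the node and the numerator and denominator of the weight of the edge
  leading to it.\<close>

definition encodes_path :: "nat list \<Rightarrow> wpath \<Rightarrow> bool" where
  "encodes_path ws P \<longleftrightarrow>
     (\<exists>es. ws = length es # fst P # concat (map (\<lambda>(v, a, b). [v, a, b]) es) \<and>
           (\<forall>(v, a, b)\<in>set es. b \<noteq> 0) \<and>
           snd P = map (\<lambda>(v, a, b). (v, real a / real b)) es)"

text \<open>A report on a set \<open>X\<close> of vectors lists, in some order and without repetition, the
  coordinates of each vector of \<open>X\<close> followed by its weighted path.\<close>

definition encodes_report :: "nat list \<Rightarrow> nat list set \<Rightarrow> (nat list \<Rightarrow> wpath) \<Rightarrow> bool" where
  "encodes_report ws X P \<longleftrightarrow>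
     (\<exists>xs g. distinct xs \<and> set xs = X \<and> ws = concat (map (\<lambda>x. x @ g x) xs) \<and>
             (\<forall>x\<in>X. encodes_path (g x) (P x)))"


section \<open>Soft-O bounds\<close>

text \<open>\<open>soft k f\<close> is \<open>f\<close> times a power of its logarithm, shifted so that the logarithmic factor is
  at least 1 for all \<open>f \<ge> 0\<close>.\<close>

definition soft :: "nat \<Rightarrow> real \<Rightarrow> real" where
  "soft k f = f * (1 + ln (1 + f)) ^ k"

end

(* Cut probabilities of random hash functions are comparable to lp distances, so nested hash tuples give a random
hierarchy of cells; a random priority order picks a representative in each cell. Nodes are pairs (representative,
level), weighted by rounded distances of consecutive representatives: the triangle inequality makes this
non-contracting, and averaging over cells bounds the expected stretch. A derandomised Chernoff bound replaces the
randomness by 2^N seeds. The RAM program keeps the cells in circular lists and rewrites only those cells whose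
representative changes, in expectation O(log(d Delta)) vectors. *)
theory Submission
 imports Defs
begin

text \<open>The program is fixed once d, \<Delta> and p are, before the word length is known. So
  hash labels and permutations of all grid vectors can be compiled into it as constants, selected by
  a decision tree on the seed bits and the coordinates; no hash function is evaluated at run time.
  The price is one step per seed bit, so only O(d log(d \<Delta>)) random bits are affordable. This
  many suffice: a union bound over all subsets of the grid and all pairs of points asks for about
  \<Delta>^d * \<Delta>^d samples up to a polynomial in d \<Delta>, and the logarithm of that number
  is O(d log(d \<Delta>)). The probabilistic obstacle is the stretch: an edge at level i is paid for
  when two points separate just below it, an event correlated with the cell whose representative
  sets the price. It is overcome by revealing the separating hash first and averaging over the
  remaining ones. Uniformity in p, where geometric series degenerate into plain counts at p = 1 and
  at p = 2, is obtained by keeping their partial sums as factors of the normalising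
  constant.\<close>

abbreviation (input) iff_ascii (infixr "<->" 25) where "A <-> B == (A = B)"

type_synonym vec = "nat list"
type_synonym hsh = "nat \<times> nat => vec => int"
type_synonym seed = "(nat => vec => nat) \<times> (vec => vec)"

section \<open>Expectations under finitely supported distributions\<close>

abbreviation expec :: "'a pmf => ('a => real) => real" where
 "expec M f == measure_pmf.expectation M f"

abbreviation "dif x y == %g. of_bool (g x ~= g y) :: real"

abbreviation "rc A == real (card A)"

text \<open>Finite support makes every real function integrable, so linearity, monotonicity and
  iterated expectations hold without analytic side conditions.\<close>

definition fin_pmf :: "'a pmf => bool" where
 "fin_pmf M <-> finite (set_pmf M)"

lemma fin_integrable: "fin_pmf M ==> integrable (measure_pmf M) (f :: 'a => real)"
 by (simp add: fin_pmf_def integrable_measure_pmf_finite)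

lemma expec_mono:
 assumes "fin_pmf M" "!!x. x : set_pmf M ==> f x <= g x"
 shows "expec M f <= expec M g"
 using assms by (intro integral_mono_AE fin_integrable) (auto simp: AE_measure_pmf_iff)

lemma expec_cong:
 assumes "!!x. x : set_pmf M ==> f x = g x"
 shows "expec M f = expec M g"
 using assms by (intro integral_cong_AE) (auto simp: AE_measure_pmf_iff)

lemma expec_sum:
 assumes "fin_pmf M"
 shows "expec M (%x. SUM i:A. f i x) = (SUM i:A. expec M (f i))"
 using assms by (simp add: fin_integrable)

lemma expec_nonneg: "(!!x. x : set_pmf M ==> 0 <= f x) ==> 0 <= expec M f"
 by (rule integral_nonneg_AE) (auto simp: AE_measure_pmf_iff)

lemma expec_diff: "fin_pmf M ==> expec M (%x. f x - g x) = expec M f - expec M g"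
 by (simp add: fin_integrable)

lemma fin_pmf_bind: "fin_pmf M ==> (!!x. x : set_pmf M ==> fin_pmf (K x)) ==> fin_pmf (bind_pmf M K)"
 by (simp add: fin_pmf_def set_bind_pmf)

lemma fin_pmf_return: "fin_pmf (return_pmf x)"
 by (simp add: fin_pmf_def)

lemma fin_pmf_map: "fin_pmf M ==> fin_pmf (map_pmf f M)"
 by (simp add: fin_pmf_def)

lemma fin_pmf_pair: "fin_pmf M ==> fin_pmf N ==> fin_pmf (pair_pmf M N)"
 by (simp add: fin_pmf_def)

lemma fin_pmf_of_set: "finite A ==> A ~= {} ==> fin_pmf (pmf_of_set A)"
 by (simp add: fin_pmf_def)

lemma fin_pmf_Pi: "finite I ==> (!!i. i : I ==> fin_pmf (p i)) ==> fin_pmf (Pi_pmf I dflt p)"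
 unfolding fin_pmf_def by (subst set_Pi_pmf) (auto intro!: finite_PiE_dflt)

lemma expec_bind:
 assumes "fin_pmf M" "!!x. x : set_pmf M ==> fin_pmf (K x)"
 shows "expec (bind_pmf M K) f = expec M (%x. expec (K x) f)"
 using assms unfolding fin_pmf_def
 by (subst pmf_expectation_bind[of "set_pmf M"])
 (auto simp: integral_measure_pmf_real[where A="set_pmf M"] mult.commute)

lemma expec_pair:
 assumes "fin_pmf M" "fin_pmf N"
 shows "expec (pair_pmf M N) f = expec M (%x. expec N (%y. f (x, y)))"
 unfolding pair_pmf_def using assms
 by (simp add: expec_bind fin_pmf_bind fin_pmf_return)

lemma expec_Pi_insert:
 assumes "finite I" "i ~: I" "!!j. j : insert i I ==> fin_pmf (p j)"
 shows "expec (Pi_pmf (insert i I) dflt p) f = expec (p i) (%y. expec (Pi_pmf I dflt p) (%g. f (g(i := y))))"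
 using assms by (simp add: Pi_pmf_insert' expec_bind fin_pmf_bind fin_pmf_return fin_pmf_Pi)

lemma ex_pmf_weights:
 fixes w :: "'a => real"
 assumes "finite A" "!!x. x : A ==> 0 <= w x" "sum w A = 1"
 obtains q where "set_pmf q <= A" "!!f. expec q f = (SUM x:A. w x * f x)"
proof -
 define f where "f x = (if x : A then w x else 0)" for x
 have *: "(\<integral>\<^sup>+ x. ennreal (f x) \<partial>count_space UNIV) = 1"
 using assms
 by (subst nn_integral_count_space'[of A]) (auto simp: f_def simp flip: ennreal_1)
 define q where "q = embed_pmf f"
 have pq: "pmf q x = f x" for x
 unfolding q_def by (rule pmf_embed_pmf) (use * assms in "auto simp: f_def")
 show thesis
 proof
 show sub: "set_pmf q <= A"
 by (auto simp: set_pmf_iff pq f_def split: if_splits)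
 show "expec q g = (SUM x:A. w x * g x)" for g
 using sub assms(1) by (subst integral_measure_pmf_real[of A]) (auto simp: pq f_def mult.commute)
 qed
qed

section \<open>Separation of two integers by a randomly shifted grid\<close>

lemma card_shift_sep:
 fixes a b P :: int
 assumes "0 < P" "a <= b"
 shows "int (card {u : {0..<P}. (a + u) div P ~= (b + u) div P}) = min P (b - a)"
proof -
 define c where "c = b - a"
 have c: "0 <= c" using assms by (simp add: c_def)
 have inj: "inj_on (%u. (a + u) mod P) {0..<P}"
 proof (rule inj_onI)
 fix u v assume uv: "u : {0..<P}" "v : {0..<P}" "(a + u) mod P = (a + v) mod P"
 hence "P dvd (a + u) - (a + v)" by (simp add: mod_eq_dvd_iff)
 hence "P dvd u - v" by (simp add: algebra_simps)
 with uv show "u = v"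
 by (metis atLeastLessThan_iff dvd_minus_mod minus_mod_self2 mod_eq_dvd_iff mod_pos_pos_trivial)
 qed
 have img: "(%u. (a + u) mod P) ` {0..<P} = {0..<P}"
 by (rule endo_inj_surj) (use inj assms in auto)
 \<comment> \<open>The points fall into different blocks exactly when the remainder of the lower one
   is within c of the end of its block. Over one period of u this remainder permutes the residues,
   so it remains to count residues; if c reaches P all of them qualify, which explains the
   minimum.\<close>
 have iff: "(a + u) div P ~= (b + u) div P <-> P - c <= (a + u) mod P" for u
 proof -
 define q r where "q = (a + u) div P" and "r = (a + u) mod P"
 have r: "0 <= r" "r < P" using assms by (auto simp: r_def)
 have "b + u = q * P + (r + c)"
 using div_mult_mod_eq[of "a + u" P] by (simp add: q_def r_def c_def)
 hence 1: "(b + u) div P = q + (r + c) div P" using assms by simp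
 have 2: "(r + c) div P = 0 <-> r + c < P"
 using r c assms by (auto simp: zdiv_eq_0_iff)
 show ?thesis using 1 2 unfolding q_def[symmetric] r_def[symmetric] by auto
 qed
 have "bij_betw (%u. (a + u) mod P) {u : {0..<P}. P - c <= (a + u) mod P} {r : {0..<P}. P - c <= r}"
 unfolding bij_betw_def
 proof
 show "inj_on (%u. (a + u) mod P) {u : {0..<P}. P - c <= (a + u) mod P}"
 using inj by (rule inj_on_subset) auto
 show "(%u. (a + u) mod P) ` {u : {0..<P}. P - c <= (a + u) mod P} = {r : {0..<P}. P - c <= r}"
 proof (intro equalityI subsetI)
 fix r assume r: "r : {r : {0..<P}. P - c <= r}"
 then obtain u where "u : {0..<P}" "r = (a + u) mod P"
 using img by (metis (no_types, lifting) image_iff mem_Collect_eq)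
 thus "r : (%u. (a + u) mod P) ` {u : {0..<P}. P - c <= (a + u) mod P}"
 using r by (intro image_eqI[of _ _ u]) auto
 qed (use assms in auto)
 qed
 hence "card {u : {0..<P}. P - c <= (a + u) mod P} = card {r : {0..<P}. P - c <= r}"
 by (rule bij_betw_same_card)
 also have "{r : {0..<P}. P - c <= r} = {max 0 (P - c)..<P}" by auto
 finally have "int (card {u : {0..<P}. P - c <= (a + u) mod P}) = min P c"
 using assms c by auto
 thus ?thesis by (simp add: iff c_def)
qed

lemma expec_shift_sep:
 fixes a b P :: int
 assumes "0 < P"
 shows "expec (pmf_of_set {0..<P}) (%u. of_bool ((a + u) div P ~= (b + u) div P)) =
 min 1 (\<bar>real_of_int a - real_of_int b\<bar> / real_of_int P)"
proof -
 have *: "expec (pmf_of_set {0..<P}) (%u. of_bool ((a + u) div P ~= (b + u) div P)) =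
 min 1 (\<bar>real_of_int a - real_of_int b\<bar> / real_of_int P)" if "a <= b" for a b
 proof -
 have "expec (pmf_of_set {0..<P}) (%u. of_bool ((a + u) div P ~= (b + u) div P)) =
 (SUM u:{0..<P}. of_bool ((a + u) div P ~= (b + u) div P)) / rc {0..<P}"
 using assms by (subst integral_pmf_of_set) auto
 also have "(SUM u:{0..<P}. of_bool ((a + u) div P ~= (b + u) div P) :: real) =
 real (card {u : {0..<P}. (a + u) div P ~= (b + u) div P})"
 by (simp add: sum.If_cases of_bool_def Int_def)
 also have "... = real_of_int (min P (b - a))"
 by (simp flip: card_shift_sep[OF assms that])
 finally show ?thesis using assms that by (auto simp: min_def field_simps)
 qed
 show ?thesis
 proof (cases "a <= b")
 case False
 hence "b <= a" by simp
 from *[OF this] have "expec (pmf_of_set {0..<P}) (%u. of_bool ((b + u) div P ~= (a + u) div P)) =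
 min 1 (\<bar>real_of_int a - real_of_int b\<bar> / real_of_int P)" by (simp add: abs_minus_commute)
 moreover have "(%u. of_bool ((b + u) div P ~= (a + u) div P)) = (%u. of_bool ((a + u) div P ~= (b + u) div P) :: real)"
 by (rule ext, rule arg_cong[of _ _ of_bool]) auto
 ultimately show ?thesis by simp
 qed (rule *)
qed

section \<open>Random signs and truncated Khintchine inequalities\<close>

definition sgn_pmf :: "int pmf" where "sgn_pmf = pmf_of_set {-1, 1}"

lemma fin_sgn_pmf: "fin_pmf sgn_pmf"
 unfolding sgn_pmf_def by (rule fin_pmf_of_set) auto

lemma expec_sgn: "expec sgn_pmf f = (f 1 + f (-1)) / 2"
 unfolding sgn_pmf_def by (subst integral_pmf_of_set) auto

abbreviation signs :: "'i set => ('i => int) pmf" where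
 "signs I == Pi_pmf I 0 (%_. sgn_pmf)"

lemma fin_signs: "finite I ==> fin_pmf (signs I)"
 by (rule fin_pmf_Pi) (auto simp: fin_sgn_pmf)

lemma sum_upd_notin: "i ~: I ==> (SUM k:I. real_of_int (if k = i then y else g k) * b k) = (SUM k:I. real_of_int (g k) * b k)"
 by (rule sum.cong) auto

text \<open>Splitting off one sign averages over two opposite shifts of the remaining sum, which
  kills the odd powers. The constant 3, that of a Gaussian, is just what completes the square in the
  induction step for the fourth moment.\<close>

lemma sign_sum_moments:
 fixes b :: "'i => real"
 assumes "finite I"
 shows "expec (signs I) (%e. (SUM i:I. e i * b i)\<^sup>2) = (SUM i:I. (b i)\<^sup>2)"
 and "expec (signs I) (%e. (SUM i:I. e i * b i) ^ 4) <= 3 * (SUM i:I. (b i)\<^sup>2)\<^sup>2"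
proof -
 have "expec (signs I) (%e. (SUM i:I. e i * b i)\<^sup>2) = (SUM i:I. (b i)\<^sup>2) &
 expec (signs I) (%e. (SUM i:I. e i * b i) ^ 4) <= 3 * (SUM i:I. (b i)\<^sup>2)\<^sup>2"
 using assms
 proof (induction I)
 case empty
 show ?case by simp
 next
 case (insert x F)
 define th where "th e = (SUM i:F. real_of_int (e i) * b i)" for e
 define Y where "Y = (SUM i:F. (b i)\<^sup>2)"
 have ins: "expec (signs (insert x F)) (%e. h (SUM i:insert x F. e i * b i)) =
 expec (signs F) (%e. (h (b x + th e) + h (- b x + th e)) / 2)" for h :: "real => real"
 using insert.hyps
 by (simp add: expec_Pi_insert fin_sgn_pmf sum_upd_notin expec_sgn th_def fin_signs fin_integrable add_divide_distrib)
 have fF: "fin_pmf (signs F)" using insert.hyps by (simp add: fin_signs)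
 have e2: "((b x + t)\<^sup>2 + (- b x + t)\<^sup>2) / 2 = (b x)\<^sup>2 + t^2" for t
 by (simp add: power2_eq_square field_simps)
 have e4: "((b x + t) ^ 4 + (- b x + t) ^ 4) / 2 = t ^ 4 + 6 * (b x)\<^sup>2 * t^2 + (b x) ^ 4" for t
 by (simp add: power2_eq_square power4_eq_xxxx field_simps)
 have IH: "expec (signs F) (%e. (th e)\<^sup>2) = Y" "expec (signs F) (%e. (th e) ^ 4) <= 3 * Y^2"
 using insert.IH by (auto simp: th_def Y_def)
 have 1: "expec (signs (insert x F)) (%e. (SUM i:insert x F. e i * b i)\<^sup>2) = (b x)\<^sup>2 + Y"
 using ins[of "%t. t\<^sup>2"] IH fF unfolding e2 by (simp add: fin_integrable)
 have "expec (signs (insert x F)) (%e. (SUM i:insert x F. e i * b i) ^ 4) =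
 expec (signs F) (%e. (th e) ^ 4) + 6 * (b x)\<^sup>2 * Y + (b x) ^ 4"
 using ins[of "%t. t ^ 4"] IH fF unfolding e4 by (simp add: fin_integrable)
 also have "... <= 3 * Y^2 + 6 * (b x)\<^sup>2 * Y + 3 * (b x) ^ 4"
 proof -
 have "0 <= (b x) ^ 4" by simp
 thus ?thesis using IH(2) by linarith
 qed
 also have "... = 3 * ((b x)\<^sup>2 + Y)\<^sup>2"
 by (simp add: power2_eq_square power4_eq_xxxx field_simps)
 finally show ?case using 1 insert.hyps by (simp add: Y_def)
 qed
 thus "expec (signs I) (%e. (SUM i:I. e i * b i)\<^sup>2) = (SUM i:I. (b i)\<^sup>2)"
 and "expec (signs I) (%e. (SUM i:I. e i * b i) ^ 4) <= 3 * (SUM i:I. (b i)\<^sup>2)\<^sup>2" by auto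
qed

text \<open>A minorant of the truncated absolute value that involves second and fourth powers only
  and touches 1 at t^2 = 4. It turns moment bounds into a lower bound on an expectation.\<close>

lemma min_abs_quartic: "t\<^sup>2 / 2 - t ^ 4 / 16 <= min 1 \<bar>t :: real\<bar>"
proof -
 have a: "t\<^sup>2 / 2 - t ^ 4 / 16 <= 1"
 proof -
 have "0 <= (t^2 / 4 - 1)\<^sup>2" by simp
 thus ?thesis by (simp add: power2_eq_square power4_eq_xxxx field_simps)
 qed
 have b: "t\<^sup>2 / 2 - t ^ 4 / 16 <= \<bar>t\<bar>" 
 proof (cases "\<bar>t\<bar> <= 1")
 case True
 hence "\<bar>t\<bar> * \<bar>t\<bar> <= \<bar>t\<bar> * 1" by (intro mult_left_mono) auto
 hence "t\<^sup>2 <= \<bar>t\<bar>" by (simp add: power2_eq_square)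
 moreover have "0 <= t ^ 4" by (simp add: zero_le_even_power)
 ultimately show ?thesis using zero_le_power2[of t] by linarith
 next
 case False
 with a show ?thesis by linarith
 qed
 from a b show ?thesis by simp
qed

text \<open>The upper bound linearises the absolute value by the inequality of arithmetic and
  geometric means at its typical size. The lower bound applies the quartic minorant after division
  by the standard deviation, where the two moments give 1/2 - 3/16 = 5/16.\<close>

lemma truncated_khintchine:
 fixes b :: "'i => real"
 assumes "finite I"
 defines "Y == (SUM i:I. (b i)\<^sup>2)"
 shows "expec (signs I) (%e. min 1 \<bar>SUM i:I. e i * b i\<bar>) <= min 1 (sqrt Y)"
 and "5 / 16 * min 1 (sqrt Y) <= expec (signs I) (%e. min 1 \<bar>SUM i:I. e i * b i\<bar>)"
proof -
 have fI: "fin_pmf (signs I)" using assms by (simp add: fin_signs)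
 define th where "th e = (SUM i:I. real_of_int (e i) * b i)" for e
 have m2: "expec (signs I) (%e. (th e)\<^sup>2) = Y" and m4: "expec (signs I) (%e. (th e) ^ 4) <= 3 * Y^2"
 using sign_sum_moments[OF assms(1), of b] by (auto simp: th_def Y_def)
 have Y0: "0 <= Y" unfolding Y_def by (intro sum_nonneg) auto
 have u1: "expec (signs I) (%e. min 1 \<bar>th e\<bar>) <= 1"
 using expec_mono[OF fI, of "%e. min 1 \<bar>th e\<bar>" "%_. 1"] by simp
 have u2: "expec (signs I) (%e. min 1 \<bar>th e\<bar>) <= sqrt Y"
 proof (cases "Y = 0")
 case True
 \<comment> \<open>For Y = 0 the splitting point degenerates; an arbitrary positive
   \<open>ep\<close> takes its place and is sent to 0 afterwards.\<close>
 have "expec (signs I) (%e. min 1 \<bar>th e\<bar>) <= expec (signs I) (%e. ep + (th e)\<^sup>2 / ep)" if "0 < ep" for ep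
 proof (rule expec_mono[OF fI])
 fix e
 have "0 <= (\<bar>th e\<bar> - ep)\<^sup>2 + \<bar>th e\<bar> * ep" using that by simp
 hence "\<bar>th e\<bar> * ep <= ep^2 + (th e)\<^sup>2" by (simp add: power2_eq_square algebra_simps)
 hence "\<bar>th e\<bar> <= ep + (th e)\<^sup>2 / ep" using that by (simp add: field_simps power2_eq_square)
 thus "min 1 \<bar>th e\<bar> <= ep + (th e)\<^sup>2 / ep" by simp
 qed
 also have "expec (signs I) (%e. ep + (th e)\<^sup>2 / ep) = ep" for ep :: real
 using fI m2 True by (simp add: fin_integrable)
 finally have "expec (signs I) (%e. min 1 \<bar>th e\<bar>) <= 0 + ep" if "0 < ep" for ep
 using that by simp
 hence "expec (signs I) (%e. min 1 \<bar>th e\<bar>) <= 0" by (rule field_le_epsilon)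
 thus ?thesis using True by simp
 next
 case False
 hence Yp: "0 < sqrt Y" using Y0 by simp
 have "expec (signs I) (%e. min 1 \<bar>th e\<bar>) <= expec (signs I) (%e. sqrt Y / 2 + (th e)\<^sup>2 / (2 * sqrt Y))"
 proof (rule expec_mono[OF fI])
 fix e
 have "0 <= (\<bar>th e\<bar> - sqrt Y)\<^sup>2" by simp
 hence "\<bar>th e\<bar> <= sqrt Y / 2 + (th e)\<^sup>2 / (2 * sqrt Y)"
 using Yp by (simp add: power2_eq_square field_simps)
 thus "min 1 \<bar>th e\<bar> <= sqrt Y / 2 + (th e)\<^sup>2 / (2 * sqrt Y)" by simp
 qed
 also have "... = sqrt Y / 2 + Y / (2 * sqrt Y)" using fI m2 by (simp add: fin_integrable)
 also have "... = sqrt Y" using Y0 Yp by (simp add: real_div_sqrt field_simps)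
 finally show ?thesis .
 qed
 from u1 u2 show "expec (signs I) (%e. min 1 \<bar>SUM i:I. e i * b i\<bar>) <= min 1 (sqrt Y)"
 by (simp add: th_def)
 have "5 / 16 * min 1 (sqrt Y) <= expec (signs I) (%e. min 1 \<bar>th e\<bar>)"
 proof (cases "Y = 0")
 case True
 thus ?thesis by (simp add: expec_nonneg)
 next
 case False
 define r where "r = sqrt Y"
 \<comment> \<open>With m <= 1 and m <= r, the product of m with min 1 of t =
   \<open>th e / r\<close> lies below min 1 of \<open>th e\<close>, so the minorant can be applied
   in the rescaled variable.\<close>
 define m where "m = min 1 r"
 have r: "0 < r" "r\<^sup>2 = Y" using False Y0 by (auto simp: r_def)
 have m: "0 < m" "m <= 1" "m <= r" using r by (auto simp: m_def)
 have "5 / 16 * m <= m * (Y / (2 * r^2) - 3 * Y^2 / (16 * r ^ 4))"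
 proof -
 have "r ^ 4 = Y^2" using r by (metis power2_eq_square power4_eq_xxxx mult.assoc)
 thus ?thesis using False r by simp
 qed
 also have "... <= m * (Y / (2 * r^2) - expec (signs I) (%e. (th e) ^ 4) / (16 * r ^ 4))"
 using m r m4 by (intro mult_left_mono diff_left_mono divide_right_mono) auto
 also have "... = expec (signs I) (%e. m * ((th e)\<^sup>2 / (2 * r^2) - (th e) ^ 4 / (16 * r ^ 4)))"
 using fI m2 by (simp add: fin_integrable)
 also have "... <= expec (signs I) (%e. min 1 \<bar>th e\<bar>)"
 proof (rule expec_mono[OF fI])
 fix e
 define t where "t = th e / r"
 have "m * ((th e)\<^sup>2 / (2 * r^2) - (th e) ^ 4 / (16 * r ^ 4)) = m * (t^2 / 2 - t ^ 4 / 16)"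
 by (simp add: t_def power_divide mult.commute)
 also have "... <= m * min 1 \<bar>t\<bar>" using m min_abs_quartic[of t] by (intro mult_left_mono) auto
 also have "... = min m (m * \<bar>t\<bar>)" using m by (simp add: min_mult_distrib_left)
 also have "... <= min 1 (r * \<bar>t\<bar>)" using m by (intro min.mono mult_right_mono) auto
 also have "r * \<bar>t\<bar> = \<bar>th e\<bar>" using r by (simp add: t_def abs_divide)
 finally show "m * ((th e)\<^sup>2 / (2 * r^2) - (th e) ^ 4 / (16 * r ^ 4)) <= min 1 \<bar>th e\<bar>" .
 qed
 finally show ?thesis by (simp add: m_def r_def)
 qed
 thus "5 / 16 * min 1 (sqrt Y) <= expec (signs I) (%e. min 1 \<bar>SUM i:I. e i * b i\<bar>)"
 by (simp add: th_def)
qed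

section \<open>Truncated sums of independent variables\<close>

lemma truncated_sum_upper:
 assumes "finite I" "!!i. i : I ==> fin_pmf (q i)"
 "!!i y. i : I ==> 0 <= h i y" "0 <= (be::real)"
 shows "expec (Pi_pmf I dflt q) (%g. min (SUM i:I. h i (g i)) be) <= 
 min be (SUM i:I. expec (q i) (%y. min (h i y) be))"
proof -
 have fI: "fin_pmf (Pi_pmf I dflt q)" using assms by (intro fin_pmf_Pi)
 have le: "min (SUM i:J. h i (g i)) be <= (SUM i:J. min (h i (g i)) be)" if "finite J" "J <= I" for g J
 using that
 proof (induction J)
 case (insert x F)
 have "0 <= (SUM i:F. min (h i (g i)) be)"
 using insert.prems assms(3,4) by (intro sum_nonneg) auto
 moreover have "0 <= h x (g x)" using insert.prems assms(3) by auto
 moreover have "min (SUM i:F. h i (g i)) be <= (SUM i:F. min (h i (g i)) be)"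
 using insert by auto
 ultimately show ?case using insert.hyps assms(4) by (simp add: min_def split: if_splits)
 qed (use assms in auto)
 have "expec (Pi_pmf I dflt q) (%g. min (SUM i:I. h i (g i)) be) <= expec (Pi_pmf I dflt q) (%g. (SUM i:I. min (h i (g i)) be))"
 using le[OF assms(1)] by (intro expec_mono fI) auto
 also have "... = (SUM i:I. expec (Pi_pmf I dflt q) (%g. min (h i (g i)) be))"
 by (rule expec_sum[OF fI])
 also have "... = (SUM i:I. expec (q i) (%y. min (h i y) be))"
 proof (rule sum.cong[OF refl])
 fix i assume i: "i : I"
 have "expec (Pi_pmf I dflt q) (%g. min (h i (g i)) be) = expec (map_pmf (%g. g i) (Pi_pmf I dflt q)) (%y. min (h i y) be)"
 by simp
 thus "expec (Pi_pmf I dflt q) (%g. min (h i (g i)) be) = expec (q i) (%y. min (h i y) be)"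
 using assms(1) i by (simp add: Pi_pmf_component)
 qed
 finally have 1: "expec (Pi_pmf I dflt q) (%g. min (SUM i:I. h i (g i)) be) <= (SUM i:I. expec (q i) (%y. min (h i y) be))" .
 have "expec (Pi_pmf I dflt q) (%g. min (SUM i:I. h i (g i)) be) <= expec (Pi_pmf I dflt q) (%g. be)"
 by (intro expec_mono fI) auto
 with 1 show ?thesis by simp
qed

lemma prod_one_minus_ge:
 fixes a :: "'i => real"
 assumes "finite I" "!!i. i : I ==> 0 <= a i" "!!i. i : I ==> a i <= 1"
 shows "1 - (SUM i:I. a i) <= (\<Prod>i\<in>I. 1 - a i)"
 using assms
proof (induction I)
 case (insert x F)
 have 1: "(\<Prod>i\<in>F. 1 - a i) <= 1" using insert.prems by (intro prod_le_1) auto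
 have "a x * (\<Prod>i\<in>F. 1 - a i) <= a x * 1" using 1 insert.prems by (intro mult_left_mono) auto
 moreover have "1 - (SUM i:F. a i) <= (\<Prod>i\<in>F. 1 - a i)" using insert by auto
 ultimately show ?case using insert.hyps by (simp add: algebra_simps)
qed simp

lemma one_minus_exp_ge: "0 <= (x::real) ==> min 1 x / 2 <= 1 - exp (- x)"
proof -
 assume x: "0 <= x"
 have "exp (- x) * (1 + x) <= exp (-x) * exp x"
 using exp_ge_add_one_self[of x] by (intro mult_left_mono) auto
 hence "exp (- x) <= 1 / (1 + x)" using x by (simp add: field_simps exp_minus)
 moreover have "min 1 x / 2 <= 1 - 1 / (1 + x)"
 using x mult_left_mono[of x 1 x] by (cases "x <= 1") (auto simp: min_def field_simps)
 ultimately show ?thesis by linarith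
qed

text \<open>The truncated sum dominates be times 1 minus the product of the 1 - m_i, and a product
  of independent factors, unlike a minimum, has a product as its expectation. That product is at
  most exp (- S), and 1 - exp (- S) is at least half of min 1 S.\<close>

lemma truncated_sum_lower:
 assumes "finite I" "!!i. i : I ==> fin_pmf (q i)"
 "!!i y. i : I ==> 0 <= h i y" "0 < (be::real)"
 shows "min be (SUM i:I. expec (q i) (%y. min (h i y) be)) / 2 <=
 expec (Pi_pmf I dflt q) (%g. min (SUM i:I. h i (g i)) be)"
proof -
 have fI: "fin_pmf (Pi_pmf I dflt q)" using assms by (intro fin_pmf_Pi)
 define m where "m i y = min (h i y) be / be" for i y
 have m: "0 <= m i y" "m i y <= 1" if "i : I" for i y
 using assms that by (auto simp: m_def min_def)
 have pt: "be * (1 - (\<Prod>i\<in>I. 1 - m i (g i))) <= min (SUM i:I. h i (g i)) be" for g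
 proof -
 have "1 - (SUM i:I. m i (g i)) <= (\<Prod>i\<in>I. 1 - m i (g i))"
 using m by (intro prod_one_minus_ge) (auto simp: assms)
 hence "1 - (\<Prod>i\<in>I. 1 - m i (g i)) <= (SUM i:I. m i (g i))" by simp
 also have "... <= (SUM i:I. h i (g i) / be)"
 using assms by (intro sum_mono) (auto simp: m_def divide_right_mono)
 finally have "1 - (\<Prod>i\<in>I. 1 - m i (g i)) <= (SUM i:I. h i (g i)) / be" by (simp add: sum_divide_distrib)
 moreover have "0 <= (\<Prod>i\<in>I. 1 - m i (g i))" using m by (intro prod_nonneg) auto
 ultimately show ?thesis using assms(4) by (simp add: field_simps)
 qed
 define S where "S = (SUM i:I. expec (q i) (m i))"
 have S0: "0 <= S" unfolding S_def using m by (intro sum_nonneg expec_nonneg) auto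
 have "(\<Prod>i\<in>I. expec (q i) (%y. 1 - m i y)) = (\<Prod>i\<in>I. 1 - expec (q i) (m i))"
 by (rule prod.cong) (simp_all add: expec_diff assms)
 also have "... <= (\<Prod>i\<in>I. exp (- expec (q i) (m i)))"
 proof (rule prod_mono)
 fix i assume i: "i : I"
 have "expec (q i) (m i) <= expec (q i) (%_. 1)" using m i assms by (intro expec_mono) auto
 moreover have "1 + (- expec (q i) (m i)) <= exp (- expec (q i) (m i))" by (rule exp_ge_add_one_self)
 ultimately show "0 <= 1 - expec (q i) (m i) & 1 - expec (q i) (m i) <= exp (- expec (q i) (m i))" by simp
 qed
 also have "... = exp (- S)" using assms(1) by (simp add: S_def exp_sum sum_negf[symmetric])
 finally have P: "(\<Prod>i\<in>I. expec (q i) (%y. 1 - m i y)) <= exp (- S)" .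
 have "min 1 S / 2 <= 1 - exp (- S)" using S0 by (rule one_minus_exp_ge)
 also have "... <= 1 - (\<Prod>i\<in>I. expec (q i) (%y. 1 - m i y))" using P by simp
 also have "(\<Prod>i\<in>I. expec (q i) (%y. 1 - m i y)) = expec (Pi_pmf I dflt q) (%g. \<Prod>i\<in>I. 1 - m i (g i))"
 using assms m by (subst expectation_prod_Pi_pmf) (auto simp: fin_integrable)
 also have "1 - expec (Pi_pmf I dflt q) (%g. \<Prod>i\<in>I. 1 - m i (g i)) = expec (Pi_pmf I dflt q) (%g. 1 - (\<Prod>i\<in>I. 1 - m i (g i)))"
 by (simp add: expec_diff[OF fI])
 finally have "be * (min 1 S / 2) <= be * expec (Pi_pmf I dflt q) (%g. 1 - (\<Prod>i\<in>I. 1 - m i (g i)))"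
 using assms(4) by (intro mult_left_mono) auto
 also have "... = expec (Pi_pmf I dflt q) (%g. be * (1 - (\<Prod>i\<in>I. 1 - m i (g i))))"
 by simp
 also have "... <= expec (Pi_pmf I dflt q) (%g. min (SUM i:I. h i (g i)) be)"
 using pt by (intro expec_mono fI) auto
 also have "be * (min 1 S / 2) = min be (be * S) / 2" using assms(4) by (simp add: min_mult_distrib_left)
 also have "be * S = (SUM i:I. expec (q i) (%y. min (h i y) be))"
 using assms(4) unfolding S_def m_def by (simp add: sum_distrib_left)
 finally show ?thesis .
qed

section \<open>Geometric sums and truncated second moments of random scales\<close>

definition gsum :: "real => nat => real" where
 "gsum q n = (SUM i<=n. q ^ i)"

lemma gsum_ge_1: "0 <= q ==> 1 <= gsum q n"
 by (induction n) (auto simp: gsum_def intro: add_increasing2)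

lemma gsum_mono: "0 <= q ==> m <= n ==> gsum q m <= gsum q n"
 unfolding gsum_def by (intro sum_mono2) auto

text \<open>Halving the range of the sum loses at most a factor 2, whatever the ratio up to 1. This
  allows ranges to be adjusted without singling out the ratio 1, which occurs for s / 4 at p = 2 and
  for 2 / s at p = 1.\<close>

lemma gsum_double:
 assumes "0 <= q" "q <= 1" "n <= 2 * m + 1"
 shows "gsum q n <= 2 * gsum q m"
proof -
 have "gsum q n <= gsum q (2 * m + 1)" using assms by (intro gsum_mono) auto
 also have "... = (SUM i:{..m} Un {m + 1..2 * m + 1}. q ^ i)"
 unfolding gsum_def by (rule sum.cong) auto
 also have "... = gsum q m + (SUM i:{m + 1..2 * m + 1}. q ^ i)"
 unfolding gsum_def by (subst sum.union_disjoint) auto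
 also have "(SUM i:{m + 1..2 * m + 1}. q ^ i) = (SUM i<=m. q ^ (i + (m + 1)))"
 by (rule sum.reindex_bij_witness[of _ "%i. i + (m + 1)" "%i. i - (m + 1)"]) auto
 also have "... <= gsum q m"
 unfolding gsum_def using assms by (intro sum_mono power_decreasing) auto
 finally show ?thesis by simp
qed

lemma sum_powers_less: "(SUM i<n. 2 ^ i :: real) <= 2 ^ n"
 by (induction n) auto

lemma sum_powers_base:
 fixes s :: real assumes "2 <= s" shows "(SUM i<=n. s ^ i) <= 2 * s ^ n"
proof (induction n)
 case (Suc n)
 have "(SUM i<=Suc n. s ^ i) <= 2 * s ^ n + s ^ Suc n" using Suc by simp
 also have "2 * s ^ n <= s * s ^ n" using assms by (intro mult_right_mono) auto
 finally show ?case by simp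
qed simp

lemma ex_dyadic: 
 assumes "1 <= (a::real)" obtains aa :: nat where "2 ^ aa <= a" "a < 2 ^ (aa + 1)"
proof -
 define aa where "aa = nat \<lfloor>log 2 a\<rfloor>"
 have l: "0 <= log 2 a" using assms by simp
 hence "real aa <= log 2 a" "log 2 a < real aa + 1" by (auto simp: aa_def)
 hence "2 powr real aa <= a" "a < 2 powr (real aa + 1)"
 using assms by (auto simp: le_log_iff log_less_iff)
 thus thesis using that[of aa] by (simp add: powr_realpow powr_add)
qed

text \<open>Up to the normaliser of the weights (1 / s)^j, this is the mean square of a after
  multiplication by the random scale 2^j, truncated at 4^l. For s = 2 powr p the scale has tail
  exponent p: a discrete stand-in for a p-stable multiplier.\<close>

definition item_sum :: "real => nat => nat => real => real" where
 "item_sum s B l a = (SUM j<=B. (1 / s) ^ j * min (4 ^ j * a^2) (4 ^ l))"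

text \<open>Counting scales downward from l turns the truncation into a comparison of a with 2^i.
  The level l then enters only through the prefactor and the number of terms.\<close>

lemma item_sum_core:
 fixes s a :: real
 assumes "0 < s" "l <= B"
 shows "(SUM j<=l. (1 / s) ^ j * min (4 ^ j * a^2) (4 ^ l)) = 
 (4 / s) ^ l * (SUM i<=l. s ^ i * min (a^2 / 4 ^ i) 1)"
proof -
 have "(SUM j<=l. (1 / s) ^ j * min (4 ^ j * a^2) (4 ^ l)) = (SUM i<=l. (1 / s) ^ (l - i) * min (4 ^ (l - i) * a^2) (4 ^ l))"
 by (rule sum.reindex_bij_witness[of _ "%i. l - i" "%i. l - i"]) auto
 also have "... = (SUM i<=l. (4 / s) ^ l * (s ^ i * min (a^2 / 4 ^ i) 1))"
 proof (rule sum.cong[OF refl])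
 fix i assume "i : {..l}"
 hence i: "i <= l" by simp
 have "s ^ l = s ^ (l - i) * s ^ i" using i by (metis le_add_diff_inverse2 power_add)
 hence 1: "(1 / s) ^ (l - i) = s ^ i / s ^ l" using assms by (simp add: power_one_over)
 have 2: "(4::real) ^ (l - i) * a^2 = 4 ^ l * (a^2 / 4 ^ i)" using i by (simp add: power_diff)
 have 3: "min (4 ^ l * (a^2 / 4 ^ i)) (4 ^ l) = 4 ^ l * min (a^2 / 4 ^ i) 1"
 by (simp add: min_mult_distrib_left)
 show "(1 / s) ^ (l - i) * min (4 ^ (l - i) * a^2) (4 ^ l) = (4 / s) ^ l * (s ^ i * min (a^2 / 4 ^ i) 1)"
 unfolding 1 2 3 by (simp add: power_divide)
 qed
 finally show ?thesis by (simp add: sum_distrib_left)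
qed

lemma tail_sum:
 assumes "2 <= s"
 shows "(SUM j:{l<..B}. (1 / s) ^ j) <= (1 / s :: real) ^ l"
proof (cases "l <= B")
 case True
 have h: "1 / s <= 1 / 2" "0 < 1 / s" using assms by (auto simp: field_simps)
 have "(SUM j:{l<..B}. (1 / s) ^ j) <= (1 / s) ^ l - (1 / s) ^ B" 
 using True
 proof (induction B rule: dec_induct)
 case (step n)
 have "(1 / s) * (1 / s) ^ n <= 1 / 2 * (1 / s) ^ n" using h by (intro mult_right_mono) auto
 hence "2 * (1 / s) ^ Suc n <= (1 / s) ^ n" by (simp add: mult.commute)
 moreover have "{l<..Suc n} = insert (Suc n) {l<..n}" using step by auto
 ultimately show ?case using step by simp
 qed simp
 thus ?thesis using h by (smt (verit) zero_le_power)
qed (use assms in auto)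

context
 fixes p s :: real
 assumes p: "1 <= p" "p <= 2" and s: "s = 2 powr p"
begin

lemma s_bounds: "2 <= s" "s <= 4"
 using p powr_mono[of 1 p 2] powr_mono[of p 2 2] by (auto simp: s)

lemma s_pow: "s ^ n = (2 ^ n) powr p"
 unfolding s by (simp add: powr_realpow[symmetric] powr_powr mult.commute)

lemma powr_dyadic:
 assumes "2 ^ aa <= a" "a < 2 ^ (aa + 1)"
 shows "s ^ aa <= a powr p" "a powr p <= s ^ (aa + 1)"
 "a powr p * (4 / s) ^ aa <= a^2" "a\<^sup>2 <= a powr p * (4 / s) ^ (aa + 1)"
proof -
 have a: "0 < a" using assms(1) by (smt (verit) zero_less_power)
 show "s ^ aa <= a powr p" unfolding s_pow using assms p by (intro powr_mono2) auto
 show "a powr p <= s ^ (aa + 1)" unfolding s_pow using assms p a by (intro powr_mono2) auto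
 have q: "(4 / s) ^ n = (2 ^ n) powr (2 - p)" for n
 proof -
 have "(4::real) ^ n = (2 ^ n) powr 2" by (simp add: powr_numeral power_mult_distrib[symmetric] power_even_eq[symmetric] power2_eq_square)
 thus ?thesis by (simp add: power_divide s_pow powr_diff)
 qed
 have a2: "a\<^sup>2 = a powr p * a powr (2 - p)" using a by (simp add: powr_add[symmetric] powr_numeral)
 show "a powr p * (4 / s) ^ aa <= a^2"
 unfolding q a2 using assms p by (intro mult_left_mono powr_mono2) auto
 show "a\<^sup>2 <= a powr p * (4 / s) ^ (aa + 1)"
 unfolding q a2 using assms p a by (intro mult_left_mono powr_mono2) auto
qed

text \<open>Up to the dyadic exponent of a the truncation is active and the terms grow with ratio s
  >= 2, so their sum is of order a powr p. Beyond it they are geometric with ratio s / 4, which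
  produces \<open>gsum\<close>. Scales above l add one more unit of the prefactor.\<close>

lemma item_sum_upper:
 assumes "1 <= a" "l <= B"
 shows "item_sum s B l a <= 4 * a powr p * (4 / s) ^ l * gsum (s / 4) l"
proof -
 obtain aa where al: "2 ^ aa <= a" "a < 2 ^ (aa + 1)" using ex_dyadic[OF assms(1)] .
 note pd = powr_dyadic[OF al]
 note sb = s_bounds
 have q: "0 < s / 4" "s / 4 <= 1" using sb by auto
 have ap: "1 <= a powr p" using assms p by (simp add: ge_one_powr_ge_zero)
 have "(SUM i<=l. s ^ i * min (a^2 / 4 ^ i) 1) <= (SUM i<=l. if i <= aa then s ^ i else a\<^sup>2 * (s / 4) ^ i)"
 using sb by (intro sum_mono) (auto simp: min_def power_divide field_simps)
 also have "... = (SUM i:{..l} Int {i. i <= aa}. s ^ i) + (SUM i:{..l} Int - {i. i <= aa}. a\<^sup>2 * (s / 4) ^ i)"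
 by (rule sum.If_cases) simp
 also have "(SUM i:{..l} Int {i. i <= aa}. s ^ i) <= (SUM i<=aa. s ^ i)"
 using sb by (intro sum_mono2) auto
 also have "(SUM i<=aa. s ^ i) <= 2 * s ^ aa" using sb by (intro sum_powers_base)
 also have "2 * s ^ aa <= 2 * a powr p" using pd by simp
 also have "(SUM i:{..l} Int - {i. i <= aa}. a\<^sup>2 * (s / 4) ^ i) <= a powr p * (gsum (s / 4) l)"
 proof -
 have "(SUM i:{..l} Int - {i. i <= aa}. a\<^sup>2 * (s / 4) ^ i) = a^2 * (SUM i:{aa + 1..l}. (s / 4) ^ i)"
 unfolding sum_distrib_left by (rule sum.cong) auto
 also have "... <= a powr p * (4 / s) ^ (aa + 1) * (SUM i:{aa + 1..l}. (s / 4) ^ i)"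
 using pd q by (intro mult_right_mono sum_nonneg) auto
 also have "... = a powr p * (SUM i:{aa + 1..l}. (s / 4) ^ (i - (aa + 1)))"
 unfolding sum_distrib_left mult.assoc using sb
 by (intro sum.cong refl arg_cong[where f="%x. a powr p * x"]) (auto simp: power_diff power_divide field_simps)
 also have "... <= a powr p * gsum (s / 4) l"
 proof (rule mult_left_mono)
 have "(SUM i:{aa + 1..l}. (s / 4) ^ (i - (aa + 1))) = (SUM i:(%i. i - (aa + 1)) ` {aa + 1..l}. (s / 4) ^ i)"
 by (subst sum.reindex) (auto simp: inj_on_def)
 also have "... <= gsum (s / 4) l"
 unfolding gsum_def using q by (intro sum_mono2) auto
 finally show "(SUM i:{aa + 1..l}. (s / 4) ^ (i - (aa + 1))) <= gsum (s / 4) l" .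
 qed (use ap in auto)
 finally show ?thesis .
 qed
 finally have core: "(SUM i<=l. s ^ i * min (a^2 / 4 ^ i) 1) <= 2 * a powr p + a powr p * gsum (s / 4) l" by simp
 have "item_sum s B l a = (SUM j:{..l} Un {l<..B}. (1 / s) ^ j * min (4 ^ j * a^2) (4 ^ l))"
 unfolding item_sum_def using assms by (intro sum.cong) auto
 also have "... = (4 / s) ^ l * (SUM i<=l. s ^ i * min (a^2 / 4 ^ i) 1) + (SUM j:{l<..B}. (1 / s) ^ j * min (4 ^ j * a^2) (4 ^ l))"
 using sb assms by (subst sum.union_disjoint) (auto simp: item_sum_core[where B=B])
 also have "(SUM j:{l<..B}. (1 / s) ^ j * min (4 ^ j * a^2) (4 ^ l)) <= (SUM j:{l<..B}. (1 / s) ^ j * 4 ^ l)"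
 using sb by (intro sum_mono mult_left_mono) auto
 also have "... = 4 ^ l * (SUM j:{l<..B}. (1 / s) ^ j)" by (simp add: sum_distrib_left mult.commute)
 also have "... <= 4 ^ l * (1 / s) ^ l" using tail_sum[OF sb(1)] by (intro mult_left_mono) auto
 also have "... = (4 / s) ^ l * 1" by (simp add: power_divide)
 finally have "item_sum s B l a <= (4 / s) ^ l * ((SUM i<=l. s ^ i * min (a^2 / 4 ^ i) 1) + 1)"
 by (simp add: algebra_simps)
 also have "... <= (4 / s) ^ l * (4 * a powr p * gsum (s / 4) l)"
 proof (rule mult_left_mono)
 have g: "1 <= gsum (s / 4) l" using q by (intro gsum_ge_1) auto
 have "a powr p * 1 <= a powr p * gsum (s / 4) l" using g ap by (intro mult_left_mono) auto
 with core ap show "(SUM i<=l. s ^ i * min (a^2 / 4 ^ i) 1) + 1 <= 4 * a powr p * gsum (s / 4) l" by linarith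
 qed (use sb in auto)
 finally show ?thesis by (simp add: mult_ac)
qed

text \<open>Only the terms past the dyadic exponent of a are kept, where nothing is truncated. As
  that exponent is at most M and l >= 2 M + 2, about half of the range survives, and doubling
  restores the full geometric sum.\<close>

lemma item_sum_lower:
 assumes "1 <= a" "a <= 2 ^ M" "2 * M + 2 <= l" "l <= B"
 shows "a powr p * (4 / s) ^ l * gsum (s / 4) l / 4 <= item_sum s B l a"
proof -
 obtain aa where al: "2 ^ aa <= a" "a < 2 ^ (aa + 1)" using ex_dyadic[OF assms(1)] .
 have "(2::real) ^ aa <= 2 ^ M" using al assms by linarith
 hence aM: "aa <= M" by simp
 note pd = powr_dyadic[OF al]
 note sb = s_bounds
 have q: "0 < s / 4" "s / 4 <= 1" "4 / s <= 2" using sb by (auto simp: field_simps)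
 have "gsum (s / 4) l <= 2 * gsum (s / 4) (l - (aa + 1))"
 using q aM assms by (intro gsum_double) auto
 also have "gsum (s / 4) (l - (aa + 1)) = (SUM i:{aa + 1..l}. (s / 4) ^ (i - (aa + 1)))"
 unfolding gsum_def using aM assms
 by (intro sum.reindex_bij_witness[of _ "%i. i - (aa + 1)" "%i. i + (aa + 1)"]) auto
 also have "... = (4 / s) ^ (aa + 1) * (SUM i:{aa + 1..l}. (s / 4) ^ i)"
 unfolding sum_distrib_left using sb
 by (intro sum.cong refl) (auto simp: power_diff power_divide field_simps)
 finally have "a powr p * gsum (s / 4) l <= a powr p * (2 * ((4 / s) ^ (aa + 1) * (SUM i:{aa + 1..l}. (s / 4) ^ i)))"
 by (intro mult_left_mono) auto
 also have "... = 2 * (a powr p * (4 / s) ^ aa) * (4 / s) * (SUM i:{aa + 1..l}. (s / 4) ^ i)"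
 by simp
 also have "... <= 2 * a^2 * 2 * (SUM i:{aa + 1..l}. (s / 4) ^ i)"
 using pd sb q(3) by (intro mult_right_mono mult_mono sum_nonneg) auto
 also have "... = 4 * (SUM i:{aa + 1..l}. s ^ i * min (a^2 / 4 ^ i) 1)"
 proof -
 have "a\<^sup>2 * (s / 4) ^ i = s ^ i * min (a^2 / 4 ^ i) 1" if "i : {aa + 1..l}" for i
 proof -
 have "a <= 2 ^ i" using al that power_increasing[of "aa + 1" i "2::real"] by auto
 hence "a\<^sup>2 <= (2 ^ i)\<^sup>2" using assms by (intro power_mono) auto
 also have "(2 ^ i)\<^sup>2 = (4::real) ^ i" by (simp add: power2_eq_square power_mult_distrib[symmetric])
 finally show ?thesis by (simp add: min_def power_divide)
 qed
 hence "(SUM i:{aa + 1..l}. a\<^sup>2 * (s / 4) ^ i) = (SUM i:{aa + 1..l}. s ^ i * min (a^2 / 4 ^ i) 1)"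
 by (rule sum.cong[OF refl])
 thus ?thesis by (simp add: sum_distrib_left[symmetric])
 qed
 also have "... <= 4 * (SUM i<=l. s ^ i * min (a^2 / 4 ^ i) 1)"
 using sb by (intro mult_left_mono sum_mono2) auto
 finally have "(4 / s) ^ l * (a powr p * gsum (s / 4) l) <= (4 / s) ^ l * (4 * (SUM i<=l. s ^ i * min (a^2 / 4 ^ i) 1))"
 using sb by (intro mult_left_mono) auto
 also have "... = 4 * (SUM j<=l. (1 / s) ^ j * min (4 ^ j * a^2) (4 ^ l))"
 using sb assms by (simp add: item_sum_core[where B=B])
 also have "... <= 4 * item_sum s B l a"
 unfolding item_sum_def using sb assms by (intro mult_left_mono sum_mono2) auto
 finally show ?thesis by (simp add: mult_ac)
qed


text \<open>In the relevant range S l behaves like X (4 / s)^l with X proportional to the p-th power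
  of the norm. It crosses 4^l where s^l is about X, that is, where 2^l is about X powr (1 / p).
  Before the crossing the summands are powers of 2, after it they are geometric with ratio 2 / s; so
  the sum is of order X powr (1 / p) times \<open>gsum (2 / s) B\<close>, which is linear in the
  norm.\<close>

lemma layer_estimate:
 fixes a :: "nat => nat" and d M :: nat
 assumes d: "1 <= d" "d <= 2 ^ M" "1 <= M" and a: "!!t. t < d ==> a t <= 2 ^ M" and nz: "EX t<d. a t ~= 0"
 and Z: "1 <= Z" "Z <= 2"
 defines "B == 64 * M"
 defines "S == (%l. 2 ^ (8 * M) * (SUM t<d. item_sum s B l (real (a t)) / Z))"
 defines "K == (2 ^ (8 * M) * gsum (s / 4) B) powr (1 / p) * gsum (2 / s) B"
 defines "ta == (SUM t<d. real (a t) powr p) powr (1 / p)"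
 shows "(SUM l<=B. min (4 ^ l) (S l) / 2 ^ l) <= 10 * (K * ta)"
 and "K * ta / 1024 <= (SUM l<=B. min (4 ^ l) (S l) / 2 ^ l)"
proof -
 note sb = s_bounds
 define T where "T = (SUM t<d. real (a t) powr p)"
 define U where "U = gsum (s / 4) B"
 define V where "V = gsum (2 / s) B"
 define X where "X = 2 ^ (8 * M) * T * U"
 define R where "R = X powr (1 / p)"
 have q: "0 < s / 4" "s / 4 <= 1" "0 < 2 / s" "2 / s <= 1" using sb by auto
 have UV: "1 <= U" "1 <= V" using q by (auto simp: U_def V_def intro!: gsum_ge_1)
 have T1: "1 <= T"
 proof -
 obtain t where t: "t < d" "a t ~= 0" using nz by blast
 have "1 <= real (a t) powr p" using t p by (intro ge_one_powr_ge_zero) auto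
 also have "... <= T" unfolding T_def using t by (intro member_le_sum) auto
 finally show ?thesis .
 qed
 have T2: "T <= 2 ^ (3 * M)"
 proof -
 have "real (a t) powr p <= 2 ^ (2 * M)" if "t < d" for t
 proof (cases "a t = 0")
 case False
 hence "real (a t) powr p <= real (a t) powr 2" using p by (intro powr_mono) auto
 also have "... = (real (a t))\<^sup>2" using False by (simp add: powr_numeral)
 also have "... <= (2 ^ M)\<^sup>2" using a[OF that] by (intro power_mono) (auto simp: of_nat_le_iff[of _ "2 ^ M", where 'a=real, simplified])
 finally show ?thesis by (simp add: power_mult[symmetric] mult.commute)
 qed simp
 hence "T <= (SUM t<d. 2 ^ (2 * M))" unfolding T_def by (intro sum_mono) auto
 also have "... = real d * 2 ^ (2 * M)" by simp
 also have "... <= 2 ^ M * 2 ^ (2 * M)" using d by (intro mult_right_mono) (auto simp: of_nat_le_iff[of _ "2 ^ M", where 'a=real, simplified])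
 finally show ?thesis by (simp add: power_add[symmetric])
 qed
 have UB: "U <= 2 ^ (7 * M)"
 proof -
 have "U <= (SUM i<=B. 1)" unfolding U_def gsum_def using q by (intro sum_mono power_le_one) auto
 also have "... = 64 * real M + 1" by (simp add: B_def)
 also have "... <= 2 ^ (7 * M)" using d(3)
 proof (induction M rule: dec_induct)
 case (step n)
 have "64 * real (Suc n) + 1 <= 2 ^ 7 * (64 * real n + 1)" by simp
 also have "... <= 2 ^ 7 * 2 ^ (7 * n)" using step by (intro mult_left_mono) auto
 finally show ?case by (simp add: power_add)
 qed simp
 finally show ?thesis .
 qed
 have X0: "2 ^ (8 * M) <= X"
 proof -
 have "1 * 1 <= T * U" using T1 UV by (intro mult_mono) auto
 thus ?thesis unfolding X_def by (simp add: mult.assoc)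
 qed
 \<comment> \<open>The exponents 8 of the copies, 3 of T and 7 of U add up to 18. This keeps the
   crossing index below a third of B = 64 M.\<close>
 have X1: "X <= 2 ^ (18 * M)"
 proof -
 have "X <= 2 ^ (8 * M) * 2 ^ (3 * M) * 2 ^ (7 * M)"
 unfolding X_def using T1 T2 UB UV by (intro mult_mono) auto
 thus ?thesis by (simp add: power_add[symmetric])
 qed
 have Xp: "0 < X" using X0 by (smt (verit) zero_less_power)
 have "EX k. X <= s ^ k"
 proof -
 have "X <= 2 ^ (18 * M)" by (rule X1)
 also have "... <= s ^ (18 * M)" using sb by (intro power_mono) auto
 finally show ?thesis ..
 qed
 \<comment> \<open>The crossing index. The factor 2^(8 M) pushes it to at least 4 M, where the lower
   bound for single items is available.\<close>
 define lam where "lam = (LEAST k. X <= s ^ k)"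
 have lam: "X <= s ^ lam" unfolding lam_def by (rule LeastI_ex) fact
 have lam_low: "4 * M <= lam"
 proof -
 have "(4::real) ^ (4 * M) = 2 ^ (8 * M)" by (simp add: power_mult)
 also have "... <= s ^ lam" using X0 lam by linarith
 also have "... <= 4 ^ lam" using sb by (intro power_mono) auto
 finally show ?thesis by simp
 qed
 have lam': "s ^ (lam - 1) < X"
 using not_less_Least[of "lam - 1" "%k. X <= s ^ k"] lam_low d(3) by (simp add: lam_def[symmetric])
 have lam_up: "lam <= 18 * M"
 proof -
 have "(2::real) ^ (lam - 1) <= s ^ (lam - 1)" using sb by (intro power_mono) auto
 also have "... < 2 ^ (18 * M)" using lam' X1 by linarith
 finally have "lam - 1 < 18 * M" by simp
 thus ?thesis by simp
 qed
 have R1: "R <= 2 ^ lam"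
 proof -
 have "R <= ((2 ^ lam) powr p) powr (1 / p)" unfolding R_def using lam Xp p by (intro powr_mono2) (auto simp: s_pow)
 thus ?thesis using p by (simp add: powr_powr)
 qed
 have R2: "2 ^ lam <= 2 * R"
 proof -
 have "((2 ^ (lam - 1)) powr p) powr (1 / p) <= R" unfolding R_def using lam' p by (intro powr_mono2) (auto simp: s_pow)
 hence "2 ^ (lam - 1) <= R" using p by (simp add: powr_powr)
 moreover have "(2::real) ^ lam = 2 * 2 ^ (lam - 1)" using lam_low d(3) by (simp add: power_Suc[symmetric])
 ultimately show ?thesis by linarith
 qed
 have RK: "R * V = K * ta"
 unfolding R_def K_def ta_def X_def U_def[symmetric] V_def[symmetric] T_def[symmetric]
 using T1 UV by (simp add: powr_mult mult_ac)
 have i0: "item_sum s B l 0 = 0" for l unfolding item_sum_def by simp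
 have vl: "(4 / s) ^ l / 2 ^ l = (2 / s) ^ l" for l
 proof -
 have "(4 / s) ^ l = (2 / s) ^ l * 2 ^ l" by (simp add: power_mult_distrib[symmetric])
 thus ?thesis by simp
 qed
 have sv: "s ^ l * (2 / s) ^ l = 2 ^ l" for l
 using sb by (simp add: power_mult_distrib[symmetric])
 have S_up: "S l <= 4 * X * (4 / s) ^ l" if "l <= B" for l
 proof -
 have "item_sum s B l (real (a t)) / Z <= 4 * (4 / s) ^ l * U * real (a t) powr p" for t
 proof (cases "a t = 0")
 case False
 have "item_sum s B l (real (a t)) <= 4 * real (a t) powr p * (4 / s) ^ l * gsum (s / 4) l"
 using False that by (intro item_sum_upper) auto
 also have "... <= 4 * real (a t) powr p * (4 / s) ^ l * U"
 unfolding U_def using q that sb by (intro mult_left_mono gsum_mono) auto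
 finally have 1: "item_sum s B l (real (a t)) <= 4 * real (a t) powr p * (4 / s) ^ l * U" .
 have "item_sum s B l (real (a t)) / Z <= item_sum s B l (real (a t)) / 1"
 using Z sb by (intro divide_left_mono) (auto simp: item_sum_def intro!: sum_nonneg)
 with 1 show ?thesis by (simp add: mult_ac)
 qed (auto simp: i0)
 hence "(SUM t<d. item_sum s B l (real (a t)) / Z) <= (SUM t<d. 4 * (4 / s) ^ l * U * real (a t) powr p)"
 by (intro sum_mono) auto
 also have "... = 4 * (4 / s) ^ l * U * T" by (simp add: T_def sum_distrib_left)
 finally show ?thesis unfolding S_def X_def by (simp add: mult_ac)
 qed
 have S_lo: "X * (4 / s) ^ l / 128 <= S l" if "l <= B" "lam <= l" for l
 proof -
 \<comment> \<open>Four halvings lead from 64 M down to 4 M, hence the factor 16.\<close>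
 have g: "U <= 16 * gsum (s / 4) l"
 proof -
 have "U <= 2 * gsum (s / 4) (32 * M)" unfolding U_def B_def using q by (intro gsum_double) auto
 also have "gsum (s / 4) (32 * M) <= 2 * gsum (s / 4) (16 * M)" using q by (intro gsum_double) auto
 also have "gsum (s / 4) (16 * M) <= 2 * gsum (s / 4) (8 * M)" using q by (intro gsum_double) auto
 also have "gsum (s / 4) (8 * M) <= 2 * gsum (s / 4) (4 * M)" using q by (intro gsum_double) auto
 also have "gsum (s / 4) (4 * M) <= gsum (s / 4) l" using q lam_low that by (intro gsum_mono) auto
 finally show ?thesis by simp
 qed
 have "(4 / s) ^ l * U / 128 * real (a t) powr p <= item_sum s B l (real (a t)) / Z" if t: "t < d" for t
 proof (cases "a t = 0")
 case False
 have "2 * M + 2 <= l" using lam_low that \<open>lam <= l\<close> d(3) by auto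
 hence 2: "real (a t) powr p * (4 / s) ^ l * gsum (s / 4) l / 4 <= item_sum s B l (real (a t))"
 using a[OF t] False \<open>l <= B\<close>
 by (intro item_sum_lower[where M=M]) (auto simp: of_nat_le_iff[of _ "2 ^ M", where 'a=real, simplified])
 have "(4 / s) ^ l * U / 128 * real (a t) powr p = real (a t) powr p * (4 / s) ^ l * (U / 16) / 4 / 2" by simp
 also have "... <= real (a t) powr p * (4 / s) ^ l * gsum (s / 4) l / 4 / 2"
 using g sb by (intro divide_right_mono mult_left_mono) auto
 also have "... <= item_sum s B l (real (a t)) / 2" using 2 by (intro divide_right_mono) auto
 also have "... <= item_sum s B l (real (a t)) / Z"
 using Z sb by (intro divide_left_mono) (auto simp: item_sum_def intro!: sum_nonneg)
 finally show ?thesis .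
 qed (auto simp: i0)
 hence "(SUM t<d. (4 / s) ^ l * U / 128 * real (a t) powr p) <= (SUM t<d. item_sum s B l (real (a t)) / Z)"
 by (intro sum_mono) auto
 also have "(SUM t<d. (4 / s) ^ l * U / 128 * real (a t) powr p) = (4 / s) ^ l * U / 128 * T"
 by (simp add: T_def sum_distrib_left)
 finally have "2 ^ (8 * M) * ((4 / s) ^ l * U / 128 * T) <= S l"
 unfolding S_def by (intro mult_left_mono) auto
 thus ?thesis unfolding X_def by (simp add: mult_ac)
 qed
 \<comment> \<open>Before \<open>lam\<close> the first entry of the minimum is used, from
   \<open>lam\<close> on the second; X <= s^lam converts the latter into 2^lam times powers of 2 /
   s.\<close>
 have "(SUM l<=B. min (4 ^ l) (S l) / 2 ^ l) <= (SUM l<=B. if l < lam then 2 ^ l else 4 * 2 ^ lam * (2 / s) ^ (l - lam))"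
 proof (rule sum_mono)
 fix l assume "l : {..B}"
 hence l: "l <= B" by simp
 have 1: "min (4 ^ l) (S l) / 2 ^ l <= (4 ^ l :: real) / 2 ^ l" by (intro divide_right_mono) auto
 have 2: "(4 ^ l :: real) / 2 ^ l = 2 ^ l" by (simp add: power_divide[symmetric])
 show "min (4 ^ l) (S l) / 2 ^ l <= (if l < lam then 2 ^ l else 4 * 2 ^ lam * (2 / s) ^ (l - lam))"
 proof (cases "l < lam")
 case False
 have "min (4 ^ l) (S l) / 2 ^ l <= 4 * X * (4 / s) ^ l / 2 ^ l"
 using S_up[OF l] by (intro divide_right_mono) auto
 also have "... = 4 * X * (2 / s) ^ l" unfolding vl[symmetric] by simp
 also have "... <= 4 * s ^ lam * (2 / s) ^ l" using lam q by (intro mult_right_mono) auto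
 also have "... = 4 * (s ^ lam * (2 / s) ^ lam) * (2 / s) ^ (l - lam)"
 using False by (simp add: power_add[symmetric])
 finally show ?thesis using False by (simp add: sv)
 qed (use 1 2 in simp)
 qed
 also have "... = (SUM l:{..B} Int {l. l < lam}. 2 ^ l) + (SUM l:{..B} Int - {l. l < lam}. 4 * 2 ^ lam * (2 / s) ^ (l - lam))"
 by (rule sum.If_cases) simp
 also have "... <= 2 ^ lam + 4 * 2 ^ lam * V"
 proof (rule add_mono)
 have "(SUM l:{..B} Int {l. l < lam}. 2 ^ l :: real) <= (SUM l<lam. 2 ^ l)" by (intro sum_mono2) auto
 thus "(SUM l:{..B} Int {l. l < lam}. 2 ^ l :: real) <= 2 ^ lam" using sum_powers_less[of lam] by linarith
 have "(SUM l:{..B} Int - {l. l < lam}. (2 / s) ^ (l - lam)) = (SUM i:(%l. l - lam) ` ({..B} Int - {l. l < lam}). (2 / s) ^ i)"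
 by (subst sum.reindex) (auto simp: inj_on_def)
 also have "... <= V" unfolding V_def gsum_def using q by (intro sum_mono2) auto
 finally show "(SUM l:{..B} Int - {l. l < lam}. 4 * 2 ^ lam * (2 / s) ^ (l - lam)) <= 4 * 2 ^ lam * V"
 by (simp add: sum_distrib_left[symmetric])
 qed
 also have "... <= 5 * (2 ^ lam * V)" using UV by simp
 also have "... <= 5 * (2 * R * V)" using R2 UV by (intro mult_left_mono mult_right_mono) auto
 finally show "(SUM l<=B. min (4 ^ l) (S l) / 2 ^ l) <= 10 * (K * ta)" using RK by simp
 have "K * ta / 1024 = R / 4 * V / 256" using RK by simp
 also have "... <= 2 ^ lam / 4 * V / 256" using R1 UV by (intro divide_right_mono mult_right_mono) auto
 also have "2 ^ lam / 4 <= X * (2 / s) ^ lam"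
 proof -
 have "2 ^ lam / 4 <= 2 ^ lam / s" using sb by (intro divide_left_mono) auto
 also have "... = s ^ lam * (2 / s) ^ lam / s" by (simp add: sv)
 also have "... = s ^ (lam - 1) * (2 / s) ^ lam"
 using sb lam_low d(3) by (cases lam) auto
 also have "... <= X * (2 / s) ^ lam" using lam' q by (intro mult_right_mono) auto
 finally show ?thesis .
 qed
 also have "X * (2 / s) ^ lam * V / 256 <= X * (2 / s) ^ lam * (2 * gsum (2 / s) (B - lam)) / 256"
 unfolding V_def using Xp q lam_up by (intro divide_right_mono mult_left_mono gsum_double) (auto simp: B_def)
 also have "... = (SUM i<=B - lam. X * (2 / s) ^ (lam + i) / 128)"
 unfolding gsum_def by (simp add: sum_distrib_left power_add sum_divide_distrib mult_ac)
 also have "... = (SUM l:{lam..B}. X * (2 / s) ^ l / 128)"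
 using lam_up by (intro sum.reindex_bij_witness[of _ "%l. l - lam" "%i. lam + i"]) (auto simp: B_def)
 also have "... <= (SUM l:{lam..B}. min (4 ^ l) (S l) / 2 ^ l)"
 proof (rule sum_mono)
 fix l assume l: "l : {lam..B}"
 have "X * (2 / s) ^ l <= s ^ l * (2 / s) ^ l"
 proof (rule mult_right_mono)
 have "s ^ lam <= s ^ l" using l sb by (intro power_increasing) auto
 thus "X <= s ^ l" using lam by linarith
 qed (use q in auto)
 hence "X * (2 / s) ^ l / 128 <= 2 ^ l" using Xp q by (simp add: sv) (smt (verit) zero_le_power)
 moreover have "(2 :: real) ^ l = 4 ^ l / 2 ^ l" by (simp add: power_divide[symmetric])
 ultimately have 1: "X * (2 / s) ^ l / 128 <= 4 ^ l / 2 ^ l" by simp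
 have "X * (4 / s) ^ l / 128 / 2 ^ l <= S l / 2 ^ l" using S_lo[of l] l by (intro divide_right_mono) auto
 moreover have "X * (4 / s) ^ l / 128 / 2 ^ l = X * (2 / s) ^ l / 128" unfolding vl[symmetric] by simp
 ultimately have "X * (2 / s) ^ l / 128 <= S l / 2 ^ l" by metis
 with 1 show "X * (2 / s) ^ l / 128 <= min (4 ^ l) (S l) / 2 ^ l"
 by (cases "4 ^ l <= S l") (simp_all only: min_def if_True if_False)
 qed
 also have "... <= (SUM l<=B. min (4 ^ l) (S l) / 2 ^ l)"
 proof (rule sum_mono2)
 fix l
 have "0 <= S l" unfolding S_def using Z sb by (intro mult_nonneg_nonneg sum_nonneg divide_nonneg_nonneg) (auto simp: item_sum_def intro!: sum_nonneg)
 thus "0 <= min (4 ^ l) (S l) / 2 ^ l" by simp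
 qed auto
 finally show "K * ta / 1024 <= (SUM l<=B. min (4 ^ l) (S l) / 2 ^ l)" using UV by simp
qed

end

text \<open>A square root is not additive, but written as a sum of dyadic truncations of Y it
  becomes accessible to the estimates for truncated sums of independent terms. The gap between 0 and
  1 excludes small Y, for which layers starting at 4^0 would miss the square root.\<close>

lemma dyadic_layers:
 fixes Y :: real and B :: nat
 assumes Y: "Y = 0 | 1 <= Y"
 defines "Q == (SUM l<=B. min Y (4 ^ l) / 2 ^ l)"
 shows "min (2 ^ B) (sqrt Y) <= 2 * Q" "Q <= 4 * min (2 ^ B) (sqrt Y)"
proof -
 have "min (2 ^ B) (sqrt Y) <= 2 * Q & Q <= 4 * min (2 ^ B) (sqrt Y)"
 proof (cases "Y = 0")
 case False
 hence Y1: "1 <= Y" using Y by simp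
 hence "1 <= sqrt Y" by simp
 then obtain aa where al: "2 ^ aa <= sqrt Y" "sqrt Y < 2 ^ (aa + 1)" using ex_dyadic by blast
 have sq: "(2 ^ n)\<^sup>2 = (4::real) ^ n" for n by (simp add: power2_eq_square power_mult_distrib[symmetric])
 have a4: "4 ^ aa <= Y"
 proof -
 have "(2 ^ aa)\<^sup>2 <= (sqrt Y)\<^sup>2" using al by (intro power_mono) auto
 thus ?thesis using Y1 by (simp add: sq)
 qed
 have e: "(4 ^ l :: real) / 2 ^ l = 2 ^ l" for l by (simp add: power_divide[symmetric])
 have trm: "min Y (4 ^ l) / 2 ^ l <= Q" if "l <= B" for l
 unfolding Q_def using that Y1 by (intro member_le_sum) auto
 have 1: "min (2 ^ B) (sqrt Y) <= 2 * Q"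
 proof (cases "B <= aa")
 case True
 have "(4::real) ^ B <= 4 ^ aa" using True by (intro power_increasing) auto
 hence "4 ^ B <= Y" using a4 by linarith
 hence "min Y (4 ^ B) = 4 ^ B" by simp
 hence "2 ^ B <= Q" using trm[of B] e[of B] by simp
 moreover have "(0::real) < 2 ^ B" by simp
 ultimately show ?thesis by linarith
 next
 case False
 have "min Y (4 ^ aa) = 4 ^ aa" using a4 by simp
 hence "2 ^ aa <= Q" using trm[of aa] e[of aa] False by simp
 thus ?thesis using al by simp
 qed
 have "Q <= (SUM l<=B. 2 ^ l)" unfolding Q_def
 proof (rule sum_mono)
 fix l
 have "min Y (4 ^ l) / 2 ^ l <= 4 ^ l / 2 ^ l" by (intro divide_right_mono) auto
 thus "min Y (4 ^ l) / 2 ^ l <= 2 ^ l" by (simp add: e)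
 qed
 hence 2: "Q <= 4 * 2 ^ B" using sum_powers_base[of 2 B] zero_le_power[of "2::real" B] by linarith
 have "Q <= (SUM l<=B. if l <= aa then 2 ^ l else Y * (1 / 2) ^ l)" unfolding Q_def
 proof (rule sum_mono)
 fix l
 have "min Y (4 ^ l) / 2 ^ l <= 4 ^ l / 2 ^ l" "min Y (4 ^ l) / 2 ^ l <= Y / 2 ^ l" by (auto intro!: divide_right_mono)
 thus "min Y (4 ^ l) / 2 ^ l <= (if l <= aa then 2 ^ l else Y * (1 / 2) ^ l)" by (simp add: e power_divide)
 qed
 also have "... = (SUM l:{..B} Int {l. l <= aa}. 2 ^ l) + (SUM l:{..B} Int - {l. l <= aa}. Y * (1 / 2) ^ l)"
 by (rule sum.If_cases) simp
 also have "... <= 2 * sqrt Y + 2 * sqrt Y"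
 proof (rule add_mono)
 have "(SUM l:{..B} Int {l. l <= aa}. 2 ^ l :: real) <= (SUM l<=aa. 2 ^ l)" by (intro sum_mono2) auto
 thus "(SUM l:{..B} Int {l. l <= aa}. 2 ^ l :: real) <= 2 * sqrt Y" using sum_powers_base[of 2 aa] al by simp
 have "(SUM l:{..B} Int - {l. l <= aa}. Y * (1 / 2) ^ l) = Y * (SUM l:{aa<..B}. (1 / 2) ^ l)"
 unfolding sum_distrib_left by (rule sum.cong) auto
 also have "... <= Y * (1 / 2) ^ aa" using tail_sum[of 2 aa B] Y1 by (intro mult_left_mono) auto
 also have "... = sqrt Y * (sqrt Y / 2 ^ aa)" using Y1 by (simp add: power_divide)
 also have "... <= sqrt Y * 2" using al Y1 by (intro mult_left_mono) (auto simp: field_simps)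
 finally show "(SUM l:{..B} Int - {l. l <= aa}. Y * (1 / 2) ^ l) <= 2 * sqrt Y" by simp
 qed
 finally show ?thesis using 1 2 by simp
 qed (simp add: Q_def)
 thus "min (2 ^ B) (sqrt Y) <= 2 * Q" "Q <= 4 * min (2 ^ B) (sqrt Y)" by auto
qed

section \<open>Random hash functions with cut probability comparable to the lp distance\<close>

definition m0 :: "nat => nat => nat" where
 "m0 d D = (LEAST M. d * D <= 2 ^ M)"

lemma m0_le: "d * D <= 2 ^ m0 d D"
 unfolding m0_def by (rule LeastI[of _ "d * D"]) (simp add: less_imp_le)

lemma m0_ge_1: "2 <= d * D ==> 1 <= m0 d D"
 using m0_le[of d D] by (cases "m0 d D") auto

lemma m0_less: "2 <= d * D ==> 2 ^ (m0 d D - 1) < d * D"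
 using not_less_Least[of "m0 d D - 1" "%M. d * D <= 2 ^ M"] m0_ge_1[of d D]
 by (simp add: m0_def[symmetric])

text \<open>A hash rounds a random signed and scaled combination of coordinates to a shifted grid of
  width 2^B. Given signs and scales, the cut probability is the projected difference over 2^B,
  truncated at 1. Averaging the signs gives the l2 norm of the scaled differences, and averaging the
  scales, which have tail exponent p, turns it into the lp norm.\<close>

lemma ex_hash_family:
 fixes p :: real
 assumes d: "1 <= d" and D: "2 <= D" and p: "1 <= p" "p <= 2"
 shows "EX ka > 0. EX G :: (vec => int) pmf. fin_pmf G &
 (ALL x:grid d D. ALL y:grid d D.
 ka * lp_dist p x y <= expec G (dif x y) &
 expec G (dif x y) <= 2 ^ 19 * ka * lp_dist p x y)"
proof -
 define M where "M = m0 d D"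
 have dD: "2 <= d * D" using d D mult_le_mono[of 1 d 2 D] by simp
 have M: "1 <= M" "d * D <= 2 ^ M" using m0_ge_1[OF dD] m0_le by (auto simp: M_def)
 have dM: "d <= 2 ^ M" "D <= 2 ^ M" using M(2) d D
 by (metis dual_order.trans mult.right_neutral mult_le_mono2 one_le_numeral order_trans nat_mult_1 mult_le_mono1 le_trans)+
 define s where "s = 2 powr p"
 note sb = s_bounds[OF p s_def]
 define B where "B = 64 * M"
 define Z where "Z = (SUM j<=B. (1 / s) ^ j)"
 have Z: "1 <= Z" "Z <= 2"
 proof -
 show "1 <= Z" using gsum_ge_1[of "1 / s" B] sb by (simp add: Z_def gsum_def)
 have "Z = (SUM j:{0} Un {0<..B}. (1 / s) ^ j)" unfolding Z_def by (rule sum.cong) auto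
 also have "... = 1 + (SUM j:{0<..B}. (1 / s) ^ j)" by (subst sum.union_disjoint) auto
 also have "... <= 1 + (1 / s) ^ 0" using tail_sum[OF sb(1), of 0 B] by simp
 finally show "Z <= 2" by simp
 qed
 obtain jl where jl: "set_pmf jl <= {..B}" "!!f. expec jl f = (SUM j<=B. ((1 / s) ^ j / Z) * f j)"
 proof (rule ex_pmf_weights[of "{..B}" "%j. (1 / s) ^ j / Z"])
 show "(SUM j<=B. (1 / s) ^ j / Z) = 1" using Z by (simp add: sum_divide_distrib[symmetric] Z_def[symmetric])
 qed (use sb Z in auto)
 have fjl: "fin_pmf jl" unfolding fin_pmf_def by (rule finite_subset[OF jl(1)]) simp
 define I where "I = {..<2 ^ (8 * M) :: nat} \<times> {..<d}"
 have fI: "finite I" by (simp add: I_def)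
 define P where "P = (2 ^ B :: int)"
 have P: "0 < P" by (simp add: P_def)
 define JJ where "JJ = Pi_pmf I 0 (%_. jl)"
 have fJJ: "fin_pmf JJ" unfolding JJ_def using fI fjl by (intro fin_pmf_Pi) auto
 have fS: "fin_pmf (signs I)" by (rule fin_signs[OF fI])
 have fP: "fin_pmf (pmf_of_set {0..<P})" using P by (intro fin_pmf_of_set) auto
 define h where "h jj e u = (%x::vec. ((SUM i:I. e i * 2 ^ jj i * int (x ! snd i)) + u) div P)" for jj :: "nat \<times> nat => nat" and e u
 define G where "G = bind_pmf JJ (%jj. bind_pmf (signs I) (%e. map_pmf (h jj e) (pmf_of_set {0..<P})))"
 have fG: "fin_pmf G" unfolding G_def using fJJ fS fP by (intro fin_pmf_bind fin_pmf_map) auto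
 define K where "K = (2 ^ (8 * M) * gsum (s / 4) B) powr (1 / p) * gsum (2 / s) B"
 \<comment> \<open>The losses of the lower bound: 1024 from the layers, 2 from independence, 5/16
   from the signs, 4 from the dyadic sum. The upper bound loses 2 times 10, and the quotient of both
   is 2^19.\<close>
 define ka where "ka = K / 1024 / 2 * (5 / 16 / 4 / 2 ^ B)"
 have "0 < gsum (s / 4) B" "0 < gsum (2 / s) B" using gsum_ge_1[of "s / 4" B] gsum_ge_1[of "2 / s" B] sb by auto
 hence Kp: "0 < K" by (simp add: K_def)
 have main: "ka * lp_dist p x y <= expec G (dif x y) &
 expec G (dif x y) <= 2 ^ 19 * ka * lp_dist p x y"
 if x: "x : grid d D" and y: "y : grid d D" for x y
 proof (cases "x = y")
 case True
 thus ?thesis by (simp add: lp_dist_def)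
 next
 case False
 have len: "length x = d" "length y = d" using x y by (auto simp: grid_def)
 have bd: "x ! t <= D" "y ! t <= D" if "t < d" for t
 using x y that nth_mem[of t x] nth_mem[of t y] by (auto simp: grid_def subset_iff)
 define v where "v t = int (x ! t) - int (y ! t)" for t
 define a where "a t = nat \<bar>v t\<bar>" for t
 have va: "\<bar>real_of_int (v t)\<bar> = real (a t)" for t by (simp add: a_def)
 have aM: "a t <= 2 ^ M" if "t < d" for t 
 proof -
 have "x ! t <= 2 ^ M" "y ! t <= 2 ^ M" using bd[OF that] dM(2) by linarith+
 hence "int (x ! t) <= 2 ^ M" "int (y ! t) <= 2 ^ M" by (metis of_nat_le_iff of_nat_numeral of_nat_power)+
 hence "\<bar>v t\<bar> <= 2 ^ M" unfolding v_def by linarith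
 thus ?thesis by (simp add: a_def nat_le_iff)
 qed
 have nz: "EX t<d. a t ~= 0"
 proof -
 obtain t where "t < d" "x ! t ~= y ! t" using False len by (metis nth_equalityI)
 thus ?thesis by (auto simp: a_def v_def intro!: exI[of _ t])
 qed
 define ta where "ta = (SUM t<d. real (a t) powr p) powr (1 / p)"
 have tau: "lp_dist p x y = ta"
 unfolding lp_dist_def ta_def len using va by (auto simp: v_def intro!: arg_cong2[where f="(powr)"] sum.cong)
 define Y where "Y jj = (SUM i:I. 4 ^ jj i * (real (a (snd i)))\<^sup>2)" for jj :: "nat \<times> nat => nat"
 have sep: "expec (map_pmf (h jj e) (pmf_of_set {0..<P})) (dif x y) =
 min 1 \<bar>SUM i:I. e i * (2 ^ jj i * real_of_int (v (snd i)) / 2 ^ B)\<bar>" for jj e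
 proof -
 have "expec (map_pmf (h jj e) (pmf_of_set {0..<P})) (dif x y) =
 expec (pmf_of_set {0..<P}) (%u. of_bool (((SUM i:I. e i * 2 ^ jj i * int (x ! snd i)) + u) div P ~= ((SUM i:I. e i * 2 ^ jj i * int (y ! snd i)) + u) div P))"
 by (simp add: h_def)
 also have "... = min 1 (\<bar>real_of_int (SUM i:I. e i * 2 ^ jj i * int (x ! snd i)) - real_of_int (SUM i:I. e i * 2 ^ jj i * int (y ! snd i))\<bar> / real_of_int P)"
 by (rule expec_shift_sep[OF P])
 also have "real_of_int (SUM i:I. e i * 2 ^ jj i * int (x ! snd i)) - real_of_int (SUM i:I. e i * 2 ^ jj i * int (y ! snd i)) =
 real_of_int (SUM i:I. e i * 2 ^ jj i * v (snd i))"
 unfolding of_int_diff[symmetric] sum_subtractf[symmetric] by (simp add: v_def algebra_simps)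
 also have "\<bar>real_of_int (SUM i:I. e i * 2 ^ jj i * v (snd i))\<bar> / real_of_int P = \<bar>SUM i:I. e i * (2 ^ jj i * real_of_int (v (snd i)) / 2 ^ B)\<bar>"
 proof -
 have "(SUM i:I. e i * (2 ^ jj i * real_of_int (v (snd i)) / 2 ^ B)) = real_of_int (SUM i:I. e i * 2 ^ jj i * v (snd i)) / 2 ^ B"
 by (simp add: sum_divide_distrib mult.assoc)
 thus ?thesis by (simp add: P_def abs_divide)
 qed
 finally show ?thesis .
 qed
 have eq: "expec G (dif x y) = expec JJ (%jj. expec (signs I) (%e. min 1 \<bar>SUM i:I. e i * (2 ^ jj i * real_of_int (v (snd i)) / 2 ^ B)\<bar>))"
 unfolding G_def using fJJ fS fP by (simp add: expec_bind fin_pmf_bind fin_pmf_map sep del: integral_map_pmf)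
 have sq: "(SUM i:I. (2 ^ jj i * real_of_int (v (snd i)) / 2 ^ B)\<^sup>2) = Y jj / (2 ^ B)\<^sup>2" for jj
 proof -
 have "(2 ^ jj i * real_of_int (v (snd i)) / 2 ^ B)\<^sup>2 = 4 ^ jj i * (real (a (snd i)))\<^sup>2 / (2 ^ B)\<^sup>2" for i
 proof -
 have 1: "(2 ^ jj i)\<^sup>2 = (4 :: real) ^ jj i" by (simp add: power2_eq_square power_mult_distrib[symmetric])
 have 2: "(real_of_int (v (snd i)))\<^sup>2 = (real (a (snd i)))\<^sup>2" unfolding va[symmetric] by simp
 show ?thesis unfolding power_mult_distrib power_divide 1 2 ..
 qed
 thus ?thesis by (simp add: Y_def sum_divide_distrib)
 qed
 have mn: "min 1 (sqrt (Y jj / (2 ^ B)\<^sup>2)) = min (2 ^ B) (sqrt (Y jj)) / 2 ^ B" for jj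
 by (simp add: real_sqrt_divide min_divide_distrib_right)
 \<comment> \<open>Y is a natural number, which provides the gap that the dyadic layers
   require.\<close>
 have Y01: "Y jj = 0 | 1 <= Y jj" for jj
 proof -
 have "Y jj = real (SUM i:I. 4 ^ jj i * (a (snd i))\<^sup>2)" by (simp add: Y_def)
 thus ?thesis by (cases "(SUM i:I. 4 ^ jj i * (a (snd i))\<^sup>2)") auto
 qed
 define Q where "Q jj = (SUM l<=B. min (Y jj) (4 ^ l) / 2 ^ l)" for jj
 have up: "expec (signs I) (%e. min 1 \<bar>SUM i:I. e i * (2 ^ jj i * real_of_int (v (snd i)) / 2 ^ B)\<bar>) <= 2 * Q jj / 2 ^ B" for jj
 proof -
 have "expec (signs I) (%e. min 1 \<bar>SUM i:I. e i * (2 ^ jj i * real_of_int (v (snd i)) / 2 ^ B)\<bar>) <= min (2 ^ B) (sqrt (Y jj)) / 2 ^ B"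
 using truncated_khintchine(1)[OF fI, of "%i. 2 ^ jj i * real_of_int (v (snd i)) / 2 ^ B"] unfolding sq mn .
 also have "... <= 2 * Q jj / 2 ^ B"
 using dyadic_layers(1)[where Y="Y jj" and B=B, OF Y01] unfolding Q_def by (intro divide_right_mono) auto
 finally show ?thesis .
 qed
 have lo: "5 / 16 / 4 / 2 ^ B * Q jj <= expec (signs I) (%e. min 1 \<bar>SUM i:I. e i * (2 ^ jj i * real_of_int (v (snd i)) / 2 ^ B)\<bar>)" for jj
 proof -
 have "5 / 16 / 4 / 2 ^ B * Q jj <= 5 / 16 / 4 / 2 ^ B * (4 * min (2 ^ B) (sqrt (Y jj)))"
 using dyadic_layers(2)[where Y="Y jj" and B=B, OF Y01] unfolding Q_def by (intro mult_left_mono) auto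
 also have "... = 5 / 16 * (min (2 ^ B) (sqrt (Y jj)) / 2 ^ B)" by simp
 also have "... <= expec (signs I) (%e. min 1 \<bar>SUM i:I. e i * (2 ^ jj i * real_of_int (v (snd i)) / 2 ^ B)\<bar>)"
 using truncated_khintchine(2)[OF fI, of "%i. 2 ^ jj i * real_of_int (v (snd i)) / 2 ^ B"] unfolding sq mn .
 finally show ?thesis .
 qed
 define S where "S l = 2 ^ (8 * M) * (SUM t<d. item_sum s B l (real (a t)) / Z)" for l
 have Sl: "(SUM i:I. expec jl (%j. min (4 ^ j * (real (a (snd i)))\<^sup>2) (4 ^ l))) = S l" for l
 proof -
 have "(SUM i:I. expec jl (%j. min (4 ^ j * (real (a (snd i)))\<^sup>2) (4 ^ l))) = (SUM i:I. item_sum s B l (real (a (snd i))) / Z)"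
 by (simp add: jl(2) item_sum_def sum_divide_distrib)
 also have "... = (SUM k:{..<2 ^ (8 * M) :: nat}. SUM t<d. item_sum s B l (real (a t)) / Z)"
 unfolding I_def sum.cartesian_product by (rule sum.cong) auto
 finally show ?thesis by (simp add: S_def)
 qed
 have EQ: "expec JJ Q = (SUM l<=B. expec JJ (%jj. min (Y jj) (4 ^ l)) / 2 ^ l)"
 unfolding Q_def using fJJ by (subst expec_sum) auto
 have EQ_up: "expec JJ Q <= (SUM l<=B. min (4 ^ l) (S l) / 2 ^ l)"
 unfolding EQ
 proof (intro sum_mono divide_right_mono)
 fix l
 show "expec JJ (%jj. min (Y jj) (4 ^ l)) <= min (4 ^ l) (S l)"
 unfolding JJ_def Y_def Sl[symmetric]
 using truncated_sum_upper[OF fI, of "%_. jl" "%i j. 4 ^ j * (real (a (snd i)))\<^sup>2" "4 ^ l" 0] fjl by simp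
 qed auto
 have EQ_lo: "(SUM l<=B. min (4 ^ l) (S l) / 2 ^ l) / 2 <= expec JJ Q"
 unfolding EQ sum_divide_distrib
 proof (intro sum_mono)
 fix l
 have "min (4 ^ l) (S l) / 2 <= expec JJ (%jj. min (Y jj) (4 ^ l))"
 unfolding JJ_def Y_def Sl[symmetric]
 using truncated_sum_lower[OF fI, of "%_. jl" "%i j. 4 ^ j * (real (a (snd i)))\<^sup>2" "4 ^ l" 0] fjl by simp
 hence "min (4 ^ l) (S l) / 2 / 2 ^ l <= expec JJ (%jj. min (Y jj) (4 ^ l)) / 2 ^ l"
 by (intro divide_right_mono) auto
 thus "min (4 ^ l) (S l) / 2 ^ l / 2 <= expec JJ (%jj. min (Y jj) (4 ^ l)) / 2 ^ l" by simp
 qed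
 note le = layer_estimate[OF p s_def d dM(1) M(1) aM nz Z]
 have L1: "(SUM l<=B. min (4 ^ l) (S l) / 2 ^ l) <= 10 * (K * ta)"
 using le(1) unfolding B_def S_def K_def ta_def by blast
 have L2: "K * ta / 1024 <= (SUM l<=B. min (4 ^ l) (S l) / 2 ^ l)"
 using le(2) unfolding B_def S_def K_def ta_def by blast
 have "ka * ta = 5 / 16 / 4 / 2 ^ B * (K * ta / 1024 / 2)" by (simp add: ka_def)
 also have "... <= 5 / 16 / 4 / 2 ^ B * expec JJ Q" using L2 EQ_lo by (intro mult_left_mono) auto
 also have "... = expec JJ (%jj. 5 / 16 / 4 / 2 ^ B * Q jj)" by simp
 also have "... <= expec G (dif x y)" unfolding eq using lo by (intro expec_mono fJJ) auto
 finally have 1: "ka * ta <= expec G (dif x y)" .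
 have "expec G (dif x y) <= expec JJ (%jj. 2 * Q jj / 2 ^ B)" unfolding eq using up by (intro expec_mono fJJ) auto
 also have "... = 2 / 2 ^ B * expec JJ Q" by simp
 also have "... <= 2 / 2 ^ B * (10 * (K * ta))" using L1 EQ_up by (intro mult_left_mono) auto
 also have "... = 524288 * ka * ta" by (simp add: ka_def)
 finally have 2: "expec G (dif x y) <= 2 ^ 19 * ka * ta" by simp
 from 1 2 show ?thesis by (simp add: tau)
 qed
 have "0 < ka" using Kp by (simp add: ka_def)
 with main fG show ?thesis by blast
qed

section \<open>Derandomised sampling\<close>

lemma ex_le_expec:
 assumes "fin_pmf M" shows "EX x:set_pmf M. f x <= expec M f"
proof -
 obtain x where x: "x : set_pmf M" "!!y. y : set_pmf M ==> f x <= f y"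
 using arg_min_if_finite[of "set_pmf M" f] assms set_pmf_not_empty[of M] unfolding fin_pmf_def
 by (metis not_le_imp_less)
 have "expec M (%_. f x) <= expec M f" using x assms by (intro expec_mono) auto
 with x show ?thesis by auto
qed

text \<open>Derandomised Chernoff bound: the samples are chosen one at a time so as not to increase the
 pessimistic estimator \<open>\<Sum>q. exp (\<Sum>i. f q (si i) - 2 * E (f q))\<close>.\<close>

lemma sparsify:
 fixes f :: "'q => 's => real" and B :: real
 assumes M: "fin_pmf M" and Q: "finite Q" "Q ~= {}" and B: "0 < B" and I: "finite I"
 and f: "!!q s. q : Q ==> s : set_pmf M ==> 0 <= f q s & f q s <= B"
 shows "EX si :: 'i => 's. (ALL i. si i : set_pmf M) &
 (ALL q:Q. (SUM i:I. f q (si i)) <= 2 * rc I * expec M (f q) + B * ln (rc Q))"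
proof -
 define g where "g q s = f q s / B" for q s
 define h where "h q s = exp (g q s - 2 * expec M (g q))" for q s
 have g: "0 <= g q s" "g q s <= 1" if "q : Q" "s : set_pmf M" for q s
 using f[OF that] B by (auto simp: g_def)
 \<comment> \<open>On [0, 1] the exponential stays below 1 + 2 g, so its mean is at most exp of
   twice the mean of g. This is where the factor 2 of the bound comes from.\<close>
 have Eh: "expec M (h q) <= 1" if q: "q : Q" for q
 proof -
 have "expec M (h q) = exp (- (2 * expec M (g q))) * expec M (%s. exp (g q s))"
 proof -
 have "h q = (%s. exp (- (2 * expec M (g q))) * exp (g q s))"
 by (auto simp: h_def fun_eq_iff exp_add[symmetric])
 thus ?thesis by simp
 qed
 also have "expec M (%s. exp (g q s)) <= expec M (%s. 1 + 2 * g q s)"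
 proof (rule expec_mono[OF M])
 fix s assume s: "s : set_pmf M"
 have "exp (g q s) <= 1 + g q s + (g q s)\<^sup>2" using g[OF q s] by (intro exp_bound) auto
 also have "(g q s)\<^sup>2 <= g q s * 1" unfolding power2_eq_square using g[OF q s] by (intro mult_left_mono) auto
 finally show "exp (g q s) <= 1 + 2 * g q s" by simp
 qed
 also have "... = 1 + 2 * expec M (g q)" using M by (simp add: fin_integrable)
 also have "... <= exp (2 * expec M (g q))" by (rule exp_ge_add_one_self)
 finally show ?thesis by (simp add: exp_minus field_simps)
 qed
 have "EX si. (ALL i. si i : set_pmf M) & (SUM q:Q. \<Prod>i\<in>I. h q (si i)) <= rc Q"
 using I
 proof (induction I)
 case empty
 obtain s where "s : set_pmf M" using set_pmf_not_empty[of M] by blast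
 thus ?case by (intro exI[of _ "%_. s"]) auto
 next
 case (insert i F)
 then obtain si where si: "ALL i. si i : set_pmf M" "(SUM q:Q. \<Prod>i\<in>F. h q (si i)) <= rc Q" by blast
 define P where "P q = (\<Prod>i\<in>F. h q (si i))" for q
 have P: "0 <= P q" for q unfolding P_def by (intro prod_nonneg) (auto simp: h_def)
 \<comment> \<open>Some atom keeps the estimator at or below its mean over the next sample, and that
   mean is at most the previous value because each factor has mean at most 1.\<close>
 obtain s where s: "s : set_pmf M" "(SUM q:Q. P q * h q s) <= expec M (%s. SUM q:Q. P q * h q s)"
 using ex_le_expec[OF M, of "%s. SUM q:Q. P q * h q s"] by blast
 note s(2)
 also have "expec M (%s. SUM q:Q. P q * h q s) = (SUM q:Q. P q * expec M (h q))"
 by (subst expec_sum[OF M]) simp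
 also have "... <= (SUM q:Q. P q * 1)" using Eh P by (intro sum_mono mult_left_mono) auto
 also have "... <= rc Q" using si(2) by (simp add: P_def)
 finally have le: "(SUM q:Q. P q * h q s) <= rc Q" .
 have "(\<Prod>k\<in>F. h q ((si(i := s)) k)) = P q" for q
 unfolding P_def using insert.hyps by (intro prod.cong) auto
 hence "(\<Prod>k\<in>insert i F. h q ((si(i := s)) k)) = P q * h q s" for q
 using insert.hyps by simp
 thus ?case using le si(1) s(1) by (intro exI[of _ "si(i := s)"]) (auto simp del: fun_upd_apply simp: fun_upd_def)
 qed
 then obtain si where si: "ALL i. si i : set_pmf M" "(SUM q:Q. \<Prod>i\<in>I. h q (si i)) <= rc Q" by blast
 have "(SUM i:I. f q (si i)) <= 2 * rc I * expec M (f q) + B * ln (rc Q)" if q: "q : Q" for q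
 proof -
 \<comment> \<open>All terms of the estimator are positive, so each single one inherits the bound on
   the sum; its logarithm is the claim for q.\<close>
 have "(\<Prod>i\<in>I. h q (si i)) <= (SUM q:Q. \<Prod>i\<in>I. h q (si i))"
 using q Q by (intro member_le_sum) (auto intro!: prod_nonneg simp: h_def)
 also note si(2)
 also have "(\<Prod>i\<in>I. h q (si i)) = exp (SUM i:I. g q (si i) - 2 * expec M (g q))"
 using I by (simp add: h_def exp_sum)
 finally have e: "exp (SUM i:I. g q (si i) - 2 * expec M (g q)) <= rc Q" .
 have "0 < rc Q" using Q by (simp add: card_gt_0_iff)
 with e have "(SUM i:I. g q (si i) - 2 * expec M (g q)) <= ln (rc Q)"
 by (metis exp_le_cancel_iff exp_ln)
 hence "B * (SUM i:I. g q (si i) - 2 * expec M (g q)) <= B * ln (rc Q)"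
 using B by (intro mult_left_mono) auto
 moreover have "expec M (g q) = expec M (f q) / B"
 proof -
 have "g q = (%s. f q s / B)" by (auto simp: g_def)
 thus ?thesis by simp
 qed
 hence "B * (SUM i:I. g q (si i) - 2 * expec M (g q)) = (SUM i:I. f q (si i)) - 2 * rc I * expec M (f q)"
 using B by (simp add: g_def sum_subtractf sum_distrib_left right_diff_distrib)
 ultimately show ?thesis by linarith
 qed
 with si(1) show ?thesis by blast
qed

section \<open>Average distance inside a random cell\<close>

lemma average_bound:
 fixes D :: "'a => real" and M :: "'b pmf" and S :: "'b => 'a set" and r c La :: real
 assumes M: "fin_pmf M" and Om: "finite Om" "x : Om" "D x = 0" "!!z. z : Om ==> 0 <= D z"
 and S: "!!om. om : set_pmf M ==> S om <= Om" "!!om. om : set_pmf M ==> x : S om"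
 and r: "0 < r" and c: "0 <= c" and La: "1 <= La" "rc Om <= exp La"
 and far: "!!z. z : Om ==> expec M (%om. of_bool (z : S om)) <= 3 * exp (- (D z / (2 * r)))"
 and near: "!!z. z : Om ==> expec M (%om. of_bool (z ~: S om)) <= c * D z / r"
 shows "expec M (%om. (SUM z:S om. D z) / rc (S om)) <=
 r * (2 * ln (rc {z : Om. D z <= 4 * La * r} / rc {z : Om. D z <= r / La}) + 2 * ln La + (36 + 8 * c))"
proof -
 \<comment> \<open>Points are sorted by distance. Up to t they contribute at most t to the average.
   Beyond F they are so unlikely that even the sum of their distances is of order r. In between,
   their total is compared with the size of the cell, which rarely falls below half of the ball
   N.\<close>
 define F where "F = 4 * La * r"
 define N where "N = {z : Om. D z <= r / La}"
 define n where "n = rc N"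
 define nF where "nF = rc {z : Om. D z <= F}"
 have rL: "r / La <= F"
 proof -
 have "r / La <= r" using r La(1) by (simp add: field_simps)
 also have "... <= F" unfolding F_def using r La(1) by simp
 finally show ?thesis .
 qed
 have F0: "0 < F" using r La by (simp add: F_def)
 have NS: "N <= {z : Om. D z <= F}" using rL by (auto simp: N_def)
 have fN: "finite N" using Om by (simp add: N_def)
 have "x : N" using Om r La by (simp add: N_def)
 hence n1: "1 <= n" using fN by (simp add: n_def Suc_le_eq card_gt_0_iff) auto
 have nnF: "n <= nF" unfolding n_def nF_def using NS Om(1) by (auto intro: card_mono)
 \<comment> \<open>Chosen so that exp (- t / (2 r)) = n / (nF * La): then nF candidates at distance
   at most F, each with three times this probability, sum to 12 r n.\<close>
 define t where "t = 2 * r * (ln (nF / n) + ln La)"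
 have t0: "0 <= t" unfolding t_def using n1 nnF r La by simp
 define W1 where "W1 = {z : Om. t < D z & D z <= F}"
 define W2 where "W2 = {z : Om. t < D z & F < D z}"
 have W: "finite W1" "finite W2" using Om by (auto simp: W1_def W2_def)
 define ub where "ub om = t + (SUM z:W2. D z * of_bool (z : S om)) + F * (2 / n * (SUM z:N. of_bool (z ~: S om)))
 + 2 / n * (SUM z:W1. D z * of_bool (z : S om))" for om
 have D0: "0 <= D z" if "z : W1 Un W2 Un N" for z using that Om by (auto simp: W1_def W2_def N_def)
 have "expec M (%om. (SUM z:S om. D z) / rc (S om)) <= expec M ub"
 proof (rule expec_mono[OF M])
 fix om assume w: "om : set_pmf M"
 have fS: "finite (S om)" using S(1)[OF w] Om(1) by (rule finite_subset)
 have k1: "1 <= rc (S om)" using S(2)[OF w] fS by (simp add: Suc_le_eq card_gt_0_iff) auto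
 define a1 where "a1 = (SUM z:W1. D z * of_bool (z : S om))"
 define a2 where "a2 = (SUM z:W2. D z * of_bool (z : S om))"
 define b where "b = (SUM z:N. of_bool (z ~: S om) :: real)"
 have a0: "0 <= a1" "0 <= a2" "0 <= b" unfolding a1_def a2_def b_def using D0 by (auto intro!: sum_nonneg)
 have a1: "a1 = (SUM z:S om Int W1. D z)" and a2: "a2 = (SUM z:S om Int W2. D z)"
 unfolding a1_def a2_def using W fS by (auto simp: sum.inter_restrict of_bool_def Int_commute intro!: sum.cong)
 have "(SUM z:S om. D z) = (SUM z:{z : S om. D z <= t} Un (S om Int W1 Un S om Int W2). D z)"
 using S(1)[OF w] by (intro sum.cong) (auto simp: W1_def W2_def)
 also have "... = (SUM z:{z : S om. D z <= t}. D z) + (a1 + a2)"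
 unfolding a1 a2 using fS by (subst sum.union_disjoint; (subst sum.union_disjoint)?) (auto simp: W1_def W2_def)
 also have "(SUM z:{z : S om. D z <= t}. D z) <= (SUM z:S om. t)"
 by (rule order_trans[OF sum_mono[of _ _ "%_. t"] sum_mono2]) (use fS t0 in auto)
 also have "... = t * rc (S om)" by simp
 finally have "(SUM z:S om. D z) / rc (S om) <= t + a1 / rc (S om) + a2 / rc (S om)"
 using k1 by (simp add: field_simps)
 also have "a2 / rc (S om) <= a2" using a0 k1 by (simp add: field_simps mult_le_cancel_left1)
 \<comment> \<open>Either the cell contains half of N, and dividing by its size gains 2 / n; or half
   of N is missing, and then 2 / n * b >= 1 pays for the trivial bound F.\<close>
 also have "a1 / rc (S om) <= F * (2 / n * b) + 2 / n * a1"
 proof (cases "n / 2 <= rc (S om Int N)")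
 case True
 have "rc (S om Int N) <= rc (S om)" using fS by (auto intro: card_mono)
 hence "n / 2 <= rc (S om)" using True by linarith
 hence "a1 / rc (S om) <= a1 / (n / 2)" using a0 n1 k1 by (intro divide_left_mono) auto
 moreover have "0 <= F * (2 / n * b)" using F0 n1 a0 by simp
 moreover have "a1 / (n / 2) = 2 / n * a1" by simp
 ultimately show ?thesis by linarith
 next
 case False
 have "a1 <= (SUM z:S om Int W1. F)" unfolding a1 by (intro sum_mono) (auto simp: W1_def)
 also have "... <= F * rc (S om)" using fS F0 by (auto intro!: card_mono)
 finally have 1: "a1 / rc (S om) <= F" using k1 by (simp add: field_simps)
 have "b = rc (N - S om)"
 unfolding b_def using fN by (simp add: of_bool_def sum.If_cases Diff_eq Collect_neg_eq[symmetric] set_diff_eq Int_def)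
 also have "card (N - S om) = card N - card (S om Int N)"
 using fN by (metis Int_commute card_Diff_subset_Int finite_Int)
 also have "real ... = n - rc (S om Int N)"
 unfolding n_def using fN by (intro of_nat_diff card_mono) auto
 finally have "n / 2 <= b" using False by linarith
 hence "1 <= 2 / n * b" using n1 by (simp add: field_simps)
 hence "F * 1 <= F * (2 / n * b)" using F0 by (intro mult_left_mono) auto
 moreover have "0 <= 2 / n * a1" using n1 a0 by simp
 ultimately show ?thesis using 1 by linarith
 qed
 finally show "(SUM z:S om. D z) / rc (S om) <= ub om"
 by (simp add: ub_def a1_def a2_def b_def)
 qed
 also have "expec M ub = t + (SUM z:W2. D z * expec M (%om. of_bool (z : S om))) + F * (2 / n * (SUM z:N. expec M (%om. of_bool (z ~: S om))))
 + 2 / n * (SUM z:W1. D z * expec M (%om. of_bool (z : S om)))"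
 unfolding ub_def using M by (simp add: fin_integrable)
 also have "... <= t + 12 * r + 8 * c * r + 24 * r"
 proof (intro add_mono order_refl)
 \<comment> \<open>One half of the exponent absorbs the factor D z; the other half is at most exp (-
   La) and cancels the number of points.\<close>
 have "(SUM z:W2. D z * expec M (%om. of_bool (z : S om))) <= (SUM z:W2. 12 * r * exp (- La))"
 proof (rule sum_mono)
 fix z assume z: "z : W2"
 define y where "y = D z / (4 * r)"
 have Dz: "0 <= D z" "z : Om" "F < D z" using z D0 by (auto simp: W2_def)
 have y: "0 <= y" "La <= y" using Dz r by (auto simp: y_def F_def field_simps)
 have "y * exp (- y) <= 1"
 proof -
 have "y <= exp y" using exp_ge_add_one_self[of y] by linarith
 thus ?thesis by (simp add: exp_minus field_simps)
 qed
 have "D z * expec M (%om. of_bool (z : S om)) <= D z * (3 * exp (- (D z / (2 * r))))"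
 using far Dz by (intro mult_left_mono) auto
 also have "D z / (2 * r) = y + y" using r by (simp add: y_def)
 also have "D z * (3 * exp (- (y + y))) = 12 * r * (y * exp (- y)) * exp (- y)"
 proof -
 have "exp (- (y + y)) = exp (- y) * exp (- y)" by (simp add: exp_add[symmetric])
 moreover have "D z = 4 * r * y" using r by (simp add: y_def)
 ultimately show ?thesis by simp
 qed
 also have "... <= 12 * r * 1 * exp (- La)"
 using \<open>y * exp (- y) <= 1\<close> y r by (intro mult_mono mult_left_mono) auto
 finally show "D z * expec M (%om. of_bool (z : S om)) <= 12 * r * exp (- La)" by simp
 qed
 also have "... = rc W2 * (12 * r * exp (- La))" by simp
 also have "... <= exp La * (12 * r * exp (- La))"
 proof (rule mult_right_mono)
 have "card W2 <= card Om" using Om by (intro card_mono) (auto simp: W2_def)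
 thus "rc W2 <= exp La" using La(2) by linarith
 qed (use r in auto)
 finally show "(SUM z:W2. D z * expec M (%om. of_bool (z : S om))) <= 12 * r"
 by (simp add: exp_minus field_simps)
 have "(SUM z:N. expec M (%om. of_bool (z ~: S om))) <= (SUM z:N. c / La)"
 proof (rule sum_mono)
 fix z assume z: "z : N"
 hence "expec M (%om. of_bool (z ~: S om)) <= c * D z / r" using near by (auto simp: N_def)
 also have "... <= c * (r / La) / r" using z c r by (intro divide_right_mono mult_left_mono) (auto simp: N_def)
 finally show "expec M (%om. of_bool (z ~: S om)) <= c / La" using r by simp
 qed
 also have "... = n * (c / La)" by (simp add: n_def)
 finally have "F * (2 / n * (SUM z:N. expec M (%om. of_bool (z ~: S om)))) <= F * (2 / n * (n * (c / La)))"
 using F0 n1 by (intro mult_left_mono) auto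
 also have "... = 8 * c * r" using n1 La by (simp add: F_def field_simps)
 finally show "F * (2 / n * (SUM z:N. expec M (%om. of_bool (z ~: S om)))) <= 8 * c * r" .
 have "(SUM z:W1. D z * expec M (%om. of_bool (z : S om))) <= (SUM z:W1. 12 * r * n / nF)"
 proof (rule sum_mono)
 fix z assume z: "z : W1"
 have Dz: "0 <= D z" "z : Om" "t < D z" "D z <= F" using z D0 by (auto simp: W1_def)
 have "D z * expec M (%om. of_bool (z : S om)) <= D z * (3 * exp (- (D z / (2 * r))))"
 using far Dz by (intro mult_left_mono) auto
 also have "... <= F * (3 * exp (- (t / (2 * r))))"
 using Dz r F0 by (intro mult_mono) (auto simp: divide_right_mono)
 also have "t / (2 * r) = ln (nF / n * La)" using r n1 nnF La by (simp add: t_def ln_mult ln_div)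
 also have "exp (- ln (nF / n * La)) = n / (nF * La)" using n1 nnF La by (simp add: exp_minus)
 also have "F * (3 * (n / (nF * La))) = 12 * r * n / nF" using La by (simp add: F_def field_simps)
 finally show "D z * expec M (%om. of_bool (z : S om)) <= 12 * r * n / nF" .
 qed
 also have "... = rc W1 * (12 * r * n / nF)" by simp
 also have "... <= nF * (12 * r * n / nF)"
 proof (rule mult_right_mono)
 show "rc W1 <= nF" unfolding nF_def using Om by (auto intro!: card_mono simp: W1_def)
 qed (use r n1 nnF in auto)
 also have "... = 12 * r * n" using n1 nnF by simp
 finally have "2 / n * (SUM z:W1. D z * expec M (%om. of_bool (z : S om))) <= 2 / n * (12 * r * n)"
 using n1 by (intro mult_left_mono) auto
 also have "... = 24 * r" using n1 by simp
 finally show "2 / n * (SUM z:W1. D z * expec M (%om. of_bool (z : S om))) <= 24 * r" .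
 qed
 also have "t + 12 * r + 8 * c * r + 24 * r = r * (2 * ln (nF / n) + 2 * ln La + (36 + 8 * c))"
 by (simp add: t_def algebra_simps)
 finally show ?thesis by (simp add: nF_def n_def N_def F_def)
qed

section \<open>Uniform priorities from random permutations\<close>

definition perms_pmf :: "'a set => ('a => 'a) pmf" where
 "perms_pmf U = pmf_of_set {pe. pe permutes U}"

lemma perms_ne: "{pe. pe permutes U} ~= {}"
 using permutes_id by blast

lemma fin_perms_pmf: "finite U ==> fin_pmf (perms_pmf U)"
 unfolding perms_pmf_def by (intro fin_pmf_of_set finite_permutations perms_ne)

lemma arg_min_on_eq:
 fixes f :: "'a => nat"
 assumes "finite Y" "inj_on f Y" "x : Y"
 shows "arg_min_on f Y = x <-> (ALL y:Y. f x <= f y)"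
proof
 assume "arg_min_on f Y = x"
 thus "ALL y:Y. f x <= f y" using arg_min_least[OF assms(1), of _ f] assms(3) by auto
next
 assume a: "ALL y:Y. f x <= f y"
 have m: "arg_min_on f Y : Y" using assms by (intro arg_min_if_finite) auto
 hence "f x <= f (arg_min_on f Y)" using a by blast
 moreover have "f (arg_min_on f Y) <= f x" using assms by (intro arg_min_least) auto
 ultimately show "arg_min_on f Y = x" using assms m by (metis inj_onD order_antisym)
qed

text \<open>Composition with the transposition of two members of Y maps the permutations whose
  minimum is at one of them injectively to those whose minimum is at the other. Hence all members of
  Y are equally likely.\<close>

lemma perms_min_prob:
 fixes key :: "'a => nat"
 assumes U: "finite U" and key: "inj_on key U" and Y: "Y <= U" "z : Y"
 shows "expec (perms_pmf U) (%pe. of_bool (arg_min_on (key o pe) Y = z)) = 1 / rc Y"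
proof -
 define A where "A z = {pe. pe permutes U & arg_min_on (key o pe) Y = z}" for z
 have fP: "finite {pe. pe permutes U}" using U by (rule finite_permutations)
 have fA: "finite (A z)" for z by (rule finite_subset[OF _ fP]) (auto simp: A_def)
 have fY: "finite Y" using Y U finite_subset by blast
 have inj: "inj_on (key o pe) Y" if "pe permutes U" for pe
 proof (rule comp_inj_on)
 show "inj_on pe Y" using that by (meson inj_on_subset permutes_inj subset_UNIV)
 show "inj_on key (pe ` Y)" using key by (rule inj_on_subset) (use that Y permutes_image in blast)
 qed
 have sub: "(%pe. pe o Transposition.transpose a b) ` A a <= A b" if ab: "a : Y" "b : Y" for a b
 proof safe
 fix pe assume pi: "pe : A a"
 define ta where "ta = Transposition.transpose a b"
 have ta: "ta permutes U" unfolding ta_def using ab Y by (intro permutes_swap_id) auto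
 have p: "pe permutes U" using pi by (simp add: A_def)
 have p': "(pe o ta) permutes U" using p ta by (intro permutes_compose)
 have ty: "ta y : Y" if "y : Y" for y using that ab by (auto simp: ta_def Transposition.transpose_def)
 have le: "ALL y:Y. (key o pe) a <= (key o pe) y"
 using arg_min_on_eq[OF fY inj[OF p] ab(1)] pi by (simp add: A_def)
 have "arg_min_on (key o (pe o ta)) Y = b"
 using le ty by (subst arg_min_on_eq[OF fY inj[OF p'] ab(2)]) (auto simp: ta_def)
 with p' show "pe o Transposition.transpose a b : A b" by (simp add: A_def ta_def)
 qed
 have le: "card (A a) <= card (A b)" if "a : Y" "b : Y" for a b
 proof -
 have "inj_on (%pe. pe o Transposition.transpose a b) (A a)"
 proof (rule inj_onI)
 fix f g :: "'a => 'a" assume "f o Transposition.transpose a b = g o Transposition.transpose a b"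
 hence "f (Transposition.transpose a b (Transposition.transpose a b y)) = g (Transposition.transpose a b (Transposition.transpose a b y))" for y
 by (metis comp_apply)
 thus "f = g" by (simp add: fun_eq_iff)
 qed
 hence "card (A a) = card ((%pe. pe o Transposition.transpose a b) ` A a)" by (simp add: card_image)
 also have "... <= card (A b)" by (rule card_mono[OF fA sub[OF that]])
 finally show ?thesis .
 qed
 have "{pe. pe permutes U} = (\<Union>y\<in>Y. A y)"
 proof -
 have "arg_min_on f Y : Y" for f :: "'a => nat" using fY Y by (intro arg_min_if_finite) auto
 thus ?thesis by (auto simp: A_def)
 qed
 hence "card {pe. pe permutes U} = (SUM y:Y. card (A y))"
 using fY fA by (simp add: card_UN_disjoint A_def disjoint_iff)
 also have "... = (SUM y:Y. card (A z))" using le Y by (intro sum.cong) (auto intro: antisym)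
 finally have c: "card {pe. pe permutes U} = card Y * card (A z)" by simp
 have "expec (perms_pmf U) (%pe. of_bool (arg_min_on (key o pe) Y = z)) =
 (SUM pe:{pe. pe permutes U}. of_bool (arg_min_on (key o pe) Y = z)) / rc {pe. pe permutes U}"
 unfolding perms_pmf_def using fP perms_ne by (subst integral_pmf_of_set) auto
 also have "(SUM pe:{pe. pe permutes U}. of_bool (arg_min_on (key o pe) Y = z) :: real) = rc (A z)"
 using fP by (simp add: of_bool_def sum.If_cases A_def Int_def)
 also have "rc (A z) / rc {pe. pe permutes U} = 1 / rc Y"
 proof -
 have "card {pe. pe permutes U} ~= 0" using fP perms_ne[of U] by simp
 thus ?thesis using c by auto
 qed
 finally show ?thesis .
qed

section \<open>The lp metric on the grid and its integer rounding\<close>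

lemma powr_convex_nonneg:
 assumes "1 <= p" "0 <= a" "0 <= b" "0 <= t" "t <= (1::real)"
 shows "((1 - t) * a + t * b) powr p <= (1 - t) * a powr p + t * b powr p"
proof -
 have aux: "(t * b) powr p <= t * b powr p" if "0 <= t" "t <= 1" "0 <= b" for t b :: real
 proof (cases "t = 0")
 case False
 hence "t powr p <= t powr 1" using that assms(1) by (intro powr_mono') auto
 hence "t powr p <= t" using that False by simp
 thus ?thesis using that by (simp add: powr_mult mult_right_mono)
 qed simp
 consider "a = 0" | "b = 0" | "0 < a" "0 < b" using assms by linarith
 thus ?thesis
 proof cases
 case 1
 thus ?thesis using aux[of t b] assms by simp
 next
 case 2
 thus ?thesis using aux[of "1 - t" a] assms by simp
 next
 case 3
 thus ?thesis using convex_onD[OF powr_convex[OF assms(1)], of t a b] assms by simp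
 qed
qed

text \<open>Convexity proof: after normalising both families, their normalised sum is a convex
  combination with weights A / (A + B) and B / (A + B). Vanishing norms are split off so that the
  normalisation makes sense.\<close>

lemma minkowski_sum:
 fixes a b :: "'i => real"
 assumes p: "1 <= p" and fin: "finite I" and a: "!!i. 0 <= a i" and b: "!!i. 0 <= b i"
 shows "(SUM i:I. (a i + b i) powr p) powr (1 / p) <= (SUM i:I. a i powr p) powr (1 / p) + (SUM i:I. b i powr p) powr (1 / p)"
proof -
 define A where "A = (SUM i:I. a i powr p) powr (1 / p)"
 define B where "B = (SUM i:I. b i powr p) powr (1 / p)"
 have Ap: "A powr p = (SUM i:I. a i powr p)" and Bp: "B powr p = (SUM i:I. b i powr p)"
 using p by (auto simp: A_def B_def powr_powr sum_nonneg)
 have AB: "0 <= A" "0 <= B" by (auto simp: A_def B_def)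
 have A0: "a i = 0" if "A = 0" "i : I" for i
 proof -
 have "(SUM i:I. a i powr p) = 0" using Ap that by simp
 hence "a i powr p = 0" using that fin by (subst (asm) sum_nonneg_eq_0_iff) auto
 thus ?thesis by simp
 qed
 have B0: "b i = 0" if "B = 0" "i : I" for i
 proof -
 have "(SUM i:I. b i powr p) = 0" using Bp that by simp
 hence "b i powr p = 0" using that fin by (subst (asm) sum_nonneg_eq_0_iff) auto
 thus ?thesis by simp
 qed
 consider "A = 0" | "B = 0" | "0 < A" "0 < B" using AB by linarith
 thus ?thesis
 proof cases
 case 1
 hence "(SUM i:I. (a i + b i) powr p) = (SUM i:I. b i powr p)" using A0 by (intro sum.cong) auto
 thus ?thesis by simp
 next
 case 2
 hence "(SUM i:I. (a i + b i) powr p) = (SUM i:I. a i powr p)" using B0 by (intro sum.cong) auto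
 thus ?thesis by simp
 next
 case 3
 define t where "t = B / (A + B)"
 have t: "0 <= t" "t <= 1" "1 - t = A / (A + B)" using 3 by (auto simp: t_def field_simps)
 have "(a i + b i) powr p / (A + B) powr p <= (1 - t) * (a i powr p / A powr p) + t * (b i powr p / B powr p)" for i
 proof -
 have "(a i + b i) / (A + B) = (1 - t) * (a i / A) + t * (b i / B)"
 using 3 unfolding t(3) by (simp add: t_def add_divide_distrib)
 hence "(a i + b i) powr p / (A + B) powr p = ((1 - t) * (a i / A) + t * (b i / B)) powr p"
 using a b AB by (simp add: powr_divide[symmetric])
 also have "... <= (1 - t) * (a i / A) powr p + t * (b i / B) powr p"
 using a b AB t p by (intro powr_convex_nonneg) auto
 finally show ?thesis using a b AB by (simp add: powr_divide)
 qed
 hence "(SUM i:I. (a i + b i) powr p / (A + B) powr p) <= (SUM i:I. (1 - t) * (a i powr p / A powr p) + t * (b i powr p / B powr p))"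
 by (rule sum_mono)
 also have "... = (1 - t) * ((SUM i:I. a i powr p) / A powr p) + t * ((SUM i:I. b i powr p) / B powr p)"
 by (simp add: sum.distrib sum_distrib_left sum_divide_distrib)
 also have "... = 1" using 3 by (simp add: Ap[symmetric] Bp[symmetric])
 finally have "(SUM i:I. (a i + b i) powr p) <= (A + B) powr p"
 using 3 by (simp add: sum_divide_distrib[symmetric] field_simps)
 hence "(SUM i:I. (a i + b i) powr p) powr (1 / p) <= ((A + B) powr p) powr (1 / p)"
 using p by (intro powr_mono2) (auto intro!: sum_nonneg)
 thus ?thesis using p AB by (simp add: powr_powr A_def B_def)
 qed
qed

lemma lp_dist_nonneg: "0 <= lp_dist p x y"
 by (simp add: lp_dist_def)

lemma lp_dist_refl: "lp_dist p x x = 0"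
 by (simp add: lp_dist_def)

lemma lp_dist_sym: "length x = length y ==> lp_dist p x y = lp_dist p y x"
 by (simp add: lp_dist_def abs_minus_commute)

lemma lp_dist_triangle:
 assumes p: "1 <= p" and l: "length x = length y" "length y = length z"
 shows "lp_dist p x z <= lp_dist p x y + lp_dist p y z"
proof -
 have "lp_dist p x z <= (SUM i<length x. (\<bar>real (x ! i) - real (y ! i)\<bar> + \<bar>real (y ! i) - real (z ! i)\<bar>) powr p) powr (1 / p)"
 unfolding lp_dist_def using p by (intro powr_mono2 sum_mono) (auto intro!: sum_nonneg)
 also have "... <= lp_dist p x y + lp_dist p y z"
 unfolding lp_dist_def l(1)[symmetric] by (rule minkowski_sum[OF p]) auto
 finally show ?thesis .
qed

lemma grid_nth: "x : grid d D ==> t < d ==> x ! t : {1..D}"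
 by (force simp: grid_def)

lemma grid_length: "x : grid d D ==> length x = d"
 by (simp add: grid_def)

lemma finite_grid: "finite (grid d D)"
proof -
 have "grid d D = {xs. set xs <= {1..D} & length xs = d}" by (auto simp: grid_def)
 thus ?thesis by (simp add: finite_lists_length_eq)
qed

lemma card_grid: "card (grid d D) = D ^ d"
proof -
 have "grid d D = {xs. set xs <= {1..D} & length xs = d}" by (auto simp: grid_def)
 thus ?thesis by (simp add: card_lists_length_eq)
qed

definition cdiff :: "vec => vec => nat => nat" where
 "cdiff x y t = nat \<bar>int (x ! t) - int (y ! t)\<bar>"

lemma cdiff_real: "real (cdiff x y t) = \<bar>real (x ! t) - real (y ! t)\<bar>"
 by (simp add: cdiff_def)

lemma lp_dist_cdiff: "lp_dist p x y = (SUM t<length x. real (cdiff x y t) powr p) powr (1 / p)"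
 by (simp add: lp_dist_def cdiff_real)

lemma cdiff_le:
 assumes "x : grid d D" "y : grid d D" "t < d" shows "cdiff x y t <= D"
 using grid_nth[OF assms(1,3)] grid_nth[OF assms(2,3)] by (auto simp: cdiff_def)

lemma lp_dist_le:
 assumes x: "x : grid d D" and y: "y : grid d D" and p: "1 <= p" and d: "1 <= d"
 shows "lp_dist p x y <= real (d * D)"
proof -
 have "(SUM t<d. real (cdiff x y t) powr p) <= (SUM t<d. real D powr p)"
 using p cdiff_le[OF x y] by (intro sum_mono powr_mono2) auto
 also have "... = real d * real D powr p" by simp
 also have "... <= real d powr p * real D powr p"
 using powr_mono[of 1 p "real d"] d p by (intro mult_right_mono) auto
 also have "... = real (d * D) powr p" by (simp add: powr_mult)
 finally have "(SUM t<d. real (cdiff x y t) powr p) powr (1 / p) <= (real (d * D) powr p) powr (1 / p)"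
 using p by (intro powr_mono2) (auto intro!: sum_nonneg)
 thus ?thesis using p by (simp add: powr_powr lp_dist_cdiff grid_length[OF x] del: of_nat_mult)
qed

lemma lp_dist_ge_1:
 assumes x: "x : grid d D" and y: "y : grid d D" and p: "1 <= p" and "x ~= y"
 shows "1 <= lp_dist p x y"
proof -
 obtain t where t: "t < d" "x ! t ~= y ! t"
 using assms grid_length[OF x] grid_length[OF y] by (metis nth_equalityI)
 have "1 <= real (cdiff x y t) powr p"
 using t p by (intro ge_one_powr_ge_zero) (auto simp: cdiff_def)
 also have "... <= (SUM t<d. real (cdiff x y t) powr p)" using t by (intro member_le_sum) auto
 finally have "1 powr (1 / p) <= (SUM t<d. real (cdiff x y t) powr p) powr (1 / p)"
 using p by (intro powr_mono2) auto
 thus ?thesis by (simp add: lp_dist_cdiff grid_length[OF x])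
qed

text \<open>Rounding up never shortens a distance and makes powers and roots natural numbers that
  fit into tables: differences of coordinates are at most D, sums of rounded powers at most d
  D^2.\<close>

definition pow_tab :: "real => nat => nat" where
 "pow_tab p a = nat \<lceil>real a powr p\<rceil>"

definition root_tab :: "real => nat => nat" where
 "root_tab p s = nat \<lceil>real s powr (1 / p)\<rceil>"

definition wdist :: "real => vec => vec => nat" where
 "wdist p x y = root_tab p (SUM t<length x. pow_tab p (cdiff x y t))"

lemma wdist_sym: "length x = length y ==> wdist p x y = wdist p y x"
 by (simp add: wdist_def cdiff_def abs_minus_commute)

lemma pow_tab_bounds:
 assumes "1 <= p"
 shows "real a powr p <= real (pow_tab p a)" "real (pow_tab p a) <= 2 * real a powr p"
proof -
 show "real a powr p <= real (pow_tab p a)" unfolding pow_tab_def by linarith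
 show "real (pow_tab p a) <= 2 * real a powr p"
 proof (cases "a = 0")
 case False
 hence "1 <= real a powr p" using assms by (intro ge_one_powr_ge_zero) auto
 thus ?thesis unfolding pow_tab_def by linarith
 qed (simp add: pow_tab_def)
qed

lemma root_tab_bounds:
 assumes "1 <= p"
 shows "real s powr (1 / p) <= real (root_tab p s)" "real (root_tab p s) <= 2 * real s powr (1 / p)"
proof -
 show "real s powr (1 / p) <= real (root_tab p s)" unfolding root_tab_def by linarith
 show "real (root_tab p s) <= 2 * real s powr (1 / p)"
 proof (cases "s = 0")
 case False
 hence "1 <= real s powr (1 / p)" using assms by (intro ge_one_powr_ge_zero) auto
 thus ?thesis unfolding root_tab_def by linarith
 qed (simp add: root_tab_def)
qed

lemma pow_tab_le:
 assumes "1 <= p" "p <= 2" "a <= D" shows "pow_tab p a <= D^2"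
proof (cases "a = 0")
 case False
 hence "real a powr p <= real a powr 2" using assms by (intro powr_mono) auto
 also have "... = real (a^2)" using False by (simp add: powr_numeral)
 also have "... <= real (D^2)" using assms by (intro of_nat_mono power_mono) auto
 finally have "\<lceil>real a powr p\<rceil> <= int (D^2)" by (simp add: ceiling_le_iff)
 thus ?thesis unfolding pow_tab_def by (simp only: nat_le_iff)
qed (simp add: pow_tab_def)

lemma root_tab_le:
 assumes "1 <= p" shows "root_tab p s <= s"
proof (cases "s = 0")
 case False
 hence "real s powr (1 / p) <= real s powr 1" using assms by (intro powr_mono) auto
 hence "\<lceil>real s powr (1 / p)\<rceil> <= int s" using False by (simp add: ceiling_le_iff)
 thus ?thesis unfolding root_tab_def by (simp only: nat_le_iff)
qed (simp add: root_tab_def)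

lemma wdist_ge: "1 <= p ==> lp_dist p x y <= real (wdist p x y)"
proof -
 assume p: "1 <= p"
 have "lp_dist p x y <= real (SUM t<length x. pow_tab p (cdiff x y t)) powr (1 / p)"
 unfolding lp_dist_cdiff of_nat_sum using p pow_tab_bounds(1)[OF p]
 by (intro powr_mono2 sum_mono) (auto intro!: sum_nonneg)
 also have "... <= real (wdist p x y)" unfolding wdist_def by (rule root_tab_bounds[OF p])
 finally show ?thesis .
qed

text \<open>Rounding up a number that is 0 or at least 1 at most doubles it. The root itself costs a
  factor 2, and the doubled powers leave the root as 2 powr (1 / p) <= 2.\<close>

lemma wdist_le: "1 <= p ==> real (wdist p x y) <= 4 * lp_dist p x y"
proof -
 assume p: "1 <= p"
 have "real (wdist p x y) <= 2 * real (SUM t<length x. pow_tab p (cdiff x y t)) powr (1 / p)"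
 unfolding wdist_def by (rule root_tab_bounds[OF p])
 also have "real (SUM t<length x. pow_tab p (cdiff x y t)) powr (1 / p) <= (2 * (SUM t<length x. real (cdiff x y t) powr p)) powr (1 / p)"
 unfolding of_nat_sum sum_distrib_left using p pow_tab_bounds(2)[OF p]
 by (intro powr_mono2 sum_mono) (auto intro!: sum_nonneg)
 also have "... = 2 powr (1 / p) * lp_dist p x y"
 unfolding lp_dist_cdiff by (simp add: powr_mult sum_nonneg)
 also have "... <= 2 powr 1 * lp_dist p x y"
 using p by (intro mult_right_mono powr_mono lp_dist_nonneg) auto
 finally show ?thesis by simp
qed

section \<open>Growth of balls across scales\<close>

definition rat :: "real => vec set => vec => real => real => real" where
 "rat p Om x La r = ln (rc {z : Om. lp_dist p x z <= 4 * La * r} / rc {z : Om. lp_dist p x z <= r / La})"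

context
 fixes p La :: real and Om :: "vec set" and x :: "vec"
 assumes fin: "finite Om" and x: "x : Om" and La: "1 <= La"
begin

lemma rat_bounds:
 assumes "0 < r" shows "0 <= rat p Om x La r" "rat p Om x La r <= ln (rc Om)"
proof -
 define a where "a = card {z : Om. lp_dist p x z <= 4 * La * r}"
 define b where "b = card {z : Om. lp_dist p x z <= r / La}"
 have rL: "r / La <= 4 * La * r"
 proof -
 have "r / La <= r * 1" using assms La by (simp add: field_simps)
 also have "... <= r * (4 * La)" using assms La by (intro mult_left_mono) auto
 finally show ?thesis by (simp add: mult_ac)
 qed
 have "x : {z : Om. lp_dist p x z <= r / La}" using x assms La by (simp add: lp_dist_refl)
 hence b1: "1 <= b" unfolding b_def using fin by (simp add: Suc_le_eq card_gt_0_iff) auto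
 have ab: "b <= a" unfolding a_def b_def using fin rL by (intro card_mono) auto
 have am: "a <= card Om" unfolding a_def using fin by (intro card_mono) auto
 have r: "rat p Om x La r = ln (real a / real b)" by (simp add: rat_def a_def b_def)
 show "0 <= rat p Om x La r" unfolding r using b1 ab by simp
 have "real a / real b <= real a / 1" using b1 by (intro divide_left_mono) auto
 also have "... <= rc Om" using am by simp
 finally show "rat p Om x La r <= ln (rc Om)" unfolding r using b1 ab am by (subst ln_le_cancel_iff) auto
qed

text \<open>The two balls of a ratio have radii differing by the factor 4 La^2 <= 2^h, that is, by
  at most h halvings. The sum of the differences f i - f (i + h) telescopes, leaving h logarithms of
  cardinalities whatever the number of levels.\<close>

lemma sum_rat:
 assumes R: "0 < R" and h: "4 * La^2 <= 2 ^ h"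
 shows "(SUM i<n. rat p Om x La (R / 2 ^ i)) <= real h * ln (rc Om)"
proof -
 define f where "f i = ln (rc {z : Om. lp_dist p x z <= 4 * La * (R / 2 ^ i)})" for i
 have c1: "1 <= rc {z : Om. lp_dist p x z <= s}" if "0 <= s" for s
 proof -
 have "x : {z : Om. lp_dist p x z <= s}" using x that by (simp add: lp_dist_refl)
 thus ?thesis using fin by (simp add: Suc_le_eq card_gt_0_iff) auto
 qed
 have f0: "0 <= f i" for i unfolding f_def using c1[of "4 * La * (R / 2 ^ i)"] R La by simp
 have fm: "f i <= ln (rc Om)" for i
 proof -
 have "rc {z : Om. lp_dist p x z <= 4 * La * (R / 2 ^ i)} <= rc Om"
 using fin by (auto intro: card_mono)
 thus ?thesis unfolding f_def using c1[of "4 * La * (R / 2 ^ i)"] R La by (subst ln_le_cancel_iff) auto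
 qed
 have step: "rat p Om x La (R / 2 ^ i) <= f i - f (i + h)" for i
 proof -
 have "4 * La * (R / 2 ^ (i + h)) <= R / 2 ^ i / La"
 proof -
 have "4 * La * (R / 2 ^ (i + h)) = (4 * La^2) / 2 ^ h * (R / 2 ^ i / La)"
 using La by (simp add: power_add power2_eq_square field_simps)
 also have "... <= 1 * (R / 2 ^ i / La)" using h R La by (intro mult_right_mono) (auto simp: field_simps)
 finally show ?thesis by simp
 qed
 hence "card {z : Om. lp_dist p x z <= 4 * La * (R / 2 ^ (i + h))} <= card {z : Om. lp_dist p x z <= R / 2 ^ i / La}"
 using fin by (intro card_mono) auto
 hence "f (i + h) <= ln (rc {z : Om. lp_dist p x z <= R / 2 ^ i / La})"
 unfolding f_def using c1[of "4 * La * (R / 2 ^ (i + h))"] R La by (subst ln_le_cancel_iff) auto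
 moreover have "rat p Om x La (R / 2 ^ i) = f i - ln (rc {z : Om. lp_dist p x z <= R / 2 ^ i / La})"
 unfolding rat_def f_def using c1[of "4 * La * (R / 2 ^ i)"] c1[of "R / 2 ^ i / La"] R La by (subst ln_div) auto
 ultimately show ?thesis by linarith
 qed
 have tele: "(SUM i<h. f i) + (SUM i<n. f (i + h)) = (SUM i<n + h. f i)" for n
 by (induction n) (auto simp: add.commute)
 have "(SUM i<n. rat p Om x La (R / 2 ^ i)) <= (SUM i<n. f i - f (i + h))" by (intro sum_mono step)
 also have "... = (SUM i<n. f i) - (SUM i<n. f (i + h))" by (simp add: sum_subtractf)
 also have "(SUM i<n. f i) <= (SUM i<n + h. f i)" using f0 by (intro sum_mono2) auto
 also have "(SUM i<n + h. f i) - (SUM i<n. f (i + h)) = (SUM i<h. f i)" using tele[of n] by simp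
 also have "... <= (SUM i<h. ln (rc Om))" by (intro sum_mono fm)
 finally show ?thesis by simp
qed

end

section \<open>The hierarchy of hash cells and its expected stretch\<close>

locale hash_levels =
 fixes d D :: nat and p ka :: real and G :: "(vec => int) pmf" and n0 :: nat
 assumes d: "1 <= d" and D: "2 <= D" and p: "1 <= p" "p <= 2" and fG: "fin_pmf G"
 and ka: "0 < ka" and n0: "real n0 * ka * real (d * D) = 1"
 and sep_lo: "!!x y. x : grid d D ==> y : grid d D ==> ka * lp_dist p x y <= expec G (dif x y)"
 and sep_up: "!!x y. x : grid d D ==> y : grid d D ==> expec G (dif x y) <= 2 ^ 19 * ka * lp_dist p x y"
begin

text \<open>Level j adds n0 * 2^j fresh hashes. With n0 * ka * d * D = 1, all hashes up to level i
  >= 1 cut a pair at distance r an expected number of times of order r /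
  \<open>rad i\<close>.\<close>

definition Jl :: "nat => (nat \<times> nat) set" where
 "Jl i = Sigma {1..i} (%j. {..<n0 * 2 ^ j})"

abbreviation M where "M == m0 d D"

definition rad :: "nat => real" where "rad i = real (d * D) / 2 ^ i"

definition hashes :: "hsh pmf" where
 "hashes = Pi_pmf (Jl M) (%_. 0) (%_. G)"

definition hlist :: "hsh => nat => vec => int list" where
 "hlist om i x = concat (map (%j. map (%t. om (j, t) x) [0..<n0 * 2 ^ j]) [1..<Suc i])"

text \<open>Cumulative hash lists make the cells nested. Level 0 is one cell because its list is
  empty; past level M a vector is its own label, so the last cells are singletons.\<close>

definition lab :: "hsh => nat => vec => nat" where
 "lab om i x = (if i <= M then to_nat (hlist om i x) else to_nat x)"

text \<open>Cells are taken for an arbitrary set of hashes, so that a single hash can be withdrawn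
  from a level.\<close>

definition scell :: "(nat \<times> nat) set => vec set => hsh => vec => vec set" where
 "scell A Om om x = {z : Om. ALL q:A. om q z = om q x}"

definition savg :: "(nat \<times> nat) set => vec set => hsh => vec => real" where
 "savg A Om om x = (SUM z:scell A Om om x. lp_dist p x z) / rc (scell A Om om x)"

lemma finite_Jl: "finite (Jl i)"
 by (simp add: Jl_def)

lemma fin_hashes: "fin_pmf hashes"
 unfolding hashes_def using finite_Jl fG by (intro fin_pmf_Pi) auto

lemma Jl_mono: "i <= j ==> Jl i <= Jl j"
 by (auto simp: Jl_def)

lemma card_Jl: "card (Jl i) = n0 * (2 ^ (i + 1) - 2)"
proof -
 have "card (Jl i) = (SUM j:{1..i}. n0 * 2 ^ j)" by (simp add: Jl_def)
 also have "... = n0 * (2 ^ (i + 1) - 2)"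
 proof (induction i)
 case (Suc i)
 have "(2::nat) <= 2 ^ (i + 1)" by simp
 thus ?case using Suc by (simp add: algebra_simps)
 qed simp
 finally show ?thesis .
qed

lemma hlist_eq_iff: "hlist om i x = hlist om i y <-> (ALL q:Jl i. om q x = om q y)"
proof (induction i)
 case (Suc i)
 have len: "length (hlist om i x) = length (hlist om i y)" by (simp add: hlist_def length_concat comp_def)
 have S: "hlist om (Suc i) z = hlist om i z @ map (%t. om (Suc i, t) z) [0..<n0 * 2 ^ Suc i]" for z
 by (simp add: hlist_def)
 have J: "Jl (Suc i) = Jl i Un {Suc i} \<times> {..<n0 * 2 ^ Suc i}" by (auto simp: Jl_def le_Suc_eq)
 show ?case unfolding S J using Suc len by (auto simp: map_eq_conv atLeast0LessThan)
qed (simp add: hlist_def Jl_def)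

lemma lab_eq_iff: "i <= M ==> lab om i x = lab om i y <-> (ALL q:Jl i. om q x = om q y)"
 by (simp add: lab_def hlist_eq_iff)

lemma lab_last: "M < i ==> lab om i x = lab om i y <-> x = y"
 by (simp add: lab_def)

lemma lab_0: "lab om 0 x = lab om 0 y"
 by (simp add: lab_eq_iff Jl_def)

abbreviation "sep om i x y == lab om (Suc i) x ~= lab om (Suc i) y"

lemma lab_nested: "lab om (Suc i) x = lab om (Suc i) y ==> lab om i x = lab om i y"
proof (cases "Suc i <= M")
 case True
 assume "lab om (Suc i) x = lab om (Suc i) y"
 thus ?thesis using True Jl_mono[of i "Suc i"] by (auto simp: lab_eq_iff)
qed (simp add: lab_last)

lemma kn0: "real n0 * ka = 1 / real (d * D)"
 using n0 d D by (simp add: field_simps)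

lemma n0_pos: "0 < n0"
 using n0 by (cases n0) auto

lemma expec_agree:
 fixes A J :: "(nat \<times> nat) set" and x z :: "vec"
 assumes J: "finite J" and A: "A <= J"
 shows "expec (Pi_pmf J (%_. 0) (%_. G)) (%om. of_bool (ALL q:A. om q z = om q x)) =
 (1 - expec G (dif z x)) ^ card A"
proof -
 define h where "h q g = (if q : A then of_bool (g z = g x) else 1 :: real)" for q :: "nat \<times> nat" and g :: "vec => int"
 have fA: "finite A" using A J by (rule finite_subset)
 have "of_bool (ALL q:A. om q z = om q x) = (\<Prod>q\<in>J. h q (om q))" for om :: "nat \<times> nat => vec => int"
 proof -
 have "(\<Prod>q\<in>J. h q (om q)) = (\<Prod>q\<in>A. of_bool (om q z = om q x))"
 unfolding h_def using J A by (simp add: prod.If_cases Int_absorb1)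
 also have "... = of_bool (ALL q:A. om q z = om q x)" using fA by (induction A) auto
 finally show ?thesis by simp
 qed
 hence "expec (Pi_pmf J (%_. 0) (%_. G)) (%om. of_bool (ALL q:A. om q z = om q x)) =
 expec (Pi_pmf J (%_. 0) (%_. G)) (%om. \<Prod>q\<in>J. h q (om q))" by simp
 also have "... = (\<Prod>q\<in>J. expec G (h q))"
 using J fG by (intro expectation_prod_Pi_pmf) (auto simp: fin_integrable h_def)
 also have "... = (\<Prod>q\<in>J. if q : A then expec G (%g. of_bool (g z = g x)) else 1)"
 proof (rule prod.cong[OF refl])
 fix q
 have "h q = (if q : A then (%g. of_bool (g z = g x)) else (%_. 1))" by (auto simp: h_def)
 thus "expec G (h q) = (if q : A then expec G (%g. of_bool (g z = g x)) else 1)" by simp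
 qed
 also have "... = expec G (%g. of_bool (g z = g x)) ^ card A"
 using J A by (simp add: prod.If_cases Int_absorb1)
 also have "expec G (%g. of_bool (g z = g x)) = 1 - expec G (dif z x)"
 using expec_diff[OF fG, of "%_. 1" "%g. of_bool (g z ~= g x)"] by (simp add: of_bool_not_iff)
 finally show ?thesis .
qed

abbreviation C1 :: real where "C1 == 36 + 8 * 2 ^ 20"

text \<open>Independence supplies both hypotheses of the averaging bound: a point survives all cuts
  with probability (1 - de)^(card A), exponentially small in its distance over r, and is lost with
  probability at most card A * de, which gives 2 * 2^19 = 2^20. At r = d * D every distance is at
  most r, and the factor 3 > e makes the survival bound trivial.\<close>

lemma avg_cuts:
 assumes J: "finite J" "A <= J" and Om: "Om <= grid d D" "x : Om"
 and La: "1 <= La" "rc Om <= exp La" and r: "0 < r"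
 and A1: "r = real (d * D) | 1 / (2 * r) <= rc A * ka" and A2: "rc A * ka <= 2 / r"
 shows "expec (Pi_pmf J (%_. 0) (%_. G)) (%om. savg A Om om x) <= r * (2 * rat p Om x La r + 2 * ln La + C1)"
proof -
 let ?P = "Pi_pmf J (%_. 0) (%_. G)"
 have fP: "fin_pmf ?P" using J fG by (intro fin_pmf_Pi) auto
 have xg: "x : grid d D" using Om by auto
 have "expec ?P (%om. (SUM z:scell A Om om x. lp_dist p x z) / rc (scell A Om om x)) <=
 r * (2 * ln (rc {z : Om. lp_dist p x z <= 4 * La * r} / rc {z : Om. lp_dist p x z <= r / La}) + 2 * ln La + (36 + 8 * 2 ^ 20))"
 proof (rule average_bound[OF fP])
 show "finite Om" using Om finite_grid finite_subset by blast
 show "1 <= La" "rc Om <= exp La" "0 < r" "x : Om" by fact+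
 fix z assume z: "z : Om"
 hence zg: "z : grid d D" using Om by auto
 define de where "de = expec G (dif z x)"
 have sy: "lp_dist p z x = lp_dist p x z" using grid_length[OF zg] grid_length[OF xg] by (intro lp_dist_sym) simp
 have de: "ka * lp_dist p x z <= de" "de <= 2 ^ 19 * ka * lp_dist p x z"
 using sep_lo[OF zg xg] sep_up[OF zg xg] by (auto simp: de_def sy)
 have de1: "0 <= de" "de <= 1" 
 unfolding de_def using expec_mono[OF fG, of "%g. of_bool (g z ~= g x)" "%_. 1"] by (auto intro!: expec_nonneg)
 have pr: "expec ?P (%om. of_bool (z : scell A Om om x)) = (1 - de) ^ card A"
 using expec_agree[OF J, of z x] z by (simp add: scell_def de_def)
 have lp: "0 <= lp_dist p x z" by (rule lp_dist_nonneg)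
 show "expec ?P (%om. of_bool (z : scell A Om om x)) <= 3 * exp (- (lp_dist p x z / (2 * r)))"
 using A1
 proof
 assume "r = real (d * D)"
 hence "lp_dist p x z <= r" using lp_dist_le[OF xg zg p(1) d] by simp
 hence "exp (- 1) <= exp (- (lp_dist p x z / (2 * r)))" using r lp by (simp add: field_simps)
 moreover have "1 / 3 <= exp (- 1 :: real)"
 using exp_le by (simp add: exp_minus field_simps)
 moreover have "(1 - de) ^ card A <= 1" using de1 by (intro power_le_one) auto
 ultimately show ?thesis unfolding pr by linarith
 next
 assume a: "1 / (2 * r) <= rc A * ka"
 have "(1 - de) ^ card A <= exp (- de) ^ card A"
 using de1 exp_ge_add_one_self[of "- de"] by (intro power_mono) auto
 also have "... = exp (- (rc A * de))" by (simp add: exp_of_nat_mult[symmetric])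
 also have "... <= exp (- (lp_dist p x z / (2 * r)))"
 proof -
 have "lp_dist p x z / (2 * r) <= lp_dist p x z * (rc A * ka)"
 using mult_left_mono[OF a lp] by simp
 also have "... <= rc A * de" using mult_left_mono[OF de(1), of "rc A"] by (simp add: mult_ac)
 finally show ?thesis by simp
 qed
 finally show ?thesis unfolding pr using exp_ge_zero[of "- (lp_dist p x z / (2 * r))"] by linarith
 qed
 have "expec ?P (%om. of_bool (z ~: scell A Om om x)) = 1 - (1 - de) ^ card A"
 using expec_diff[OF fP, of "%_. 1" "%om. of_bool (z : scell A Om om x)"] unfolding pr by (simp add: of_bool_not_iff)
 also have "... <= rc A * de" using Bernoulli_inequality[of "- de" "card A"] de1 by simp
 also have "... <= rc A * (2 ^ 19 * ka * lp_dist p x z)" using de by (intro mult_left_mono) auto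
 also have "... = rc A * ka * (2 ^ 19 * lp_dist p x z)" by simp
 also have "... <= 2 / r * (2 ^ 19 * lp_dist p x z)" using A2 lp by (intro mult_right_mono) auto
 finally show "expec ?P (%om. of_bool (z ~: scell A Om om x)) <= 2 ^ 20 * lp_dist p x z / r" by simp
 qed (use Om in "auto simp: lp_dist_refl lp_dist_nonneg scell_def")
 thus ?thesis by (simp add: savg_def rat_def)
qed

text \<open>Withdrawing at most one hash keeps the number of cuts of level i within a factor 4 below
  2 / (ka * \<open>rad i\<close>). Level 0, which has no cuts, is the exception in the first
  claim.\<close>

lemma rad_cut_bounds:
 assumes "B <= {q}"
 shows "rad i = real (d * D) | 1 / (2 * rad i) <= rc (Jl i - B) * ka"
 "rc (Jl i - B) * ka <= 2 / rad i" "0 < rad i"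
proof -
 have dD: "0 < real (d * D)" using d D by simp
 show "0 < rad i" using dD by (simp add: rad_def)
 have 1: "card (Jl i - B) <= n0 * 2 ^ (i + 1)"
 using card_mono[OF finite_Jl, of "Jl i - B" i] card_Jl[of i] by (metis Diff_subset diff_le_self le_trans mult_le_mono2)
 have "rc (Jl i - B) * ka <= real (n0 * 2 ^ (i + 1)) * ka"
 using 1 ka by (intro mult_right_mono of_nat_mono) auto
 also have "... = 2 ^ (i + 1) * (real n0 * ka)" by simp
 also have "... = 2 / rad i" unfolding kn0 by (simp add: rad_def)
 finally show "rc (Jl i - B) * ka <= 2 / rad i" .
 show "rad i = real (d * D) | 1 / (2 * rad i) <= rc (Jl i - B) * ka"
 proof (cases "i = 0")
 case False
 then obtain k where k: "i = Suc k" by (cases i) auto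
 have "n0 * (2 ^ k + 1) <= n0 * (2 ^ (i + 1) - 2)"
 proof (rule mult_left_mono)
 have "(1::nat) <= 2 ^ k" by simp
 hence "2 ^ k + 3 <= (2::nat) ^ (i + 1)" unfolding k by simp
 thus "2 ^ k + 1 <= (2::nat) ^ (i + 1) - 2" by linarith
 qed simp
 hence "n0 * 2 ^ k + 1 <= card (Jl i)" unfolding card_Jl using n0_pos by (simp add: algebra_simps)
 moreover have "card (Jl i) <= card (Jl i - B) + 1"
 proof -
 have "finite B" "card B <= 1" using assms finite_subset[of B "{q}"] card_mono[of "{q}" B] by auto
 thus ?thesis using diff_card_le_card_Diff[of B "Jl i"] by linarith
 qed
 ultimately have "n0 * 2 ^ k <= card (Jl i - B)" by linarith
 hence "real (n0 * 2 ^ k) * ka <= rc (Jl i - B) * ka" using ka by (intro mult_right_mono of_nat_mono) auto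
 moreover have "real (n0 * 2 ^ k) * ka = 2 ^ k * (real n0 * ka)" by simp
 moreover have "2 ^ k * (real n0 * ka) = 1 / (2 * rad i)" unfolding kn0 by (simp add: rad_def k)
 ultimately show ?thesis by simp
 qed (simp add: rad_def)
qed

lemma savg_nonneg: "0 <= savg A Om om x"
 unfolding savg_def by (intro divide_nonneg_nonneg sum_nonneg lp_dist_nonneg) auto

text \<open>The cut by q and the cell of x may depend on the same hash. Revealing g = om q first
  leaves the other hashes independent, and the cell is then one of the remaining hashes: within the
  slice on which g agrees with x if q is among the hashes up to level i, within Om otherwise. Adding
  both ratios covers the two cases.\<close>

lemma expected_cut:
 assumes q: "q : Jl (Suc i)" and i: "i < M" and Om: "Om <= grid d D" "x : Om"
 and La: "1 <= La" "rc Om <= exp La"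
 shows "expec hashes (%om. of_bool (om q x ~= om q y) * savg (Jl i) Om om x) <=
 rad i * expec G (%g. of_bool (g x ~= g y) * (2 * rat p {z : Om. g z = g x} x La (rad i) + 2 * rat p Om x La (rad i) + 2 * ln La + C1))"
proof -
 let ?J = "Jl M - {q}"
 have fOm: "finite Om" using Om finite_grid finite_subset by blast
 have qM: "q : Jl M" using q i Jl_mono[of "Suc i" M] by auto
 have JM: "Jl M = insert q ?J" using qM by auto
 have fJ: "finite ?J" using finite_Jl by simp
 have A: "Jl i - {q} <= ?J" using Jl_mono[of i M] i by auto
 have "expec hashes (%om. of_bool (om q x ~= om q y) * savg (Jl i) Om om x) =
 expec G (%g. expec (Pi_pmf ?J (%_. 0) (%_. G)) (%om. of_bool (g x ~= g y) * savg (Jl i) Om (fun_upd om q g) x))"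
 unfolding hashes_def by (subst JM, subst expec_Pi_insert) (use fJ fG in auto)
 also have "... <= expec G (%g. rad i * (of_bool (g x ~= g y) * (2 * rat p {z : Om. g z = g x} x La (rad i) + 2 * rat p Om x La (rad i) + 2 * ln La + C1)))"
 proof (rule expec_mono[OF fG])
 fix g :: "vec => int"
 define Og where "Og = {z : Om. g z = g x}"
 define Om' where "Om' = (if q : Jl i then Og else Om)"
 have s: "scell (Jl i) Om (fun_upd om q g) x = scell (Jl i - {q}) Om' om x" for om
 by (auto simp: scell_def Om'_def Og_def)
 have sa: "savg (Jl i) Om (fun_upd om q g) x = savg (Jl i - {q}) Om' om x" for om
 unfolding savg_def s ..
 have Om': "Om' <= grid d D" "x : Om'" "Om' <= Om" using Om by (auto simp: Om'_def Og_def)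
 have c: "rc Om' <= exp La" using card_mono[OF fOm Om'(3)] La(2) by linarith
 have r0: "0 < rad i" by (rule rad_cut_bounds(3)[of "{}"]) simp
 have "expec (Pi_pmf ?J (%_. 0) (%_. G)) (%om. savg (Jl i - {q}) Om' om x) <= rad i * (2 * rat p Om' x La (rad i) + 2 * ln La + C1)"
 by (rule avg_cuts[OF fJ A Om'(1,2) La(1) c r0 rad_cut_bounds(1,2)[OF order_refl]])
 also have "... <= rad i * (2 * rat p Og x La (rad i) + 2 * rat p Om x La (rad i) + 2 * ln La + C1)"
 proof (rule mult_left_mono)
 have "0 <= rat p Om x La (rad i)" by (rule rat_bounds(1)[OF fOm Om(2) La(1) r0])
 moreover have "0 <= rat p Og x La (rad i)"
 by (rule rat_bounds(1)[OF _ _ La(1) r0]) (use fOm Om in "auto simp: Og_def")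
 ultimately show "2 * rat p Om' x La (rad i) + 2 * ln La + C1 <= 2 * rat p Og x La (rad i) + 2 * rat p Om x La (rad i) + 2 * ln La + C1"
 by (simp add: Om'_def)
 qed (use r0 in auto)
 finally show "expec (Pi_pmf ?J (%_. 0) (%_. G)) (%om. of_bool (g x ~= g y) * savg (Jl i) Om (fun_upd om q g) x) <=
 rad i * (of_bool (g x ~= g y) * (2 * rat p {z : Om. g z = g x} x La (rad i) + 2 * rat p Om x La (rad i) + 2 * ln La + C1))"
 unfolding sa by (cases "g x = g y") (auto simp: Og_def)
 qed
 finally show ?thesis by simp
qed

text \<open>A union bound turns separation at level i + 1 into single cuts, whose number times
  \<open>rad i\<close> is at most 4 / ka; thus the scale cancels. The sum over levels is moved
  inside the expectation over g, where the slice is the same at every level and the ratios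
  telescope. The factor 2^21 is 4 * 2^19.\<close>

lemma expected_stretch:
 assumes Om: "Om <= grid d D" "x : Om" "y : Om" "x ~= y"
 and La: "1 <= La" "rc Om <= exp La" and h: "4 * La^2 <= 2 ^ h"
 shows "expec hashes (%om. SUM i<Suc M. of_bool (sep om i x y) * savg (Jl i) Om om x) <=
 lp_dist p x y * (2 ^ 21 * (4 * real h * La + real M * (2 * ln La + C1)) + (2 * La + 2 * ln La + C1))"
proof -
 have fOm: "finite Om" using Om finite_grid finite_subset by blast
 have g: "x : grid d D" "y : grid d D" using Om by auto
 define W where "W g i = 2 * rat p {z : Om. g z = g x} x La (rad i) + 2 * rat p Om x La (rad i) + 2 * ln La + C1" for g :: "vec => int" and i
 have r0: "0 < rad i" for i by (rule rad_cut_bounds(3)[of "{}"]) simp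
 have lnL: "0 <= ln La" using La by simp
 have lncard: "ln (rc Om') <= La" if "Om' <= Om" "x : Om'" for Om'
 proof -
 have "rc Om' <= exp La" using card_mono[OF fOm that(1)] La(2) by linarith
 moreover have "0 < rc Om'" using that fOm finite_subset[OF that(1)] by (auto simp: card_gt_0_iff)
 ultimately show ?thesis by (metis ln_exp ln_le_cancel_iff exp_gt_zero)
 qed
 have W0: "0 <= W g i" for g :: "vec => int" and i
 proof -
 have "0 <= rat p Om x La (rad i)" by (rule rat_bounds(1)[OF fOm Om(2) La(1) r0])
 moreover have "0 <= rat p {z : Om. g z = g x} x La (rad i)"
 by (rule rat_bounds(1)[OF _ _ La(1) r0]) (use fOm Om in auto)
 ultimately show ?thesis using lnL by (simp add: W_def)
 qed
 have lev: "expec hashes (%om. of_bool (sep om i x y) * savg (Jl i) Om om x) <=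
 4 / ka * expec G (%g. of_bool (g x ~= g y) * W g i)" if i: "i < M" for i
 proof -
 have "expec hashes (%om. of_bool (sep om i x y) * savg (Jl i) Om om x) <=
 expec hashes (%om. SUM q:Jl (Suc i). of_bool (om q x ~= om q y) * savg (Jl i) Om om x)"
 proof (rule expec_mono[OF fin_hashes])
 fix om
 have "of_bool (sep om i x y) <= (SUM q:Jl (Suc i). of_bool (om q x ~= om q y) :: real)"
 proof (cases "lab om (Suc i) x = lab om (Suc i) y")
 case False
 then obtain q where q: "q : Jl (Suc i)" "om q x ~= om q y" using i by (auto simp: lab_eq_iff)
 have "of_bool (om q x ~= om q y) <= (SUM q:Jl (Suc i). of_bool (om q x ~= om q y) :: real)"
 using q finite_Jl by (intro member_le_sum) auto
 thus ?thesis using q False by simp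
 qed (simp add: sum_nonneg)
 hence "of_bool (sep om i x y) * savg (Jl i) Om om x <= (SUM q:Jl (Suc i). of_bool (om q x ~= om q y) :: real) * savg (Jl i) Om om x"
 by (intro mult_right_mono savg_nonneg)
 thus "of_bool (sep om i x y) * savg (Jl i) Om om x <= (SUM q:Jl (Suc i). of_bool (om q x ~= om q y) * savg (Jl i) Om om x)"
 by (simp only: sum_distrib_right)
 qed
 also have "... = (SUM q:Jl (Suc i). expec hashes (%om. of_bool (om q x ~= om q y) * savg (Jl i) Om om x))"
 by (rule expec_sum[OF fin_hashes])
 also have "... <= (SUM q:Jl (Suc i). rad i * expec G (%g. of_bool (g x ~= g y) * W g i))"
 unfolding W_def by (intro sum_mono expected_cut i Om La)
 also have "... = real (card (Jl (Suc i))) * rad i * expec G (%g. of_bool (g x ~= g y) * W g i)" by simp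
 also have "... <= 4 / ka * expec G (%g. of_bool (g x ~= g y) * W g i)"
 proof (rule mult_right_mono)
 have "card (Jl (Suc i)) <= n0 * 2 ^ (i + 2)" unfolding card_Jl by simp
 hence "real (card (Jl (Suc i))) * rad i <= real (n0 * 2 ^ (i + 2)) * rad i"
 using r0[of i] by (intro mult_right_mono of_nat_mono) auto
 also have "... = 4 * (real n0 * real (d * D))" by (simp add: rad_def)
 also have "real n0 * real (d * D) = 1 / ka" using n0 ka by (simp add: field_simps)
 finally show "real (card (Jl (Suc i))) * rad i <= 4 / ka" by simp
 qed (use W0 in "auto intro!: expec_nonneg")
 finally show ?thesis .
 qed
 have "expec hashes (%om. SUM i<Suc M. of_bool (sep om i x y) * savg (Jl i) Om om x) =
 (SUM i<M. expec hashes (%om. of_bool (sep om i x y) * savg (Jl i) Om om x)) + expec hashes (%om. savg (Jl M) Om om x)"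
 by (subst expec_sum[OF fin_hashes]) (use Om(4) in "simp add: lab_last")
 also have "(SUM i<M. expec hashes (%om. of_bool (sep om i x y) * savg (Jl i) Om om x)) <=
 (SUM i<M. 4 / ka * expec G (%g. of_bool (g x ~= g y) * W g i))"
 by (intro sum_mono lev) auto
 also have "... = 4 / ka * expec G (%g. of_bool (g x ~= g y) * (SUM i<M. W g i))"
 unfolding sum_distrib_left[symmetric] by (simp add: expec_sum[OF fG, symmetric] sum_distrib_left)
 also have "... <= 4 / ka * expec G (%g. of_bool (g x ~= g y) * (4 * real h * La + real M * (2 * ln La + C1)))"
 proof (intro mult_left_mono expec_mono[OF fG])
 fix g :: "vec => int"
 have 1: "(SUM i<M. rat p Om x La (rad i)) <= real h * La"
 proof -
 have "(SUM i<M. rat p Om x La (rad i)) <= real h * ln (rc Om)"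
 unfolding rad_def using d D by (intro sum_rat fOm Om La h) auto
 also have "... <= real h * La" using lncard[of Om] Om by (intro mult_left_mono) auto
 finally show ?thesis .
 qed
 have 2: "(SUM i<M. rat p {z : Om. g z = g x} x La (rad i)) <= real h * La"
 proof -
 have "(SUM i<M. rat p {z : Om. g z = g x} x La (rad i)) <= real h * ln (rc {z : Om. g z = g x})"
 unfolding rad_def using d D fOm Om by (intro sum_rat La h) auto
 also have "... <= real h * La" using lncard[of "{z : Om. g z = g x}"] Om by (intro mult_left_mono) auto
 finally show ?thesis .
 qed
 have "(SUM i<M. W g i) = 2 * (SUM i<M. rat p {z : Om. g z = g x} x La (rad i)) + 2 * (SUM i<M. rat p Om x La (rad i)) + real M * (2 * ln La + C1)"
 unfolding W_def by (simp add: sum.distrib sum_distrib_left algebra_simps)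
 also have "... <= 4 * real h * La + real M * (2 * ln La + C1)" using 1 2 by simp
 finally show "(SUM i<M. W g i) <= 4 * real h * La + real M * (2 * ln La + C1)" .
 qed (use ka in auto)
 also have "... = 4 / ka * expec G (dif x y) * (4 * real h * La + real M * (2 * ln La + C1))" by simp
 also have "... <= 4 / ka * (2 ^ 19 * ka * lp_dist p x y) * (4 * real h * La + real M * (2 * ln La + C1))"
 using sep_up[OF g] ka La lnL by (intro mult_right_mono mult_left_mono) auto
 also have "... = lp_dist p x y * (2 ^ 21 * (4 * real h * La + real M * (2 * ln La + C1)))" using ka by simp
 \<comment> \<open>Separation into singletons is certain here, so no probability helps. But
   \<open>rad M\<close> is at most 1 and distinct grid points are at distance at least 1, so this
   one level costs in proportion to the distance.\<close>
 also have "expec hashes (%om. savg (Jl M) Om om x) <= lp_dist p x y * (2 * La + 2 * ln La + C1)"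
 proof -
 have "expec hashes (%om. savg (Jl M - {}) Om om x) <= rad M * (2 * rat p Om x La (rad M) + 2 * ln La + C1)"
 unfolding hashes_def using finite_Jl
 by (intro avg_cuts Om La r0 rad_cut_bounds(1,2)[where q=undefined]) auto
 also have "... <= rad M * (2 * La + 2 * ln La + C1)"
 proof (rule mult_left_mono)
 have "rat p Om x La (rad M) <= ln (rc Om)" by (rule rat_bounds(2)[OF fOm Om(2) La(1) r0])
 thus "2 * rat p Om x La (rad M) + 2 * ln La + C1 <= 2 * La + 2 * ln La + C1"
 using lncard[of Om] Om by simp
 qed (use r0[of M] in simp)
 also have "... <= lp_dist p x y * (2 * La + 2 * ln La + C1)"
 proof (rule mult_right_mono)
 have "real (d * D) <= real (2 ^ M)" using m0_le[of d D] by (rule of_nat_mono)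
 hence "rad M <= 1" by (simp add: rad_def)
 also have "1 <= lp_dist p x y" by (rule lp_dist_ge_1[OF g p(1) Om(4)])
 finally show "rad M <= lp_dist p x y" .
 qed (use La lnL in auto)
 finally show ?thesis by simp
 qed
 finally show ?thesis by (simp add: algebra_simps)
qed

end

text \<open>Mixing the hash family with a constant function multiplies all cut probabilities by th.
  This lowers ka to exactly 1 / (n0 d D) with a natural number n0.\<close>

lemma ex_hash_levels:
 assumes d: "1 <= d" and D: "2 <= D" and p: "1 <= p" "p <= 2"
 shows "EX ka G n0. hash_levels d D p ka G n0"
proof -
 obtain ka0 and G0 :: "(vec => int) pmf" where k0: "0 < ka0" and fG0: "fin_pmf G0" and
 GG: "ALL x:grid d D. ALL y:grid d D.
 ka0 * lp_dist p x y <= expec G0 (dif x y) &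
 expec G0 (dif x y) <= 2 ^ 19 * ka0 * lp_dist p x y"
 using ex_hash_family[OF assms] by blast
 have G0: "fin_pmf G0"
 "!!x y. x : grid d D ==> y : grid d D ==> ka0 * lp_dist p x y <= expec G0 (dif x y)"
 "!!x y. x : grid d D ==> y : grid d D ==> expec G0 (dif x y) <= 2 ^ 19 * ka0 * lp_dist p x y"
 using fG0 GG by auto
 define n0 where "n0 = nat \<lceil>1 / (ka0 * real (d * D))\<rceil> + 1"
 have dD: "0 < real (d * D)" using d D by simp
 have "1 / (ka0 * real (d * D)) <= real n0" unfolding n0_def by linarith
 hence n0: "1 <= real n0 * (ka0 * real (d * D))" using k0 dD by (simp add: field_simps)
 have n0p: "0 < real n0" by (simp add: n0_def)
 define ka where "ka = 1 / (real n0 * real (d * D))"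
 have kp: "0 < ka" using n0p dD by (simp add: ka_def)
 have kk: "ka <= ka0" 
 proof -
 have "1 <= ka0 * (real n0 * real (d * D))" using n0 by (simp only: mult_ac)
 moreover have "0 < real n0 * real (d * D)" using n0p dD by (intro mult_pos_pos)
 ultimately show ?thesis unfolding ka_def by (simp only: divide_le_eq if_True)
 qed
 define th where "th = ka / ka0"
 have th: "0 <= th" "th <= 1" using kk kp k0 by (auto simp: th_def)
 define G where "G = bind_pmf (bernoulli_pmf th) (%b. if b then G0 else return_pmf (%_. 0))"
 have fb: "fin_pmf (bernoulli_pmf th)" by (simp add: fin_pmf_def)
 have fG: "fin_pmf G" unfolding G_def using fb G0(1) by (intro fin_pmf_bind) (auto simp: fin_pmf_return)
 have E: "expec G (dif x y) = th * expec G0 (dif x y)" for x y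
 unfolding G_def by (subst expec_bind[OF fb]) (use G0(1) th in "auto simp: fin_pmf_return")
 have k: "ka = th * ka0" using k0 by (simp add: th_def)
 have "hash_levels d D p ka G n0"
 proof
 show "real n0 * ka * real (d * D) = 1" using n0p dD d D by (simp add: ka_def)
 fix x y assume xy: "x : grid d D" "y : grid d D"
 show "ka * lp_dist p x y <= expec G (dif x y)"
 unfolding E using mult_left_mono[OF G0(2)[OF xy] th(1)] by (simp add: k mult.assoc)
 show "expec G (dif x y) <= 2 ^ 19 * ka * lp_dist p x y"
 unfolding E using mult_left_mono[OF G0(3)[OF xy] th(1)] by (simp add: k mult_ac)
 qed (use assms fG kp in auto)
 thus ?thesis by blast
qed

section \<open>Representatives and a finite supply of seeds\<close>

definition cell :: "(nat => vec => nat) => vec set => nat => vec => vec set" where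
 "cell lab Om i x = {z : Om. lab i z = lab i x}"

definition rep :: "(nat => vec => nat) => (vec => nat) => vec set => nat => vec => vec" where
 "rep lab pr Om i x = arg_min_on pr (cell lab Om i x)"

text \<open>Digits in base D + 1. The number may exceed a machine word, so the programs compare keys
  digit by digit.\<close>

definition key :: "nat => vec => nat" where
 "key D xs = foldl (%a c. a * (D + 1) + c) 0 xs"

lemma key_snoc: "key D (xs @ [c]) = key D xs * (D + 1) + c"
 by (simp add: key_def)

lemma key_less_iff:
 assumes "length xs = length ys" "c <= D" "e <= D"
 shows "key D (xs @ [c]) < key D (ys @ [e]) <-> key D xs < key D ys | (key D xs = key D ys & c < e)"
proof -
 have "a * (D + 1) + c < b * (D + 1) + e" if "a < b" for a b
 proof -
 have "(a + 1) * (D + 1) <= b * (D + 1)" using that by (intro mult_le_mono1) auto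
 thus ?thesis using assms by simp
 qed
 moreover have "b * (D + 1) + e < a * (D + 1) + c" if "b < a" for a b
 proof -
 have "(b + 1) * (D + 1) <= a * (D + 1)" using that by (intro mult_le_mono1) auto
 thus ?thesis using assms by simp
 qed
 ultimately show ?thesis unfolding key_snoc by (metis add_less_cancel_left nat_neq_iff not_less_iff_gr_or_eq)
qed

lemma key_inj:
 assumes "length xs = length ys" "set xs <= {..D}" "set ys <= {..D}" "key D xs = key D ys"
 shows "xs = ys"
 using assms
proof (induction xs arbitrary: ys rule: rev_induct)
 case (snoc c xs)
 obtain zs e where ys: "ys = zs @ [e]" using snoc.prems(1) by (cases ys rule: rev_cases) auto
 have eq: "key D xs * (D + 1) + c = key D zs * (D + 1) + e" using snoc.prems(4) by (simp only: ys key_snoc)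
 have ce: "c < D + 1" "e < D + 1" using snoc.prems by (auto simp: ys)
 have "c = e" using arg_cong[OF eq, of "%n. n mod (D + 1)"] ce by (simp only: mod_mult_self3 mod_less)
 moreover have "key D xs * Suc D = key D zs * Suc D" using eq \<open>c = e\<close> by simp
 hence "key D xs = key D zs" by (simp only: mult_cancel2) simp
 ultimately show ?case using snoc ys by auto
qed simp

lemma key_inj_on_grid: "inj_on (key D) (grid d D)"
 by (rule inj_onI) (auto intro!: key_inj simp: grid_def subset_iff)

lemma cell_refl: "x : Om ==> x : cell lab Om i x"
 by (simp add: cell_def)

lemma cell_cong: "lab i x = lab i y ==> cell lab Om i x = cell lab Om i y"
 by (simp add: cell_def)

lemma finite_cell: "finite Om ==> finite (cell lab Om i x)"
 by (simp add: cell_def)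

lemma cell_subset: "cell lab Om i x <= Om"
 by (auto simp: cell_def)

lemma rep_cong: "lab i x = lab i y ==> rep lab pr Om i x = rep lab pr Om i y"
 by (simp add: rep_def cell_cong[of lab i x y])

lemma rep_in_cell: "finite Om ==> cell lab Om i x ~= {} ==> rep lab pr Om i x : cell lab Om i x"
 unfolding rep_def by (rule arg_min_if_finite(1)) (auto simp: finite_cell)

lemma rep_min: "finite Om ==> z : cell lab Om i x ==> pr (rep lab pr Om i x) <= pr z"
 unfolding rep_def by (rule arg_min_least) (auto simp: finite_cell)

lemma rep_eqI:
 assumes "finite Om" "inj_on pr Om" "z : cell lab Om i x" "!!y. y : cell lab Om i x ==> pr z <= pr y"
 shows "rep lab pr Om i x = z"
proof -
 have r: "rep lab pr Om i x : cell lab Om i x" using assms by (intro rep_in_cell) auto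
 have "pr (rep lab pr Om i x) = pr z" using rep_min[OF assms(1,3), of pr] assms(4)[OF r] by simp
 moreover have "rep lab pr Om i x : Om" "z : Om" using r assms(3) cell_subset by blast+
 ultimately show ?thesis using assms(2) by (auto dest: inj_onD)
qed

text \<open>The vector of least priority is uniform in its cell; a mean over priorities is a mean
  over the cell.\<close>

lemma expec_rep:
 assumes "Om <= grid d D" "x : Om" 
 shows "expec (perms_pmf (grid d D)) (%pe. f (rep lb (key D o pe) Om i x)) =
 (SUM z:cell lb Om i x. f z) / rc (cell lb Om i x)"
proof -
 let ?P = "perms_pmf (grid d D)" and ?Y = "cell lb Om i x"
 have fOm: "finite Om" using assms finite_grid finite_subset by blast
 have fP: "fin_pmf ?P" by (rule fin_perms_pmf[OF finite_grid])
 have Y: "?Y <= grid d D" "?Y ~= {}" "finite ?Y" 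
 using cell_subset[of lb Om i x] cell_refl[OF assms(2), of lb i] finite_cell[OF fOm, of lb i x] assms(1) by auto
 have "f (rep lb (key D o pe) Om i x) = (SUM z:?Y. f z * of_bool (arg_min_on (key D o pe) ?Y = z))" for pe
 proof -
 have "arg_min_on (key D o pe) ?Y : ?Y" using Y by (intro arg_min_if_finite) auto
 thus ?thesis using Y by (simp add: rep_def of_bool_def sum.delta' if_distrib cong: if_cong)
 qed
 hence "expec ?P (%pe. f (rep lb (key D o pe) Om i x)) = (SUM z:?Y. f z * expec ?P (%pe. of_bool (arg_min_on (key D o pe) ?Y = z)))"
 by (simp add: expec_sum[OF fP])
 also have "... = (SUM z:?Y. f z * (1 / real (card ?Y)))"
 using perms_min_prob[OF finite_grid key_inj_on_grid Y(1)] by (intro sum.cong) auto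
 finally show ?thesis by (simp add: sum_divide_distrib)
qed

definition good_seed :: "nat => nat => seed => bool" where
 "good_seed d D s <-> (ALL x y. fst s 0 x = fst s 0 y) &
 (ALL i x y. fst s (Suc i) x = fst s (Suc i) y --> fst s i x = fst s i y) &
 (ALL x y. fst s (Suc (m0 d D)) x = fst s (Suc (m0 d D)) y --> x = y) &
 snd s permutes grid d D"

text \<open>Controls the half of the tree path on the side of x: an edge from level i to level i + 1
  belongs to it only if x and y are separated at level i + 1.\<close>

definition stretch :: "real => nat => nat => vec set => vec => vec => seed => real" where
 "stretch p d D Om x y s = (SUM i<Suc (m0 d D). of_bool (fst s (Suc i) x ~= fst s (Suc i) y) *
 lp_dist p x (rep (fst s) (key D o snd s) Om i x))"

text \<open>Counts the records to be rewritten when x enters or leaves. As x represents a cell with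
  probability one over its size, each level contributes exactly 1 in expectation.\<close>

definition load :: "nat => nat => vec set => vec => seed => real" where
 "load d D Om x s = (SUM i<=Suc (m0 d D). of_bool (rep (fst s) (key D o snd s) Om i x = x) *
 real (card (cell (fst s) Om i x)))"

text \<open>Since f >= ln 2, additive constants are absorbed into multiples of f. The leading term
  2^21 * 3 * 2^23, from the constant of the averaging bound, is well below 2^47.\<close>

lemma log_factor_bound:
 fixes f :: real and M h :: nat
 assumes f: "ln 2 <= f" and M: "real M <= 3 * f" and h: "real h <= 3 + 3 * ln (1 + f)"
 shows "2 ^ 21 * (4 * real h * (1 + f) + real M * (2 * ln (1 + f) + (36 + 8 * 2 ^ 20))) + (2 * (1 + f) + 2 * ln (1 + f) + (36 + 8 * 2 ^ 20))
 <= 2 ^ 47 * (f * (1 + ln (1 + f)))"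
proof -
 have f2: "2 / 3 <= f" using f ln2_ge_two_thirds by linarith
 define l where "l = ln (1 + f)"
 have l0: "0 <= l" using f2 by (simp add: l_def)
 have fl: "0 <= f * l" using f2 l0 by simp
 have h': "real h * (1 + f) <= (3 + 3 * l) * (5 / 2 * f)"
 using h f2 l0 unfolding l_def[symmetric] by (intro mult_mono) auto
 have M': "real M * (2 * l + (36 + 8 * 2 ^ 20)) <= 3 * f * (2 * l + (36 + 8 * 2 ^ 20))"
 using M l0 by (intro mult_right_mono) auto
 have lf: "l <= 3 / 2 * (f * l)" using mult_right_mono[OF f2 l0] by simp
 have "2 ^ 21 * (4 * real h * (1 + f) + real M * (2 * l + (36 + 8 * 2 ^ 20))) + (2 * (1 + f) + 2 * l + (36 + 8 * 2 ^ 20))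
 <= 2 ^ 21 * (4 * ((3 + 3 * l) * (5 / 2 * f)) + 3 * f * (2 * l + (36 + 8 * 2 ^ 20))) + (2 * (5 / 2 * f) + 3 * (f * l) + (36 + 8 * 2 ^ 20) * (3 / 2 * f))"
 
 proof -
 have "4 * real h * (1 + f) <= 4 * ((3 + 3 * l) * (5 / 2 * f))" using h' by linarith
 thus ?thesis using M' lf f2 by (intro add_mono mult_left_mono) auto
 qed
 also have "... <= 2 ^ 47 * (f * (1 + l))"
 using f2 fl by (simp add: algebra_simps)
 finally show ?thesis by (simp add: l_def)
qed

lemma m0_le_ln:
 assumes "2 <= d * D" shows "real (m0 d D) <= 3 * ln (real (d * D))"
proof -
 have ge: "2 / 3 <= ln (2::real)" by (rule ln2_ge_two_thirds)
 have 1: "ln 2 <= ln (real (d * D))" using assms by (subst ln_le_cancel_iff) linarith+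
 have "real (2 ^ (m0 d D - 1)) <= real (d * D)" using m0_less[OF assms] by linarith
 moreover have "0 < real (d * D)" using assms by linarith
 ultimately have "ln (2 ^ (m0 d D - 1)) <= ln (real (d * D))" by (subst ln_le_cancel_iff) (simp_all del: of_nat_mult)
 hence "real (m0 d D - 1) * ln 2 <= ln (real (d * D))" by (simp add: ln_realpow)
 moreover have "real (m0 d D - 1) * (2 / 3) <= real (m0 d D - 1) * ln 2" using ge by (intro mult_left_mono) auto
 moreover have "real (m0 d D) = real (m0 d D - 1) + 1" using m0_ge_1[OF assms] by simp
 ultimately show ?thesis using 1 ge by linarith
qed

lemma m0_le_self: "m0 d D <= d * D"
 unfolding m0_def by (rule Least_le) (simp add: less_imp_le)

text \<open>On the left stands the largest value of a sampled quantity times the logarithm of the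
  number of quantities: two kinds, 2^(D^d) subsets, two points each. Once the number of seeds
  exceeds this product, the additive Chernoff error per seed is at most 1.\<close>

lemma sample_size:
 fixes d D :: nat
 assumes d: "1 <= d" and D: "2 <= D"
 shows "real (Suc (Suc (m0 d D))) * real (d * D) * real (D ^ d) * ln (real (2 * 2 ^ (D ^ d) * D ^ d * D ^ d))
 <= 2 ^ ((2 * d + 6) * m0 d D)"
proof -
 define n where "n = d * D"
 have n: "2 <= n" using d D mult_le_mono[of 1 d 2 D] by (simp add: n_def)
 define g where "g = real (D ^ d)"
 have g1: "2 <= g" unfolding g_def using D d self_le_power[of D d] by linarith
 have "ln (real (2 * 2 ^ (D ^ d) * D ^ d * D ^ d)) = ln (2 * 2 ^ (D ^ d) * g * g)" by (simp add: g_def)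
 also have "... = ln 2 + g * ln 2 + ln g + ln g" using g1 by (simp add: ln_mult ln_realpow) (simp add: g_def)
 also have "... <= 1 + g * 1 + (g - 1) + (g - 1)"
 using ln_2_less_1 g1 by (intro add_mono mult_left_mono ln_le_minus_one) auto
 also have "... <= 3 * g" by simp
 finally have l: "ln (real (2 * 2 ^ (D ^ d) * D ^ d * D ^ d)) <= 3 * g" .
 have m: "real (Suc (Suc (m0 d D))) <= 2 * real n" using m0_le_self[of d D] n unfolding n_def[symmetric] by simp
 have gn: "g <= real n ^ d"
 proof -
 have "D <= n" using d by (simp add: n_def)
 hence "D ^ d <= n ^ d" by (rule power_mono) simp
 thus ?thesis by (simp add: g_def of_nat_le_iff[symmetric, where 'a=real] del: of_nat_le_iff)
 qed
 have "real (Suc (Suc (m0 d D))) * real (d * D) * real (D ^ d) * ln (real (2 * 2 ^ (D ^ d) * D ^ d * D ^ d))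
 <= 2 * real n * real n * g * (3 * g)"
 proof -
 have "1 <= 2 * 2 ^ (D ^ d) * D ^ d * D ^ d" using D by (simp add: Suc_le_eq)
 hence "0 <= ln (real (2 * 2 ^ (D ^ d) * D ^ d * D ^ d))" by (intro ln_ge_zero) linarith
 thus ?thesis unfolding n_def[symmetric] g_def[symmetric] using l m g1
 by (intro mult_mono) (auto simp: g_def simp del: of_nat_mult of_nat_power)
 qed
 also have "... = 6 * (real n)\<^sup>2 * (g * g)" by (simp add: power2_eq_square)
 also have "... <= real n ^ 4 * (real n)\<^sup>2 * (real n ^ d * real n ^ d)"
 proof (intro mult_mono)
 have "(2::real) ^ 4 <= real n ^ 4" using n by (intro power_mono) auto
 thus "6 <= real n ^ 4" by simp
 qed (use gn g1 in auto)
 also have "... = real n ^ (2 * d + 6)" by (simp add: power_add[symmetric])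
 also have "... <= (2 ^ m0 d D) ^ (2 * d + 6)"
 proof (rule power_mono)
 have "real n <= real (2 ^ m0 d D)" using m0_le[of d D] unfolding n_def by (rule of_nat_mono)
 thus "real n <= 2 ^ m0 d D" by simp
 qed simp
 finally show ?thesis by (simp add: power_mult[symmetric] mult.commute)
qed

text \<open>Both estimates are imposed at once for all sets and points. The error of 1 per seed is
  absorbed: distinct grid points have distance at least 1, which bounds the stretch bound away from
  0, and the load has mean m0 + 2, so twice the mean plus 1 is 2 m0 + 5.\<close>

lemma ex_seeds:
 fixes d D :: nat and p :: real
 assumes d: "1 <= d" and D: "2 <= D" and p: "1 <= p" "p <= 2"
 defines "N == (2 * d + 6) * m0 d D"
 shows "EX sd :: bool list => seed.
 (ALL bs. good_seed d D (sd bs)) &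
 (ALL Om x y. Om <= grid d D --> x : Om --> y : Om -->
 (SUM bs:{bs. length bs = N}. stretch p d D Om x y (sd bs)) <=
 2 ^ N * (2 ^ 49 * soft 1 (ln (real (card Om * d * D))) * lp_dist p x y)) &
 (ALL Om x. Om <= grid d D --> x : Om -->
 (SUM bs:{bs. length bs = N}. load d D Om x (sd bs)) <= 2 ^ N * (2 * real (m0 d D) + 5))"
proof -
 obtain ka G n0 where "hash_levels d D p ka G n0" using ex_hash_levels[OF assms(1-4)] by blast
 then interpret hash_levels d D p ka G n0 .
 let ?P = "perms_pmf (grid d D)"
 have dD: "2 <= d * D" using d D mult_le_mono[of 1 d 2 D] by simp
 have fP: "fin_pmf ?P" by (rule fin_perms_pmf[OF finite_grid])
 define SS where "SS = pair_pmf (map_pmf lab hashes) ?P"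
 have fSS: "fin_pmf SS" unfolding SS_def by (intro fin_pmf_pair fin_pmf_map fin_hashes fP)
 have good: "good_seed d D s" if "s : set_pmf SS" for s
 proof -
 have "fst s : set_pmf (map_pmf lab hashes)" using that by (auto simp: SS_def)
 then obtain om where w: "fst s = lab om" by auto
 have "snd s permutes grid d D"
 using that by (auto simp: SS_def perms_pmf_def set_pmf_of_set[OF perms_ne finite_permutations[OF finite_grid]])
 thus ?thesis unfolding good_seed_def w using lab_0 lab_nested lab_last by (metis lessI)
 qed
 have ESS: "expec SS f = expec hashes (%om. expec ?P (%pe. f (lab om, pe)))" for f
 unfolding SS_def using fin_hashes fP by (simp add: expec_pair fin_pmf_map)
 have cs: "cell (lab om) Om i x = scell (Jl i) Om om x" if "i <= M" for om Om i x
 using that by (auto simp: cell_def scell_def lab_eq_iff)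
 define Q where "Q = (UNIV :: bool set) \<times> Pow (grid d D) \<times> grid d D \<times> grid d D"
 \<comment> \<open>The Boolean selects stretch or load; quadruples that do not describe points of a
   set get the value 0.\<close>
 define F where "F q s = (case q of (b, Om, x, y) => if Om <= grid d D & x : Om & y : Om then
 (if b then stretch p d D Om x y s else load d D Om x s) else 0)" for q s
 define B where "B = real (Suc (Suc M)) * real (d * D) * real (D ^ d)"
 have Bp: "0 < B" using d D by (simp add: B_def)
 have fQ: "finite Q" unfolding Q_def using finite_grid by auto
 have "replicate d 1 : grid d D" using D by (auto simp: grid_def)
 hence Qne: "Q ~= {}" unfolding Q_def by auto
 have cQ: "card Q = 2 * 2 ^ (D ^ d) * D ^ d * D ^ d"
 unfolding Q_def by (simp add: card_cartesian_product card_Pow finite_grid card_grid)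
 have dD1: "1 <= real (d * D)" using dD by linarith
 have Dd1: "1 <= real (D ^ d)" using D by simp
 have Fb: "0 <= F q s & F q s <= B" if q: "q : Q" for q s
 proof -
 obtain b Om x y where qq: "q = (b, Om, x, y)" by (metis prod_cases4)
 show ?thesis
 proof (cases "Om <= grid d D & x : Om & y : Om")
 case True
 have fOm: "finite Om" using True finite_grid finite_subset by blast
 have st: "0 <= stretch p d D Om x y s" unfolding stretch_def by (intro sum_nonneg mult_nonneg_nonneg lp_dist_nonneg) auto
 have "stretch p d D Om x y s <= (SUM i<Suc M. real (d * D))"
 unfolding stretch_def
 proof (rule sum_mono)
 fix i
 have "rep (fst s) (key D o snd s) Om i x : grid d D"
 using rep_in_cell[OF fOm, of "fst s" i x "key D o snd s"] cell_refl[of x Om "fst s" i] cell_subset[of "fst s" Om i x] True by blast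
 hence "lp_dist p x (rep (fst s) (key D o snd s) Om i x) <= real (d * D)"
 using True p d by (intro lp_dist_le) auto
 thus "of_bool (fst s (Suc i) x ~= fst s (Suc i) y) * lp_dist p x (rep (fst s) (key D o snd s) Om i x) <= real (d * D)"
 by (simp add: of_bool_def)
 qed
 also have "... = real (Suc M) * real (d * D) * 1" by simp
 also have "... <= B" unfolding B_def using Dd1 by (intro mult_mono) auto
 finally have st2: "stretch p d D Om x y s <= B" .
 have ld: "0 <= load d D Om x s" unfolding load_def by (intro sum_nonneg mult_nonneg_nonneg) auto
 have "load d D Om x s <= (SUM i<=Suc M. real (D ^ d))"
 unfolding load_def
 proof (rule sum_mono)
 fix i
 have "card (cell (fst s) Om i x) <= card (grid d D)"
 using True cell_subset[of "fst s" Om i x] by (intro card_mono finite_grid) auto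
 thus "of_bool (rep (fst s) (key D o snd s) Om i x = x) * real (card (cell (fst s) Om i x)) <= real (D ^ d)"
 using Dd1 by (simp add: of_bool_def card_grid flip: of_nat_power)
 qed
 also have "... = real (Suc (Suc M)) * 1 * real (D ^ d)" by simp
 also have "... <= B" unfolding B_def using dD1 by (intro mult_right_mono mult_left_mono) auto
 finally have ld2: "load d D Om x s <= B" .
 show ?thesis using st st2 ld ld2 Bp by (auto simp: F_def qq)
 qed (use Bp in "auto simp: F_def qq")
 qed
 have fin_bs: "finite {bs :: bool list. length bs = N}" using finite_lists_length_eq[of "UNIV :: bool set" N] by simp
 have card_bs: "card {bs :: bool list. length bs = N} = 2 ^ N" using card_lists_length_eq[of "UNIV :: bool set" N] by simp
 obtain sd where sd: "ALL bs. sd bs : set_pmf SS"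
 "ALL q:Q. (SUM bs:{bs :: bool list. length bs = N}. F q (sd bs)) <= 2 * rc {bs :: bool list. length bs = N} * expec SS (F q) + B * ln (rc Q)"
 using sparsify[OF fSS fQ Qne Bp fin_bs, of F] Fb by blast
 have Bln: "B * ln (rc Q) <= 2 ^ N"
 unfolding B_def cQ N_def by (rule sample_size[OF d D])
 have bnd: "(SUM bs:{bs :: bool list. length bs = N}. F q (sd bs)) <= 2 ^ N * (2 * expec SS (F q) + 1)" if "q : Q" for q
 using bspec[OF sd(2) that] Bln unfolding card_bs by (simp add: algebra_simps)
 have 1: "(SUM bs:{bs. length bs = N}. stretch p d D Om x y (sd bs)) <=
 2 ^ N * (2 ^ 49 * soft 1 (ln (real (card Om * d * D))) * lp_dist p x y)"
 if Om: "Om <= grid d D" "x : Om" "y : Om" for Om x y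
 proof (cases "x = y")
 case True
 thus ?thesis by (simp add: stretch_def lp_dist_refl)
 next
 case False
 have fOm: "finite Om" using Om finite_grid finite_subset by blast
 define m where "m = card Om"
 have m1: "1 <= m" using Om fOm by (auto simp: m_def Suc_le_eq card_gt_0_iff)
 define f where "f = ln (real (m * d * D))"
 \<comment> \<open>The averaging bound asks for a parameter that is at least 1 and at least the
   logarithm of the number of points.\<close>
 define La where "La = 1 + f"
 have mdD: "d * D <= m * d * D" "m <= m * d * D" using m1 d D mult_le_mono[OF m1, of "d * D" "d * D"] by (auto simp: mult.assoc)
 have f2: "ln 2 <= f" unfolding f_def using mdD(1) dD by (subst ln_le_cancel_iff) linarith+
 have fd: "ln (real (d * D)) <= f" unfolding f_def using mdD(1) dD by (subst ln_le_cancel_iff) linarith+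
 have f0: "0 < f" using f2 ln2_ge_two_thirds by linarith
 have La: "1 <= La" "rc Om <= exp La"
 proof -
 show "1 <= La" using f0 by (simp add: La_def)
 have "real m <= real (m * d * D)" using mdD by linarith
 also have "... = exp f" unfolding f_def using mdD dD by (subst exp_ln) linarith+
 also have "... <= exp La" by (simp add: La_def)
 finally show "rc Om <= exp La" by (simp add: m_def)
 qed
 \<comment> \<open>Least number of halvings with 4 La^2 <= 2^h. It is of order log La, the origin of
   the iterated logarithm in the soft bound.\<close>
 define h where "h = nat \<lceil>log 2 (4 * La^2)\<rceil>"
 have hl: "log 2 (4 * La^2) <= real h" unfolding h_def by linarith
 have h1: "4 * La^2 <= 2 ^ h"
 proof -
 have "4 * La^2 <= 2 powr real h" using hl La by (simp add: log_le_iff)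
 thus ?thesis by (simp add: powr_realpow)
 qed
 have h2: "real h <= 3 + 3 * ln (1 + f)"
 proof -
 have "log 2 (4 * La^2) = log 2 (2 ^ 2) + 2 * log 2 La" using La by (simp add: log_mult log_nat_power)
 also have "log 2 (2 ^ 2) = (2::real)" by (simp only: log_nat_power) simp
 also have "log 2 La <= 3 / 2 * ln La"
 proof -
 have "ln La * (2 / 3) <= ln La * ln 2" using La ln2_ge_two_thirds by (intro mult_left_mono) auto
 hence "ln La / ln 2 <= 3 / 2 * ln La * (ln 2) / ln 2" by (intro divide_right_mono) auto
 also have "... = 3 / 2 * ln La" by simp
 finally show ?thesis by (simp add: log_def)
 qed
 finally have "log 2 (4 * La^2) <= 2 + 3 * ln La" by simp
 moreover have "0 <= log 2 (4 * La^2)"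
 proof -
 have "1 <= La^2" using La by simp
 hence "1 <= 4 * La^2" "0 < 4 * La^2" by linarith+
 thus ?thesis by (subst zero_le_log_cancel_iff) auto
 qed
 hence "real h <= log 2 (4 * La^2) + 1" unfolding h_def by linarith
 ultimately show ?thesis by (simp add: La_def)
 qed
 have q: "(True, Om, x, y) : Q" using Om by (auto simp: Q_def)
 have "expec SS (F (True, Om, x, y)) = expec hashes (%om. expec ?P (%pe. SUM i<Suc M. of_bool (sep om i x y) *
 lp_dist p x (rep (lab om) (key D o pe) Om i x)))"
 unfolding ESS using Om by (simp add: F_def stretch_def)
 also have "... = expec hashes (%om. SUM i<Suc M. of_bool (sep om i x y) * savg (Jl i) Om om x)"
 proof (rule expec_cong)
 fix om
 show "expec ?P (%pe. SUM i<Suc M. of_bool (sep om i x y) * lp_dist p x (rep (lab om) (key D o pe) Om i x)) =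
 (SUM i<Suc M. of_bool (sep om i x y) * savg (Jl i) Om om x)"
 unfolding expec_sum[OF fP] using expec_rep[OF Om(1,2), of "lp_dist p x" "lab om"]
 by (intro sum.cong) (auto simp: savg_def cs)
 qed
 also have "... <= lp_dist p x y * (2 ^ 21 * (4 * real h * La + real M * (2 * ln La + C1)) + (2 * La + 2 * ln La + C1))"
 by (rule expected_stretch[OF Om False La h1])
 also have "... <= lp_dist p x y * (2 ^ 47 * (f * (1 + ln (1 + f))))"
 proof (rule mult_left_mono)
 have "real M <= 3 * f" using m0_le_ln[OF dD] fd by linarith
 thus "2 ^ 21 * (4 * real h * La + real M * (2 * ln La + C1)) + (2 * La + 2 * ln La + C1) <= 2 ^ 47 * (f * (1 + ln (1 + f)))"
 unfolding La_def by (rule log_factor_bound[OF f2 _ h2])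
 qed (rule lp_dist_nonneg)
 finally have e: "2 * expec SS (F (True, Om, x, y)) + 1 <= 2 * (lp_dist p x y * (2 ^ 47 * (f * (1 + ln (1 + f))))) + 1" by linarith
 also have "... <= 2 ^ 49 * soft 1 f * lp_dist p x y"
 proof -
 define z where "z = lp_dist p x y * (f * (1 + ln (1 + f)))"
 have "1 <= lp_dist p x y" using Om False p by (intro lp_dist_ge_1[of _ d D]) auto
 moreover have "2 / 3 <= f * (1 + ln (1 + f))"
 proof -
 have "2 / 3 * 1 <= f * (1 + ln (1 + f))" using f2 ln2_ge_two_thirds f0 by (intro mult_mono) auto
 thus ?thesis by simp
 qed
 ultimately have "1 * (2 / 3) <= z" unfolding z_def by (intro mult_mono) auto
 hence "2 * (2 ^ 47 * z) + 1 <= 2 ^ 49 * z" by simp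
 thus ?thesis by (simp add: z_def soft_def mult_ac)
 qed
 finally have "2 ^ N * (2 * expec SS (F (True, Om, x, y)) + 1) <= 2 ^ N * (2 ^ 49 * soft 1 f * lp_dist p x y)"
 by (intro mult_left_mono) auto
 moreover have "(SUM bs:{bs. length bs = N}. stretch p d D Om x y (sd bs)) = (SUM bs:{bs. length bs = N}. F (True, Om, x, y) (sd bs))"
 using Om by (simp add: F_def)
 ultimately show ?thesis using bnd[OF q] unfolding f_def m_def by linarith
 qed
 have 2: "(SUM bs:{bs. length bs = N}. load d D Om x (sd bs)) <= 2 ^ N * (2 * real M + 5)"
 if Om: "Om <= grid d D" "x : Om" for Om x
 proof -
 have fOm: "finite Om" using Om finite_grid finite_subset by blast
 have q: "(False, Om, x, x) : Q" using Om by (auto simp: Q_def)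
 have "expec SS (F (False, Om, x, x)) = expec hashes (%om. expec ?P (%pe. SUM i<=Suc M. of_bool (rep (lab om) (key D o pe) Om i x = x) *
 real (card (cell (lab om) Om i x))))"
 unfolding ESS using Om by (simp add: F_def load_def)
 also have "... = expec hashes (%om. real (Suc (Suc M)))"
 proof (rule expec_cong)
 fix om
 have "(SUM i<=Suc M. expec ?P (%pe. of_bool (rep (lab om) (key D o pe) Om i x = x) * real (card (cell (lab om) Om i x)))) = (SUM i<=Suc M. 1)"
 proof (rule sum.cong[OF refl])
 fix i
 have c: "x : cell (lab om) Om i x" "finite (cell (lab om) Om i x)" using Om fOm by (auto intro: cell_refl finite_cell)
 hence "0 < card (cell (lab om) Om i x)" by (auto simp: card_gt_0_iff)
 moreover have "(SUM z:cell (lab om) Om i x. of_bool (z = x)) = (1::real)"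
 using c by (simp add: of_bool_def sum.delta)
 ultimately show "expec ?P (%pe. of_bool (rep (lab om) (key D o pe) Om i x = x) * real (card (cell (lab om) Om i x))) = 1"
 using expec_rep[OF Om, of "%z. of_bool (z = x)" "lab om" i] by simp
 qed
 thus "expec ?P (%pe. SUM i<=Suc M. of_bool (rep (lab om) (key D o pe) Om i x = x) * real (card (cell (lab om) Om i x))) = real (Suc (Suc M))"
 unfolding expec_sum[OF fP] by simp
 qed
 finally have "2 ^ N * (2 * expec SS (F (False, Om, x, x)) + 1) = 2 ^ N * (2 * real M + 5)" by simp
 moreover have "(SUM bs:{bs. length bs = N}. load d D Om x (sd bs)) = (SUM bs:{bs. length bs = N}. F (False, Om, x, x) (sd bs))"
 using Om by (simp add: F_def)
 ultimately show ?thesis using bnd[OF q] by linarith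
 qed
 have 0: "ALL bs. good_seed d D (sd bs)" using sd(1) good by blast
 show ?thesis using 0 1 2 by blast
qed

section \<open>Trees given by levels and parents\<close>

definition plen :: "wtree => vec => real" where
 "plen T q = sum_list (map snd (path_steps T q))"

lemma path_steps_single: "path_steps T [a] = []"
 by (simp add: path_steps_def)

lemma path_steps_Cons: "path_steps T (a # b # q) = (b, weight T {a, b}) # path_steps T (b # q)"
 by (simp add: path_steps_def)

lemma path_steps_snoc: "q ~= [] ==> path_steps T (q @ [b]) = path_steps T q @ [(b, weight T {last q, b})]"
proof (induction q rule: list_nonempty_induct)
 case (cons a q)
 thus ?case by (cases q) (auto simp: path_steps_Cons)
qed (simp add: path_steps_Cons path_steps_single)

lemma plen_single: "plen T [a] = 0"
 by (simp add: plen_def path_steps_single)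

lemma plen_Cons: "plen T (a # b # q) = weight T {a, b} + plen T (b # q)"
 by (simp add: plen_def path_steps_Cons)

lemma plen_snoc: "q ~= [] ==> plen T (q @ [b]) = plen T q + weight T {last q, b}"
 by (simp add: plen_def path_steps_snoc)

lemma is_path_rev: "is_path T u v q ==> is_path T v u (rev q)"
 unfolding is_path_def by (simp add: hd_rev last_rev insert_commute)

locale lev_tree =
 fixes T :: wtree and lev par :: "nat => nat"
 assumes fin: "finite (nodes T)" and root_in: "root T : nodes T" and lev_root: "lev (root T) = 0"
 and par_in: "!!v. v : nodes T ==> v ~= root T ==> par v : nodes T"
 and lev_par: "!!v. v : nodes T ==> v ~= root T ==> lev v = Suc (lev (par v))"
 and edges_eq: "edges T = {{v, par v} |v. v : nodes T & v ~= root T}"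
begin

lemma lev_0: "v : nodes T ==> lev v = 0 ==> v = root T"
 using lev_par by fastforce

lemma adj: "{a, b} : edges T <-> (a : nodes T & a ~= root T & par a = b) | (b : nodes T & b ~= root T & par b = a)"
 unfolding edges_eq by (auto simp: doubleton_eq_iff)

text \<open>The deeper endpoint climbs to its parent, the first one in a tie.\<close>

function tp :: "nat => nat => vec" where
 "tp u v = (if u = v | u ~: nodes T | v ~: nodes T then [u]
 else if lev v <= lev u then u # tp (par u) v else tp u (par v) @ [v])"
 by pat_completeness auto
termination
proof (relation "Wellfounded.measure (%(u, v). lev u + lev v)", goal_cases)
 case (2 u v)
 hence "u ~= root T" using lev_0[of v] by (auto simp: lev_root)
 thus ?case using lev_par[of u] 2 by auto
next
 case (3 u v)
 hence "v ~= root T" by (auto simp: lev_root)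
 thus ?case using lev_par[of v] 3 by auto
qed simp

declare tp.simps [simp del]

lemma not_root:
 assumes "u : nodes T" "v : nodes T" "u ~= v"
 shows "lev v <= lev u ==> u ~= root T" "~ lev v <= lev u ==> v ~= root T"
 using assms lev_0[of v] by (auto simp: lev_root)

text \<open>The level bounds strengthen the induction: they show that the endpoint to be attached,
  which has maximal level, is not yet on the path.\<close>

lemma tp_props:
 assumes "u : nodes T" "v : nodes T"
 shows "is_path T u v (tp u v) & (ALL a:set (tp u v). lev a <= max (lev u) (lev v) &
 (lev a = lev v --> lev u < lev v --> a = v) & (lev a = lev u --> lev v < lev u --> a = u) &
 (lev u = lev v --> lev a = lev u --> a = u | a = v))"
 using assms
proof (induction u v rule: tp.induct)
 case (1 u v)
 show ?case
 proof (cases "u = v")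
 case True
 thus ?thesis using 1(3,4) by (simp add: tp.simps is_path_def)
 next
 case ne: False
 show ?thesis
 proof (cases "lev v <= lev u")
 case True
 have nr: "u ~= root T" using not_root(1)[OF 1(3,4) ne True] .
 have pu: "par u : nodes T" "lev u = Suc (lev (par u))" using par_in lev_par 1(3) nr by auto
 have eq: "tp u v = u # tp (par u) v" using ne 1(3,4) True by (simp add: tp.simps[of u v])
 have IH: "is_path T (par u) v (tp (par u) v)"
 "!!a. a : set (tp (par u) v) ==> lev a <= max (lev (par u)) (lev v) & (lev a = lev v --> lev (par u) < lev v --> a = v)"
 using 1(1)[OF _ True pu(1) 1(4)] ne 1(3,4) by blast+
 have "u ~: set (tp (par u) v)"
 proof
 assume "u : set (tp (par u) v)"
 from IH(2)[OF this] pu(2) True ne show False by auto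
 qed
 moreover have "{u, par u} : edges T" using adj nr 1(3) by blast
 moreover obtain b q where "tp (par u) v = b # q" "b = par u"
 using IH(1) by (cases "tp (par u) v") (auto simp: is_path_def)
 ultimately have "is_path T u v (tp u v)" using IH(1) 1(3) unfolding eq is_path_def by auto
 moreover have "ALL a:set (tp u v). lev a <= max (lev u) (lev v) &
 (lev a = lev v --> lev u < lev v --> a = v) & (lev a = lev u --> lev v < lev u --> a = u) &
 (lev u = lev v --> lev a = lev u --> a = u | a = v)"
 proof
 fix a assume "a : set (tp u v)"
 hence "a = u | a : set (tp (par u) v)" by (simp add: eq)
 thus "lev a <= max (lev u) (lev v) &
 (lev a = lev v --> lev u < lev v --> a = v) & (lev a = lev u --> lev v < lev u --> a = u) &
 (lev u = lev v --> lev a = lev u --> a = u | a = v)"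
 using IH(2)[of a] pu(2) True by (auto simp: max_def split: if_splits)
 qed
 ultimately show ?thesis by blast
 next
 case False
 have nr: "v ~= root T" using not_root(2)[OF 1(3,4) ne False] .
 have pv: "par v : nodes T" "lev v = Suc (lev (par v))" using par_in lev_par 1(4) nr by auto
 have eq: "tp u v = tp u (par v) @ [v]" using ne 1(3,4) False by (simp add: tp.simps[of u v])
 have IH: "is_path T u (par v) (tp u (par v))"
 "!!a. a : set (tp u (par v)) ==> lev a <= max (lev u) (lev (par v))"
 using 1(2)[OF _ False 1(3) pv(1)] ne 1(3,4) by blast+
 have "v ~: set (tp u (par v))"
 proof
 assume "v : set (tp u (par v))"
 from IH(2)[OF this] pv(2) False show False by auto
 qed
 moreover have "{par v, v} : edges T" using adj nr 1(4) by blast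
 ultimately have "is_path T u v (tp u v)" using IH(1) 1(4) unfolding eq is_path_def
 by (auto simp: successively_append_iff)
 moreover have "ALL a:set (tp u v). lev a <= max (lev u) (lev v) &
 (lev a = lev v --> lev u < lev v --> a = v) & (lev a = lev u --> lev v < lev u --> a = u) &
 (lev u = lev v --> lev a = lev u --> a = u | a = v)"
 proof
 fix a assume "a : set (tp u v)"
 hence "a = v | a : set (tp u (par v))" by (auto simp: eq)
 thus "lev a <= max (lev u) (lev v) &
 (lev a = lev v --> lev u < lev v --> a = v) & (lev a = lev u --> lev v < lev u --> a = u) &
 (lev u = lev v --> lev a = lev u --> a = u | a = v)"
 using IH(2)[of a] pv(2) False by (auto simp: max_def split: if_splits)
 qed
 ultimately show ?thesis by blast
 qed
 qed
qed

text \<open>A simple path that has stepped to a child cannot climb again, because the only parent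
  available is the node it came from.\<close>

lemma descends:
 assumes "distinct (u # c # q)" "successively (%a b. {a, b} : edges T) (u # c # q)"
 "par c = u" "c : nodes T" "c ~= root T"
 shows "lev u < lev (last (c # q))"
 using assms
proof (induction q arbitrary: u c)
 case (Cons e q)
 have "{c, e} : edges T" using Cons.prems by simp
 hence "e : nodes T & e ~= root T & par e = c" using Cons.prems adj[of c e] by auto
 hence "lev c < lev (last (e # q))" using Cons.prems by (intro Cons.IH) auto
 moreover have "lev c = Suc (lev u)" using lev_par Cons.prems by auto
 ultimately show ?case by simp
qed (simp add: lev_par)

text \<open>From the deeper end a path must go up, since a descending path ends strictly deeper than
  it starts. Uniqueness of paths follows along the recursion of \<open>tp\<close>.\<close>

lemma first_step:
 assumes "is_path T u v q" "u ~= v" "lev v <= lev u" "u : nodes T"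
 shows "EX q'. q = u # q' & is_path T (par u) v q'"
proof -
 obtain q1 where q1: "q = u # q1" using assms(1) by (cases q) (auto simp: is_path_def)
 obtain c q2 where q2: "q1 = c # q2" using assms(1,2) q1 by (cases q1) (auto simp: is_path_def)
 have d: "distinct (u # c # q2)" "successively (%a b. {a, b} : edges T) (u # c # q2)" "last (c # q2) = v"
 using assms(1) by (auto simp: is_path_def q1 q2)
 have "{u, c} : edges T" using d by simp
 moreover have "~ (c : nodes T & c ~= root T & par c = u)"
 using descends[OF d(1,2)] d(3) assms(3) by auto
 ultimately have "par u = c" using adj by blast
 thus ?thesis using assms(1) by (auto simp: is_path_def q1 q2)
qed

lemma path_unique:
 assumes "is_path T u v q" "u : nodes T" "v : nodes T"
 shows "q = tp u v"
 using assms
proof (induction u v arbitrary: q rule: tp.induct)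
 case (1 u v)
 show ?case
 proof (cases "u = v")
 case True
 obtain a r where r: "q = a # r" using 1(3) by (cases q) (auto simp: is_path_def)
 have "r = []" using 1(3) True by (auto simp: is_path_def r split: if_splits)
 thus ?thesis using 1(3) True by (simp add: r tp.simps is_path_def)
 next
 case ne: False
 show ?thesis
 proof (cases "lev v <= lev u")
 case True
 have nr: "u ~= root T" using not_root(1)[OF 1(4,5) ne True] .
 obtain q' where q': "q = u # q'" "is_path T (par u) v q'" using first_step[OF 1(3) ne True 1(4)] by blast
 have "q' = tp (par u) v" using 1(1)[OF _ True q'(2) par_in[OF 1(4) nr] 1(5)] ne 1(4,5) by blast
 thus ?thesis using q' ne 1(4,5) True by (simp add: tp.simps[of u v])
 next
 case False
 have nr: "v ~= root T" using not_root(2)[OF 1(4,5) ne False] .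
 obtain q' where q': "rev q = v # q'" "is_path T (par v) u q'"
 using first_step[OF is_path_rev[OF 1(3)]] ne False 1(5) by auto
 have "rev q' = tp u (par v)"
 using 1(2)[OF _ False is_path_rev[OF q'(2)] 1(4) par_in[OF 1(5) nr]] ne 1(4,5) by blast
 moreover have "q = rev q' @ [v]" using q'(1) by (metis rev.simps(2) rev_rev_ident)
 ultimately show ?thesis using ne 1(4,5) False by (simp add: tp.simps[of u v])
 qed
 qed
qed

lemma ex1_path: "u : nodes T ==> v : nodes T ==> EX! q. is_path T u v q"
 using tp_props path_unique by blast

lemma the_path_tp: "u : nodes T ==> v : nodes T ==> the_path T u v = tp u v"
 unfolding the_path_def using ex1_path tp_props by (intro the1_equality) blast+

lemma rooted_weighted_treeI:
 assumes "!!e. e : edges T ==> 0 <= weight T e"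
 shows "rooted_weighted_tree T"
 unfolding rooted_weighted_tree_def
proof (intro conjI)
 show "edges T <= {{u, v} |u v. u : nodes T & v : nodes T & u ~= v}"
 proof
 fix e assume "e : edges T"
 then obtain v where v: "v : nodes T" "v ~= root T" "e = {v, par v}" by (auto simp: edges_eq)
 moreover have "v ~= par v" using lev_par[OF v(1,2)] by auto
 ultimately show "e : {{u, v} |u v. u : nodes T & v : nodes T & u ~= v}" using par_in by blast
 qed
qed (use fin root_in assms ex1_path in auto)

end

section \<open>The weighted tree belonging to a seed\<close>

definition node_pt :: "nat => vec set => (vec => nat) => nat => vec" where
 "node_pt L Om nm a = (THE y. y : Om & (EX i<=L. a = nm y + i))"

definition node_lev :: "nat => vec set => (vec => nat) => nat => nat" where
 "node_lev L Om nm a = a - nm (node_pt L Om nm a)"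

text \<open>In the program \<open>nm\<close> is the address of a record. Records are longer than the
  number of levels, so address plus level determines both summands.\<close>

definition node_name :: "(nat => vec => nat) => (vec => nat) => vec set => (vec => nat) => nat => vec => nat" where
 "node_name lab pr Om nm i x = nm (rep lab pr Om i x) + i"

text \<open>Weights are functions of two-element sets, so the endpoints are recovered by Max and Min
  and decoded; symmetry of the rounded distance makes their order irrelevant. The empty set of
  vectors gets a one-node tree.\<close>

definition mk_tree :: "real => nat => (nat => vec => nat) => (vec => nat) => vec set => (vec => nat) => wtree" where
 "mk_tree p L lab pr Om nm =
 \<lparr>nodes = (if Om = {} then {0} else {node_name lab pr Om nm i x |i x. i <= L & x : Om}),
 root = (if Om = {} then 0 else node_name lab pr Om nm 0 (SOME x. x : Om)),
 edges = {{node_name lab pr Om nm (Suc i) x, node_name lab pr Om nm i x} |i x. i < L & x : Om},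
 weight = (%e. real (wdist p (node_pt L Om nm (Max e)) (node_pt L Om nm (Min e))))\<rparr>"

lemma empty_tree: "rooted_weighted_tree (mk_tree p L lab pr {} nm)"
proof -
 let ?T = "mk_tree p L lab pr {} nm"
 have "is_path ?T 0 0 q <-> q = [0]" for q
 proof
 assume "is_path ?T 0 0 q"
 hence q: "q ~= []" "distinct q" "set q <= {0}" by (auto simp: is_path_def mk_tree_def)
 then obtain a r where "q = a # r" by (cases q) auto
 with q show "q = [0]" by (cases r) auto
 qed (simp add: is_path_def mk_tree_def)
 thus ?thesis by (simp add: rooted_weighted_tree_def) (simp add: mk_tree_def)
qed

locale seed_tree =
 fixes p :: real and d D L :: nat and lab :: "nat => vec => nat" and pr :: "vec => nat"
 and Om :: "vec set" and nm :: "vec => nat"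
 assumes p: "1 <= p" and Om: "Om <= grid d D" and lab0: "!!x y. lab 0 x = lab 0 y"
 and nested: "!!i x y. lab (Suc i) x = lab (Suc i) y ==> lab i x = lab i y"
 and labL: "!!x y. lab L x = lab L y ==> x = y"
 and pr: "inj_on pr Om"
 and spaced: "!!x y i j. x : Om ==> y : Om ==> i <= L ==> j <= L ==> nm x + i = nm y + j ==> x = y & i = j"
begin

abbreviation rp where "rp == rep lab pr Om"
abbreviation nn where "nn == node_name lab pr Om nm"
abbreviation T where "T == mk_tree p L lab pr Om nm"
abbreviation pt where "pt == node_pt L Om nm"
abbreviation lv where "lv == node_lev L Om nm"

lemma fOm: "finite Om"
 using Om finite_grid finite_subset by blast

lemma rp_cell: "x : Om ==> rp i x : cell lab Om i x"
 using rep_in_cell[OF fOm] cell_refl by blast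

lemma rp_in: "x : Om ==> rp i x : Om"
 using rp_cell cell_subset by blast

lemma rp_lab: "x : Om ==> lab i (rp i x) = lab i x"
 using rp_cell by (auto simp: cell_def)

lemma nested_le: "i <= j ==> lab j x = lab j y ==> lab i x = lab i y"
 by (induction j rule: dec_induct) (auto dest: nested)

lemma rp_rp: "x : Om ==> i <= j ==> rp i (rp j x) = rp i x"
 using nested_le[OF _ rp_lab] rep_cong by metis

lemma rp_L: "x : Om ==> rp L x = x"
 using labL rp_lab by blast

lemma rp_eq_iff:
 assumes "x : Om" "y : Om" shows "rp i x = rp i y <-> lab i x = lab i y"
 using rp_lab[OF assms(1)] rp_lab[OF assms(2)] rep_cong by metis

lemma node_pt_eq: "y : Om ==> i <= L ==> pt (nm y + i) = y"
 unfolding node_pt_def by (rule the_equality) (use spaced in blast)+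

lemma pt_nn: "x : Om ==> i <= L ==> pt (nn i x) = rp i x"
 unfolding node_name_def by (intro node_pt_eq rp_in)

lemma lv_nn: "x : Om ==> i <= L ==> lv (nn i x) = i"
 unfolding node_lev_def by (simp add: pt_nn) (simp add: node_name_def)

lemma nn_eq_iff:
 assumes "x : Om" "y : Om" "i <= L" "j <= L"
 shows "nn i x = nn j y <-> i = j & lab i x = lab i y"
proof
 assume "nn i x = nn j y"
 hence "rp i x = rp j y & i = j" unfolding node_name_def using spaced rp_in assms by blast
 thus "i = j & lab i x = lab i y" using rp_eq_iff assms by blast
next
 assume "i = j & lab i x = lab i y"
 thus "nn i x = nn j y" unfolding node_name_def using rep_cong by metis
qed

definition pa :: "nat => nat" where "pa a = nn (lv a - 1) (pt a)"

lemma pa_nn: "x : Om ==> Suc i <= L ==> pa (nn (Suc i) x) = nn i x"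
 unfolding pa_def by (simp add: pt_nn lv_nn) (simp add: node_name_def rp_rp)

lemma nodes_T: "Om ~= {} ==> nodes T = {nn i x |i x. i <= L & x : Om}"
 by (simp add: mk_tree_def)

lemma root_T: "x : Om ==> root T = nn 0 x"
proof -
 assume x: "x : Om"
 have "rp 0 (SOME x. x : Om) = rp 0 x" by (rule rep_cong) (rule lab0)
 thus ?thesis using x by (auto simp: mk_tree_def node_name_def)
qed

lemma edges_T: "edges T = {{nn (Suc i) x, nn i x} |i x. i < L & x : Om}"
 by (simp add: mk_tree_def)

lemma length_pt: "x : Om ==> i <= L ==> length (pt (nn i x)) = d"
 using pt_nn rp_in Om grid_length by (metis subset_iff)

lemma length_rp: "x : Om ==> length (rp i x) = d"
 using rp_in Om grid_length by (metis subset_iff)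

lemma weight_T:
 assumes "x : Om" "y : Om" "i <= L" "j <= L"
 shows "weight T {nn i x, nn j y} = real (wdist p (rp i x) (rp j y))"
proof -
 have *: "wdist p (rp i x) (rp j y) = wdist p (rp j y) (rp i x)"
 using length_rp assms by (intro wdist_sym) auto
 show ?thesis using assms * by (cases "nn i x <= nn j y") (auto simp: mk_tree_def pt_nn max_def min_def)
qed

lemma edge_iff:
 assumes "x : Om" "y : Om" "i <= L" "j <= L"
 shows "{nn i x, nn j y} : edges T <-> (j = Suc i | i = Suc j) & lab (min i j) x = lab (min i j) y"
proof
 assume "{nn i x, nn j y} : edges T"
 then obtain k z where kz: "k < L" "z : Om" "{nn i x, nn j y} = {nn (Suc k) z, nn k z}"
 by (auto simp: edges_T)
 hence "(nn i x = nn (Suc k) z & nn j y = nn k z) | (nn i x = nn k z & nn j y = nn (Suc k) z)"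
 by (auto simp: doubleton_eq_iff)
 thus "(j = Suc i | i = Suc j) & lab (min i j) x = lab (min i j) y"
 proof
 assume "nn i x = nn (Suc k) z & nn j y = nn k z"
 hence "i = Suc k" "lab i x = lab i z" "j = k" "lab j y = lab j z"
 using nn_eq_iff[of x z i "Suc k"] nn_eq_iff[of y z j k] kz assms by auto
 thus ?thesis using nested[of k x z] by (simp add: min_def)
 next
 assume "nn i x = nn k z & nn j y = nn (Suc k) z"
 hence "j = Suc k" "lab i x = lab i z" "i = k" "lab j y = lab j z"
 using nn_eq_iff[of x z i k] nn_eq_iff[of y z j "Suc k"] kz assms by auto
 thus ?thesis using nested[of k y z] by (simp add: min_def)
 qed
next
 assume a: "(j = Suc i | i = Suc j) & lab (min i j) x = lab (min i j) y"
 show "{nn i x, nn j y} : edges T"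
 proof (cases "j = Suc i")
 case True
 hence "nn i x = nn i y" using a assms nn_eq_iff by auto
 thus ?thesis unfolding edges_T using True assms by (intro CollectI exI[of _ i] exI[of _ y]) auto
 next
 case False
 hence i: "i = Suc j" using a by blast
 hence "nn j x = nn j y" using a assms nn_eq_iff by auto
 thus ?thesis unfolding edges_T using i assms by (intro CollectI exI[of _ j] exI[of _ x]) auto
 qed
qed

lemma lev_tree_T:
 assumes ne: "Om ~= {}" shows "lev_tree T lv pa"
proof
 obtain x0 where x0: "x0 : Om" using ne by blast
 have r: "root T = nn 0 x0" by (rule root_T[OF x0])
 show "finite (nodes T)"
 proof -
 have "nodes T = (%(i, x). nn i x) ` ({..L} \<times> Om)" using nodes_T[OF ne] by auto
 thus ?thesis using fOm by simp
 qed
 show "root T : nodes T" using x0 r nodes_T[OF ne] by auto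
 show "lv (root T) = 0" using x0 r lv_nn by simp
 fix v assume v: "v : nodes T" "v ~= root T"
 then obtain i x where ix: "v = nn i x" "i <= L" "x : Om" using nodes_T[OF ne] by auto
 then obtain k where k: "i = Suc k" using v(2) root_T by (cases i) auto
 show "pa v : nodes T" using ix k pa_nn nodes_T[OF ne] by (auto intro!: exI[of _ k] exI[of _ x])
 show "lv v = Suc (lv (pa v))" using ix k pa_nn lv_nn by auto
next
 obtain x0 where x0: "x0 : Om" using ne by blast
 show "edges T = {{v, pa v} |v. v : nodes T & v ~= root T}"
 proof (intro equalityI subsetI)
 fix e assume "e : edges T"
 then obtain i x where ix: "i < L" "x : Om" "e = {nn (Suc i) x, nn i x}" by (auto simp: edges_T)
 moreover have "nn (Suc i) x ~= root T" using ix root_T[OF x0] nn_eq_iff[of x x0 "Suc i" 0] x0 by auto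
 moreover have "nn (Suc i) x : nodes T" 
 unfolding nodes_T[OF ne] using ix by (intro CollectI exI[of _ "Suc i"] exI[of _ x]) auto
 ultimately show "e : {{v, pa v} |v. v : nodes T & v ~= root T}"
 using pa_nn[of x i] by (auto intro!: exI[of _ "nn (Suc i) x"])
 next
 fix e assume "e : {{v, pa v} |v. v : nodes T & v ~= root T}"
 then obtain v where v: "v : nodes T" "v ~= root T" "e = {v, pa v}" by blast
 then obtain i x where ix: "v = nn i x" "i <= L" "x : Om" using nodes_T[OF ne] by auto
 then obtain k where k: "i = Suc k" using v(2) root_T by (cases i) auto
 show "e : edges T" 
 unfolding edges_T using v(3) ix k pa_nn[of x k] by (intro CollectI exI[of _ k] exI[of _ x]) auto
 qed
qed

lemma tree_T: "rooted_weighted_tree T"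
proof (cases "Om = {}")
 case True
 thus ?thesis using empty_tree by simp
next
 case False
 then interpret lev_tree T lv pa by (rule lev_tree_T)
 show ?thesis by (rule rooted_weighted_treeI) (simp add: mk_tree_def)
qed

lemma root_path:
 assumes x: "x : Om" "i <= L"
 shows "the_path T (root T) (nn i x) = map (%j. nn j x) [0..<Suc i]"
proof -
 have ne: "Om ~= {}" using x by blast
 interpret lev_tree T lv pa by (rule lev_tree_T[OF ne])
 have nd: "nn j x : nodes T" if "j <= L" for j using that x nodes_T[OF ne] by auto
 have "tp (nn 0 x) (nn i x) = map (%j. nn j x) [0..<Suc i]"
 using x(2)
 proof (induction i)
 case (Suc i)
 have "nn 0 x ~= nn (Suc i) x" using nn_eq_iff[of x x 0 "Suc i"] x Suc.prems by auto
 hence "tp (nn 0 x) (nn (Suc i) x) = tp (nn 0 x) (nn i x) @ [nn (Suc i) x]"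
 using nd[of 0] nd[OF Suc.prems] lv_nn x Suc.prems pa_nn by (simp add: tp.simps[of "nn 0 x" "nn (Suc i) x"])
 thus ?case using Suc by simp
 qed (simp add: tp.simps)
 thus ?thesis using the_path_tp[OF nd[of 0] nd[OF x(2)]] root_T[OF x(1)] by simp
qed

lemma weighted_path_T:
 assumes x: "x : Om" "i <= L"
 shows "weighted_path T (nn i x) = (nn 0 x, map (%j. (nn (Suc j) x, real (wdist p (rp (Suc j) x) (rp j x)))) [0..<i])"
proof -
 have "path_steps T (map (%j. nn j x) [0..<Suc i]) = map (%j. (nn (Suc j) x, real (wdist p (rp (Suc j) x) (rp j x)))) [0..<i]"
 using x(2)
 proof (induction i)
 case (Suc i)
 have *: "map (%j. nn j x) [0..<Suc (Suc i)] = map (%j. nn j x) [0..<Suc i] @ [nn (Suc i) x]" by simp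
 have "weight T {nn i x, nn (Suc i) x} = real (wdist p (rp (Suc i) x) (rp i x))"
 using weight_T[of x x "Suc i" i] x Suc.prems by (simp add: insert_commute)
 thus ?case unfolding * by (subst path_steps_snoc) (use Suc in auto)
 qed (simp add: path_steps_single)
 thus ?thesis unfolding weighted_path_def using root_path[OF x] root_T[OF x(1)] by simp
qed

lemma leaf_T:
 assumes x: "x : Om" shows "leaf T (nn L x)"
 unfolding leaf_def
proof (intro conjI ballI impI)
 have ne: "Om ~= {}" using x by blast
 show "nn L x : nodes T" using x nodes_T[OF ne] by auto
 fix u assume "u : nodes T" and u: "nn L x : set (the_path T (root T) u)"
 then obtain i y where iy: "u = nn i y" "i <= L" "y : Om" using nodes_T[OF ne] by auto
 then obtain j where j: "j <= i" "nn L x = nn j y" using u root_path[of y i] by (auto simp: less_Suc_eq_le simp del: upt_Suc)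
 hence "L = j" using nn_eq_iff[of x y L j] x iy by auto
 thus "u = nn L x" using j iy by simp
qed

text \<open>Each edge weighs at least the distance between the points of its two nodes, so the
  triangle inequality can be applied along any path.\<close>

lemma plen_ge:
 assumes "q ~= []" "set q <= nodes T" "Om ~= {}" 
 shows "successively (%a b. {a, b} : edges T) q ==> lp_dist p (pt (hd q)) (pt (last q)) <= plen T q"
 using assms(1,2)
proof (induction q rule: list_nonempty_induct)
 case (cons a q)
 obtain b r where q: "q = b # r" using cons.hyps by (cases q) auto
 have sub: "a : nodes T" "b : nodes T" "last q : nodes T" using cons q by auto
 then obtain i x j y k z where n: "a = nn i x" "i <= L" "x : Om" "b = nn j y" "j <= L" "y : Om"
 "last q = nn k z" "k <= L" "z : Om"
 unfolding nodes_T[OF assms(3)] by blast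
 have "lp_dist p (pt a) (pt (last q)) <= lp_dist p (pt a) (pt b) + lp_dist p (pt b) (pt (last q))"
 using n length_pt by (intro lp_dist_triangle p) auto
 also have "lp_dist p (pt a) (pt b) <= weight T {a, b}"
 using weight_T[of x y i j] n wdist_ge[OF p] pt_nn by auto
 also have "lp_dist p (pt b) (pt (last q)) <= plen T q" using cons by (auto simp: q)
 finally show ?case using cons.hyps by (simp add: q plen_Cons)
qed (simp add: plen_single lp_dist_refl)

lemma phi: "x : Om ==> nm x + L = nn L x"
 by (simp add: node_name_def rp_L)

lemma tree_dist_plen: "tree_dist T u v = plen T (the_path T u v)"
 by (simp add: tree_dist_def plen_def)

lemma non_contracting_T: "non_contracting p Om T (%x. nm x + L)"
 unfolding non_contracting_def
proof (intro ballI)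
 fix x y assume xy: "x : Om" "y : Om"
 have ne: "Om ~= {}" using xy by blast
 interpret lev_tree T lv pa by (rule lev_tree_T[OF ne])
 have nd: "nn L x : nodes T" "nn L y : nodes T" using xy nodes_T[OF ne] by auto
 have "is_path T (nn L x) (nn L y) (the_path T (nn L x) (nn L y))"
 using tp_props[OF nd] the_path_tp[OF nd] by simp
 hence "lp_dist p (pt (nn L x)) (pt (nn L y)) <= plen T (the_path T (nn L x) (nn L y))"
 using plen_ge[OF _ _ ne, of "the_path T (nn L x) (nn L y)"] by (auto simp: is_path_def)
 thus "lp_dist p x y <= tree_dist T (nm x + L) (nm y + L)"
 using xy by (simp add: phi pt_nn rp_L tree_dist_plen)
qed

text \<open>Induction on the level of the two nodes: while labels agree the nodes coincide, and
  after the first separation every level adds one edge at each end.\<close>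

lemma tree_dist_T:
 assumes xy: "x : Om" "y : Om"
 shows "tree_dist T (nm x + L) (nm y + L) = (SUM i<L. of_bool (lab (Suc i) x ~= lab (Suc i) y) *
 (real (wdist p (rp (Suc i) x) (rp i x)) + real (wdist p (rp (Suc i) y) (rp i y))))"
proof -
 have ne: "Om ~= {}" using xy by blast
 interpret lev_tree T lv pa by (rule lev_tree_T[OF ne])
 have nd: "nn i z : nodes T" if "i <= L" "z : Om" for i z using that nodes_T[OF ne] by auto
 have "plen T (tp (nn k x) (nn k y)) = (SUM i<k. of_bool (lab (Suc i) x ~= lab (Suc i) y) *
 (real (wdist p (rp (Suc i) x) (rp i x)) + real (wdist p (rp (Suc i) y) (rp i y))))" if "k <= L" for k
 using that
 proof (induction k)
 case 0
 have "nn 0 x = nn 0 y" using nn_eq_iff[of x y 0 0] xy lab0 by simp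
 thus ?case by (simp add: tp.simps plen_single)
 next
 case (Suc k)
 show ?case
 proof (cases "lab (Suc k) x = lab (Suc k) y")
 case True
 have "nn (Suc k) x = nn (Suc k) y" using nn_eq_iff xy Suc.prems True by auto
 moreover have "lab (Suc i) x = lab (Suc i) y" if "i < Suc k" for i using nested_le[OF _ True] that by auto
 ultimately show ?thesis by (simp add: tp.simps plen_single)
 next
 case False
 have ne1: "nn (Suc k) x ~= nn (Suc k) y" using nn_eq_iff xy Suc.prems False by auto
 have ne2: "nn k x ~= nn (Suc k) y" using nn_eq_iff[of x y k "Suc k"] xy Suc.prems by auto
 have nds: "nn (Suc k) x : nodes T" "nn (Suc k) y : nodes T" "nn k x : nodes T" "nn k y : nodes T"
 using nd xy Suc.prems by auto
 have e1: "tp (nn (Suc k) x) (nn (Suc k) y) = nn (Suc k) x # tp (nn k x) (nn (Suc k) y)"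
 using ne1 nds xy Suc.prems lv_nn pa_nn by (simp add: tp.simps[of "nn (Suc k) x" "nn (Suc k) y"])
 have e2: "tp (nn k x) (nn (Suc k) y) = tp (nn k x) (nn k y) @ [nn (Suc k) y]"
 using ne2 nds xy Suc.prems lv_nn pa_nn by (simp add: tp.simps[of "nn k x" "nn (Suc k) y"])
 have ip: "is_path T (nn k x) (nn k y) (tp (nn k x) (nn k y))" using tp_props nds by blast
 then obtain r where r: "tp (nn k x) (nn k y) = nn k x # r" by (cases "tp (nn k x) (nn k y)") (auto simp: is_path_def)
 have l: "last (tp (nn k x) (nn k y)) = nn k y" using ip by (simp add: is_path_def)
 have "plen T (tp (nn (Suc k) x) (nn (Suc k) y)) = weight T {nn (Suc k) x, nn k x} + plen T (tp (nn k x) (nn k y) @ [nn (Suc k) y])"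
 unfolding e1 e2 r by (simp add: plen_Cons)
 also have "plen T (tp (nn k x) (nn k y) @ [nn (Suc k) y]) = plen T (tp (nn k x) (nn k y)) + weight T {nn k y, nn (Suc k) y}"
 using plen_snoc[of "tp (nn k x) (nn k y)"] l r by simp
 also have "weight T {nn k y, nn (Suc k) y} = real (wdist p (rp (Suc k) y) (rp k y))"
 using weight_T[of y y "Suc k" k] xy Suc.prems by (simp add: insert_commute)
 also have "weight T {nn (Suc k) x, nn k x} = real (wdist p (rp (Suc k) x) (rp k x))"
 using weight_T[of x x "Suc k" k] xy Suc.prems by simp
 finally show ?thesis using Suc False by simp
 qed
 qed
 from this[of L] show ?thesis using xy the_path_tp[OF nd nd] by (simp add: phi tree_dist_plen)
qed

text \<open>An edge weighs at most 4 times the distances from x to its two representatives. The sum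
  with the lower representative is shifted by one level, which is possible because separation is
  monotone and the last representative is x itself; hence 8.\<close>

lemma half_bound:
 assumes xy: "x : Om" "y : Om"
 shows "(SUM i<L. of_bool (lab (Suc i) x ~= lab (Suc i) y) * real (wdist p (rp (Suc i) x) (rp i x)))
 <= 8 * (SUM i<L. of_bool (lab (Suc i) x ~= lab (Suc i) y) * lp_dist p x (rp i x))"
proof -
 define D where "D i = lp_dist p x (rp i x)" for i
 define b where "b i = (of_bool (lab i x ~= lab i y) :: real)" for i
 have D0: "0 <= D i" for i by (simp add: D_def lp_dist_nonneg)
 have b: "0 <= b i" "b i <= b (Suc i)" for i using nested[of i x y] by (auto simp: b_def)
 have lx: "length x = d" using xy Om grid_length by blast
 have w: "real (wdist p (rp (Suc i) x) (rp i x)) <= 4 * (D (Suc i) + D i)" for i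
 proof -
 have "real (wdist p (rp (Suc i) x) (rp i x)) <= 4 * lp_dist p (rp (Suc i) x) (rp i x)" by (rule wdist_le[OF p])
 also have "lp_dist p (rp (Suc i) x) (rp i x) <= lp_dist p (rp (Suc i) x) x + lp_dist p x (rp i x)"
 using length_rp xy lx by (intro lp_dist_triangle p) auto
 also have "lp_dist p (rp (Suc i) x) x = D (Suc i)" unfolding D_def using length_rp xy lx by (intro lp_dist_sym) auto
 finally show ?thesis by (simp add: D_def)
 qed
 have "(SUM i<L. b (Suc i) * real (wdist p (rp (Suc i) x) (rp i x))) <= (SUM i<L. b (Suc i) * (4 * (D (Suc i) + D i)))"
 using w b by (intro sum_mono mult_left_mono) auto
 also have "... = 4 * (SUM i<L. b (Suc i) * D (Suc i)) + 4 * (SUM i<L. b (Suc i) * D i)"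
 by (simp add: sum_distrib_left sum.distrib[symmetric] algebra_simps)
 also have "(SUM i<L. b (Suc i) * D (Suc i)) <= (SUM i<L. b (Suc i) * D i)"
 proof -
 have "(SUM i<L. b (Suc i) * D (Suc i)) <= b 0 * D 0 + (SUM i<L. b (Suc i) * D (Suc i))" using b D0 by simp
 also have "... = (SUM i<Suc L. b i * D i)" by (subst sum.lessThan_Suc_shift) simp
 also have "... = (SUM i<L. b i * D i)" using xy by (simp add: D_def rp_L lp_dist_refl)
 also have "... <= (SUM i<L. b (Suc i) * D i)" using b D0 by (intro sum_mono mult_right_mono) auto
 finally show ?thesis .
 qed
 finally show ?thesis by (simp add: b_def D_def)
qed

lemma tree_dist_le:
 assumes xy: "x : Om" "y : Om"
 shows "tree_dist T (nm x + L) (nm y + L) <=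
 8 * (SUM i<L. of_bool (lab (Suc i) x ~= lab (Suc i) y) * lp_dist p x (rp i x)) +
 8 * (SUM i<L. of_bool (lab (Suc i) y ~= lab (Suc i) x) * lp_dist p y (rp i y))"
proof -
 have "tree_dist T (nm x + L) (nm y + L) = (SUM i<L. of_bool (lab (Suc i) x ~= lab (Suc i) y) * real (wdist p (rp (Suc i) x) (rp i x))) +
 (SUM i<L. of_bool (lab (Suc i) y ~= lab (Suc i) x) * real (wdist p (rp (Suc i) y) (rp i y)))"
 unfolding tree_dist_T[OF xy] sum.distrib[symmetric] by (intro sum.cong) (auto simp: algebra_simps)
 thus ?thesis using half_bound[OF xy] half_bound[OF xy(2,1)] by linarith
qed

end

text \<open>Addresses only encode a representative and a level, so recoding with other addresses is
  an isomorphism. Up to isomorphism the tree thus depends on the seed and the set, not on the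
  history that produced the addresses.\<close>

lemma embedding_iso_mk_tree:
 assumes "seed_tree p d D L lab pr Om nm" "seed_tree p d D L lab pr Om nm'"
 shows "embedding_iso Om (mk_tree p L lab pr Om nm, %x. nm x + L) (mk_tree p L lab pr Om nm', %x. nm' x + L)"
proof (cases "Om = {}")
 case True
 show ?thesis unfolding embedding_iso_def True mk_tree_def by (auto intro!: exI[of _ id])
next
 case ne: False
 interpret A: seed_tree p d D L lab pr Om nm by fact
 interpret B: seed_tree p d D L lab pr Om nm' by fact
 define f where "f a = nm' (A.pt a) + A.lv a" for a
 have fn: "f (A.nn i x) = B.nn i x" if "x : Om" "i <= L" for i x
 unfolding f_def using that by (simp add: A.pt_nn A.lv_nn) (simp add: node_name_def)
 obtain x0 where x0: "x0 : Om" using ne by blast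
 have nodes: "nodes A.T = (%(i, x). A.nn i x) ` ({..L} \<times> Om)" "nodes B.T = (%(i, x). B.nn i x) ` ({..L} \<times> Om)"
 using A.nodes_T[OF ne] B.nodes_T[OF ne] by auto
 have "bij_betw f (nodes A.T) (nodes B.T)"
 unfolding bij_betw_def
 proof
 show "inj_on f (nodes A.T)"
 by (rule inj_onI) (use nodes fn A.nn_eq_iff B.nn_eq_iff in auto)
 show "f ` nodes A.T = nodes B.T" unfolding nodes image_image using fn by (intro image_cong) auto
 qed
 moreover have "f (root A.T) = root B.T" using A.root_T[OF x0] B.root_T[OF x0] fn[OF x0] by simp
 moreover have "{u, v} : edges A.T <-> {f u, f v} : edges B.T" if uv: "u : nodes A.T" "v : nodes A.T" for u v
 proof -
 obtain i x j y where n: "u = A.nn i x" "i <= L" "x : Om" "v = A.nn j y" "j <= L" "y : Om"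
 using uv unfolding A.nodes_T[OF ne] by blast
 show ?thesis unfolding n(1,4) using A.edge_iff[OF n(3,6,2,5)] B.edge_iff[OF n(3,6,2,5)] fn n by simp
 qed
 moreover have "weight B.T (f ` e) = weight A.T e" if e: "e : edges A.T" for e
 proof -
 obtain i x where n: "i < L" "x : Om" "e = {A.nn (Suc i) x, A.nn i x}" using e by (auto simp: A.edges_T)
 show ?thesis unfolding n(3) using fn[of x i] fn[of x "Suc i"] A.weight_T[of x x "Suc i" i] B.weight_T[of x x "Suc i" i] n by simp
 qed
 moreover have "f (nm x + L) = nm' x + L" if "x : Om" for x
 using that A.phi[OF that] B.phi[OF that] fn[OF that, of L] by simp
 ultimately show ?thesis unfolding embedding_iso_def by auto
qed

lemma embedding_iso_trans:
 assumes "embedding_iso Om (T, ph) (T', ph')" "embedding_iso Om (T', ph') (T'', ph'')"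
 "edges T <= {{u, v} |u v. u : nodes T & v : nodes T}"
 shows "embedding_iso Om (T, ph) (T'', ph'')"
proof -
 obtain f where f: "bij_betw f (nodes T) (nodes T')" "f (root T) = root T'"
 "ALL u:nodes T. ALL v:nodes T. {u, v} : edges T <-> {f u, f v} : edges T'"
 "ALL e:edges T. weight T' (f ` e) = weight T e" "ALL x:Om. f (ph x) = ph' x"
 using assms(1) unfolding embedding_iso_def by auto
 obtain g where g: "bij_betw g (nodes T') (nodes T'')" "g (root T') = root T''"
 "ALL u:nodes T'. ALL v:nodes T'. {u, v} : edges T' <-> {g u, g v} : edges T''"
 "ALL e:edges T'. weight T'' (g ` e) = weight T' e" "ALL x:Om. g (ph' x) = ph'' x"
 using assms(2) unfolding embedding_iso_def by auto
 have fn: "f u : nodes T'" if "u : nodes T" for u using f(1) that bij_betwE by blast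
 have "f ` e : edges T'" if e: "e : edges T" for e
 proof -
 obtain u v where "u : nodes T" "v : nodes T" "e = {u, v}" using e assms(3) by blast
 thus ?thesis using f(3) e by auto
 qed
 hence "ALL e:edges T. weight T'' ((g o f) ` e) = weight T e" using f(4) g(4) by (metis image_comp)
 moreover have "bij_betw (g o f) (nodes T) (nodes T'')" using f(1) g(1) by (rule bij_betw_trans)
 ultimately show ?thesis unfolding embedding_iso_def using f g fn by (auto intro!: exI[of _ "g o f"])
qed

lemma iso_class_mk_tree:
 assumes "seed_tree p d D L lab pr Om nm" "seed_tree p d D L lab pr Om nm'"
 shows "iso_class Om (mk_tree p L lab pr Om nm, %x. nm x + L) = iso_class Om (mk_tree p L lab pr Om nm', %x. nm' x + L)"
proof -
 have sub: "edges (mk_tree p L lab pr Om nm) <= {{u, v} |u v. u : nodes (mk_tree p L lab pr Om nm) & v : nodes (mk_tree p L lab pr Om nm)}"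
 for nm
 proof
 fix e assume "e : edges (mk_tree p L lab pr Om nm)"
 then obtain i x where ix: "i < L" "x : Om" "e = {node_name lab pr Om nm (Suc i) x, node_name lab pr Om nm i x}"
 by (auto simp: mk_tree_def)
 have "node_name lab pr Om nm j x : nodes (mk_tree p L lab pr Om nm)" if "j <= L" for j
 using that ix(2) by (auto simp: mk_tree_def)
 thus "e : {{u, v} |u v. u : nodes (mk_tree p L lab pr Om nm) & v : nodes (mk_tree p L lab pr Om nm)}"
 using ix by (auto intro!: exI)
 qed
 have "embedding_iso Om (mk_tree p L lab pr Om nm, %x. nm x + L) (T', ph') <->
 embedding_iso Om (mk_tree p L lab pr Om nm', %x. nm' x + L) (T', ph')" for T' ph'
 using embedding_iso_trans[OF embedding_iso_mk_tree[OF assms] _ sub]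
 embedding_iso_trans[OF embedding_iso_mk_tree[OF assms(2,1)] _ sub] by blast
 thus ?thesis unfolding iso_class_def by auto
qed

section \<open>Registers and a program logic with running times\<close>

datatype rname = Tm nat | Crd nat | Pri nat | Rp nat | Ch nat | Bt nat | Slt "vec" | Rpr nat nat | Cnt

instance rname :: countable
 by countable_datatype

text \<open>Registers are numbers, and countability provides one for every vector
  (\<open>Slt\<close>) and every pair of level and cell label (\<open>Rpr\<close>). As the grid is
  finite, only finitely many of them occur in a program.\<close>

definition rn :: "rname => nat" where "rn = to_nat"

lemma rn_eq [simp]: "rn a = rn b <-> a = b"
 by (simp add: rn_def)

abbreviation "tm n == rn (Tm n)"

abbreviation rg :: "state => rname => nat" where "rg s q == reg s (rn q)"

definition stm where "stm a v s = s\<lparr>mem := (mem s)(a := v)\<rparr>"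
definition wrt where "wrt v s = s\<lparr>out := out s @ [v]\<rparr>"

lemma state_simps [simp]:
 "reg (tick s) = reg s" "mem (tick s) = mem s" "inp (tick s) = inp s" "out (tick s) = out s" "time (tick s) = Suc (time s)"
 "reg (set_reg r a s) = (reg s)(r := a)" "mem (set_reg r a s) = mem s" "inp (set_reg r a s) = inp s" "out (set_reg r a s) = out s" "time (set_reg r a s) = time s"
 "reg (stm b v s) = reg s" "mem (stm b v s) = (mem s)(b := v)" "inp (stm b v s) = inp s" "out (stm b v s) = out s" "time (stm b v s) = time s"
 "reg (wrt v s) = reg s" "mem (wrt v s) = mem s" "inp (wrt v s) = inp s" "out (wrt v s) = out s @ [v]" "time (wrt v s) = time s"
 by (simp_all add: tick_def set_reg_def stm_def wrt_def)

text \<open>Total correctness of deterministic code: the outcome is a point mass. Random words are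
  drawn by the initialisation only, which is treated separately.\<close>

definition wp where
 "wp w c Q s <-> (EX s'. exec w c s = return_spmf s' & Q s')"

lemma wp_Seq: "wp w a (%s'. wp w b Q s') s ==> wp w (Seq a b) Q s"
 by (auto simp: wp_def)

lemma wp_mono: "wp w c P s ==> (!!s'. P s' ==> Q s') ==> wp w c Q s"
 by (auto simp: wp_def)

lemma wp_Cond: "(rg s q ~= 0 ==> wp w a Q (tick s)) ==> (rg s q = 0 ==> wp w b Q (tick s)) ==> wp w (Cond (rn q) a b) Q s"
 by (auto simp: wp_def)

lemma exec_While: "exec w (While r c) s =
 (if reg s r ~= 0 then bind_spmf (exec w c (tick s)) (exec w (While r c)) else return_spmf (tick s))"
proof -
 have "exec w (While r c) = (%s. map_spmf tick (loop (%s. reg s r ~= 0) (%s. exec w c (tick s)) s))"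
 by (rule ext) simp
 thus ?thesis by (simp add: loop.simps[of _ _ s] map_spmf_bind_spmf o_def)
qed

lemma wp_While:
 assumes "rg s q ~= 0 ==> wp w c (%s'. wp w (While (rn q) c) Q s') (tick s)" "rg s q = 0 ==> Q (tick s)"
 shows "wp w (While (rn q) c) Q s"
 using assms unfolding wp_def exec_While[of w "rn q" c s] by auto

fun seqs :: "com list => com" where
 "seqs [] = Skip"
| "seqs (c # cs) = Seq c (seqs cs)"

lemma wp_Skip:
 assumes "!!s'. (!!q. rg s' q = rg s q) ==> mem s' = mem s ==> out s' = out s ==> inp s' = inp s ==> time s' = Suc (time s) ==> Q s'"
 shows "wp w Skip Q s"
 using assms[of "tick s"] by (simp add: wp_def)

lemma wp_Nil:
 assumes "!!s'. (!!q. rg s' q = rg s q) ==> mem s' = mem s ==> out s' = out s ==> inp s' = inp s ==> time s' = Suc (time s) ==> Q s'"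
 shows "wp w (seqs []) Q s"
 using wp_Skip[OF assms] by simp

lemma wp_Cons: "wp w c (%s'. wp w (seqs cs) Q s') s ==> wp w (seqs (c # cs)) Q s"
 by (simp add: wp_Seq)

lemma wp_const:
 assumes "!!s'. (!!q. rg s' q = (if q = r then n mod 2 ^ w else rg s q)) ==> mem s' = mem s ==> out s' = out s ==> inp s' = inp s ==> time s' = Suc (time s) ==> Q s'"
 shows "wp w (Const (rn r) n) Q s"
 using assms[of "tick (set_reg (rn r) (n mod 2 ^ w) s)"] by (simp add: wp_def)

lemma wp_bin:
 assumes "!!s'. (!!q. rg s' q = (if q = r then binop_word w f (rg s a) (rg s b) else rg s q)) ==> mem s' = mem s ==> out s' = out s ==> inp s' = inp s ==> time s' = Suc (time s) ==> Q s'"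
 shows "wp w (Bin f (rn r) (rn a) (rn b)) Q s"
 using assms[of "tick (set_reg (rn r) (binop_word w f (rg s a) (rg s b)) s)"] by (simp add: wp_def)

lemma wp_load:
 assumes "!!s'. (!!q. rg s' q = (if q = r then mem s (rg s a) else rg s q)) ==> mem s' = mem s ==> out s' = out s ==> inp s' = inp s ==> time s' = Suc (time s) ==> Q s'"
 shows "wp w (Load (rn r) (rn a)) Q s"
 using assms[of "tick (set_reg (rn r) (mem s (rg s a)) s)"] by (simp add: wp_def)

lemma wp_store:
 assumes "!!s'. (!!q. rg s' q = rg s q) ==> mem s' = (mem s)(rg s a := rg s r) ==> out s' = out s ==> inp s' = inp s ==> time s' = Suc (time s) ==> Q s'"
 shows "wp w (Store (rn a) (rn r)) Q s"
 using assms[of "tick (stm (rg s a) (rg s r) s)"] by (simp add: wp_def) (simp add: stm_def)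

lemma wp_write:
 assumes "!!s'. (!!q. rg s' q = rg s q) ==> mem s' = mem s ==> out s' = out s @ [rg s r] ==> inp s' = inp s ==> time s' = Suc (time s) ==> Q s'"
 shows "wp w (Write (rn r)) Q s"
 using assms[of "tick (wrt (rg s r) s)"] by (simp add: wp_def) (simp add: wrt_def)

lemma wp_mv:
 assumes "!!s'. (!!q. rg s' q = (if q = r then rg s a else rg s q)) ==> mem s' = mem s ==> out s' = out s ==> inp s' = inp s ==> time s' = Suc (time s) ==> Q s'"
 shows "wp w (Bin Or (rn r) (rn a) (rn a)) Q s"
 by (rule wp_bin) (use assms in simp)

text \<open>The empty sequence at the end of an unrolled loop is a \<open>Skip\<close> and costs one
  step, hence the \<open>tick\<close> before the postcondition.\<close>

lemma wp_loop:
 assumes "I 0 s" "!!i s. i < n ==> I i s ==> wp w (f i) (I (Suc i)) s" "!!s'. I n s' ==> Q (tick s')"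
 shows "wp w (seqs (map f [0..<n])) Q s"
proof -
 have "wp w (seqs (map f [k..<n])) Q s" if "I k s" "k <= n" for k s
 using that
 proof (induction "n - k" arbitrary: k s)
 case 0
 thus ?case using assms(3) by (simp add: wp_def)
 next
 case (Suc m)
 have k: "k < n" using Suc by simp
 have "wp w (f k) (%s'. wp w (seqs (map f [Suc k..<n])) Q s') s"
 by (rule wp_mono[OF assms(2)[OF k Suc.prems(1)]]) (use Suc k in auto)
 thus ?case using k by (simp add: upt_rec[of k n] wp_Seq)
 qed
 from this[OF assms(1)] show ?thesis by simp
qed

definition frm where
 "frm V s s' <-> inp s' = inp s & (ALL q. q ~: V --> rg s' q = rg s q)"

lemma frm_refl: "frm V s s"
 by (simp add: frm_def)

lemma frm_trans: "frm V s s' ==> frm V' s' s'' ==> V <= U ==> V' <= U ==> frm U s s''"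
 unfolding frm_def by (metis subsetD)

lemma frm_mono: "frm V s s' ==> V <= U ==> frm U s s'"
 unfolding frm_def by blast

lemma frmD: "frm V s s' ==> q ~: V ==> rg s' q = rg s q" "frm V s s' ==> inp s' = inp s"
 by (auto simp: frm_def)

text \<open>Fields of the record of a vector: coordinates, addresses of its representatives, weights
  of its path, digits of its priority, forward and backward ring links per level, and a word of the
  free list.\<close>

datatype fld = Cf nat | Nf nat | Wf nat | Pf nat | Nx nat | Pv nat | Fr

text \<open>Residues modulo 7 tell the kinds of fields apart, which makes offsets injective for all
  indices at once.\<close>

fun off :: "fld => nat" where
 "off (Cf t) = 7 * t" | "off (Nf t) = 7 * t + 1" | "off (Wf t) = 7 * t + 2" | "off (Pf t) = 7 * t + 3"
| "off (Nx t) = 7 * t + 4" | "off (Pv t) = 7 * t + 5" | "off Fr = 6"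

declare off.simps [simp del]

lemma off_eq: "off f = off g <-> f = g"
 by (cases f; cases g; simp add: off.simps; presburger)

definition ldf where
 "ldf r a f = seqs [Const (tm 0) (off f), Bin Plus (tm 0) (rn a) (tm 0), Load (rn r) (tm 0)]"

definition stf where
 "stf a f r = seqs [Const (tm 0) (off f), Bin Plus (tm 0) (rn a) (tm 0), Store (tm 0) (rn r)]"

lemma wp_ldf:
 assumes "rg s a + off f < 2 ^ w" "a ~= Tm 0"
 "!!s'. rg s' r = mem s (rg s a + off f) ==> frm {Tm 0, r} s s' ==> mem s' = mem s ==> out s' = out s ==> time s' = time s + 4 ==> Q s'"
 shows "wp w (ldf r a f) Q s"
 unfolding ldf_def
 apply (rule wp_Cons wp_Nil wp_const wp_bin wp_load assms(3))+
 subgoal premises pr using assms(1,2) by (simp add: pr)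
 subgoal premises pr by (simp add: pr frm_def)
 subgoal premises pr by (simp add: pr)
 subgoal premises pr by (simp add: pr)
 subgoal premises pr by (simp add: pr)
 done

lemma wp_stf:
 assumes "rg s a + off f < 2 ^ w" "a ~= Tm 0" "r ~= Tm 0"
 "!!s'. frm {Tm 0} s s' ==> mem s' = (mem s)(rg s a + off f := rg s r) ==> out s' = out s ==> time s' = time s + 4 ==> Q s'"
 shows "wp w (stf a f r) Q s"
 unfolding stf_def
 apply (rule wp_Cons wp_Nil wp_const wp_bin wp_store assms(4))+
 subgoal premises pr by (simp add: pr frm_def)
 subgoal premises pr using assms(1-3) by (simp add: pr)
 subgoal premises pr by (simp add: pr)
 subgoal premises pr by (simp add: pr)
 done

section \<open>Memory layout, rounded distances and comparison of priorities\<close>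

locale layout =
 fixes p :: real and d D L cap w :: nat
 assumes d: "1 <= d" and D: "2 <= D" and p: "1 <= p" "p <= 2"
 and fits: "2 * D + 2 + d * D^2 + cap * (7 * (d + L + 1)) <= 2 ^ w" and cap: "1 <= cap"
begin

text \<open>The length also leaves room for a weight at level L + 1, a dummy entry that the sweep
  over lower edges writes at the last level.\<close>

definition K where "K = 7 * (d + L + 1)"
definition RT where "RT = 2 * D + 1"
definition base where "base = 2 * D + 2 + d * D^2"
definition slot where "slot k = base + k * K"
definition SL where "SL = slot ` {..<cap}"

text \<open>The table of powers is centred at D: it is read at x + D - y, which takes the absolute
  value without a branch.\<close>

definition tabs where
 "tabs m <-> (ALL j<=2 * D. m j = pow_tab p (nat \<bar>int j - int D\<bar>)) & (ALL s<=d * D^2. m (RT + s) = root_tab p s)"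

definition vf :: "fld => bool" where "vf f <-> off f < K"

lemma vf_simps [simp]: "t < d ==> vf (Cf t)" "t < d ==> vf (Pf t)" "i <= L ==> vf (Nf i)" "i <= Suc L ==> vf (Wf i)"
 "i <= L ==> vf (Nx i)" "i <= L ==> vf (Pv i)" "vf Fr"
 using d by (auto simp: vf_def K_def off.simps)

lemma K_pos: "0 < K" by (simp add: K_def)

lemma slot_bound: "a : SL ==> vf f ==> a + off f < 2 ^ w"
proof -
 assume "a : SL" "vf f"
 then obtain k where k: "k < cap" "a = base + k * K" "off f < K" by (auto simp: SL_def slot_def vf_def)
 have "(k + 1) * K <= cap * K" using k by (intro mult_le_mono1) auto
 hence "a + off f < base + cap * K" using k by (simp add: algebra_simps)
 also have "... <= 2 ^ w" using fits by (simp add: base_def K_def)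
 finally show ?thesis .
qed

lemma slot_pos: "a : SL ==> 0 < a" by (auto simp: SL_def slot_def base_def)

lemma slot_less: "a : SL ==> a < 2 ^ w" using slot_bound[of a Fr] by simp

lemma slot_inj: "slot j = slot k <-> j = k"
 using K_pos by (auto simp: slot_def)

lemma slot_add_eq:
 assumes "a : SL" "b : SL" "x < K" "y < K"
 shows "a + x = b + y <-> a = b & x = y"
proof
 assume eq: "a + x = b + y"
 obtain j k where jk: "a = base + j * K" "b = base + k * K" using assms by (auto simp: SL_def slot_def)
 have "j * K + x = k * K + y" using eq jk by simp
 moreover have "(j * K + x) div K = j" "(k * K + y) div K = k" using assms K_pos by auto
 ultimately have "j = k" by metis
 thus "a = b & x = y" using eq jk by simp
qed simp

lemma fld_eq: "a : SL ==> b : SL ==> vf f ==> vf g ==> a + off f = b + off g <-> a = b & f = g"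
 using slot_add_eq[of a b "off f" "off g"] by (auto simp: vf_def off_eq)

lemma small_words: "2 * D + 2 + d * D^2 <= 2 ^ w" "K <= 2 ^ w" "1 <= w" "Suc L < 2 ^ w" "d < 2 ^ w"
proof -
 show 1: "2 * D + 2 + d * D^2 <= 2 ^ w" using fits by linarith
 have "1 * K <= cap * K" using cap by (intro mult_le_mono1)
 thus k: "K <= 2 ^ w" using fits unfolding K_def by linarith
 thus "Suc L < 2 ^ w" "d < 2 ^ w" by (auto simp: K_def)
 show "1 <= w"
 proof (rule ccontr)
 assume "~ 1 <= w"
 hence "w = 0" by simp
 with 1 show False by simp
 qed
qed

lemma one_mod: "1 mod 2 ^ w = (1 :: nat)"
 using small_words(3) one_less_power[of "2::nat" w] by simp

definition coords where
 "coords m a x <-> a : SL & x : grid d D & (ALL t<d. m (a + off (Cf t)) = x ! t)"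

definition wd1 where
 "wd1 A B t = seqs [ldf (Tm 1) A (Cf t), ldf (Tm 2) B (Cf t), Const (tm 3) D,
 Bin Plus (tm 1) (tm 1) (tm 3), Bin Minus (tm 1) (tm 1) (tm 2),
 Load (tm 1) (tm 1), Bin Plus (tm 5) (tm 5) (tm 1)]"

definition wd where
 "wd A B = seqs [Const (tm 5) 0, seqs (map (wd1 A B) [0..<d]), Const (tm 0) RT,
 Bin Plus (tm 0) (tm 0) (tm 5), Load (tm 5) (tm 0)]"

abbreviation "VW == {Tm 0, Tm 1, Tm 2, Tm 3, Tm 5}"

lemma pow_sum_le:
 assumes "x : grid d D" "y : grid d D" "n <= d"
 shows "(SUM u<n. pow_tab p (cdiff x y u)) <= d * D^2"
proof -
 have "(SUM u<n. pow_tab p (cdiff x y u)) <= (SUM u<n. D\<^sup>2)"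
 using assms cdiff_le by (intro sum_mono pow_tab_le p) auto
 also have "... <= d * D^2" using assms by simp
 finally show ?thesis .
qed

lemma wd1_value:
 assumes x: "coords m a x" and y: "coords m b y" and t: "t < d" and tb: "tabs m"
 shows "((SUM u<t. pow_tab p (cdiff x y u)) + m (((m ((a + off (Cf t) mod 2 ^ w) mod 2 ^ w) + D mod 2 ^ w) mod 2 ^ w +
 (2 ^ w - m ((b + off (Cf t) mod 2 ^ w) mod 2 ^ w))) mod 2 ^ w)) mod 2 ^ w = (SUM u<Suc t. pow_tab p (cdiff x y u))"
proof -
 have ab: "(a + off (Cf t) mod 2 ^ w) mod 2 ^ w = a + off (Cf t)" "(b + off (Cf t) mod 2 ^ w) mod 2 ^ w = b + off (Cf t)"
 using slot_bound[of a "Cf t"] slot_bound[of b "Cf t"] x y t by (simp_all add: coords_def mod_add_right_eq)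
 have v: "m (a + off (Cf t)) = x ! t" "m (b + off (Cf t)) = y ! t" using x y t by (auto simp: coords_def)
 have g: "x ! t : {1..D}" "y ! t : {1..D}" using x y t grid_nth by (auto simp: coords_def)
 \<comment> \<open>D is added before y is subtracted, so the word subtraction, done by adding 2^w -
   y, comes out as the true index between 0 and 2 D.\<close>
 define j where "j = x ! t + D - y ! t"
 have W: "2 * D < 2 ^ w" using small_words(1) by linarith
 have "(x ! t + D mod 2 ^ w) mod 2 ^ w = x ! t + D" using g W by (simp add: mod_add_right_eq)
 moreover have "(x ! t + D + (2 ^ w - y ! t)) mod 2 ^ w = j"
 proof -
 have "x ! t + D + (2 ^ w - y ! t) = j + 2 ^ w" using g W by (simp add: j_def)
 moreover have "j <= 2 * D" using g by (auto simp: j_def)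
 hence "j < 2 ^ w" using W by linarith
 ultimately show ?thesis by simp
 qed
 ultimately have idx: "((x ! t + D mod 2 ^ w) mod 2 ^ w + (2 ^ w - y ! t)) mod 2 ^ w = j" by simp
 have "j <= 2 * D" "nat \<bar>int j - int D\<bar> = cdiff x y t" using g by (auto simp: j_def cdiff_def)
 hence mj: "m j = pow_tab p (cdiff x y t)" using tb unfolding tabs_def by metis
 have "(SUM u<Suc t. pow_tab p (cdiff x y u)) < 2 ^ w"
 using pow_sum_le[of x y "Suc t"] x y t small_words(1) by (auto simp: coords_def)
 thus ?thesis unfolding ab v idx mj by simp
qed

lemma wp_wd1:
 assumes AB: "A ~: VW" "B ~: VW" and t: "t < d" and tb: "tabs (mem s)"
 and Q: "!!s'. frm VW s s' ==> mem s' = mem s ==> out s' = out s ==> time s' = time s + 14 ==>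
 (!!x y. coords (mem s) (rg s A) x ==> coords (mem s) (rg s B) y ==>
 rg s (Tm 5) = (SUM u<t. pow_tab p (cdiff x y u)) ==> rg s' (Tm 5) = (SUM u<Suc t. pow_tab p (cdiff x y u))) ==> Q s'"
 shows "wp w (wd1 A B t) Q s"
 unfolding wd1_def ldf_def
 apply (rule wp_Cons wp_Nil wp_const wp_bin wp_load Q)+
 subgoal premises pr using AB by (simp add: pr frm_def)
 subgoal premises pr by (simp add: pr)
 subgoal premises pr by (simp add: pr)
 subgoal premises pr by (simp add: pr)
 subgoal premises pr for s1 s2 s3 s4 s5 s6 s7 s8 s9 s10 s11 s12 s13 s14 x y
 using AB wd1_value[OF pr(71,72) t tb] pr(73) by (simp add: pr(1-70))
 done

lemma wp_wd:
 assumes AB: "A ~: VW" "B ~: VW" and tb: "tabs (mem s)"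
 and Q: "!!s'. frm VW s s' ==> mem s' = mem s ==> out s' = out s ==> time s' <= time s + 14 * d + 6 ==>
 (!!x y. coords (mem s) (rg s A) x ==> coords (mem s) (rg s B) y ==> rg s' (Tm 5) = wdist p x y) ==> Q s'"
 shows "wp w (wd A B) Q s"
 unfolding wd_def
proof (rule wp_Cons, rule wp_const, rule wp_Cons, goal_cases)
 case s1: (1 s1)
 define I where "I t s' <-> frm VW s s' & mem s' = mem s & out s' = out s & time s' = time s + 1 + 14 * t &
 (ALL x y. coords (mem s) (rg s A) x --> coords (mem s) (rg s B) y --> rg s' (Tm 5) = (SUM u<t. pow_tab p (cdiff x y u)))" for t s'
 show "wp w (seqs (map (wd1 A B) [0..<d]))
 (%s'. wp w (seqs [Const (tm 0) RT, Bin Plus (tm 0) (tm 0) (tm 5), Load (tm 5) (tm 0)]) Q s')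
 s1"
 proof (rule wp_loop[of I])
 show "I 0 s1" by (simp add: I_def s1 frm_def)
 next
 fix t s2 assume t: "t < d" and I: "I t s2"
 have ab: "rg s2 A = rg s A" "rg s2 B = rg s B" using I AB by (auto simp: I_def frm_def)
 show "wp w (wd1 A B t) (I (Suc t)) s2"
 proof (rule wp_wd1[OF AB t])
 show "tabs (mem s2)" using I tb by (simp add: I_def)
 fix s' assume s': "frm VW s2 s'" "mem s' = mem s2" "out s' = out s2" "time s' = time s2 + 14"
 "!!x y. coords (mem s2) (rg s2 A) x ==> coords (mem s2) (rg s2 B) y ==>
 rg s2 (Tm 5) = (SUM u<t. pow_tab p (cdiff x y u)) ==> rg s' (Tm 5) = (SUM u<Suc t. pow_tab p (cdiff x y u))"
 have "frm VW s s'" using I s'(1) frm_trans unfolding I_def by blast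
 thus "I (Suc t) s'" using I s' by (auto simp: I_def ab)
 qed
 next
 fix s2 assume I: "I d s2"
 show "wp w (seqs [Const (tm 0) RT, Bin Plus (tm 0) (tm 0) (tm 5), Load (tm 5) (tm 0)]) Q (tick s2)"
 apply (rule wp_Cons wp_Nil wp_const wp_bin wp_load Q)+
 subgoal premises pr using I by (simp add: pr I_def frm_def)
 subgoal premises pr using I by (simp add: pr I_def)
 subgoal premises pr using I by (simp add: pr I_def)
 subgoal premises pr using I by (simp add: pr I_def)
 subgoal premises pr for s3 s4 s5 s6 x y
 proof -
 have xy: "coords (mem s) (rg s A) x" "coords (mem s) (rg s B) y" by (rule pr(21), rule pr(22))
 define S where "S = (SUM u<d. pow_tab p (cdiff x y u))"
 have 5: "rg s2 (Tm 5) = S" using I xy by (auto simp: I_def S_def)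
 have S: "S <= d * D^2" using pow_sum_le[of x y d] xy by (auto simp: S_def coords_def)
 have "RT + S < 2 ^ w" using S small_words(1) by (simp add: RT_def)
 moreover have "mem s (RT + S) = root_tab p S" using tb S by (auto simp: tabs_def)
 moreover have "length x = d" "mem s2 = mem s" using I xy grid_length by (auto simp: I_def coords_def)
 ultimately show ?thesis using 5 by (simp add: pr(1-20) wdist_def S_def)
 qed
 done
 qed
qed

definition dig where
 "dig m a z <-> a : SL & z : grid d D & (ALL t<d. m (a + off (Pf t)) = z ! t)"

text \<open>Lexicographic comparison without branches: \<open>Tm 6\<close> stays 1 as long as all
  digits agreed, \<open>Tm 5\<close> becomes 1 if A is smaller at the first disagreement.\<close>

definition cm1 where
 "cm1 A B t = seqs [ldf (Tm 1) A (Pf t), ldf (Tm 2) B (Pf t), Bin Less (tm 3) (tm 1) (tm 2),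
 Bin And (tm 3) (tm 3) (tm 6), Bin Or (tm 5) (tm 5) (tm 3),
 Bin Equal (tm 3) (tm 1) (tm 2), Bin And (tm 6) (tm 6) (tm 3)]"

definition cm where
 "cm A B = seqs [Const (tm 5) 0, Const (tm 6) 1, seqs (map (cm1 A B) [0..<d])]"

abbreviation "VC == {Tm 0, Tm 1, Tm 2, Tm 3, Tm 5, Tm 6}"

lemma wp_cm1:
 assumes AB: "A ~: VC" "B ~: VC" and t: "t < d" and a: "dig (mem s) (rg s A) x" and b: "dig (mem s) (rg s B) y"
 and r: "rg s (Tm 5) = of_bool (key D (take t x) < key D (take t y))" "rg s (Tm 6) = of_bool (key D (take t x) = key D (take t y))"
 and Q: "!!s'. frm VC s s' ==> mem s' = mem s ==> out s' = out s ==> time s' = time s + 14 ==>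
 rg s' (Tm 5) = of_bool (key D (take (Suc t) x) < key D (take (Suc t) y)) ==>
 rg s' (Tm 6) = of_bool (key D (take (Suc t) x) = key D (take (Suc t) y)) ==> Q s'"
 shows "wp w (cm1 A B t) Q s"
proof -
 have m: "(rg s A + off (Pf t) mod 2 ^ w) mod 2 ^ w = rg s A + off (Pf t)" "(rg s B + off (Pf t) mod 2 ^ w) mod 2 ^ w = rg s B + off (Pf t)"
 using slot_bound[of "rg s A" "Pf t"] slot_bound[of "rg s B" "Pf t"] a b t by (simp_all add: dig_def mod_add_right_eq)
 have v: "mem s (rg s A + off (Pf t)) = x ! t" "mem s (rg s B + off (Pf t)) = y ! t" using a b t by (auto simp: dig_def)
 have g: "x ! t <= D" "y ! t <= D" using grid_nth[of x d D t] grid_nth[of y d D t] a b t by (auto simp: dig_def)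
 have l: "length x = d" "length y = d" using a b grid_length by (auto simp: dig_def)
 have tk: "take (Suc t) x = take t x @ [x ! t]" "take (Suc t) y = take t y @ [y ! t]" using l t by (auto simp: take_Suc_conv_app_nth)
 have kl: "key D (take (Suc t) x) < key D (take (Suc t) y) <-> key D (take t x) < key D (take t y) | (key D (take t x) = key D (take t y) & x ! t < y ! t)"
 unfolding tk using l g by (intro key_less_iff) auto
 have kl': "key D (take (Suc t) y) < key D (take (Suc t) x) <-> key D (take t y) < key D (take t x) | (key D (take t y) = key D (take t x) & y ! t < x ! t)"
 unfolding tk using l g by (intro key_less_iff) auto
 have ke: "key D (take (Suc t) x) = key D (take (Suc t) y) <-> key D (take t x) = key D (take t y) & x ! t = y ! t"
 using kl kl' by (metis nat_neq_iff)
 show ?thesis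
 unfolding cm1_def ldf_def
 apply (rule wp_Cons wp_Nil wp_const wp_bin wp_load Q)+
 subgoal premises pr using AB by (simp add: pr frm_def)
 subgoal premises pr by (simp add: pr)
 subgoal premises pr by (simp add: pr)
 subgoal premises pr by (simp add: pr)
 subgoal premises pr using AB one_mod by (simp add: pr m v r kl of_bool_def)
 subgoal premises pr using AB one_mod by (simp add: pr m v r ke of_bool_def)
 done
qed

lemma wp_cm:
 assumes AB: "A ~: VC" "B ~: VC" and a: "dig (mem s) (rg s A) x" and b: "dig (mem s) (rg s B) y"
 and Q: "!!s'. frm VC s s' ==> mem s' = mem s ==> out s' = out s ==> time s' <= time s + 14 * d + 4 ==>
 rg s' (Tm 5) = of_bool (key D x < key D y) ==> Q s'"
 shows "wp w (cm A B) Q s"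
 unfolding cm_def
proof (rule wp_Cons, rule wp_const, rule wp_Cons, rule wp_const, rule wp_Cons, goal_cases)
 case s0: (1 s0 s1)
 define I where "I t s' <-> frm VC s s' & mem s' = mem s & out s' = out s & time s' = time s + 2 + 14 * t &
 rg s' (Tm 5) = of_bool (key D (take t x) < key D (take t y)) &
 rg s' (Tm 6) = of_bool (key D (take t x) = key D (take t y))" for t s'
 show "wp w (seqs (map (cm1 A B) [0..<d])) (%s'. wp w (seqs []) Q s') s1"
 proof (rule wp_loop[of I])
 show "I 0 s1" using one_mod by (simp add: I_def s0 frm_def)
 next
 fix t s2 assume t: "t < d" and I: "I t s2"
 have ab: "rg s2 A = rg s A" "rg s2 B = rg s B" using I AB by (auto simp: I_def frm_def)
 show "wp w (cm1 A B t) (I (Suc t)) s2"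
 proof (rule wp_cm1[OF AB t, of s2 x y])
 fix s' assume s': "frm VC s2 s'" "mem s' = mem s2" "out s' = out s2" "time s' = time s2 + 14"
 "rg s' (Tm 5) = of_bool (key D (take (Suc t) x) < key D (take (Suc t) y))"
 "rg s' (Tm 6) = of_bool (key D (take (Suc t) x) = key D (take (Suc t) y))"
 have "frm VC s s'" using I s'(1) frm_trans unfolding I_def by blast
 thus "I (Suc t) s'" using I s' by (auto simp: I_def)
 qed (use I a b in "auto simp: I_def ab")
 next
 fix s2 assume I: "I d s2"
 have "length x = d" "length y = d" using a b grid_length by (auto simp: dig_def)
 thus "wp w (seqs []) Q (tick s2)"
 using I by (intro wp_Nil Q) (simp_all add: I_def frm_def)
 qed
qed

end

section \<open>Circular doubly linked lists in memory\<close>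

context layout begin

definition chain where
 "chain m i xs <-> successively (%a b. m (a + off (Nx i)) = b & m (b + off (Pv i)) = a) xs"

definition ring where
 "ring m i l <-> l ~= [] & distinct l & set l <= SL & chain m i (l @ [hd l])"

lemma chain_glue: "chain m i (xs @ r # ys) <-> chain m i (xs @ [r]) & chain m i (r # ys)"
 unfolding chain_def by (induction xs rule: induct_list012) auto

lemma ring_rotate:
 assumes "ring m i (xs @ r # ys)" shows "ring m i (r # ys @ xs)"
proof (cases xs)
 case (Cons a as)
 have "chain m i ((a # as) @ r # (ys @ [a]))" using assms Cons by (simp add: ring_def)
 hence "chain m i (a # as @ [r])" "chain m i ((r # ys) @ [a])" using chain_glue[of m i "a # as" r "ys @ [a]"] by auto
 hence "chain m i ((r # ys) @ a # as @ [r])" using chain_glue[of m i "r # ys" a "as @ [r]"] by simp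
 thus ?thesis using assms Cons by (auto simp: ring_def)
qed (use assms in simp)

lemma ring_start:
 assumes "ring m i l" "r : set l"
 obtains l' where "ring m i (r # l')" "set (r # l') = set l"
proof -
 obtain xs ys where "l = xs @ r # ys" using assms(2) by (meson split_list)
 with assms(1) show thesis by (intro that[of "ys @ xs"]) (auto dest: ring_rotate)
qed

lemma ring_next:
 assumes "ring m i l" "k < length l"
 shows "m (l ! k + off (Nx i)) = (l @ [hd l]) ! Suc k"
 using assms unfolding ring_def chain_def successively_conv_nth
 by (auto simp: nth_append)

lemma ring_cong:
 assumes "ring m i l" "!!a. a : set l ==> m' (a + off (Nx i)) = m (a + off (Nx i)) & m' (a + off (Pv i)) = m (a + off (Pv i))"
 shows "ring m' i l"
proof -
 have "chain m i xs ==> set xs <= set l ==> chain m' i xs" for xs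
 unfolding chain_def by (induction xs rule: induct_list012) (auto simp: assms(2))
 moreover have "set (l @ [hd l]) <= set l" using assms(1) by (auto simp: ring_def)
 ultimately show ?thesis using assms(1) by (auto simp: ring_def)
qed

lemma chain_eq:
 assumes "chain m i xs" "!!a. a : set (butlast xs) ==> m' (a + off (Nx i)) = m (a + off (Nx i))"
 "!!a. a : set (tl xs) ==> m' (a + off (Pv i)) = m (a + off (Pv i))"
 shows "chain m' i xs"
 using assms unfolding chain_def
proof (induction xs rule: induct_list012)
 case (3 a b xs)
 have "successively (%a b. m' (a + off (Nx i)) = b & m' (b + off (Pv i)) = a) (b # xs)"
 using 3 by (intro 3(2)) (auto split: if_splits dest: in_set_butlastD)
 thus ?case using 3 by (auto split: if_splits)
qed auto

text \<open>The updates are nested in program order, with the old successor n read beforehand. If r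
  was alone then n = r, and the last write closes the ring at r.\<close>

lemma ring_insert:
 assumes r: "ring m i (r # l)" and s: "s : SL" "s ~: set (r # l)" and i: "i <= L"
 defines "n == m (r + off (Nx i))"
 shows "ring (((m(r + off (Nx i) := s, s + off (Pv i) := r))(s + off (Nx i) := n))(n + off (Pv i) := s)) i (r # s # l)"
proof -
 let ?m = "((m(r + off (Nx i) := s, s + off (Pv i) := r))(s + off (Nx i) := n))(n + off (Pv i) := s)"
 have sl: "set (r # l) <= SL" and dis: "distinct (r # l)" using r by (auto simp: ring_def)
 have n: "n = hd (l @ [r])" unfolding n_def using ring_next[OF r, of 0] by (cases l) auto
 have nin: "n : set (r # l)" using n by (cases l) auto
 have fe: "a + off (Nx i) = b + off (Nx i) <-> a = b" "a + off (Nx i) ~= b + off (Pv i)" "a + off (Pv i) ~= b + off (Nx i)"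
 if "a : SL" "b : SL" for a b using fld_eq[of a b "Nx i" "Pv i"] fld_eq[of a b "Pv i" "Nx i"] that i by auto
 have nx: "?m (a + off (Nx i)) = (if a = s then n else if a = r then s else m (a + off (Nx i)))" if "a : SL" for a
 using fe that s sl nin by auto
 have pv: "?m (a + off (Pv i)) = (if a = n then s else if a = s then r else m (a + off (Pv i)))" if "a : SL" for a
 using fe that s sl nin by auto
 have ch: "chain m i (l @ [r])" using r by (cases l) (auto simp: ring_def chain_def)
 have "chain ?m i (l @ [r])"
 proof (rule chain_eq[OF ch])
 fix a assume "a : set (butlast (l @ [r]))"
 hence "a : set l" by simp
 thus "?m (a + off (Nx i)) = m (a + off (Nx i))" using nx[of a] s dis sl by auto
 next
 fix a assume a: "a : set (tl (l @ [r]))"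
 hence "a : set (r # l)" by (cases l) auto
 moreover have "a ~= n" using a n dis by (cases l) auto
 ultimately show "?m (a + off (Pv i)) = m (a + off (Pv i))" using pv[of a] s sl by auto
 qed
 moreover have "?m (r + off (Nx i)) = s" "?m (s + off (Nx i)) = n" using nx[of r] nx[of s] sl s by auto
 moreover have "?m (s + off (Pv i)) = r" "?m (n + off (Pv i)) = s" using pv[of s] pv[of n] sl s nin by auto
 ultimately have "chain ?m i (r # s # l @ [r])"
 unfolding chain_def using n by (cases l) auto
 thus ?thesis using s sl dis by (auto simp: ring_def)
qed

text \<open>If a single record remains, its two neighbours n and q coincide, and both writes link it
  to itself.\<close>

lemma ring_delete:
 assumes r: "ring m i (s # l)" and l: "l ~= []" and i: "i <= L"
 defines "n == m (s + off (Nx i))" and "q == m (s + off (Pv i))"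
 shows "ring (m(q + off (Nx i) := n, n + off (Pv i) := q)) i l" "n = hd l" "q = last l"
proof -
 let ?m = "m(q + off (Nx i) := n, n + off (Pv i) := q)"
 have sl: "set (s # l) <= SL" and dis: "distinct (s # l)" using r by (auto simp: ring_def)
 show n: "n = hd l" unfolding n_def using ring_next[OF r, of 0] l by (cases l) auto
 have ch: "chain m i (s # l @ [s])" using r by (simp add: ring_def)
 have ch1: "chain m i l" and qs: "m (s + off (Pv i)) = last l"
 using ch l by (auto simp: chain_def successively_append_iff successively_Cons)
 show q: "q = last l" using qs by (simp add: q_def)
 have nq: "n : set l" "q : set l" using n q l by auto
 have fe: "a + off (Nx i) = b + off (Nx i) <-> a = b" "a + off (Nx i) ~= b + off (Pv i)" "a + off (Pv i) ~= b + off (Nx i)"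
 if "a : SL" "b : SL" for a b using fld_eq[of a b "Nx i" "Pv i"] fld_eq[of a b "Pv i" "Nx i"] that i by auto
 have nx: "?m (a + off (Nx i)) = (if a = q then n else m (a + off (Nx i)))" if "a : SL" for a
 using fe that sl nq by auto
 have pv: "?m (a + off (Pv i)) = (if a = n then q else m (a + off (Pv i)))" if "a : SL" for a
 using fe that sl nq by auto
 have lb: "l = butlast l @ [last l]" using l by simp
 have "chain ?m i l"
 proof (rule chain_eq[OF ch1])
 fix a assume a: "a : set (butlast l)"
 have "a ~= last l" 
 proof -
 have "distinct (butlast l @ [last l])" using dis lb by simp
 thus ?thesis using a by auto
 qed
 thus "?m (a + off (Nx i)) = m (a + off (Nx i))" using nx[of a] q sl in_set_butlastD[OF a] by auto
 next
 fix a assume a: "a : set (tl l)"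
 have "a ~= n" "a : set l" using a n dis l by (cases l; auto)+
 thus "?m (a + off (Pv i)) = m (a + off (Pv i))" using pv[of a] sl by auto
 qed
 moreover have "?m (last l + off (Nx i)) = hd l" "?m (hd l + off (Pv i)) = last l"
 using nx[of q] pv[of n] n q nq sl by auto
 ultimately have "chain ?m i (l @ [hd l])" using l by (auto simp: chain_def successively_append_iff)
 thus "ring ?m i l" using sl dis l by (auto simp: ring_def)
qed

definition nextz where
 "nextz A i = seqs [ldf (Tm 7) (Tm 7) (Nx i), Bin Xor (tm 8) (tm 7) (rn A)]"

text \<open>A ring is never empty, so the body runs before the first test. The test is an
  \<open>Xor\<close> with the start, which vanishes exactly when the tour is complete.\<close>

definition ringfor where
 "ringfor A i body = Seq (Bin Or (tm 7) (rn A) (rn A)) (Seq body (Seq (nextz A i)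
 (While (tm 8) (Seq body (nextz A i)))))"

lemma xor_zero_iff: "Bit_Operations.xor a b = 0 <-> a = (b::nat)"
proof
 assume "Bit_Operations.xor a b = 0"
 hence "Bit_Operations.xor (Bit_Operations.xor a b) b = b" by simp
 thus "a = b" by (simp add: xor.assoc)
qed simp

text \<open>Loop control overwrites a few scratch registers between two runs of the body; loop
  invariants have to survive this.\<close>

definition stable where
 "stable I V <-> (ALL s s'. I s --> frm V s s' --> mem s' = mem s --> out s' = out s --> I s')"

lemma wp_ringfor:
 assumes A: "A ~= Tm 7" "A ~= Tm 8" "A ~= Tm 0" and i: "i <= L"
 and l: "l ~= []" "distinct l" "set l <= SL" and z0: "rg s A = hd l" and I0: "I 0 s"
 and st: "!!k. stable (I k) {Tm 0, Tm 7, Tm 8}"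
 and nx: "!!k s. I k s ==> ALL j<length l. mem s (l ! j + off (Nx i)) = (l @ [hd l]) ! Suc j"
 and body: "!!k s Q. k < length l ==> I k s ==> rg s (Tm 7) = l ! k ==> rg s A = hd l ==>
 (!!s'. I (Suc k) s' ==> rg s' (Tm 7) = l ! k ==> rg s' A = hd l ==> time s' <= time s + b ==> Q s') ==> wp w body Q s"
 and Q: "!!s'. I (length l) s' ==> rg s' A = hd l ==> time s' <= time s + 2 + length l * (b + 7) ==> Q s'"
 shows "wp w (ringfor A i body) Q s"
proof -
 have frmI: "I k s'" if "I k s" "frm {Tm 0, Tm 7, Tm 8} s s'" "mem s' = mem s" "out s' = out s" for k s s'
 using st[of k] that unfolding stable_def by blast
 have nz: "wp w (nextz A i) Q' s1"
 if I: "I (Suc k) s1" "rg s1 (Tm 7) = l ! k" "rg s1 A = hd l" and k: "k < length l"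
 and Q': "!!s'. I (Suc k) s' ==> rg s' (Tm 7) = (l @ [hd l]) ! Suc k ==> rg s' A = hd l ==>
 (rg s' (Tm 8) = 0 <-> (l @ [hd l]) ! Suc k = hd l) ==> time s' = time s1 + 6 ==> Q' s'" for s1 k Q'
 proof -
 have b: "rg s1 (Tm 7) + off (Nx i) < 2 ^ w" using I k l i by (intro slot_bound) auto
 have m: "mem s1 (rg s1 (Tm 7) + off (Nx i)) = (l @ [hd l]) ! Suc k" using nx[OF I(1)] k I by simp
 show ?thesis
 unfolding nextz_def
 proof (rule wp_Cons, rule wp_ldf[OF b])
 fix s2 assume s2: "rg s2 (Tm 7) = mem s1 (rg s1 (Tm 7) + off (Nx i))" "frm {Tm 0, Tm 7} s1 s2" "mem s2 = mem s1" "out s2 = out s1" "time s2 = time s1 + 4"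
 have s2A: "rg s2 A = hd l" using s2(2) I(3) A by (auto simp: frm_def)
 show "wp w (seqs [Bin Xor (tm 8) (tm 7) (rn A)]) Q' s2"
 proof (rule wp_Cons, rule wp_bin, rule wp_Nil, rule Q')
 fix s3 s4
 assume s3: "!!q. rg s3 q = (if q = Tm 8 then binop_word w Xor (rg s2 (Tm 7)) (rg s2 A) else rg s2 q)" "mem s3 = mem s2" "out s3 = out s2" "inp s3 = inp s2" "time s3 = Suc (time s2)"
 and s4: "!!q. rg s4 q = rg s3 q" "mem s4 = mem s3" "out s4 = out s3" "inp s4 = inp s3" "time s4 = Suc (time s3)"
 have "frm {Tm 0, Tm 7, Tm 8} s1 s4" using s2(2) by (simp add: frm_def s3 s4)
 thus "I (Suc k) s4" by (rule frmI[OF I(1)]) (simp_all add: s3 s4 s2)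
 show "rg s4 (Tm 7) = (l @ [hd l]) ! Suc k" by (simp add: s4 s3 s2 m)
 show "rg s4 A = hd l" using A by (simp add: s4 s3 s2A)
 show "(rg s4 (Tm 8) = 0) = ((l @ [hd l]) ! Suc k = hd l)" by (simp add: s4 s3 s2 m s2A[unfolded s2] xor_zero_iff)
 show "time s4 = time s1 + 6" by (simp add: s4 s3 s2)
 qed
 qed simp
 qed
 have loop: "wp w (While (tm 8) (Seq body (nextz A i))) Q s1"
 if I: "I (Suc k) s1" "rg s1 (Tm 7) = (l @ [hd l]) ! Suc k" "rg s1 A = hd l"
 "rg s1 (Tm 8) = 0 <-> (l @ [hd l]) ! Suc k = hd l" and k: "k < length l"
 and t: "time s1 <= time s + 1 + Suc k * (b + 7)" for s1 k
 using that
 proof (induction "length l - Suc k" arbitrary: k s1)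
 case 0
 hence k: "Suc k = length l" by simp
 hence e: "(l @ [hd l]) ! Suc k = hd l" by (simp add: nth_append)
 show ?case
 proof (rule wp_While)
 assume "rg s1 (Tm 8) ~= 0"
 thus "wp w (Seq body (nextz A i)) (wp w (While (tm 8) (Seq body (nextz A i))) Q) (tick s1)" using 0 e by simp
 next
 show "Q (tick s1)"
 proof (rule Q)
 have "I (Suc k) (tick s1)" by (rule frmI[OF 0(2)]) (simp_all add: frm_def)
 thus "I (length l) (tick s1)" by (simp only: k)
 qed (use 0 k in "auto simp del: mult_Suc")
 qed
 next
 case (Suc j)
 hence k: "Suc k < length l" by simp
 have e: "(l @ [hd l]) ! Suc k = l ! Suc k" using k by (simp add: nth_append)
 have ne: "l ! Suc k ~= hd l" using k l by (metis hd_conv_nth nat.simps(3) nth_eq_iff_index_eq length_greater_0_conv)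
 show ?case
 proof (rule wp_While)
 show "wp w (Seq body (nextz A i)) (wp w (While (tm 8) (Seq body (nextz A i))) Q) (tick s1)"
 proof (rule wp_Seq, rule body[OF k])
 show "I (Suc k) (tick s1)" by (rule frmI[OF Suc.prems(1)]) (simp_all add: frm_def)
 fix s2 assume s2: "I (Suc (Suc k)) s2" "rg s2 (Tm 7) = l ! Suc k" "rg s2 A = hd l" "time s2 <= time (tick s1) + b"
 show "wp w (nextz A i) (wp w (While (tm 8) (Seq body (nextz A i))) Q) s2"
 proof (rule nz[OF s2(1-3) k])
 fix s3 assume s3: "I (Suc (Suc k)) s3" "rg s3 (Tm 7) = (l @ [hd l]) ! Suc (Suc k)" "rg s3 A = hd l"
 "(rg s3 (Tm 8) = 0) = ((l @ [hd l]) ! Suc (Suc k) = hd l)" "time s3 = time s2 + 6"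
 show "wp w (While (tm 8) (Seq body (nextz A i))) Q s3"
 by (rule Suc.hyps(1)[OF _ s3(1-4) k]) (use Suc.hyps(2) Suc.prems(6) s2(4) s3(5) in auto)
 qed
 qed (use Suc.prems e in auto)
 next
 assume "rg s1 (Tm 8) = 0"
 thus "Q (tick s1)" using Suc.prems e ne by simp
 qed
 qed
 have l0: "0 < length l" using l by simp
 show ?thesis
 unfolding ringfor_def
 proof (rule wp_Seq, rule wp_mv, rule wp_Seq, rule body[OF l0], goal_cases)
 case s1: (1 s1)
 show "I 0 s1" by (rule frmI[OF I0]) (simp_all add: s1 frm_def)
 show "rg s1 (Tm 7) = l ! 0" using z0 l by (simp add: s1 hd_conv_nth)
 show "rg s1 A = hd l" using z0 A by (simp add: s1)
 fix s2 assume s2: "I (Suc 0) s2" "rg s2 (Tm 7) = l ! 0" "rg s2 A = hd l" "time s2 <= time s1 + b"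
 show "wp w (Seq (nextz A i) (While (tm 8) (Seq body (nextz A i)))) Q s2"
 proof (rule wp_Seq, rule nz[OF s2(1-3) l0])
 fix s3 assume s3: "I (Suc 0) s3" "rg s3 (Tm 7) = (l @ [hd l]) ! Suc 0" "rg s3 A = hd l"
 "(rg s3 (Tm 8) = 0) = ((l @ [hd l]) ! Suc 0 = hd l)" "time s3 = time s2 + 6"
 show "wp w (While (tm 8) (Seq body (nextz A i))) Q s3"
 by (rule loop[OF s3(1-4) l0]) (use s1(5) s2(4) s3(5) in auto)
 qed
 qed
qed

definition minbody :: com where
 "minbody = Seq (cm (Tm 7) (Tm 11)) (Cond (tm 5) (Bin Or (tm 11) (tm 7) (tm 7)) Skip)"

definition ringmin where
 "ringmin A i = Seq (Bin Or (tm 11) (rn A) (rn A)) (ringfor A i minbody)"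

abbreviation "VM == {Tm 0, Tm 1, Tm 2, Tm 3, Tm 5, Tm 6, Tm 7, Tm 8, Tm 11}"

lemma wp_ringmin:
 assumes A: "A ~: VM" and i: "i <= L" and r: "ring (mem s) i l" and z0: "rg s A = hd l"
 and dg: "!!a. a : set l ==> dig (mem s) a (zz a)"
 and Q: "!!s'. frm VM s s' ==> mem s' = mem s ==> out s' = out s ==> rg s' (Tm 11) : set l ==>
 (!!a. a : set l ==> key D (zz (rg s' (Tm 11))) <= key D (zz a)) ==>
 time s' <= time s + 3 + length l * (14 * d + 13) ==> Q s'"
 shows "wp w (ringmin A i) Q s"
 unfolding ringmin_def
proof (rule wp_Seq, rule wp_mv, goal_cases)
 case s1: (1 s1)
 define I where "I k s' <-> frm VM s s' & mem s' = mem s & out s' = out s & rg s' (Tm 11) : set l &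
 (ALL j<k. key D (zz (rg s' (Tm 11))) <= key D (zz (l ! j)))" for k s'
 have l: "l ~= []" "distinct l" "set l <= SL" using r by (auto simp: ring_def)
 show "wp w (ringfor A i minbody) Q s1"
 proof (rule wp_ringfor[where I=I and l=l and b="14 * d + 6"])
 show "I 0 s1" using l z0 by (simp add: I_def frm_def s1)
 show "rg s1 A = hd l" using z0 A by (simp add: s1)
 fix k
 show "stable (I k) {Tm 0, Tm 7, Tm 8}" unfolding stable_def I_def by (auto simp: frm_def)
 fix s2
 show "ALL j<length l. mem s2 (l ! j + off (Nx i)) = (l @ [hd l]) ! Suc j" if "I k s2"
 using ring_next[OF r] that by (simp add: I_def)
 fix Q' assume k: "k < length l" and I: "I k s2" and z: "rg s2 (Tm 7) = l ! k" "rg s2 A = hd l"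
 and Q': "!!s'. I (Suc k) s' ==> rg s' (Tm 7) = l ! k ==> rg s' A = hd l ==> time s' <= time s2 + (14 * d + 6) ==> Q' s'"
 have m: "mem s2 = mem s" using I by (simp add: I_def)
 show "wp w minbody Q' s2"
 unfolding minbody_def
 proof (rule wp_Seq, rule wp_cm[where x="zz (l ! k)" and y="zz (rg s2 (Tm 11))"])
 show "dig (mem s2) (rg s2 (Tm 7)) (zz (l ! k))" using dg[of "l ! k"] k by (simp add: z m)
 show "dig (mem s2) (rg s2 (Tm 11)) (zz (rg s2 (Tm 11)))" using dg[of "rg s2 (Tm 11)"] I by (simp add: I_def)
 fix s3 assume s3: "frm VC s2 s3" "mem s3 = mem s2" "out s3 = out s2" "time s3 <= time s2 + 14 * d + 4"
 "rg s3 (Tm 5) = of_bool (key D (zz (l ! k)) < key D (zz (rg s2 (Tm 11))))"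
 have f3: "frm VM s s3" using I s3(1) by (auto simp: I_def frm_def)
 have r3: "rg s3 (Tm 7) = l ! k" "rg s3 A = hd l" "rg s3 (Tm 11) = rg s2 (Tm 11)" using s3(1) z A by (auto simp: frm_def)
 show "wp w (Cond (tm 5) (Bin Or (tm 11) (tm 7) (tm 7)) Skip) Q' s3"
 proof (rule wp_Cond)
 assume c: "rg s3 (Tm 5) ~= 0"
 show "wp w (Bin Or (tm 11) (tm 7) (tm 7)) Q' (tick s3)"
 proof (rule wp_mv, rule Q')
 fix s4 assume s4: "!!q. rg s4 q = (if q = Tm 11 then rg (tick s3) (Tm 7) else rg (tick s3) q)" "mem s4 = mem (tick s3)" "out s4 = out (tick s3)" "inp s4 = inp (tick s3)" "time s4 = Suc (time (tick s3))"
 have lt: "key D (zz (l ! k)) < key D (zz (rg s2 (Tm 11)))" using c s3(5) by (simp add: of_bool_def split: if_splits)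
 have lt': "key D (zz (l ! k)) <= key D (zz (l ! j))" if "j < Suc k" for j
 proof (cases "j = k")
 case False
 hence "key D (zz (rg s2 (Tm 11))) <= key D (zz (l ! j))" using I that unfolding I_def by simp
 thus ?thesis using lt by linarith
 qed simp
 have "frm VM s s4" using f3 by (simp add: s4 frm_def)
 thus "I (Suc k) s4" using lt' k m by (simp add: I_def s4 r3 s3 I[unfolded I_def])
 show "rg s4 (Tm 7) = l ! k" "rg s4 A = hd l" using A by (auto simp: s4 r3)
 show "time s4 <= time s2 + (14 * d + 6)" using s3(4) by (simp add: s4)
 qed
 next
 assume c: "rg s3 (Tm 5) = 0"
 show "wp w Skip Q' (tick s3)"
 proof (rule wp_Skip, rule Q')
 fix s4 assume s4: "!!q. rg s4 q = rg (tick s3) q" "mem s4 = mem (tick s3)" "out s4 = out (tick s3)" "inp s4 = inp (tick s3)" "time s4 = Suc (time (tick s3))"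
 have lt: "key D (zz (rg s2 (Tm 11))) <= key D (zz (l ! k))" using c s3(5) by (simp add: of_bool_def split: if_splits)
 show "I (Suc k) s4" using I f3 k lt by (auto simp: I_def s4 frm_def r3 s3 less_Suc_eq)
 show "rg s4 (Tm 7) = l ! k" "rg s4 A = hd l" by (auto simp: s4 r3)
 show "time s4 <= time s2 + (14 * d + 6)" using s3(4) by (simp add: s4)
 qed
 qed
 qed (use A in auto)
 next
 fix s' assume I: "I (length l) s'" and t: "time s' <= time s1 + 2 + length l * (14 * d + 6 + 7)"
 show "Q s'"
 proof (rule Q)
 show "key D (zz (rg s' (Tm 11))) <= key D (zz a)" if "a : set l" for a
 using I that by (metis I_def in_set_conv_nth)
 show "time s' <= time s + 3 + length l * (14 * d + 13)" using t by (simp add: s1 algebra_simps)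
 qed (use I in "auto simp: I_def")
 qed (use A i l in auto)
qed

end

section \<open>Sweeps over flagged cells and printing of paths\<close>

context layout begin

text \<open>A frame condition at the granularity of record fields. Words below \<open>base\<close>
  hold the tables and must survive every update.\<close>

definition same where
 "same X m m' <-> (ALL a:SL. ALL f. vf f --> (a, f) ~: X --> m' (a + off f) = m (a + off f)) & (ALL a<base. m' a = m a)"

lemma same_refl: "same X m m"
 by (simp add: same_def)

lemma same_trans: "same X m m' ==> same Y m' m'' ==> X <= Z ==> Y <= Z ==> same Z m m''"
 unfolding same_def by (metis subsetD)

lemma same_mono: "same X m m' ==> X <= Z ==> same Z m m'"
 unfolding same_def by blast

lemma sameD: "same X m m' ==> a : SL ==> vf f ==> (a, f) ~: X ==> m' (a + off f) = m (a + off f)"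
 by (simp add: same_def)

lemma SL_base: "a : SL ==> base <= a"
 by (auto simp: SL_def slot_def)

lemma upd_fld: "a : SL ==> b : SL ==> vf f ==> vf g ==>
 (m(a + off f := v)) (b + off g) = (if b = a & g = f then v else m (b + off g))"
 using fld_eq[of b a g f] by auto

lemma same_upd:
 assumes "a : SL" "vf f" shows "same {(a, f)} m (m(a + off f := v))"
 unfolding same_def
proof (intro conjI ballI allI impI)
 fix b g assume "b : SL" "vf g" "(b, g) ~: {(a, f)}"
 thus "(m(a + off f := v)) (b + off g) = m (b + off g)" using assms by (subst upd_fld) auto
next
 fix b assume "b < base"
 thus "(m(a + off f := v)) b = m b" using SL_base[OF assms(1)] by simp
qed

lemma same_upd': "same X m m' ==> a : SL ==> vf f ==> (a, f) : X ==> same X m (m'(a + off f := v))"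
 using same_trans[OF _ same_upd, of X m m' a f X] by simp

lemma tabs_same: "tabs m ==> same X m m' ==> tabs m'"
 unfolding tabs_def same_def base_def RT_def by simp

lemma coords_same: "coords m a x ==> same X m m' ==> ALL t. (a, Cf t) ~: X ==> coords m' a x"
 unfolding coords_def by (auto simp: sameD)

lemma dig_same: "dig m a x ==> same X m m' ==> ALL t. (a, Pf t) ~: X ==> dig m' a x"
 unfolding dig_def by (auto simp: sameD)

lemma ring_same: "ring m i l ==> i <= L ==> same X m m' ==> ALL a:set l. (a, Nx i) ~: X & (a, Pv i) ~: X ==> ring m' i l"
 by (rule ring_cong, assumption) (auto simp: ring_def subset_iff intro!: sameD)

definition sweep where
 "sweep f = seqs (map (%i. Cond (rn (Ch i)) (ringfor (Rp i) i (f i)) Skip) [0..<Suc L])"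

abbreviation "VS == {Tm 0, Tm 1, Tm 2, Tm 3, Tm 5, Tm 7, Tm 8, Tm 9}"

text \<open>One record may be visited at several levels, so the invariant J is indexed by the pairs
  of level and record treated so far.\<close>

lemma wp_sweep:
 fixes s0 :: state and l :: "nat => vec"
 defines "ch == %i. rg s0 (Ch i) ~= 0"
 assumes rp: "!!i. i <= L ==> ch i ==> hd (l i) = rg s0 (Rp i)"
 and J0: "J {} (mem s0)"
 and rings: "!!D m i. J D m ==> i <= L ==> ch i ==> ring m i (l i)"
 and body: "!!i k D s Q. i <= L ==> ch i ==> k < length (l i) ==> frm VS s0 s ==> J D (mem s) ==> rg s (Tm 7) = l i ! k ==>
 (!!s'. frm (VS - {Tm 7}) s s' ==> J (insert (i, l i ! k) D) (mem s') ==> out s' = out s ==> time s' <= time s + b ==> Q s') ==>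
 wp w (f i) Q s"
 and Q: "!!s'. frm VS s0 s' ==> J {(i, a). i <= L & ch i & a : set (l i)} (mem s') ==> out s' = out s0 ==>
 time s' <= time s0 + 1 + 3 * Suc L + (SUM i<=L. of_bool (ch i) * (length (l i) * (b + 7))) ==> Q s'"
 shows "wp w (sweep f) Q s0"
 unfolding sweep_def
proof -
 define I where "I j s <-> frm VS s0 s & J {(i, a). i < j & ch i & a : set (l i)} (mem s) & out s = out s0 &
 time s <= time s0 + 3 * j + (SUM i<j. of_bool (ch i) * (length (l i) * (b + 7)))" for j s
 show "wp w (seqs (map (%i. Cond (rn (Ch i)) (ringfor (Rp i) i (f i)) Skip) [0..<Suc L])) Q s0"
 proof (rule wp_loop[of I])
 show "I 0 s0" using J0 by (simp add: I_def frm_refl)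
 next
 fix j s assume j: "j < Suc L" and I: "I j s"
 have chj: "rg s (Ch j) = rg s0 (Ch j)" "rg s (Rp j) = rg s0 (Rp j)" using I by (auto simp: I_def frm_def)
 let ?D = "%j. {(i, a). i < j & ch i & a : set (l i)}"
 show "wp w (Cond (rn (Ch j)) (ringfor (Rp j) j (f j)) Skip) (I (Suc j)) s"
 proof (rule wp_Cond)
 assume "rg s (Ch j) ~= 0"
 hence c: "ch j" by (simp add: ch_def chj)
 define H where "H k s' <-> frm VS s0 s' & J (?D j Un {(j, a) |a. a : set (take k (l j))}) (mem s') & out s' = out s0" for k s'
 have r: "ring (mem s) j (l j)" using rings[of _ "mem s" j] I c j unfolding I_def by auto
 have l: "l j ~= []" "distinct (l j)" "set (l j) <= SL" using r by (auto simp: ring_def)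
 show "wp w (ringfor (Rp j) j (f j)) (I (Suc j)) (tick s)"
 proof (rule wp_ringfor[where I=H and l="l j" and b=b])
 show "rg (tick s) (Rp j) = hd (l j)" using rp[of j] c j by (simp add: chj)
 show "H 0 (tick s)" using I by (simp add: H_def I_def frm_def)
 fix k
 show "stable (H k) {Tm 0, Tm 7, Tm 8}" unfolding stable_def H_def by (auto simp: frm_def)
 fix s1
 show "ALL ja<length (l j). mem s1 (l j ! ja + off (Nx j)) = (l j @ [hd (l j)]) ! Suc ja" if "H k s1"
 proof -
 have "ring (mem s1) j (l j)" using rings[of _ "mem s1" j] that c j unfolding H_def by auto
 thus ?thesis using ring_next by blast
 qed
 fix Q' assume k: "k < length (l j)" and H: "H k s1" and z: "rg s1 (Tm 7) = l j ! k" "rg s1 (Rp j) = hd (l j)"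
 and Q': "!!s'. H (Suc k) s' ==> rg s' (Tm 7) = l j ! k ==> rg s' (Rp j) = hd (l j) ==> time s' <= time s1 + b ==> Q' s'"
 let ?E = "?D j Un {(j, a) |a. a : set (take k (l j))}"
 show "wp w (f j) Q' s1"
 proof (rule body[of j k s1 ?E])
 fix s' assume s': "frm (VS - {Tm 7}) s1 s'" "J (insert (j, l j ! k) ?E) (mem s')" "out s' = out s1" "time s' <= time s1 + b"
 have "insert (j, l j ! k) ?E = ?D j Un {(j, a) |a. a : set (take (Suc k) (l j))}"
 using k by (auto simp: take_Suc_conv_app_nth)
 moreover have "frm VS s0 s'" using H s'(1) unfolding H_def by (blast intro: frm_trans)
 ultimately have "H (Suc k) s'" using H s' by (simp add: H_def)
 thus "Q' s'" using s' z by (intro Q') (auto simp: frm_def)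
 qed (use H k c j z in "auto simp: H_def")
 next
 fix s' assume s': "H (length (l j)) s'" "time s' <= time (tick s) + 2 + length (l j) * (b + 7)"
 have "?D j Un {(j, a) |a. a : set (take (length (l j)) (l j))} = ?D (Suc j)" using c by (auto simp: less_Suc_eq)
 thus "I (Suc j) s'" using s' I c by (auto simp: H_def I_def)
 qed (use l j in auto)
 next
 assume "rg s (Ch j) = 0"
 hence c: "~ ch j" by (simp add: ch_def chj)
 hence "?D (Suc j) = ?D j" by (auto simp: less_Suc_eq)
 thus "wp w Skip (I (Suc j)) (tick s)" using I c by (intro wp_Skip) (auto simp: I_def frm_def)
 qed
 next
 fix s' assume I: "I (Suc L) s'"
 have "{..<Suc L} = {..L}" "{(i, a). i < Suc L & ch i & a : set (l i)} = {(i, a). i <= L & ch i & a : set (l i)}" by auto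
 with I show "Q (tick s')" by (intro Q) (auto simp: I_def frm_def)
 qed
qed

text \<open>Records store addresses of representatives; the level is added only on output to obtain
  node names. Weights are integers, so every denominator is 1.\<close>

definition pathprint where
 "pathprint A = seqs [Const (tm 9) L, Write (tm 9), ldf (Tm 9) A (Nf 0), Write (tm 9),
 seqs (map (%j. seqs [ldf (Tm 9) A (Nf (Suc j)), Const (tm 1) (Suc j), Bin Plus (tm 9) (tm 9) (tm 1), Write (tm 9),
 ldf (Tm 9) A (Wf (Suc j)), Write (tm 9), Const (tm 9) 1, Write (tm 9)]) [0..<L])]"

definition prt :: com where
 "prt = seqs [seqs (map (%t. seqs [ldf (Tm 9) (Tm 7) (Cf t), Write (tm 9)]) [0..<d]), pathprint (Tm 7)]"

definition pathwords where
 "pathwords m a = L # m (a + off (Nf 0)) # concat (map (%j. [m (a + off (Nf (Suc j))) + Suc j, m (a + off (Wf (Suc j))), 1]) [0..<L])"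

lemma slot_add_bound: "a : SL ==> j < K ==> a + j < 2 ^ w"
proof -
 assume "a : SL" "j < K"
 then obtain k where k: "k < cap" "a = base + k * K" "j < K" by (auto simp: SL_def slot_def)
 have "(k + 1) * K <= cap * K" using k by (intro mult_le_mono1) auto
 hence "a + j < base + cap * K" using k by (simp add: algebra_simps)
 also have "... <= 2 ^ w" using fits by (simp add: base_def K_def)
 finally show ?thesis .
qed

lemma wp_pathprint:
 assumes A: "A ~: {Tm 0, Tm 1, Tm 9}" and a: "rg s A : SL" and N: "!!i. i <= L ==> mem s (rg s A + off (Nf i)) : SL"
 and Q: "!!s'. frm {Tm 0, Tm 1, Tm 9} s s' ==> mem s' = mem s ==> out s' = out s @ pathwords (mem s) (rg s A) ==>
 time s' <= time s + 9 + 15 * L ==> Q s'"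
 shows "wp w (pathprint A) Q s"
 unfolding pathprint_def
 apply (rule wp_Cons)
 apply (rule wp_const)
 apply (rule wp_Cons)
 apply (rule wp_write)
 apply (rule wp_Cons)
 apply (rule wp_ldf)
 subgoal premises pr using A slot_bound[OF a, of "Nf 0"] by (simp add: pr)
 subgoal using A by auto
 apply (rule wp_Cons)
 apply (rule wp_write)
 apply (rule wp_Cons)
 subgoal premises pr for s1 s2 s3 s4
 proof -
 define I where "I n s' <-> frm {Tm 0, Tm 1, Tm 9} s s' & mem s' = mem s & time s' = time s + 7 + 15 * n &
 out s' = out s @ L # mem s (rg s A + off (Nf 0)) # concat (map (%j. [mem s (rg s A + off (Nf (Suc j))) + Suc j, mem s (rg s A + off (Wf (Suc j))), 1]) [0..<n])" for n s'
 have Lw: "L < 2 ^ w" using small_words(4) by linarith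
 have As: "A ~= Tm 9" "A ~= Tm 1" "A ~= Tm 0" using A by auto
 have r2: "rg s2 A = rg s A" using As by (simp add: pr)
 have f4: "frm {Tm 0, Tm 1, Tm 9} s s4" using frmD[OF pr(12)] pr(1-10,16-20) by (auto simp: frm_def)
 have I0: "I 0 s4" unfolding I_def using f4 Lw r2 by (simp add: pr)
 show ?thesis
 proof (rule wp_loop[of I, OF I0])
 fix j s5 assume j: "j < L" and I: "I j s5"
 have rA: "rg s5 A = rg s A" using I As by (auto simp: I_def frm_def)
 have b: "(rg s A + off (Nf (Suc j)) mod 2 ^ w) mod 2 ^ w = rg s A + off (Nf (Suc j))" "(rg s A + off (Wf (Suc j)) mod 2 ^ w) mod 2 ^ w = rg s A + off (Wf (Suc j))"
 using slot_bound[OF a, of "Nf (Suc j)"] slot_bound[OF a, of "Wf (Suc j)"] j by (simp_all add: mod_add_right_eq)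
 have c: "(mem s (rg s A + off (Nf (Suc j))) + Suc j mod 2 ^ w) mod 2 ^ w = mem s (rg s A + off (Nf (Suc j))) + Suc j"
 using slot_add_bound[OF N[of "Suc j"], of "Suc j"] j by (simp add: mod_add_right_eq K_def)
 have Im: "mem s5 = mem s" "time s5 = time s + 7 + 15 * j" "inp s5 = inp s" "!!q. q ~: {Tm 0, Tm 1, Tm 9} ==> rg s5 q = rg s q" and
 Io: "out s5 = out s @ L # mem s (rg s A + off (Nf 0)) # concat (map (%j. [mem s (rg s A + off (Nf (Suc j))) + Suc j, mem s (rg s A + off (Wf (Suc j))), 1]) [0..<j])"
 using I by (auto simp: I_def frm_def)
 show "wp w (seqs [ldf (Tm 9) A (Nf (Suc j)), Const (tm 1) (Suc j), Bin Plus (tm 9) (tm 9) (tm 1), Write (tm 9),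
 ldf (Tm 9) A (Wf (Suc j)), Write (tm 9), Const (tm 9) 1, Write (tm 9)]) (I (Suc j)) s5"
 unfolding ldf_def
 apply (rule wp_Cons wp_Nil wp_const wp_bin wp_load wp_write)+
 subgoal premises prr
 unfolding I_def frm_def using As small_words(3) by (simp add: prr rA b c Im Io one_mod)
 done
 next
 fix s' assume "I L s'"
 thus "wp w (seqs []) Q (tick s')" by (intro wp_Nil Q) (simp_all add: I_def frm_def pathwords_def)
 qed
 qed
 done

lemma wp_prt:
 assumes a: "coords (mem s) (rg s (Tm 7)) x" and N: "!!i. i <= L ==> mem s (rg s (Tm 7) + off (Nf i)) : SL"
 and Q: "!!s'. frm {Tm 0, Tm 1, Tm 9} s s' ==> mem s' = mem s ==> out s' = out s @ x @ pathwords (mem s) (rg s (Tm 7)) ==>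
 time s' <= time s + 11 + 15 * L + 6 * d ==> Q s'"
 shows "wp w prt Q s"
 unfolding prt_def
proof (rule wp_Cons)
 have aS: "rg s (Tm 7) : SL" using a by (simp add: coords_def)
 have lx: "length x = d" using a grid_length[of x d D] by (simp add: coords_def)
 define I where "I n s' <-> frm {Tm 0, Tm 1, Tm 9} s s' & mem s' = mem s & time s' = time s + 6 * n & out s' = out s @ take n x" for n s'
 show "wp w (seqs (map (%t. seqs [ldf (Tm 9) (Tm 7) (Cf t), Write (tm 9)]) [0..<d])) (wp w (seqs [pathprint (Tm 7)]) Q) s"
 proof (rule wp_loop[of I])
 show "I 0 s" by (simp add: I_def frm_refl)
 next
 fix t s1 assume t: "t < d" and I: "I t s1"
 have r: "rg s1 (Tm 7) = rg s (Tm 7)" using I by (auto simp: I_def frm_def)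
 show "wp w (seqs [ldf (Tm 9) (Tm 7) (Cf t), Write (tm 9)]) (I (Suc t)) s1"
 proof (rule wp_Cons, rule wp_ldf)
 show "rg s1 (Tm 7) + off (Cf t) < 2 ^ w" using slot_bound[OF aS, of "Cf t"] t by (simp add: r)
 fix s2 assume s2: "rg s2 (Tm 9) = mem s1 (rg s1 (Tm 7) + off (Cf t))" "frm {Tm 0, Tm 9} s1 s2" "mem s2 = mem s1" "out s2 = out s1" "time s2 = time s1 + 4"
 show "wp w (seqs [Write (tm 9)]) (I (Suc t)) s2"
 apply (rule wp_Cons wp_Nil wp_write)+
 subgoal premises pr for s3 s4
 using I s2 t a by (simp add: pr I_def frm_def r coords_def take_Suc_conv_app_nth lx)
 done
 qed simp
 next
 fix s1 assume I: "I d s1"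
 have r: "rg s1 (Tm 7) = rg s (Tm 7)" using I by (auto simp: I_def frm_def)
 show "wp w (seqs [pathprint (Tm 7)]) Q (tick s1)"
 apply (rule wp_Cons, rule wp_pathprint)
 subgoal by simp
 subgoal using aS by (simp add: r)
 subgoal using N I by (simp add: r I_def)
 subgoal premises pr for s2
 proof (rule wp_Nil, rule Q)
 fix s3 assume s3: "!!q. rg s3 q = rg s2 q" "mem s3 = mem s2" "out s3 = out s2" "inp s3 = inp s2" "time s3 = Suc (time s2)"
 show "frm {Tm 0, Tm 1, Tm 9} s s3" using I pr(1) by (simp add: I_def frm_def s3)
 show "time s3 <= time s + 11 + 15 * L + 6 * d" using I pr(4) by (simp add: I_def s3)
 qed (use I pr lx in "simp_all add: I_def r")
 done
 qed
qed

end

section \<open>Records of a vector set and their repair after a change\<close>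

locale store = layout p d D L cap w for p :: real and d D L cap w :: nat +
 fixes lab :: "nat => vec => nat" and pi :: "vec => vec"
 assumes lab0: "!!x y. lab 0 x = lab 0 y" and nested: "!!i x y. lab (Suc i) x = lab (Suc i) y ==> lab i x = lab i y"
 and labL: "!!x y. lab L x = lab L y ==> x = y" and pi: "pi permutes grid d D"
begin

abbreviation "pr == key D o pi"
abbreviation "rp Om i x == rep lab pr Om i x"
abbreviation "ce Om i x == cell lab Om i x"
abbreviation "cl Om x == SUM i<=L. of_bool (rp Om i x = x) * card (ce Om i x)"
abbreviation "chs s Om x == SUM i<=L. of_bool (rg s (Ch i) ~= 0) * card (ce Om i x)"
abbreviation "chb s Om x b == SUM i<=L. of_bool (rg s (Ch i) ~= 0) * (card (ce Om i x) * b)"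

definition recs where
 "recs m Om nm <-> Om <= grid d D & inj_on nm Om & tabs m & (ALL z:Om. coords m (nm z) z & dig m (nm z) (pi z))"

definition rings where
 "rings m Om nm <-> (ALL i<=L. ALL z:Om. EX l. ring m i l & set l = nm ` ce Om i z)"

definition okN where
 "okN m Om nm i z <-> m (nm z + off (Nf i)) = nm (rp Om i z)"

text \<open>At i = 0 the truncated predecessor compares the root representative with itself; that
  entry does not belong to an edge.\<close>

definition okW where
 "okW m Om nm i z <-> m (nm z + off (Wf i)) = wdist p (rp Om i z) (rp Om (i - 1) z)"

definition good where
 "good m Om nm <-> recs m Om nm & rings m Om nm & (ALL z:Om. ALL i<=L. okN m Om nm i z) & (ALL z:Om. ALL i<=L. okW m Om nm i z)"

definition FX :: "(nat \<times> fld) set" where "FX = {(a, f). EX i. f = Nf i | f = Wf i}"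

lemma recs_same: "recs m Om nm ==> same FX m m' ==> recs m' Om nm"
 unfolding recs_def using tabs_same coords_same[of m _ _ FX m'] dig_same[of m _ _ FX m'] by (auto simp: FX_def)

lemma rings_same: "rings m Om nm ==> same FX m m' ==> rings m' Om nm"
 unfolding rings_def using ring_same[of m _ _ FX m'] by (fastforce simp: FX_def)

lemma recs_SL: "recs m Om nm ==> z : Om ==> nm z : SL"
 by (auto simp: recs_def coords_def)

lemma recs_fin: "recs m Om nm ==> finite Om"
 using finite_grid finite_subset by (auto simp: recs_def)

lemma rp_cell: "finite Om ==> ce Om i x ~= {} ==> rp Om i x : ce Om i x"
 using rep_in_cell by blast

lemma cell_of: "z : ce Om i x ==> z : Om & ce Om i z = ce Om i x & rp Om i z = rp Om i x"
 by (auto simp: cell_def rep_def)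

lemma nested_le: "i <= j ==> lab j x = lab j y ==> lab i x = lab i y"
 by (induction j rule: dec_induct) (auto dest: nested)

lemma cell_anti: "i <= j ==> ce Om j x <= ce Om i x"
 unfolding cell_def by (intro Collect_mono impI conjI) (auto intro: nested_le)

text \<open>The state once rings and representatives are those of the new set, while stored
  addresses and weights may still be stale.\<close>

definition pre where
 "pre s Om nm x <-> recs (mem s) Om nm & rings (mem s) Om nm &
 (ALL i<=L. ce Om i x ~= {} --> rg s (Rp i) = nm (rp Om i x)) & (ALL i<=L. rg s (Ch i) ~= 0 --> ce Om i x ~= {})"

definition lst where
 "lst s Om nm x i = (SOME l. ring (mem s) i l & hd l = rg s (Rp i) & set l = nm ` ce Om i x)"

lemma lst:
 assumes "pre s Om nm x" "i <= L" "rg s (Ch i) ~= 0"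
 shows "ring (mem s) i (lst s Om nm x i)" "hd (lst s Om nm x i) = rg s (Rp i)" "set (lst s Om nm x i) = nm ` ce Om i x"
 "length (lst s Om nm x i) = card (ce Om i x)"
proof -
 have ne: "ce Om i x ~= {}" and r: "rg s (Rp i) = nm (rp Om i x)" and rc: "recs (mem s) Om nm"
 using assms by (auto simp: pre_def)
 have rin: "rp Om i x : ce Om i x" by (rule rp_cell[OF recs_fin[OF rc] ne])
 then obtain l where l: "ring (mem s) i l" "set l = nm ` ce Om i (rp Om i x)"
 using assms(1,2) cell_subset[of lab Om i x] unfolding pre_def rings_def by blast
 have s: "set l = nm ` ce Om i x" using l(2) cell_of[OF rin] by simp
 obtain l' where "ring (mem s) i (nm (rp Om i x) # l')" "set (nm (rp Om i x) # l') = set l"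
 using ring_start[OF l(1), of "nm (rp Om i x)"] rin s by blast
 hence "EX l. ring (mem s) i l & hd l = rg s (Rp i) & set l = nm ` ce Om i x"
 using r s by (intro exI[of _ "nm (rp Om i x) # l'"]) simp
 from someI_ex[OF this] show *: "ring (mem s) i (lst s Om nm x i)" "hd (lst s Om nm x i) = rg s (Rp i)" "set (lst s Om nm x i) = nm ` ce Om i x"
 unfolding lst_def by blast+
 have "inj_on nm (ce Om i x)" using rc cell_subset[of lab Om i x] inj_on_subset by (auto simp: recs_def)
 moreover have "distinct (lst s Om nm x i)" using *(1) by (simp add: ring_def)
 ultimately show "length (lst s Om nm x i) = card (ce Om i x)"
 using *(3) distinct_card card_image by metis
qed

text \<open>Injectivity of g sends different levels to different fields, so a record visited at
  several levels receives the right value in each of them.\<close>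

lemma wp_rewrite:
 fixes g :: "nat => fld" and val :: "nat => vec => nat"
 defines "F == {(a, g i) |a i. True}"
 assumes pre: "pre s0 Om nm x" and g: "inj g" "!!i. i <= L ==> vf (g i)" "!!i j. g i ~= Nx j & g i ~= Pv j"
 and body: "!!i y s Q. i <= L ==> rg s0 (Ch i) ~= 0 ==> y : ce Om i x ==> frm VS s0 s ==> same F (mem s0) (mem s) ==> rg s (Tm 7) = nm y ==>
 (!!s'. frm (VS - {Tm 7}) s s' ==> mem s' = (mem s)(nm y + off (g i) := val i y) ==> out s' = out s ==> time s' <= time s + b ==> Q s') ==> wp w (f i) Q s"
 and Q: "!!s'. frm VS s0 s' ==> same F (mem s0) (mem s') ==>
 (!!z i. z : Om ==> i <= L ==> mem s' (nm z + off (g i)) = (if rg s0 (Ch i) ~= 0 & z : ce Om i x then val i z else mem s0 (nm z + off (g i)))) ==>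
 out s' = out s0 ==> time s' <= time s0 + 1 + 3 * Suc L + chb s0 Om x (b + 7) ==> Q s'"
 shows "wp w (sweep f) Q s0"
proof -
 let ?l = "lst s0 Om nm x"
 have rc: "recs (mem s0) Om nm" using pre by (simp add: pre_def)
 define J where "J D m <-> same F (mem s0) m &
 (ALL z:Om. ALL i<=L. m (nm z + off (g i)) = (if (i, nm z) : D then val i z else mem s0 (nm z + off (g i))))" for D m
 show ?thesis
 proof (rule wp_sweep[where J=J and l="?l" and b=b])
 show "J {} (mem s0)" by (simp add: J_def same_refl)
 show "hd (?l i) = rg s0 (Rp i)" if "i <= L" "rg s0 (Ch i) ~= 0" for i using lst[OF pre that] by simp
 show "ring m i (?l i)" if "J D m" "i <= L" "rg s0 (Ch i) ~= 0" for D m i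
 proof (rule ring_same[OF lst(1)[OF pre that(2,3)] that(2), of F])
 have "Nx i ~= g j" "Pv i ~= g j" for j using g(3)[of j i] by auto
 thus "ALL a:set (?l i). (a, Nx i) ~: F & (a, Pv i) ~: F" by (auto simp: F_def)
 qed (use that(1) in "simp add: J_def")
 next
 fix i k D s Q'
 assume i: "i <= L" and c: "rg s0 (Ch i) ~= 0" and k: "k < length (?l i)" and f: "frm VS s0 s" and J: "J D (mem s)" and z: "rg s (Tm 7) = ?l i ! k"
 and Q': "!!s'. frm (VS - {Tm 7}) s s' ==> J (insert (i, ?l i ! k) D) (mem s') ==> out s' = out s ==> time s' <= time s + b ==> Q' s'"
 have "?l i ! k : nm ` ce Om i x" using lst(3)[OF pre i c] k by (metis nth_mem)
 then obtain y where y: "y : ce Om i x" "?l i ! k = nm y" by blast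
 have yO: "y : Om" using cell_of[OF y(1)] by auto
 have yS: "nm y : SL" by (rule recs_SL[OF rc yO])
 have sm: "same F (mem s0) (mem s)" using J by (simp add: J_def)
 show "wp w (f i) Q' s"
 proof (rule body[OF i c y(1) f sm z[unfolded y(2)]])
 fix s' assume s': "frm (VS - {Tm 7}) s s'" "mem s' = (mem s)(nm y + off (g i) := val i y)" "out s' = out s" "time s' <= time s + b"
 have "mem s' (nm z' + off (g j)) = (if (j, nm z') : insert (i, nm y) D then val j z' else mem s0 (nm z' + off (g j)))" if zj: "z' : Om" "j <= L" for z' j
 proof -
 have e: "mem s' (nm z' + off (g j)) = (if nm z' = nm y & g j = g i then val i y else mem s (nm z' + off (g j)))"
 unfolding s'(2) by (rule upd_fld[OF yS recs_SL[OF rc zj(1)]]) (use g(2) i zj in auto)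
 have "nm z' = nm y <-> z' = y" using rc zj yO by (auto simp: recs_def inj_on_def)
 thus ?thesis using e J zj g(1) by (auto simp: J_def inj_eq)
 qed
 moreover have "same F (mem s0) (mem s')" unfolding s'(2) by (rule same_upd'[OF sm yS g(2)[OF i]]) (auto simp: F_def)
 ultimately show "Q' s'" using s' y by (intro Q') (auto simp: J_def)
 qed
 next
 fix s' assume s': "frm VS s0 s'" "J {(i, a). i <= L & rg s0 (Ch i) ~= 0 & a : set (?l i)} (mem s')" "out s' = out s0"
 "time s' <= time s0 + 1 + 3 * Suc L + (SUM i<=L. of_bool (rg s0 (Ch i) ~= 0) * (length (?l i) * (b + 7)))"
 show "Q s'"
 proof (rule Q)
 fix z i assume zi: "z : Om" "i <= L"
 have "nm z : set (?l i) <-> z : ce Om i x" if "rg s0 (Ch i) ~= 0"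
 unfolding lst(3)[OF pre zi(2) that] using rc zi cell_subset[of lab Om i x] by (auto simp: recs_def inj_on_def)
 thus "mem s' (nm z + off (g i)) = (if rg s0 (Ch i) ~= 0 & z : ce Om i x then val i z else mem s0 (nm z + off (g i)))"
 using s'(2) zi by (auto simp: J_def)
 next
 have "(SUM i<=L. of_bool (rg s0 (Ch i) ~= 0) * (length (?l i) * (b + 7))) = chb s0 Om x (b + 7)"
 using lst(4)[OF pre] by (intro sum.cong) auto
 thus "time s' <= time s0 + 1 + 3 * Suc L + chb s0 Om x (b + 7)" using s'(4) by simp
 qed (use s' in "auto simp: J_def")
 qed
qed

definition fN where "fN i = stf (Tm 7) (Nf i) (Rp i)"

text \<open>Members of a flagged cell share the representative of the next coarser level as well, so
  both ends of the edge are available in registers.\<close>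

definition fW where "fW i = seqs [wd (Rp i) (Rp (i - 1)), stf (Tm 7) (Wf i) (Tm 5)]"

text \<open>A new representative at level i also changes the edge to level i + 1. Its lower end
  differs within the cell, so it is read from each record. At i = L the minimum turns this into the
  dummy write.\<close>

definition fV where
 "fV i = seqs [ldf (Tm 9) (Tm 7) (Nf (min L (Suc i))), wd (Tm 9) (Rp i), stf (Tm 7) (Wf (Suc i)) (Tm 5)]"

lemma wp_setW:
 assumes a: "A ~: VW" "B ~: VW" and t: "tabs (mem s)" and x: "coords (mem s) (rg s A) x" and y: "coords (mem s) (rg s B) y"
 and z: "rg s (Tm 7) : SL" and i: "i <= Suc L"
 and Q: "!!s'. frm VW s s' ==> mem s' = (mem s)(rg s (Tm 7) + off (Wf i) := wdist p x y) ==> out s' = out s ==> time s' <= time s + 14 * d + 11 ==> Q s'"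
 shows "wp w (seqs [wd A B, stf (Tm 7) (Wf i) (Tm 5)]) Q s"
proof (rule wp_Cons, rule wp_wd[OF a t], goal_cases)
 case (1 s1)
 have r: "rg s1 (Tm 7) = rg s (Tm 7)" "rg s1 (Tm 5) = wdist p x y" using 1(1) 1(5)[OF x y] by (auto simp: frm_def)
 show ?case
 apply (rule wp_Cons, rule wp_stf)
 subgoal using slot_bound[OF z, of "Wf i"] i by (simp add: r)
 subgoal by simp
 subgoal by simp
 subgoal premises pr for s2
 by (rule wp_Nil, rule Q) (use 1 pr r in "simp_all add: frm_def")
 done
qed

lemma FX_sub: "same {(a, Nf i) |a i. True} m m' ==> same FX m m'" "same {(a, Wf i) |a i. True} m m' ==> same FX m m'"
 "same {(a, Wf (Suc i)) |a i. True} m m' ==> same FX m m'"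
 by (erule same_mono, force simp: FX_def)+

lemma pre_same: "pre s Om nm x ==> frm VS s s' ==> same FX (mem s) (mem s') ==> pre s' Om nm x"
 using recs_same rings_same by (auto simp: pre_def frm_def)

text \<open>Addresses are repaired first because the last sweep reads them. A weight at level i
  depends on the representatives at i and i - 1 only, hence two sweeps over weights: one for the
  edge above a flagged cell, one for the edges below.\<close>

lemma wp_sweeps:
 assumes pre: "pre s0 Om nm x"
 and N: "!!z i. z : Om ==> i <= L ==> okN (mem s0) Om nm i z | (rg s0 (Ch i) ~= 0 & z : ce Om i x)"
 and W: "!!z i. z : Om ==> i <= L ==> okW (mem s0) Om nm i z | (rg s0 (Ch i) ~= 0 & z : ce Om i x) |
 (rg s0 (Ch (i - 1)) ~= 0 & z : ce Om (i - 1) x)"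
 and Q: "!!s'. frm VS s0 s' ==> same FX (mem s0) (mem s') ==> good (mem s') Om nm ==> out s' = out s0 ==>
 time s' <= time s0 + 3 + 9 * Suc L + chs s0 Om x * (28 * d + 51) ==> wp w (seqs cs) Q s'"
 shows "wp w (seqs (sweep fN # sweep fW # sweep fV # cs)) Q s0"
proof -
 have rc: "recs (mem s0) Om nm" using pre by (simp add: pre_def)
 have fin: "finite Om" by (rule recs_fin[OF rc])
 have rpO: "rp Om j y : Om" if "y : ce Om i x" for i j y
 proof -
 have "y : Om" using cell_of[OF that] by simp
 thus ?thesis using rp_cell[OF fin, of j y] cell_refl[of y Om lab j] cell_subset by blast
 qed
 have rv: "rg s (Rp j) = nm (rp Om j y)" if "y : ce Om i x" "j <= i" "i <= L" "frm VS s0 s" for i j y s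
 proof -
 have "y : ce Om j x" using cell_anti[OF that(2)] that(1) by blast
 hence "ce Om j x ~= {}" "rp Om j y = rp Om j x" using cell_of by blast+
 thus ?thesis using that pre by (auto simp: frm_def pre_def)
 qed
 have co: "coords (mem s) (nm u) u" "tabs (mem s)" if "same FX (mem s0) (mem s)" "u : Om" for s u
 using recs_same[OF rc that(1)] that(2) by (auto simp: recs_def)
 show ?thesis
 proof (rule wp_Cons, rule wp_rewrite[where g=Nf and val="%i y. nm (rp Om i y)" and b=4, OF pre], goal_cases)
 case (4 i y s)
 have yS: "nm y : SL" using recs_SL[OF rc] cell_of[OF 4(3)] by blast
 show ?case unfolding fN_def
 by (rule wp_stf) (use 4 slot_bound[OF yS, of "Nf i"] rv[OF 4(3) order_refl 4(1,4)] in "auto simp: frm_def")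
 next
 case (5 s1)
 note F1 = FX_sub(1)[OF 5(2)]
 have N1: "mem s1 (nm z + off (Nf i)) = nm (rp Om i z)" if "z : Om" "i <= L" for z i
 using 5(3)[OF that] N[OF that] by (auto simp: okN_def)
 have c1: "rg s1 (Ch i) = rg s0 (Ch i)" for i using 5(1) by (simp add: frm_def)
 have t1: "time s1 <= time s0 + 1 + 3 * Suc L + chb s0 Om x 11" using 5(5) by simp
 have o1: "out s1 = out s0" by (rule 5(4))
 note s1 = 5(1,2)
 show ?case
 proof (rule wp_Cons, rule wp_rewrite[where g=Wf and val="%i y. wdist p (rp Om i y) (rp Om (i - 1) y)" and b="14 * d + 11", OF pre_same[OF pre 5(1) F1]], goal_cases)
 case (4 i y s)
 have f: "frm VS s0 s" by (rule frm_trans[OF s1(1) 4(4)]) auto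
 have F: "same FX (mem s0) (mem s)" by (rule same_trans[OF F1 FX_sub(2)[OF 4(5)]]) auto
 have yS: "nm y : SL" using recs_SL[OF rc] cell_of[OF 4(3)] by blast
 show ?case unfolding fW_def
 by (rule wp_setW[where x="rp Om i y" and y="rp Om (i - 1) y"])
 (use 4 yS co[OF F rpO[OF 4(3)]] rv[OF 4(3) _ 4(1) f] in "auto simp: frm_def")
 next
 case (5 s2)
 note F2 = same_trans[OF F1 FX_sub(2)[OF 5(2)] order_refl order_refl]
 have f2: "frm VS s0 s2" by (rule frm_trans[OF s1(1) 5(1)]) auto
 have N2: "mem s2 (nm z + off (Nf i)) = nm (rp Om i z)" if "z : Om" "i <= L" for z i
 using sameD[OF 5(2) recs_SL[OF rc that(1)], of "Nf i"] N1 that by simp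
 have W2: "mem s2 (nm z + off (Wf i)) = (if rg s0 (Ch i) ~= 0 & z : ce Om i x then wdist p (rp Om i z) (rp Om (i - 1) z) else mem s0 (nm z + off (Wf i)))"
 if "z : Om" "i <= L" for z i
 using 5(3)[OF that] sameD[OF s1(2) recs_SL[OF rc that(1)], of "Wf i"] that by (simp add: c1)
 have c2: "rg s2 (Ch i) = rg s0 (Ch i)" for i using f2 by (simp add: frm_def)
 have t2: "time s2 <= time s1 + 1 + 3 * Suc L + chb s0 Om x (14 * d + 18)" using 5(5) by (simp add: c1 ac_simps)
 have o2: "out s2 = out s0" using 5(4) o1 by simp
 note s2 = 5(2)
 show ?case
 proof (rule wp_Cons, rule wp_rewrite[where g="%i. Wf (Suc i)" and val="%i y. wdist p (rp Om (min L (Suc i)) y) (rp Om i y)" and b="14 * d + 15", OF pre_same[OF pre f2 F2]], goal_cases)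
 case (4 i y s)
 have f: "frm VS s0 s" by (rule frm_trans[OF f2 4(4)]) auto
 have F: "same FX (mem s0) (mem s)" by (rule same_trans[OF F2 FX_sub(3)[OF 4(5)]]) auto
 have yO: "y : Om" using cell_of[OF 4(3)] by simp
 have yS: "nm y : SL" by (rule recs_SL[OF rc yO])
 have N: "mem s (nm y + off (Nf (min L (Suc i)))) = nm (rp Om (min L (Suc i)) y)"
 using sameD[OF 4(5) yS, of "Nf (min L (Suc i))"] N2[OF yO, of "min L (Suc i)"] by auto
 show ?case unfolding fV_def
 proof (rule wp_Cons, rule wp_ldf, goal_cases)
 case 1 show ?case using slot_bound[OF yS, of "Nf (min L (Suc i))"] 4(6) by simp
 next
 case (3 s3)
 have F3: "same FX (mem s0) (mem s3)" and f3: "frm VS s0 s3" using F f 3(2,3) by (auto simp: frm_def)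
 show ?case
 by (rule wp_setW[where x="rp Om (min L (Suc i)) y" and y="rp Om i y"])
 (use 4 3 N yS co[OF F3 rpO[OF 4(3)]] rv[OF 4(3) order_refl 4(1) f3] in "auto simp: frm_def")
 qed simp
 next
 case (5 s3)
 have F3: "same FX (mem s0) (mem s3)" by (rule same_trans[OF F2 FX_sub(3)[OF 5(2)]]) auto
 have N3: "okN (mem s3) Om nm i z" if "z : Om" "i <= L" for z i
 using sameD[OF 5(2) recs_SL[OF rc that(1)], of "Nf i"] N2[OF that] that by (simp add: okN_def)
 \<comment> \<open>The last sweep writes weights of levels 1 to L + 1, so level 0 keeps the value of
   the sweep before.\<close>
 have W3: "okW (mem s3) Om nm i z" if z: "z : Om" "i <= L" for z i
 proof (cases i)
 case 0
 have "mem s3 (nm z + off (Wf 0)) = mem s2 (nm z + off (Wf 0))" using sameD[OF 5(2) recs_SL[OF rc z(1)], of "Wf 0"] by simp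
 thus ?thesis using W2[OF z] W[OF z] 0 by (auto simp: okW_def)
 next
 case (Suc j)
 have "min L (Suc j) = Suc j" "j <= L" using Suc z by auto
 thus ?thesis using 5(3)[OF z(1), of j] W2[OF z] W[OF z] Suc by (auto simp: okW_def c2)
 qed
 have r3: "recs (mem s3) Om nm" "rings (mem s3) Om nm" using recs_same[OF _ F3] rings_same[OF _ F3] pre by (auto simp: pre_def)
 have S: "chb s0 Om x b = chs s0 Om x * b" for b
 by (simp add: sum_distrib_right mult.assoc)
 have t3: "time s3 <= time s2 + 1 + 3 * Suc L + chb s0 Om x (14 * d + 22)" using 5(5) by (simp add: c2 ac_simps)
 show ?case
 proof (rule Q)
 show "frm VS s0 s3" by (rule frm_trans[OF f2 5(1)]) auto
 show "good (mem s3) Om nm" using r3 N3 W3 by (simp add: good_def)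
 show "time s3 <= time s0 + 3 + 9 * Suc L + chs s0 Om x * (28 * d + 51)"
 using t1 t2 t3 unfolding S by (simp add: algebra_simps)
 qed (use F3 5(4) o2 in auto)
 qed (auto simp: inj_on_def)
 qed (auto simp: inj_on_def)
 qed (auto simp: inj_on_def)
qed

end

section \<open>Reporting the changed paths\<close>

context store begin

definition reported where
 "reported ws m nm X <-> (EX xs. distinct xs & set xs = X & ws = concat (map (%z. z @ pathwords m (nm z)) xs))"

lemma wp_printring:
 assumes pre: "pre s0 Om nm x" and N: "!!z i. z : Om ==> i <= L ==> okN (mem s0) Om nm i z"
 and i: "i <= L" and c: "rg s0 (Ch i) ~= 0"
 and Q: "!!s' ws. frm VS s0 s' ==> mem s' = mem s0 ==> out s' = out s0 @ ws ==> reported ws (mem s0) nm (ce Om i x) ==>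
 time s' <= time s0 + 2 + card (ce Om i x) * (18 + 15 * L + 6 * d) ==> Q s'"
 shows "wp w (ringfor (Rp i) i prt) Q s0"
proof -
 have rc: "recs (mem s0) Om nm" using pre by (simp add: pre_def)
 define l where "l = lst s0 Om nm x i"
 have l: "ring (mem s0) i l" "hd l = rg s0 (Rp i)" "set l = nm ` ce Om i x" "length l = card (ce Om i x)"
 using lst[OF pre i c] by (simp_all add: l_def)
 have l': "l ~= []" "distinct l" "set l <= SL" using l(1) by (auto simp: ring_def)
 have inj: "inj_on nm (ce Om i x)" using rc cell_subset[of lab Om i x] inj_on_subset by (auto simp: recs_def)
 define un where "un = inv_into (ce Om i x) nm"
 have un: "un a : ce Om i x" "nm (un a) = a" if "a : set l" for a
 using that l(3) unfolding un_def by (auto simp: inv_into_into f_inv_into_f)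
 have ux: "distinct (map un l)" "set (map un l) = ce Om i x"
 proof -
 have "inj_on un (set l)" using un(2) by (metis inj_onI)
 thus "distinct (map un l)" using l' by (simp add: distinct_map)
 show "set (map un l) = ce Om i x" unfolding un_def set_map l(3) using inv_into_image_cancel[OF inj order_refl] by simp
 qed
 define H where "H k s' <-> frm VS s0 s' & mem s' = mem s0 &
 out s' = out s0 @ concat (map (%z. z @ pathwords (mem s0) (nm z)) (map un (take k l)))" for k s'
 show ?thesis
 proof (rule wp_ringfor[where I=H and l=l and b="11 + 15 * L + 6 * d"])
 show "rg s0 (Rp i) = hd l" using l by simp
 show "H 0 s0" by (simp add: H_def frm_refl)
 fix k
 show "stable (H k) {Tm 0, Tm 7, Tm 8}" unfolding stable_def H_def by (auto simp: frm_def)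
 fix s1
 show "ALL j<length l. mem s1 (l ! j + off (Nx i)) = (l @ [hd l]) ! Suc j" if "H k s1"
 using ring_next[OF l(1)] that by (simp add: H_def)
 fix Q' assume k: "k < length l" and H: "H k s1" and z: "rg s1 (Tm 7) = l ! k" "rg s1 (Rp i) = hd l"
 and Q': "!!s'. H (Suc k) s' ==> rg s' (Tm 7) = l ! k ==> rg s' (Rp i) = hd l ==> time s' <= time s1 + (11 + 15 * L + 6 * d) ==> Q' s'"
 define y where "y = un (l ! k)"
 have y: "y : ce Om i x" "nm y = l ! k" using un[of "l ! k"] k by (simp_all add: y_def)
 have yO: "y : Om" using y(1) cell_of by blast
 have m: "mem s1 = mem s0" using H by (simp add: H_def)
 show "wp w prt Q' s1"
 proof (rule wp_prt[where x=y])
 show "coords (mem s1) (rg s1 (Tm 7)) y" using rc yO by (simp add: m z y(2)[symmetric] recs_def)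
 show "mem s1 (rg s1 (Tm 7) + off (Nf j)) : SL" if "j <= L" for j
 proof -
 have "rp Om j y : Om" using rp_cell[OF recs_fin[OF rc], of j y] cell_refl[OF yO] cell_subset by blast
 thus ?thesis using N[OF yO that] recs_SL[OF rc] by (simp add: okN_def m z y(2)[symmetric])
 qed
 fix s' assume s': "frm {Tm 0, Tm 1, Tm 9} s1 s'" "mem s' = mem s1" "out s' = out s1 @ y @ pathwords (mem s1) (rg s1 (Tm 7))"
 "time s' <= time s1 + 11 + 15 * L + 6 * d"
 have "frm VS s0 s'" using H s'(1) by (simp add: H_def frm_def)
 hence "H (Suc k) s'" using H s' k by (simp add: H_def m z y y_def[symmetric] take_Suc_conv_app_nth)
 thus "Q' s'" using s' z by (intro Q') (auto simp: frm_def)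
 qed
 next
 fix s' assume s': "H (length l) s'" "rg s' (Rp i) = hd l" "time s' <= time s0 + 2 + length l * (11 + 15 * L + 6 * d + 7)"
 show "Q s'"
 proof (rule Q)
 show "out s' = out s0 @ concat (map (%z. z @ pathwords (mem s0) (nm z)) (map un l))" using s'(1) by (simp add: H_def)
 show "reported (concat (map (%z. z @ pathwords (mem s0) (nm z)) (map un l))) (mem s0) nm (ce Om i x)"
 unfolding reported_def using ux by blast
 show "time s' <= time s0 + 2 + card (ce Om i x) * (18 + 15 * L + 6 * d)" using s'(3) l(4) by (simp add: algebra_simps)
 qed (use s' in "auto simp: H_def")
 qed (use i l' in auto)
qed

definition changed where
 "changed ch Om x = (\<Union>i\<in>{i. i <= L & ch i}. ce Om i x)"

text \<open>Levels are tried from the root downward. Cells are nested, so the cell of the first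
  flagged level contains those of all later ones, and a single ring lists every affected vector
  once.\<close>

primrec report where
 "report 0 = Skip"
| "report (Suc n) = Cond (rn (Ch (L - n))) (ringfor (Rp (L - n)) (L - n) prt) (report n)"

lemma wp_report:
 assumes "pre s0 Om nm x" "!!z i. z : Om ==> i <= L ==> okN (mem s0) Om nm i z" "n <= Suc L" "!!i. i < Suc L - n ==> rg s0 (Ch i) = 0"
 and "!!s' ws. frm VS s0 s' ==> mem s' = mem s0 ==> out s' = out s0 @ ws ==>
 reported ws (mem s0) nm (changed (%i. rg s0 (Ch i) ~= 0) Om x) ==>
 time s' <= time s0 + n + 2 + chs s0 Om x * (18 + 15 * L + 6 * d) ==> Q s'"
 shows "wp w (report n) Q s0"
 using assms
proof (induction n arbitrary: s0)
 case 0
 have "changed (%i. rg s0 (Ch i) ~= 0) Om x = {}" using 0(4) by (auto simp: changed_def)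
 thus ?case using 0(5)[of _ "[]"] by (auto intro!: wp_Skip simp: frm_def reported_def)
next
 case (Suc n)
 let ?i = "L - n"
 have n: "n <= L" "?i <= L" "Suc L - n = Suc ?i" using Suc.prems(3) by auto
 show ?case
 unfolding report.simps
 proof (rule wp_Cond)
 assume c: "rg s0 (Ch ?i) ~= 0"
 have X: "changed (%i. rg s0 (Ch i) ~= 0) Om x = ce Om ?i x"
 proof -
 have "?i <= i" if "rg s0 (Ch i) ~= 0" for i using Suc.prems(4)[of i] that n by force
 thus ?thesis using c n(2) cell_anti[of ?i] unfolding changed_def by blast
 qed
 have "of_bool (rg s0 (Ch ?i) ~= 0) * card (ce Om ?i x) <= chs s0 Om x"
 by (rule member_le_sum) auto
 hence S: "card (ce Om ?i x) * (18 + 15 * L + 6 * d) <= chs s0 Om x * (18 + 15 * L + 6 * d)"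
 using c by (intro mult_le_mono1) simp
 show "wp w (ringfor (Rp ?i) ?i prt) Q (tick s0)"
 proof (rule wp_printring[where Om=Om and nm=nm and x=x, OF _ _ n(2)], goal_cases)
 case (4 s' ws)
 show ?case
 proof (rule Suc.prems(5)[of _ ws])
 have "time (tick s0) = time s0 + 1" by simp
 thus "time s' <= time s0 + Suc n + 2 + chs s0 Om x * (18 + 15 * L + 6 * d)"
 using 4(5) S by linarith
 qed (use 4 X in "simp_all add: frm_def")
 qed (use Suc.prems(1,2) c in "auto simp: pre_def")
 next
 assume c: "rg s0 (Ch ?i) = 0"
 show "wp w (report n) Q (tick s0)"
 proof (rule Suc.IH, goal_cases)
 case (4 i) thus ?case using c Suc.prems(4)[of i] n(3) by (cases "i = ?i") auto
 next
 case (5 s' ws) thus ?case by (intro Suc.prems(5)) (auto simp: frm_def)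
 qed (use Suc.prems in "auto simp: pre_def")
 qed
qed

definition finish :: com where
 "finish = seqs [sweep fN, sweep fW, sweep fV, report (Suc L)]"

lemma wp_finish:
 assumes pre: "pre s0 Om nm x"
 and sN: "!!z i. z : Om ==> i <= L ==> okN (mem s0) Om nm i z | (rg s0 (Ch i) ~= 0 & z : ce Om i x)"
 and sW: "!!z i. z : Om ==> i <= L ==> okW (mem s0) Om nm i z | (rg s0 (Ch i) ~= 0 & z : ce Om i x) |
 (rg s0 (Ch (i - 1)) ~= 0 & z : ce Om (i - 1) x)"
 and Q: "!!s' ws. frm VS s0 s' ==> same FX (mem s0) (mem s') ==> good (mem s') Om nm ==> out s' = out s0 @ ws ==>
 reported ws (mem s') nm (changed (%i. rg s0 (Ch i) ~= 0) Om x) ==>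
 time s' <= time s0 + 20 + 12 * L + chs s0 Om x * (69 + 15 * L + 34 * d) ==> Q s'"
 shows "wp w finish Q s0"
 unfolding finish_def
proof (rule wp_sweeps[OF pre sN sW], assumption+, goal_cases)
 case (1 s1)
 have c: "rg s1 (Ch i) = rg s0 (Ch i)" for i using 1(1) by (simp add: frm_def)
 show ?case
 proof (rule wp_Cons, rule wp_report[OF pre_same[OF pre 1(1,2)]], goal_cases)
 case (4 s2 ws)
 note f = frm_trans[OF 1(1) 4(1) order_refl order_refl]
 show ?case
 by (rule wp_Nil, rule Q[of _ ws]) (use 1 4 f in "auto simp: frm_def c algebra_simps")
 qed (use 1(3) in "auto simp: good_def")
qed

end

section \<open>Free slots and insertion into the rings\<close>

context store begin

definition ringsAt where
 "ringsAt m Om nm i <-> (ALL z:Om. EX l. ring m i l & set l = nm ` ce Om i z)"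

lemma rings_at: "rings m Om nm <-> (ALL i<=L. ringsAt m Om nm i)"
 by (simp add: rings_def ringsAt_def)

lemma ringsAt_same:
 assumes "ringsAt m Om nm i" "i <= L" "same X m m'" "!!z. z : Om ==> (nm z, Nx i) ~: X & (nm z, Pv i) ~: X"
 shows "ringsAt m' Om nm i"
 unfolding ringsAt_def
proof
 fix z assume z: "z : Om"
 then obtain l where l: "ring m i l" "set l = nm ` ce Om i z" using assms(1) by (auto simp: ringsAt_def)
 have "ring m' i l" by (rule ring_same[OF l(1) assms(2,3)]) (use l(2) assms(4) cell_subset[of lab Om i z] in auto)
 thus "EX l. ring m' i l & set l = nm ` ce Om i z" using l(2) by blast
qed

text \<open>The free slots form a stack indexed from the current cardinality on. A zero entry stands
  for the slot of the same index, so memory that was never written is already a valid stack,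
  whatever the capacity.\<close>

definition fa where
 "fa m k = (if m (slot k + off Fr) = 0 then slot k else m (slot k + off Fr))"

definition freeok where
 "freeok m Om nm <-> bij_betw (fa m) {card Om..<cap} (SL - nm ` Om)"

lemma slot_SL: "k < cap ==> slot k : SL"
 by (simp add: SL_def)

lemma freeok_same:
 assumes "freeok m Om nm" "same X m m'" "!!a. (a, Fr) ~: X"
 shows "freeok m' Om nm"
proof -
 have "fa m' k = fa m k" if "k < cap" for k using sameD[OF assms(2) slot_SL[OF that], of Fr] assms(3) by (simp add: fa_def)
 hence "bij_betw (fa m') {card Om..<cap} (SL - nm ` Om) <-> bij_betw (fa m) {card Om..<cap} (SL - nm ` Om)"
 by (intro bij_betw_cong) auto
 thus ?thesis using assms(1) by (simp add: freeok_def)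
qed

lemma good_same:
 assumes g: "good m Om nm" and s: "same X m m'"
 and X: "!!z f. z : Om ==> (nm z, f) : X ==> f = Fr"
 shows "good m' Om nm"
proof -
 have rc: "recs m Om nm" using g by (simp add: good_def)
 have "recs m' Om nm"
 unfolding recs_def
 proof (intro conjI ballI)
 show "Om <= grid d D" "inj_on nm Om" using rc by (auto simp: recs_def)
 show "tabs m'" using rc tabs_same[OF _ s] by (simp add: recs_def)
 fix z assume z: "z : Om"
 show "coords m' (nm z) z" by (rule coords_same[OF _ s]) (use rc z X in "auto simp: recs_def")
 show "dig m' (nm z) (pi z)" by (rule dig_same[OF _ s]) (use rc z X in "auto simp: recs_def")
 qed
 moreover have "rings m' Om nm"
 unfolding rings_at
 proof (intro allI impI)
 fix i assume i: "i <= L"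
 show "ringsAt m' Om nm i"
 by (rule ringsAt_same[OF _ i s]) (use g i X in "auto simp: good_def rings_at")
 qed
 moreover have "okN m' Om nm i z & okW m' Om nm i z" if "z : Om" "i <= L" for i z
 proof -
 have "(nm z, Nf i) ~: X" "(nm z, Wf i) ~: X" using X[OF that(1)] by blast+
 thus ?thesis
 using sameD[OF s recs_SL[OF rc that(1)], of "Nf i"] sameD[OF s recs_SL[OF rc that(1)], of "Wf i"] g that
 by (auto simp: okN_def okW_def good_def)
 qed
 ultimately show ?thesis by (simp add: good_def)
qed

lemma pr_inj: "inj_on pr (grid d D)"
proof -
 have "inj_on pi (grid d D)" "pi ` grid d D = grid d D" using pi by (auto simp: permutes_inj_on permutes_image)
 thus ?thesis using key_inj_on_grid[of D d] by (intro comp_inj_on) auto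
qed

lemma cell_insert: "ce (insert x Om) i z = (if lab i z = lab i x then insert x (ce Om i x) else ce Om i z)"
 by (auto simp: cell_def)

lemma rp_insert_other: "lab i z ~= lab i x ==> rp (insert x Om) i z = rp Om i z"
 by (simp add: rep_def cell_insert)

lemma rp_insert:
 assumes Om: "Om <= grid d D" "x : grid d D"
 shows "rp (insert x Om) i x = (if ce Om i x = {} | pr x < pr (rp Om i x) then x else rp Om i x)"
proof -
 have fin: "finite Om" using Om finite_grid finite_subset by blast
 have inj: "inj_on pr (insert x Om)" by (rule inj_on_subset[OF pr_inj]) (use Om in auto)
 have c: "ce (insert x Om) i x = insert x (ce Om i x)" by (simp add: cell_insert)
 show ?thesis
 proof (cases "ce Om i x = {} | pr x < pr (rp Om i x)")
 case True
 have "rp (insert x Om) i x = x"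
 proof (rule rep_eqI[OF _ inj])
 fix y assume "y : ce (insert x Om) i x"
 hence "y = x | y : ce Om i x" by (simp add: c)
 thus "pr x <= pr y" using True rep_min[OF fin, of y lab i x pr] by fastforce
 qed (use fin c in auto)
 thus ?thesis using True by simp
 next
 case False
 have "rp (insert x Om) i x = rp Om i x"
 proof (rule rep_eqI[OF _ inj])
 show "rp Om i x : ce (insert x Om) i x" unfolding c using rp_cell[OF fin] False by blast
 fix y assume "y : ce (insert x Om) i x"
 hence "y = x | y : ce Om i x" by (simp add: c)
 thus "pr (rp Om i x) <= pr y" using False rep_min[OF fin, of y lab i x pr] by fastforce
 qed (use fin in auto)
 thus ?thesis using False by simp
 qed
qed

abbreviation "RX == {(a :: nat, f). EX i. f = Nx i | f = Pv i}"

text \<open>Writes are confined to the new record and to the records of the cell of x, from which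
  the rings of all other cells are disjoint.\<close>

lemma ringsAt_insert:
 assumes r: "ringsAt m Om nm i" and i: "i <= L" and x: "x ~: Om" and S: "S : SL" "S ~: nm ` Om"
 and inj: "inj_on nm Om" and SL: "nm ` Om <= SL" and y: "y : ce Om i x"
 and r': "r = nm y" and n: "n = m (r + off (Nx i))"
 and m': "m' = ((m(r + off (Nx i) := S, S + off (Pv i) := r))(S + off (Nx i) := n))(n + off (Pv i) := S)"
 shows "ringsAt m' (insert x Om) (nm(x := S)) i" "same {(a, f). f = Nx i | f = Pv i} m m'" "n : SL"
proof -
 have yO: "y : Om" and cy: "ce Om i y = ce Om i x" using cell_of[OF y] by auto
 obtain l0 where l0: "ring m i l0" "set l0 = nm ` ce Om i x" using r yO cy by (metis ringsAt_def)
 then obtain l where l: "ring m i (r # l)" "set (r # l) = nm ` ce Om i x"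
 using ring_start[OF l0(1), of r] y r' by (metis imageI)
 have lO: "set (r # l) <= nm ` Om" using l(2) cell_subset by blast
 have Sl: "S ~: set (r # l)" using lO S(2) by blast
 have ring': "ring m' i (r # S # l)" using ring_insert[OF l(1) S(1) Sl i] by (simp add: m' n)
 have "n = (l @ [r]) ! 0" using ring_next[OF l(1), of 0] by (simp add: n)
 hence nl: "n : set (r # l)" by (cases l) auto
 thus nS: "n : SL" using lO SL by blast
 have rS: "r : SL" using lO SL by auto
 let ?X = "{(a, f). (f = Nx i | f = Pv i) & (a = S | a : nm ` ce Om i x)}"
 have sm: "same ?X m m'"
 unfolding m' by (intro same_upd' same_refl rS nS S(1)) (use i nl l(2) in auto)
 thus "same {(a, f). f = Nx i | f = Pv i} m m'" by (rule same_mono) auto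
 show "ringsAt m' (insert x Om) (nm(x := S)) i"
 unfolding ringsAt_def
 proof
 fix z assume z: "z : insert x Om"
 have img: "(nm(x := S)) ` ce Om i z = nm ` ce Om i z" for z
 using x cell_subset[of lab Om i z] by (intro image_cong) auto
 show "EX l. ring m' i l & set l = (nm(x := S)) ` ce (insert x Om) i z"
 proof (cases "lab i z = lab i x")
 case True
 hence c: "ce (insert x Om) i z = insert x (ce Om i x)" by (simp add: cell_insert)
 have "set (r # S # l) = insert S (set (r # l))" by auto
 also have "... = insert S ((nm(x := S)) ` ce Om i x)" by (simp only: l(2) img)
 also have "... = (nm(x := S)) ` ce (insert x Om) i z" by (simp only: c image_insert fun_upd_same)
 finally show ?thesis using ring' by blast
 next
 case False
 hence zO: "z : Om" using z by auto
 then obtain lz where lz: "ring m i lz" "set lz = nm ` ce Om i z" using r by (auto simp: ringsAt_def)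
 have dis: "ce Om i z Int ce Om i x = {}" using False by (auto simp: cell_def)
 have "ring m' i lz"
 proof (rule ring_same[OF lz(1) i sm], intro ballI)
 fix a assume "a : set lz"
 then obtain u where u: "u : ce Om i z" "a = nm u" using lz(2) by auto
 hence "u : Om" using cell_subset by blast
 hence "a ~= S" using u(2) S(2) by blast
 moreover have "a ~: nm ` ce Om i x"
 proof
 assume "a : nm ` ce Om i x"
 then obtain v where v: "v : ce Om i x" "nm u = nm v" using u(2) by auto
 hence "v = u" using inj \<open>u : Om\<close> cell_subset by (metis inj_onD subsetD)
 thus False using u(1) v(1) dis by blast
 qed
 ultimately show "(a, Nx i) ~: ?X & (a, Pv i) ~: ?X" by simp
 qed
 thus ?thesis using lz(2) img[of z] False by (auto simp: cell_insert)
 qed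
 qed
qed

lemma ringsAt_new:
 assumes r: "ringsAt m Om nm i" and i: "i <= L" and x: "x ~: Om" and S: "S : SL" "S ~: nm ` Om" and e: "ce Om i x = {}"
 and m': "m' = m(S + off (Nx i) := S, S + off (Pv i) := S)"
 shows "ringsAt m' (insert x Om) (nm(x := S)) i" "same {(a, f). f = Nx i | f = Pv i} m m'"
proof -
 let ?X = "{(a, f). (f = Nx i | f = Pv i) & a = S}"
 have sm: "same ?X m m'" unfolding m' by (intro same_upd' same_refl S(1)) (use i in auto)
 thus "same {(a, f). f = Nx i | f = Pv i} m m'" by (rule same_mono) auto
 have r1: "ringsAt m' Om nm i" by (rule ringsAt_same[OF r i sm]) (use S(2) in auto)
 have "S + off (Nx i) ~= S + off (Pv i)" using off_eq by simp
 hence rS: "ring m' i [S]" using S(1) by (simp add: ring_def chain_def m')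
 show "ringsAt m' (insert x Om) (nm(x := S)) i"
 unfolding ringsAt_def
 proof
 fix z assume z: "z : insert x Om"
 show "EX l. ring m' i l & set l = (nm(x := S)) ` ce (insert x Om) i z"
 proof (cases "lab i z = lab i x")
 case True
 thus ?thesis using rS e by (intro exI[of _ "[S]"]) (simp add: cell_insert)
 next
 case False
 hence zO: "z : Om" using z by auto
 then obtain lz where lz: "ring m' i lz" "set lz = nm ` ce Om i z" using r1 by (auto simp: ringsAt_def)
 have "(nm(x := S)) ` ce Om i z = nm ` ce Om i z" using x cell_subset[of lab Om i z] by (intro image_cong) auto
 thus ?thesis using lz False by (auto simp: cell_insert)
 qed
 qed
qed

text \<open>Slots have positive addresses, so 0 can stand for an empty cell. Otherwise the new
  record is linked in after the representative, and the flag records whether it takes over.\<close>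

definition ilev where
 "ilev i = Cond (rn (Rp i))
 (seqs [ldf (Tm 13) (Rp i) (Nx i), stf (Rp i) (Nx i) (Tm 12), stf (Tm 12) (Pv i) (Rp i), stf (Tm 12) (Nx i) (Tm 13), stf (Tm 13) (Pv i) (Tm 12),
 cm (Tm 12) (Rp i), Cond (tm 5) (seqs [Bin Or (rn (Rp i)) (tm 12) (tm 12), Const (rn (Ch i)) 1]) (Const (rn (Ch i)) 0)])
 (seqs [Bin Or (rn (Rp i)) (tm 12) (tm 12), Const (rn (Ch i)) 1, stf (Tm 12) (Nx i) (Tm 12), stf (Tm 12) (Pv i) (Tm 12)])"

definition WR where "WR = (range Tm - {Tm 12}) Un range Rp Un range Ch"

lemma WR_simps [simp]: "Tm k : WR <-> k ~= 12" "Rp k : WR" "Ch k : WR" "Crd k ~: WR" "Pri k ~: WR" "Bt k ~: WR" "Slt x ~: WR" "Rpr k n ~: WR" "Cnt ~: WR"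
 by (auto simp: WR_def)

lemma wp_ld:
 assumes "!!s'. (!!q. q ~= Tm 0 ==> rg s' q = (if q = r then mem s (rg s a + off f) else rg s q)) ==> mem s' = mem s ==> out s' = out s ==>
 inp s' = inp s ==> time s' = time s + 4 ==> Q s'" "rg s a : SL" "vf f" "a ~= Tm 0"
 shows "wp w (ldf r a f) Q s"
 by (rule wp_ldf[OF slot_bound]) (use assms in "auto simp: frm_def")

lemma wp_st:
 assumes "!!s'. (!!q. q ~= Tm 0 ==> rg s' q = rg s q) ==> mem s' = (mem s)(rg s a + off f := rg s r) ==> out s' = out s ==>
 inp s' = inp s ==> time s' = time s + 4 ==> Q s'" "rg s a : SL" "vf f" "a ~= Tm 0" "r ~= Tm 0"
 shows "wp w (stf a f r) Q s"
 by (rule wp_stf[OF slot_bound]) (use assms in "auto simp: frm_def")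

lemma w0: "0 < w"
 using small_words(3) by simp

lemma wp_ilev:
 assumes Om: "Om <= grid d D" "x : grid d D" "x ~: Om" and inj: "inj_on nm Om" and i: "i <= L"
 and r: "ringsAt (mem s) Om nm i" and S: "S : SL" "S ~: nm ` Om" "rg s (Tm 12) = S" and SL: "nm ` Om <= SL"
 and dg: "dig (mem s) S (pi x)" "!!z. z : Om ==> dig (mem s) (nm z) (pi z)"
 and rp: "rg s (Rp i) = (if ce Om i x = {} then 0 else nm (rp Om i x))"
 and Q: "!!s'. frm {Tm 0, Tm 1, Tm 2, Tm 3, Tm 5, Tm 6, Tm 13, Rp i, Ch i} s s' ==> same {(a, f). f = Nx i | f = Pv i} (mem s) (mem s') ==>
 ringsAt (mem s') (insert x Om) (nm(x := S)) i ==> rg s' (Rp i) = (nm(x := S)) (rp (insert x Om) i x) ==>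
 rg s' (Ch i) = of_bool (rp (insert x Om) i x = x) ==> out s' = out s ==> time s' <= time s + 14 * d + 40 ==> Q s'"
 shows "wp w (ilev i) Q s"
proof (cases "ce Om i x = {}")
 case True
 define m' where "m' = (mem s)(S + off (Nx i) := S, S + off (Pv i) := S)"
 have ins: "ringsAt m' (insert x Om) (nm(x := S)) i" "same {(a, f). f = Nx i | f = Pv i} (mem s) m'"
 using ringsAt_new[OF r i Om(3) S(1,2) True m'_def] by auto
 have rpi: "rp (insert x Om) i x = x" using rp_insert[OF Om(1,2), of i] True by simp
 have fin: "Q s'" if "frm {Tm 0, Rp i, Ch i} s s'" "mem s' = m'" "rg s' (Rp i) = S" "rg s' (Ch i) = 1" "out s' = out s" "time s' <= time s + 40" for s'
 by (rule Q) (use that ins rpi in "auto simp: frm_def")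
 show ?thesis
 unfolding ilev_def
 apply (rule wp_Cond)
 subgoal using rp True by simp
 apply (rule wp_Cons wp_Nil wp_const wp_mv wp_st fin)+
 by (insert S i, simp_all (no_asm_simp) add: frm_def m'_def one_mod w0)
next
 case False
 have finO: "finite Om" using Om finite_grid finite_subset by blast
 define y where "y = rp Om i x"
 have y: "y : ce Om i x" using rp_cell[OF finO False] by (simp add: y_def)
 hence yO: "y : Om" and yx: "y ~= x" using cell_subset Om(3) by blast+
 have yS: "nm y : SL" using yO SL by blast
 have R: "rg s (Rp i) = nm y" "nm y ~= 0" using rp False slot_pos[OF yS] by (simp_all add: y_def)
 define n where "n = mem s (nm y + off (Nx i))"
 define m' where "m' = (((mem s)(nm y + off (Nx i) := S, S + off (Pv i) := nm y))(S + off (Nx i) := n))(n + off (Pv i) := S)"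
 have ins: "ringsAt m' (insert x Om) (nm(x := S)) i" "same {(a, f). f = Nx i | f = Pv i} (mem s) m'" "n : SL"
 using ringsAt_insert[OF r i Om(3) S(1,2) inj SL y refl n_def m'_def] by auto
 have dg': "dig m' S (pi x)" "dig m' (nm y) (pi y)" using dig_same[OF _ ins(2)] dg yO by auto
 let ?lt = "key D (pi x) < key D (pi y)"
 have rpi: "rp (insert x Om) i x = (if ?lt then x else y)" using rp_insert[OF Om(1,2), of i] False by (simp add: y_def)
 have fin: "Q s'" if "frm {Tm 0, Tm 1, Tm 2, Tm 3, Tm 5, Tm 6, Tm 13, Rp i, Ch i} s s'" "mem s' = m'" "rg s' (Rp i) = (if ?lt then S else nm y)"
 "rg s' (Ch i) = of_bool ?lt" "out s' = out s" "time s' <= time s + 14 * d + 40" for s'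
 by (rule Q) (use that ins rpi yx in auto)
 show ?thesis
 unfolding ilev_def
 apply (rule wp_Cond)
 apply (rule wp_Cons wp_ld wp_st)+
 apply (rule wp_cm[where x="pi x" and y="pi y"])
 subgoal by simp
 subgoal by simp
 subgoal premises pr using dg'(1) by (simp add: pr R S(3) m'_def n_def)
 subgoal premises pr using dg'(2) by (simp add: pr R S(3) m'_def n_def)
 subgoal premises pr for s1 s2 s3 s4 s5 s6
 proof -
 note E = pr(2-26) R S(3)
 have m6: "mem s6 = m'" using pr(28) by (simp add: E m'_def n_def)
 have f6: "frm {Tm 0, Tm 1, Tm 2, Tm 3, Tm 5, Tm 6, Tm 13} s s6" using pr(27) by (simp add: frm_def E)
 have t6: "time s6 <= time s + 14 * d + 25" "out s6 = out s" using pr(29,30) by (simp_all add: E)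
 have r6: "rg s6 (Tm 12) = S" "rg s6 (Rp i) = nm y" using f6 by (simp_all add: frm_def E)
 have c: "rg s6 (Tm 5) = 0 <-> ~ ?lt" by (simp add: pr(31))
 show ?thesis
 apply (rule wp_Cons, rule wp_Cond, unfold c not_not)
 subgoal by ((rule wp_Cons wp_Nil wp_const wp_mv fin)+, insert f6[unfolded frm_def] t6 r6, simp_all (no_asm_simp) add: frm_def m6 one_mod w0)
 subgoal by ((rule wp_Cons wp_Nil wp_const wp_mv fin)+, insert f6[unfolded frm_def] t6 r6, simp_all (no_asm_simp) add: frm_def m6 one_mod w0)
 done
 qed
 by (insert R S yS i ins(3), simp_all add: n_def)
qed

end

section \<open>Insertion of a vector\<close>

context store begin

text \<open>The stack pointer is known modulo 2^w only, because the address past the last slot may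
  be 2^w itself.\<close>

definition core where
 "core s Om nm <-> good (mem s) Om nm & freeok (mem s) Om nm & rg s Cnt = slot (card Om) mod 2 ^ w & card Om <= cap"

definition regs where
 "regs s Om nm x <-> rg s (Tm 12) = (if x : Om then nm x else 0) &
 (ALL i<=L. rg s (Rp i) = (if ce Om i x = {} then 0 else nm (rp Om i x)))"

definition args where
 "args s x <-> (ALL t<d. rg s (Crd t) = x ! t & rg s (Pri t) = pi x ! t)"

lemma K_less: "K < 2 ^ w"
proof -
 have "1 * K <= cap * K" using cap by (intro mult_le_mono1)
 moreover have "base + cap * K <= 2 ^ w" "0 < base" using fits by (auto simp: K_def base_def)
 ultimately show ?thesis by linarith
qed

lemma slot_lt: "k < cap ==> slot k < 2 ^ w"
 using slot_less slot_SL by blast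

definition alloc :: com where
 "alloc = seqs [ldf (Tm 12) Cnt Fr, Cond (tm 12) Skip (Bin Or (tm 12) (rn Cnt) (rn Cnt)), Const (tm 13) K, Bin Plus (rn Cnt) (rn Cnt) (tm 13)]"

lemma wp_alloc:
 assumes c: "core s Om nm" and n: "card Om < cap" and fin: "finite Om" and x: "x ~: Om"
 and Q: "!!s' S. frm {Tm 0, Tm 12, Tm 13, Cnt} s s' ==> mem s' = mem s ==> out s' = out s ==> time s' = time s + 9 ==> rg s' (Tm 12) = S ==>
 S : SL ==> S ~: nm ` Om ==> rg s' Cnt = slot (card (insert x Om)) mod 2 ^ w ==> freeok (mem s) (insert x Om) (nm(x := S)) ==> Q s'"
 shows "wp w alloc Q s"
proof -
 have Cnt: "rg s Cnt = slot (card Om)" using c slot_lt[OF n] by (simp add: core_def)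
 define S where "S = fa (mem s) (card Om)"
 have bij: "bij_betw (fa (mem s)) {card Om..<cap} (SL - nm ` Om)" using c by (simp add: core_def freeok_def)
 have SS: "S : SL - nm ` Om" 
 proof -
 have "card Om : {card Om..<cap}" using n by simp
 thus ?thesis unfolding S_def using bij_betwE[OF bij] by blast
 qed
 have "bij_betw (fa (mem s)) ({card Om..<cap} - {card Om}) ((SL - nm ` Om) - {S})"
 unfolding S_def using bij n SS[unfolded S_def] by (intro bij_betw_DiffI) auto
 moreover have "{card Om..<cap} - {card Om} = {card (insert x Om)..<cap}" using fin x by auto
 moreover have "(SL - nm ` Om) - {S} = SL - (nm(x := S)) ` insert x Om"
 proof -
 have "(nm(x := S)) ` Om = nm ` Om" using x by (intro image_cong) auto
 thus ?thesis by auto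
 qed
 ultimately have fr: "freeok (mem s) (insert x Om) (nm(x := S))" by (simp add: freeok_def)
 have S: "(if mem s (slot (card Om) + off Fr) = 0 then slot (card Om) else mem s (slot (card Om) + off Fr)) = S"
 by (simp add: S_def fa_def)
 have cnt': "(slot (card Om) + K) mod 2 ^ w = slot (card (insert x Om)) mod 2 ^ w"
 using fin x by (simp add: slot_def algebra_simps)
 show ?thesis
 unfolding alloc_def
 proof (rule wp_Cons, rule wp_ldf, goal_cases)
 case 1 show ?case using slot_bound[OF slot_SL[OF n], of Fr] by (simp add: Cnt)
 next case 2 show ?case by simp
 next
 case (3 s1)
 have s1: "rg s1 (Tm 12) = mem s (slot (card Om) + off Fr)" "rg s1 Cnt = slot (card Om)" using 3(1,2) Cnt by (auto simp: frm_def)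
 have rest: "wp w (seqs [Const (tm 13) K, Bin Plus (rn Cnt) (rn Cnt) (tm 13)]) Q s2"
 if s2: "frm {Tm 0, Tm 12} s s2" "mem s2 = mem s" "out s2 = out s" "time s2 = time s + 6" "rg s2 (Tm 12) = S" for s2
 apply (rule wp_Cons wp_Nil wp_const wp_bin Q[of _ S])+
 subgoal premises pr using s2 by (simp add: pr frm_def)
 subgoal premises pr using s2 by (simp add: pr)
 subgoal premises pr using s2 by (simp add: pr)
 subgoal premises pr using s2 by (simp add: pr)
 subgoal premises pr using s2 by (simp add: pr)
 subgoal premises pr using s2 SS by (simp add: pr)
 subgoal premises pr using s2 SS by (simp add: pr)
 subgoal premises pr using s2(1) Cnt cnt' by (simp add: pr frm_def mod_add_right_eq)
 subgoal premises pr using s2 fr by (simp add: pr)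
 done
 show ?case
 proof (rule wp_Cons, rule wp_Cond)
 assume z: "rg s1 (Tm 12) ~= 0"
 show "wp w Skip (wp w (seqs [Const (tm 13) K, Bin Plus (rn Cnt) (rn Cnt) (tm 13)]) Q) (tick s1)"
 by (rule wp_Skip, rule rest) (use 3 z S s1 in "simp_all add: frm_def")
 next
 assume z: "rg s1 (Tm 12) = 0"
 show "wp w (Bin Or (tm 12) (rn Cnt) (rn Cnt)) (wp w (seqs [Const (tm 13) K, Bin Plus (rn Cnt) (rn Cnt) (tm 13)]) Q) (tick s1)"
 by (rule wp_mv, rule rest) (use 3 z S s1 in "simp_all add: frm_def")
 qed
 qed
qed

definition icw where "icw t = seqs [stf (Tm 12) (Cf t) (Crd t), stf (Tm 12) (Pf t) (Pri t)]"

lemma wp_icw: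
 assumes S: "rg s (Tm 12) : SL" and a: "args s x" and x: "x : grid d D"
 and Q: "!!s'. frm {Tm 0} s s' ==> same {(rg s (Tm 12), f) |f. f ~= Fr} (mem s) (mem s') ==> coords (mem s') (rg s (Tm 12)) x ==>
 dig (mem s') (rg s (Tm 12)) (pi x) ==> out s' = out s ==> time s' = time s + 9 * d + 1 ==> Q s'"
 shows "wp w (seqs (map icw [0..<d])) Q s"
proof -
 let ?S = "rg s (Tm 12)"
 define I where "I n s' <-> frm {Tm 0} s s' & same {(?S, f) |f. f ~= Fr} (mem s) (mem s') &
 (ALL t<n. mem s' (?S + off (Cf t)) = x ! t & mem s' (?S + off (Pf t)) = pi x ! t) & out s' = out s & time s' = time s + 9 * n" for n s'
 show ?thesis
 proof (rule wp_loop[of I])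
 show "I 0 s" by (simp add: I_def frm_refl same_refl)
 next
 fix t s1 assume t: "t < d" and I: "I t s1"
 have r: "rg s1 (Tm 12) = ?S" "rg s1 (Crd t) = x ! t" "rg s1 (Pri t) = pi x ! t" using I a t by (auto simp: I_def frm_def args_def)
 show "wp w (icw t) (I (Suc t)) s1"
 unfolding icw_def
 proof (rule wp_Cons, rule wp_stf, goal_cases)
 case 1 show ?case using slot_bound[OF S, of "Cf t"] t by (simp add: r)
 next case 2 show ?case by simp next case 3 show ?case by simp
 next
 case (4 s2)
 have r2: "rg s2 (Tm 12) = ?S" "rg s2 (Pri t) = pi x ! t" using 4(1) r by (auto simp: frm_def)
 show ?case
 proof (rule wp_Cons, rule wp_stf, goal_cases)
 case 1 show ?case using slot_bound[OF S, of "Pf t"] t by (simp add: r2)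
 next case 2 show ?case by simp next case 3 show ?case by simp
 next
 case (4 s3)
 have m3: "mem s3 = (mem s1)(?S + off (Cf t) := x ! t, ?S + off (Pf t) := pi x ! t)" using 4(2) \<open>mem s2 = _\<close> by (simp add: r r2)
 have "same {(?S, f) |f. f ~= Fr} (mem s) (mem s3)"
 unfolding m3 by (intro same_upd' S) (use I t in "auto simp: I_def")
 moreover have "mem s3 (?S + off (Cf u)) = x ! u & mem s3 (?S + off (Pf u)) = pi x ! u" if u: "u < Suc t" for u
 proof -
 show ?thesis
 unfolding m3 using I u by (auto simp: off_eq I_def less_Suc_eq)
 qed
 moreover have "frm {Tm 0} s s3" using I 4(1) \<open>frm {Tm 0} s1 s2\<close> by (simp add: I_def frm_def)
 moreover have "out s3 = out s" "time s3 + 1 = time s + 9 * Suc t" using I 4(3,4) \<open>out s2 = _\<close> \<open>time s2 = _\<close> by (simp_all add: I_def)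
 ultimately show ?case by (intro wp_Nil) (simp add: I_def frm_def)
 qed
 qed
 next
 fix s1 assume I: "I d s1"
 have "pi x : grid d D" using pi x by (simp add: permutes_in_image)
 hence "coords (mem s1) ?S x" "dig (mem s1) ?S (pi x)" using I S x by (simp_all add: I_def coords_def dig_def)
 thus "Q (tick s1)" using I by (intro Q) (simp_all add: I_def frm_def)
 qed
qed

definition inw where
 "inw i = seqs [Bin Or (tm 7) (tm 12) (tm 12), fN i, fW i]"

lemma wp_inw:
 assumes S: "nm x : SL" "rg s (Tm 12) = nm x" and rc: "recs (mem s) Om nm" and x: "x : Om"
 and rp: "!!i. i <= L ==> rg s (Rp i) = nm (rp Om i x)"
 and Q: "!!s'. frm VS s s' ==> same {(nm x, f) |f. EX i. f = Nf i | f = Wf i} (mem s) (mem s') ==> ALL i<=L. okN (mem s') Om nm i x & okW (mem s') Om nm i x ==>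
 out s' = out s ==> time s' <= time s + (L + 1) * (14 * d + 18) + 1 ==> Q s'"
 shows "wp w (seqs (map inw [0..<Suc L])) Q s"
proof -
 let ?F = "{(nm x, f) |f. EX i. f = Nf i | f = Wf i}"
 have rpO: "rp Om i x : Om" for i using rp_cell[OF recs_fin[OF rc], of i x] cell_refl[OF x] cell_subset by blast
 define I where "I n s' <-> frm VS s s' & same ?F (mem s) (mem s') &
 (ALL i<n. okN (mem s') Om nm i x & okW (mem s') Om nm i x) & out s' = out s & time s' <= time s + n * (14 * d + 18)" for n s'
 show ?thesis
 proof (rule wp_loop[of I])
 show "I 0 s" by (simp add: I_def frm_refl same_refl)
 next
 fix i s1 assume i: "i < Suc L" and I: "I i s1"
 have r1: "rg s1 (Tm 12) = nm x" "!!j. j <= L ==> rg s1 (Rp j) = nm (rp Om j x)" using I S rp by (auto simp: I_def frm_def)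
 show "wp w (inw i) (I (Suc i)) s1"
 unfolding inw_def fN_def
 proof (rule wp_Cons, rule wp_mv, rule wp_Cons, rule wp_st, goal_cases)
 case (1 s2 s3)
 have m3: "mem s3 = (mem s1)(nm x + off (Nf i) := nm (rp Om i x))" using 1 i by (simp add: r1)
 have f3: "frm VS s s3" using I 1(1,4,6,9) by (simp add: I_def frm_def)
 have r3: "rg s3 (Tm 7) = nm x" "!!j. j <= L ==> rg s3 (Rp j) = nm (rp Om j x)" using 1(1,6) r1 by auto
 have sm3: "same ?F (mem s) (mem s3)" unfolding m3 by (intro same_upd' S(1)) (use I i in "auto simp: I_def")
 have ok3: "okN (mem s3) Om nm i x & (ALL j<i. okN (mem s3) Om nm j x & okW (mem s3) Om nm j x)"
 using I unfolding m3 by (simp add: okN_def okW_def I_def off_eq)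
 have rc3: "recs (mem s3) Om nm"
 using rc by (rule recs_same) (rule same_mono[OF sm3], auto simp: FX_def)
 show ?case
 unfolding fW_def
 proof (rule wp_Cons, rule wp_setW[where x="rp Om i x" and y="rp Om (i - 1) x"], goal_cases)
 case (8 s4)
 have m4: "mem s4 = (mem s3)(nm x + off (Wf i) := wdist p (rp Om i x) (rp Om (i - 1) x))" using 8 r3 by simp
 have "same ?F (mem s) (mem s4)" unfolding m4 by (intro same_upd' S(1) sm3) (use i in auto)
 moreover have "ALL j<Suc i. okN (mem s4) Om nm j x & okW (mem s4) Om nm j x"
 using ok3 unfolding m4 by (auto simp: okN_def okW_def off_eq less_Suc_eq)
 moreover have "frm VS s s4" using f3 8(1) by (simp add: frm_def)
 moreover have "out s4 = out s" "time s4 + 1 <= time s + Suc i * (14 * d + 18)" using I 1(3,5,8,10) 8 by (simp_all add: I_def)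
 ultimately show ?case by (intro wp_Nil) (simp add: I_def frm_def)
 qed (use rc3 rpO r3 S i in "auto simp: recs_def")
 qed (use S r1 i in simp_all)
 next
 fix s1 assume "I (Suc L) s1"
 thus "Q (tick s1)" by (intro Q) (simp_all add: I_def frm_def less_Suc_eq_le)
 qed
qed

text \<open>The loop shared by insertion and deletion. Treated levels have the rings of the new set
  and the others those of the old one; the levels do not interfere because each has its own link
  fields.\<close>

lemma wp_levels:
 assumes rings: "rings (mem s) Om nm"
 and body: "!!j s1 Q. j <= L ==> frm WR s s1 ==> same RX (mem s) (mem s1) ==> ringsAt (mem s1) Om nm j ==> rg s1 (Rp j) = rg s (Rp j) ==>
 (!!s2. frm (WR - {q. EX i. i ~= j & (q = Rp i | q = Ch i)}) s1 s2 ==> same {(a, f). f = Nx j | f = Pv j} (mem s1) (mem s2) ==> ringsAt (mem s2) Om' nm' j ==>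
 R j (rg s2 (Rp j)) (rg s2 (Ch j)) ==> out s2 = out s1 ==> time s2 <= time s1 + b j ==> Q s2) ==> wp w (f j) Q s1"
 and Q: "!!s'. frm WR s s' ==> same RX (mem s) (mem s') ==> rings (mem s') Om' nm' ==> (!!i. i <= L ==> R i (rg s' (Rp i)) (rg s' (Ch i))) ==>
 out s' = out s ==> time s' <= time s + (SUM j<=L. b j) + 1 ==> Q s'"
 shows "wp w (seqs (map f [0..<Suc L])) Q s"
proof -
 define I where "I j s' <-> frm WR s s' & same RX (mem s) (mem s') & out s' = out s & time s' <= time s + (SUM i<j. b i) &
 (ALL i<j. ringsAt (mem s') Om' nm' i & R i (rg s' (Rp i)) (rg s' (Ch i))) &
 (ALL i. j <= i & i <= L --> ringsAt (mem s') Om nm i & rg s' (Rp i) = rg s (Rp i))" for j s'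
 show ?thesis
 proof (rule wp_loop[of I])
 show "I 0 s" using rings by (simp add: I_def frm_refl same_refl rings_at)
 next
 fix j s1 assume j: "j < Suc L" and I: "I j s1"
 show "wp w (f j) (I (Suc j)) s1"
 proof (rule body, goal_cases)
 case (6 s2)
 have a: "frm WR s s2" by (rule frm_trans[OF _ 6(1)]) (use I in "auto simp: I_def")
 have b: "same RX (mem s) (mem s2)" by (rule same_trans[OF _ 6(2)]) (use I in "auto simp: I_def")
 have c: "ringsAt (mem s2) O' n' i" if "ringsAt (mem s1) O' n' i" "i <= L" "i ~= j" for O' n' i
 by (rule ringsAt_same[OF that(1,2) 6(2)]) (use that in simp)
 have e: "rg s2 (Rp i) = rg s1 (Rp i)" "rg s2 (Ch i) = rg s1 (Ch i)" if "i ~= j" for i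
 using 6(1) that by (simp_all add: frm_def)
 have "ringsAt (mem s2) Om' nm' i & R i (rg s2 (Rp i)) (rg s2 (Ch i))" if "i < Suc j" for i
 using that 6(3,4) I j c[of Om' nm' i] e[of i] by (cases "i = j") (auto simp: I_def)
 moreover have "ALL i. Suc j <= i & i <= L --> ringsAt (mem s2) Om nm i & rg s2 (Rp i) = rg s (Rp i)"
 using c[of Om nm] e I by (simp add: I_def)
 ultimately show ?case using a b 6(5,6) I by (simp add: I_def)
 qed (use I j in "auto simp: I_def")
 next
 fix s' assume I: "I (Suc L) s'"
 have "{..<Suc L} = {..L}" by auto
 with I show "Q (tick s')" by (intro Q) (simp_all add: I_def frm_def rings_at less_Suc_eq_le)
 qed
qed

end

context store begin

lemma changed_cong: "(!!i. i <= L ==> f i = g i) ==> changed f Om x = changed g Om x"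
 by (auto simp: changed_def)

text \<open>The representative of an old vector changes only if the new one takes over, and then the
  old vector lies in a cell that is flagged for repair.\<close>

lemma rp_insert_cases:
 assumes "Om <= grid d D" "x : grid d D" "z : Om"
 shows "rp (insert x Om) i z = rp Om i z | (rp (insert x Om) i x = x & z : ce (insert x Om) i x)"
proof (cases "lab i z = lab i x")
 case True
 have "rp (insert x Om) i z = rp (insert x Om) i x" "rp Om i z = rp Om i x" by (rule rep_cong[where lab=lab and i=i, OF True])+
 moreover have "z : ce (insert x Om) i x" using True assms(3) by (simp add: cell_def)
 ultimately show ?thesis using rp_insert[OF assms(1,2), of i] by (auto split: if_splits)
qed (use rp_insert_other in blast)

definition icore :: com where
 "icore = seqs [alloc, seqs (map icw [0..<d]), seqs (map ilev [0..<Suc L]), seqs (map inw [0..<Suc L]), finish]"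

lemma wp_icore:
 assumes c: "core s Om nm" and rg: "regs s Om nm x" and ar: "args s x" and x: "x : grid d D" "x ~: Om" and n: "card Om < cap"
 and Q: "!!s' S ws. frm (WR Un {Tm 12, Cnt}) s s' ==> core s' (insert x Om) (nm(x := S)) ==> regs s' (insert x Om) (nm(x := S)) x ==>
 out s' = out s @ ws ==> reported ws (mem s') (nm(x := S)) (changed (%i. rp (insert x Om) i x = x) (insert x Om) x) ==> S : SL ==>
 time s' <= time s + 40 + 9 * d + (L + 1) * (28 * d + 80) +
 cl (insert x Om) x * (69 + 15 * L + 34 * d) ==> Q s'"
 shows "wp w icore Q s"
proof -
 let ?O = "insert x Om"
 have g: "good (mem s) Om nm" using c by (simp add: core_def)
 have rc: "recs (mem s) Om nm" using g by (simp add: good_def)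
 have fin: "finite Om" by (rule recs_fin[OF rc])
 have Om: "Om <= grid d D" using rc by (simp add: recs_def)
 show ?thesis
 unfolding icore_def
 proof (rule wp_Cons, rule wp_alloc[OF c n fin x(2)], rule wp_Cons)
 fix s1 S assume s1: "frm {Tm 0, Tm 12, Tm 13, Cnt} s s1" "mem s1 = mem s" "out s1 = out s" "time s1 = time s + 9" "rg s1 (Tm 12) = S"
 "S : SL" "S ~: nm ` Om" "rg s1 Cnt = slot (card ?O) mod 2 ^ w" "freeok (mem s) ?O (nm(x := S))"
 let ?n = "nm(x := S)"
 have S12: "rg s1 (Tm 12) : SL" using s1 by simp
 have ar1: "args s1 x" using ar s1(1) by (simp add: args_def frm_def)
 show "wp w (seqs (map icw [0..<d])) (wp w (seqs [seqs (map ilev [0..<Suc L]), seqs (map inw [0..<Suc L]), finish]) Q) s1"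
 proof (rule wp_icw[OF S12 ar1 x(1)], rule wp_Cons)
 fix s2 assume "frm {Tm 0} s1 s2" "same {(rg s1 (Tm 12), f) |f. f ~= Fr} (mem s1) (mem s2)" "coords (mem s2) (rg s1 (Tm 12)) x"
 "dig (mem s2) (rg s1 (Tm 12)) (pi x)" "out s2 = out s1" "time s2 = time s1 + 9 * d + 1"
 hence s2: "frm {Tm 0} s1 s2" "same {(S, f) |f. f ~= Fr} (mem s) (mem s2)" "coords (mem s2) S x"
 "dig (mem s2) S (pi x)" "out s2 = out s1" "time s2 = time s1 + 9 * d + 1" by (simp_all add: s1)
 have f2: "frm (WR Un {Tm 12, Cnt}) s s2" by (rule frm_trans[OF s1(1) s2(1)]) auto
 have g2: "good (mem s2) Om nm" by (rule good_same[OF g s2(2)]) (use s1(7) in auto)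
 have rc2: "recs (mem s2) Om nm" and ri2: "rings (mem s2) Om nm" using g2 by (auto simp: good_def)
 have t2: "rg s2 (Tm 12) = S" using s1 s2(1) by (simp add: frm_def)
 have rp2: "rg s2 (Rp i) = (if ce Om i x = {} then 0 else nm (rp Om i x))" if "i <= L" for i
 using rg that s1(1) s2(1) by (simp add: regs_def frm_def)
 have inj: "inj_on nm Om" and SL: "nm ` Om <= SL" using rc recs_SL[OF rc] by (auto simp: recs_def)
 show "wp w (seqs (map ilev [0..<Suc L])) (wp w (seqs [seqs (map inw [0..<Suc L]), finish]) Q) s2"
 proof (rule wp_levels[where Om'="?O" and nm'="?n" and b="%_. 14 * d + 40" and
 R="%i r c. r = ?n (rp ?O i x) & c = of_bool (rp ?O i x = x)", OF ri2], goal_cases)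
 case (1 j s3 Q')
 have dgs: "dig (mem s3) S (pi x)" "!!z. z : Om ==> dig (mem s3) (nm z) (pi z)"
 using dig_same[OF _ 1(3)] s2(4) rc2 by (auto simp: recs_def)
 have t3: "rg s3 (Tm 12) = S" using 1(2) t2 by (simp add: frm_def)
 show ?case
 proof (rule wp_ilev[OF Om x inj 1(1,4) s1(6,7) t3 SL dgs], goal_cases)
 case (3 s4)
 show ?case by (rule 1(6)[OF frm_mono[OF 3(1)]]) (use 3 in auto)
 qed (use 1(5) rp2[OF 1(1)] in simp_all)
 next
 case (2 s3)
 note s3 = 2
 show ?case
 proof (rule wp_Cons)
 have rc3: "recs (mem s3) ?O ?n"
 unfolding recs_def
 proof (intro conjI ballI)
 show "?O <= grid d D" using Om x by simp
 show "inj_on ?n ?O" using rc s1(7) x(2) by (auto simp: recs_def inj_on_def)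
 show "tabs (mem s3)" using rc2 tabs_same[OF _ s3(2)] by (simp add: recs_def)
 fix z assume z: "z : ?O"
 have "coords (mem s2) (?n z) z" "dig (mem s2) (?n z) (pi z)" using z rc2 s2(3,4) x(2) by (auto simp: recs_def)
 thus "coords (mem s3) (?n z) z" "dig (mem s3) (?n z) (pi z)" using coords_same[OF _ s3(2)] dig_same[OF _ s3(2)] by auto
 qed
 have nx: "?n x : SL" "rg s3 (Tm 12) = ?n x" using s1(6) t2 s3(1) by (simp_all add: frm_def)
 show "wp w (seqs (map inw [0..<Suc L])) (wp w (seqs [finish]) Q) s3"
 proof (rule wp_inw[OF nx rc3 insertI1], goal_cases)
 case (1 i) thus ?case using s3(4) by simp
 next
 case (2 s4)
 have F4: "same FX (mem s3) (mem s4)" by (rule same_mono[OF 2(2)]) (auto simp: FX_def)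
 have r4: "rg s4 (Rp i) = ?n (rp ?O i x)" "rg s4 (Ch i) = of_bool (rp ?O i x = x)" if "i <= L" for i
 using s3(4)[OF that] 2(1) by (auto simp: frm_def)
 note ok4 = 2(3)
 have ne: "ce ?O i x ~= {}" for i using cell_refl[of x ?O lab i] by auto
 have pre: "pre s4 ?O ?n x"
 unfolding pre_def using recs_same[OF rc3 F4] rings_same[OF s3(3) F4] r4(1) ne by blast
 \<comment> \<open>So far only link fields of old records were written. Their addresses and weights
   are those of the old set, hence right wherever the representatives are unchanged.\<close>
 have old: "mem s4 (nm z + off f) = mem s (nm z + off f)" if z: "z : Om" and f: "vf f" "!!i. f ~= Nx i & f ~= Pv i" for z f
 proof -
 have zS: "nm z : SL" "nm z ~= S" using recs_SL[OF rc z] s1(7) z by auto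
 show ?thesis using sameD[OF 2(2) zS(1) f(1)] sameD[OF s3(2) zS(1) f(1)] sameD[OF s2(2) zS(1) f(1)] f(2) zS(2) by simp
 qed
 have nr: "?n (rp Om i z) = nm (rp Om i z)" if "z : Om" for i z
 proof -
 have "rp Om i z : Om" using rp_cell[OF fin, of i z] cell_refl[OF that] cell_subset by blast
 thus ?thesis using x(2) by auto
 qed
 have zx: "?n z = nm z" if "z : Om" for z using that x(2) by auto
 show ?case
 proof (rule wp_Cons, rule wp_finish[OF pre], goal_cases)
 case (1 z i)
 show ?case
 proof (cases "z = x")
 case False
 hence z: "z : Om" using 1 by simp
 have "mem s4 (nm z + off (Nf i)) = nm (rp Om i z)" using old[OF z, of "Nf i"] g 1 z by (simp add: good_def okN_def)
 hence "okN (mem s4) ?O ?n i z" if "rp ?O i z = rp Om i z" by (simp only: okN_def that nr[OF z] zx[OF z])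
 thus ?thesis using rp_insert_cases[OF Om x(1) z, of i] r4(2)[OF 1(2)] by auto
 qed (use ok4 1 in blast)
 next
 case (2 z i)
 show ?case
 proof (cases "z = x")
 case False
 hence z: "z : Om" using 2 by simp
 have "mem s4 (nm z + off (Wf i)) = wdist p (rp Om i z) (rp Om (i - 1) z)" using old[OF z, of "Wf i"] g 2 z by (simp add: good_def okW_def)
 hence "okW (mem s4) ?O ?n i z" if "rp ?O i z = rp Om i z" "rp ?O (i - 1) z = rp Om (i - 1) z" by (simp only: okW_def that zx[OF z])
 thus ?thesis using rp_insert_cases[OF Om x(1) z, of i] rp_insert_cases[OF Om x(1) z, of "i - 1"] r4(2)[of i] r4(2)[of "i - 1"] 2 by auto
 qed (use ok4 2 in blast)
 next
 case (3 s5 ws)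
 have same5: "freeok (mem s5) ?O ?n"
 proof -
 have "freeok (mem s2) ?O ?n" by (rule freeok_same[OF s1(9) s2(2)]) simp
 hence "freeok (mem s3) ?O ?n" by (rule freeok_same[OF _ s3(2)]) simp
 hence "freeok (mem s4) ?O ?n" by (rule freeok_same[OF _ F4]) (simp add: FX_def)
 thus ?thesis by (rule freeok_same[OF _ 3(2)]) (simp add: FX_def)
 qed
 have fr5: "frm VS s4 s5" by (rule 3(1))
 have fr: "frm WR s2 s5"
 by (rule frm_trans[OF s3(1) frm_trans[OF \<open>frm VS s3 s4\<close> fr5, of WR]]) auto
 show ?case
 proof (rule wp_Nil, rule Q[of _ S ws])
 fix s6 assume s6: "!!q. rg s6 q = rg s5 q" "mem s6 = mem s5" "out s6 = out s5" "inp s6 = inp s5" "time s6 = Suc (time s5)"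
 show "frm (WR Un {Tm 12, Cnt}) s s6" 
 proof -
 have "frm (WR Un {Tm 12, Cnt}) s s5" by (rule frm_trans[OF f2 fr]) auto
 thus ?thesis by (simp add: frm_def s6)
 qed
 have "rg s6 Cnt = slot (card ?O) mod 2 ^ w" using s1(8) s2(1) fr by (simp add: frm_def s6)
 moreover have "card ?O <= cap" using n fin x by simp
 ultimately show "core s6 ?O ?n" using 3(3) same5 by (simp add: core_def s6)
 have "rg s6 (Tm 12) = S" using t2 fr by (simp add: frm_def s6)
 moreover have "rg s6 (Rp i) = ?n (rp ?O i x)" if "i <= L" for i using r4[OF that] fr5 by (simp add: frm_def s6)
 ultimately show "regs s6 ?O ?n x" using ne by (simp add: regs_def)
 show "out s6 = out s @ ws" using 3(4) \<open>out s4 = out s3\<close> s3(5) s2(5) s1(3) by (simp add: s6)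
 have "changed (%i. rg s4 (Ch i) ~= 0) ?O x = changed (%i. rp ?O i x = x) ?O x"
 by (rule changed_cong) (simp add: r4)
 thus "reported ws (mem s6) ?n (changed (%i. rp ?O i x = x) ?O x)" using 3(5) by (simp add: s6)
 show "S : SL" by (rule s1(6))
 have "chs s4 ?O x = cl ?O x"
 using r4 by (intro sum.cong) auto
 hence "time s5 <= time s4 + 20 + 12 * L + cl ?O x * (69 + 15 * L + 34 * d)"
 using 3(6) by simp
 thus "time s6 <= time s + 40 + 9 * d + (L + 1) * (28 * d + 80) +
 cl ?O x * (69 + 15 * L + 34 * d)"
 using \<open>time s4 <= _\<close> s3(6) s2(6) s1(4) by (simp add: s6 algebra_simps)
 qed
 qed
 qed
 qed
 qed
 qed
 qed
qed

end

section \<open>Deletion of a vector\<close>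

context store begin

lemma cell_delete: "ce (Om - {x}) i z = ce Om i z - {x}"
 by (auto simp: cell_def)

lemma rp_delete:
 assumes fin: "finite Om" and Om: "Om <= grid d D" and x: "x : Om" and ne: "rp Om i x ~= x"
 shows "rp (Om - {x}) i x = rp Om i x"
proof (rule rep_eqI)
 have c: "ce Om i x ~= {}" using cell_refl[of x Om lab i] x by auto
 show "rp Om i x : ce (Om - {x}) i x" using rp_cell[OF fin c] ne by (simp add: cell_delete)
 show "inj_on pr (Om - {x})" by (rule inj_on_subset[OF pr_inj]) (use Om in auto)
 fix y assume "y : ce (Om - {x}) i x"
 thus "pr (rp Om i x) <= pr y" using rep_min[OF fin, of y lab i x pr] by (simp add: cell_delete)
qed (use fin in simp)

lemma rp_delete_cases:
 assumes fin: "finite Om" and Om: "Om <= grid d D" and x: "x : Om" and z: "z : Om - {x}"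
 shows "rp (Om - {x}) i z = rp Om i z | (rp Om i x = x & z : ce (Om - {x}) i x)"
proof (cases "lab i z = lab i x")
 case True
 have "rp (Om - {x}) i z = rp (Om - {x}) i x" "rp Om i z = rp Om i x" by (rule rep_cong[where lab=lab and i=i, OF True])+
 moreover have "z : ce (Om - {x}) i x" using True z by (simp add: cell_def)
 ultimately show ?thesis using rp_delete[OF fin Om x, of i] by auto
next
 case False
 hence "ce (Om - {x}) i z = ce Om i z" by (auto simp: cell_def)
 thus ?thesis by (simp add: rep_def)
qed

text \<open>A record that is its own successor was alone, and its cell vanishes. Otherwise unlinking
  leaves a ring starting at the successor, which is where the search for a new minimum
  begins.\<close>

lemma ringsAt_delete:
 assumes r: "ringsAt m Om nm i" and i: "i <= L" and x: "x : Om" and inj: "inj_on nm Om" and SL: "nm ` Om <= SL"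
 and S: "S = nm x" and n: "n = m (S + off (Nx i))" and q: "q = m (S + off (Pv i))"
 and m': "m' = m(q + off (Nx i) := n, n + off (Pv i) := q)"
 shows "n = S <-> ce (Om - {x}) i x = {}" "n = S ==> ringsAt m (Om - {x}) nm i"
 "n ~= S ==> n : SL & q : SL & ringsAt m' (Om - {x}) nm i & same {(a, f). f = Nx i | f = Pv i} m m' &
 (EX l. ring m' i l & hd l = n & set l = nm ` ce (Om - {x}) i x)"
proof -
 obtain l0 where l0: "ring m i l0" "set l0 = nm ` ce Om i x" using r x by (metis ringsAt_def)
 then obtain l where l: "ring m i (S # l)" "set (S # l) = nm ` ce Om i x"
 using ring_start[OF l0(1), of S] cell_refl[OF x, of lab i] S by (metis imageI)
 have dis: "distinct (S # l)" using l(1) by (simp add: ring_def)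
 have sl: "set l = nm ` ce (Om - {x}) i x"
 proof -
 have "set l = set (S # l) - {S}" using dis by auto
 also have "... = nm ` ce Om i x - nm ` {x}" using l(2) S by simp
 also have "... = nm ` (ce Om i x - {x})" 
 by (rule inj_on_image_set_diff[OF inj, symmetric]) (use x in "auto simp: cell_def")
 finally show ?thesis by (simp add: cell_delete)
 qed
 have n0: "n = (l @ [S]) ! 0" using ring_next[OF l(1), of 0] by (simp add: n)
 have nl: "n = S <-> l = []" using n0 dis by (cases l) auto
 show "n = S <-> ce (Om - {x}) i x = {}" using nl sl by auto
 have other: "EX l. ring m i l & set l = nm ` ce (Om - {x}) i z & set l Int nm ` ce Om i x = {}" if z: "z : Om - {x}" "lab i z ~= lab i x" for z
 proof -
 have "ce (Om - {x}) i z = ce Om i z" "ce Om i z Int ce Om i x = {}" using z by (auto simp: cell_def)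
 moreover have "nm ` ce Om i z Int nm ` ce Om i x = nm ` (ce Om i z Int ce Om i x)"
 by (rule inj_on_image_Int[OF inj, symmetric]) (auto simp: cell_def)
 moreover obtain lz where "ring m i lz" "set lz = nm ` ce Om i z" using r z by (auto simp: ringsAt_def)
 ultimately show ?thesis by (intro exI[of _ lz]) simp
 qed
 {
 assume "n = S"
 hence e: "ce (Om - {x}) i x = {}" using nl sl by auto
 show "ringsAt m (Om - {x}) nm i"
 unfolding ringsAt_def
 proof
 fix z assume z: "z : Om - {x}"
 hence "lab i z ~= lab i x" using e by (auto simp: cell_def)
 thus "EX l. ring m i l & set l = nm ` ce (Om - {x}) i z" using other[OF z] by blast
 qed
 }
 {
 assume "n ~= S"
 hence le: "l ~= []" using nl by simp
 have del: "ring m' i l" "n = hd l" "q = last l" using ring_delete[OF l(1) le i] by (simp_all add: m' n q)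
 have nq: "n : set l" "q : set l" using del le by simp_all
 have lS: "set l <= SL" using l(1) by (simp add: ring_def)
 have nS: "n : SL" "q : SL" using nq lS by auto
 let ?X = "{(a, f). (f = Nx i | f = Pv i) & a : nm ` ce Om i x}"
 have sm: "same ?X m m'"
 unfolding m' by (intro same_upd' same_refl nS) (use i nq l(2) in auto)
 have "ringsAt m' (Om - {x}) nm i"
 unfolding ringsAt_def
 proof
 fix z assume z: "z : Om - {x}"
 show "EX l. ring m' i l & set l = nm ` ce (Om - {x}) i z"
 proof (cases "lab i z = lab i x")
 case True
 hence "ce (Om - {x}) i z = ce (Om - {x}) i x" by (rule cell_cong)
 thus ?thesis using del(1) sl by auto
 next
 case False
 then obtain lz where lz: "ring m i lz" "set lz = nm ` ce (Om - {x}) i z" "set lz Int nm ` ce Om i x = {}" using other[OF z] by blast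
 have "ring m' i lz" by (rule ring_same[OF lz(1) i sm]) (use lz(3) in auto)
 thus ?thesis using lz(2) by blast
 qed
 qed
 moreover have "same {(a, f). f = Nx i | f = Pv i} m m'" by (rule same_mono[OF sm]) auto
 ultimately show "n : SL & q : SL & ringsAt m' (Om - {x}) nm i & same {(a, f). f = Nx i | f = Pv i} m m' &
 (EX l. ring m' i l & hd l = n & set l = nm ` ce (Om - {x}) i x)"
 using nS del sl by blast
 }
qed

text \<open>\<open>Xor\<close> serves twice as a test for inequality: of the successor and of the
  representative with the record removed. A cell is searched for a new minimum only if x represented
  it, so the cost is charged to the load of x.\<close>

definition dlev where
 "dlev i = seqs [ldf (Tm 13) (Tm 12) (Nx i), Bin Xor (tm 14) (tm 13) (tm 12),
 Cond (tm 14)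
 (seqs [ldf (Tm 14) (Tm 12) (Pv i), stf (Tm 14) (Nx i) (Tm 13), stf (Tm 13) (Pv i) (Tm 14), Bin Xor (tm 14) (rn (Rp i)) (tm 12),
 Cond (tm 14) (Const (rn (Ch i)) 0)
 (seqs [ringmin (Tm 13) i, Bin Or (rn (Rp i)) (tm 11) (tm 11), Const (rn (Ch i)) 1])])
 (seqs [Const (rn (Rp i)) 0, Const (rn (Ch i)) 0])]"

lemma wp_dlev:
 assumes Om: "Om <= grid d D" "x : Om" and inj: "inj_on nm Om" and i: "i <= L"
 and r: "ringsAt (mem s) Om nm i" and S: "rg s (Tm 12) = nm x" and SL: "nm ` Om <= SL"
 and dg: "!!z. z : Om ==> dig (mem s) (nm z) (pi z)"
 and rp: "rg s (Rp i) = nm (rp Om i x)"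
 and Q: "!!s'. frm {Tm 0, Tm 1, Tm 2, Tm 3, Tm 5, Tm 6, Tm 7, Tm 8, Tm 11, Tm 13, Tm 14, Rp i, Ch i} s s' ==>
 same {(a, f). f = Nx i | f = Pv i} (mem s) (mem s') ==> ringsAt (mem s') (Om - {x}) nm i ==>
 rg s' (Rp i) = (if ce (Om - {x}) i x = {} then 0 else nm (rp (Om - {x}) i x)) ==>
 rg s' (Ch i) = of_bool (rp Om i x = x & ce (Om - {x}) i x ~= {}) ==> out s' = out s ==>
 time s' <= time s + 40 + of_bool (rp Om i x = x) * card (ce Om i x) * (14 * d + 13) ==> Q s'"
 shows "wp w (dlev i) Q s"
proof -
 let ?O = "Om - {x}"
 have fin: "finite Om" using Om(1) finite_grid finite_subset by blast
 have xS: "nm x : SL" using SL Om by blast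
 define n where "n = mem s (nm x + off (Nx i))"
 define q where "q = mem s (nm x + off (Pv i))"
 define m' where "m' = (mem s)(q + off (Nx i) := n, n + off (Pv i) := q)"
 note del = ringsAt_delete[OF r i Om(2) inj SL refl n_def q_def m'_def]
 have rO: "rp Om i x : Om"
 proof -
 have "ce Om i x ~= {}" using cell_refl[OF Om(2), of lab i] by auto
 thus ?thesis using rp_cell[OF fin] cell_subset by blast
 qed
 show ?thesis
 unfolding dlev_def
 proof (rule wp_Cons, rule wp_ld, rule wp_Cons, rule wp_bin, rule wp_Cons, goal_cases)
 case (1 s1 s2)
 have z14: "rg s2 (Tm 14) = 0 <-> n = nm x" using 1 S by (simp add: xor_zero_iff n_def)
 show ?case
 proof (rule wp_Cond)
 assume "rg s2 (Tm 14) = 0"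
 hence e: "ce ?O i x = {}" "ringsAt (mem s) ?O nm i" using z14 del(1,2) by auto
 show "wp w (seqs [Const (rn (Rp i)) 0, Const (rn (Ch i)) 0]) (wp w (seqs []) Q) (tick s2)"
 by ((rule wp_Cons wp_Nil wp_const Q)+, insert e, simp_all (no_asm_simp) add: 1 frm_def same_refl)
 next
 assume "rg s2 (Tm 14) ~= 0"
 hence ne: "n ~= nm x" using z14 by simp
 have nS: "n : SL" "q : SL" and ri: "ringsAt m' ?O nm i" and sm: "same {(a, f). f = Nx i | f = Pv i} (mem s) m'"
 using del(3)[OF ne] by auto
 obtain l where l: "ring m' i l" "hd l = n" "set l = nm ` ce ?O i x" using del(3)[OF ne] by blast
 have cne: "ce ?O i x ~= {}" using del(1) ne by simp
 show "wp w (seqs [ldf (Tm 14) (Tm 12) (Pv i), stf (Tm 14) (Nx i) (Tm 13), stf (Tm 13) (Pv i) (Tm 14), Bin Xor (tm 14) (rn (Rp i)) (tm 12),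
 Cond (tm 14) (Const (rn (Ch i)) 0)
 (seqs [ringmin (Tm 13) i, Bin Or (rn (Rp i)) (tm 11) (tm 11), Const (rn (Ch i)) 1])]) (wp w (seqs []) Q) (tick s2)"
 proof (rule wp_Cons, rule wp_ld, rule wp_Cons, rule wp_st, rule wp_Cons, rule wp_st, rule wp_Cons, rule wp_bin, rule wp_Cons, goal_cases)
 case (1 s3 s4 s5 s6)
 note E = 1 \<open>!!q. q ~= Tm 0 ==> rg s1 q = _ q\<close> \<open>mem s1 = _\<close> \<open>out s1 = _\<close> \<open>inp s1 = _\<close> \<open>time s1 = _\<close>
 \<open>!!q. rg s2 q = _ q\<close> \<open>mem s2 = _\<close> \<open>out s2 = _\<close> \<open>inp s2 = _\<close> \<open>time s2 = _\<close> S rp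
 have f6: "frm {Tm 0, Tm 13, Tm 14} s s6" by (simp add: frm_def E)
 have m6: "mem s6 = m'" by (simp add: E m'_def n_def q_def)
 have t6: "time s6 = time s + 19" "out s6 = out s" by (simp_all add: E)
 have r6: "rg s6 (Tm 13) = n" "rg s6 (Rp i) = nm (rp Om i x)" by (simp_all add: E n_def)
 have "nm (rp Om i x) = nm x <-> rp Om i x = x" using inj rO Om(2) by (auto dest: inj_onD)
 hence c: "rg s6 (Tm 14) = 0 <-> rp Om i x = x" by (simp add: E xor_zero_iff)
 show ?case
 proof (rule wp_Cond, unfold c)
 assume ne: "rp Om i x ~= x"
 show "wp w (Const (rn (Ch i)) 0) (wp w (seqs []) (wp w (seqs []) Q)) (tick s6)"
 by ((rule wp_Cons wp_Nil wp_const Q)+, insert f6[unfolded frm_def] r6 t6 ne cne sm ri rp_delete[OF fin Om ne],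
 simp_all (no_asm_simp) add: frm_def m6)
 next
 assume eq: "rp Om i x = x"
 \<comment> \<open>The search compares records by address; this attaches to an address the priority
   of its vector.\<close>
 define zz where "zz a = pi (inv_into Om nm a)" for a
 have zz: "zz (nm u) = pi u" if "u : Om" for u using inj that by (simp add: zz_def inv_into_f_f)
 have uO: "v : ce ?O i x ==> v : Om" for v by (auto simp: cell_def)
 have dg6: "dig (mem (tick s6)) a (zz a)" if al: "a : set l" for a
 proof -
 obtain u where u: "u : ce ?O i x" "a = nm u" using al l(3) by auto
 have "dig m' (nm u) (pi u)" by (rule dig_same[OF dg[OF uO[OF u(1)]] sm]) simp
 thus ?thesis using u zz[OF uO[OF u(1)]] by (simp add: m6)
 qed
 show "wp w (seqs [ringmin (Tm 13) i, Bin Or (rn (Rp i)) (tm 11) (tm 11), Const (rn (Ch i)) 1]) (wp w (seqs []) (wp w (seqs []) Q)) (tick s6)"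
 proof (rule wp_Cons, rule wp_ringmin[where l=l and zz=zz], goal_cases)
 case (6 s7)
 obtain u where u: "u : ce ?O i x" "rg s7 (Tm 11) = nm u" using 6(4) l(3) by auto
 have "rp ?O i x = u"
 proof (rule rep_eqI[OF _ _ u(1)])
 show "inj_on pr ?O" by (rule inj_on_subset[OF pr_inj]) (use Om in auto)
 fix y assume y: "y : ce ?O i x"
 have "key D (zz (nm u)) <= key D (zz (nm y))" using 6(5)[of "nm y"] y l(3) u(2) by auto
 thus "pr u <= pr y" using zz uO u(1) y by simp
 qed (use fin in simp)
 hence R: "rg s7 (Tm 11) = nm (rp ?O i x)" using u by simp
 have "length l = card (nm ` ce ?O i x)" using l(1,3) distinct_card[of l] by (simp add: ring_def)
 also have "... <= card (ce ?O i x)" by (rule card_image_le) (simp add: finite_cell fin)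
 also have "... <= card (ce Om i x)" by (rule card_mono) (auto simp: finite_cell fin cell_delete)
 finally have len: "length l <= card (ce Om i x)" .
 have "time (tick s6) = time s + 20" by (simp add: t6)
 with 6(6) mult_le_mono1[OF len, of "14 * d + 13"] have t7: "time s7 <= time s + 23 + card (ce Om i x) * (14 * d + 13)" by linarith
 have f7: "frm {Tm 0, Tm 1, Tm 2, Tm 3, Tm 5, Tm 6, Tm 7, Tm 8, Tm 11, Tm 13, Tm 14} s s7"
 using f6 6(1) by (simp add: frm_def)
 have m7: "mem s7 = m'" "out s7 = out s" using 6(2,3) by (simp_all add: m6 t6)
 show ?case
 by ((rule wp_Cons wp_Nil wp_const wp_mv Q)+, insert f7[unfolded frm_def] R t7 cne sm ri,
 simp_all (no_asm_simp) add: frm_def m7 eq one_mod w0)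
 qed (use l i dg6 in "simp_all add: m6 r6")
 qed
 qed (use nS xS 1 S i in "simp_all add: n_def q_def")
 qed
 qed (use xS S i in simp_all)
qed

definition dfree :: com where
 "dfree = seqs [Const (tm 13) K, Bin Minus (rn Cnt) (rn Cnt) (tm 13), stf Cnt Fr (Tm 12)]"

lemma wp_dfree:
 assumes c: "core s Om nm" and x: "x : Om" and S: "rg s (Tm 12) = nm x"
 and Q: "!!s'. frm {Tm 0, Tm 13, Cnt} s s' ==> same {(a, Fr) |a. True} (mem s) (mem s') ==> freeok (mem s') (Om - {x}) nm ==>
 rg s' Cnt = slot (card (Om - {x})) mod 2 ^ w ==> out s' = out s ==> time s' = time s + 7 ==> Q s'"
 shows "wp w dfree Q s"
proof -
 have rc: "recs (mem s) Om nm" using c by (simp add: core_def good_def)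
 have fin: "finite Om" by (rule recs_fin[OF rc])
 have xS: "nm x : SL" by (rule recs_SL[OF rc x])
 obtain k where k: "card Om = Suc k" using fin x by (metis card_gt_0_iff empty_iff gr0_implies_Suc)
 have k': "card (Om - {x}) = k" "k < cap" using k x c by (simp_all add: core_def)
 have sl: "slot k < 2 ^ w" by (rule slot_lt[OF k'(2)])
 have Cnt: "(rg s Cnt + (2 ^ w - K mod 2 ^ w)) mod 2 ^ w = slot k"
 proof -
 have "rg s Cnt = (slot k + K) mod 2 ^ w" using c k by (simp add: core_def slot_def algebra_simps)
 hence "(rg s Cnt + (2 ^ w - K mod 2 ^ w)) mod 2 ^ w = ((slot k + K) mod 2 ^ w + (2 ^ w - K)) mod 2 ^ w"
 using K_less by simp
 also have "... = (slot k + K + (2 ^ w - K)) mod 2 ^ w" by (rule mod_add_left_eq)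
 also have "slot k + K + (2 ^ w - K) = slot k + 2 ^ w" using K_less by simp
 finally show ?thesis using sl by simp
 qed
 have "rg s Cnt + (2 ^ w - K mod 2 ^ w) = rg s Cnt + 2 ^ w - K mod 2 ^ w" by simp
 hence Cnt': "(rg s Cnt + 2 ^ w - K mod 2 ^ w) mod 2 ^ w = slot k" using Cnt by (simp only:)
 define m' where "m' = (mem s)(slot k + off Fr := nm x)"
 have sm: "same {(a, Fr) |a. True} (mem s) m'" unfolding m'_def
 by (intro same_upd' same_refl slot_SL k'(2)) auto
 \<comment> \<open>The pushed address is positive, so it cannot be mistaken for an entry that was
   never written.\<close>
 have fk: "fa m' k = nm x" using slot_pos[OF xS] by (simp add: fa_def m'_def)
 have fo: "fa m' j = fa (mem s) j" if "j : {card Om..<cap}" for j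
 proof -
 have "slot j + off Fr ~= slot k + off Fr" using that k slot_inj by simp
 thus ?thesis by (simp add: fa_def m'_def)
 qed
 have bij: "bij_betw (fa m') {card Om..<cap} (SL - nm ` Om)"
 using c fo bij_betw_cong[of "{card Om..<cap}" "fa m'" "fa (mem s)"] by (simp add: core_def freeok_def)
 have "bij_betw (fa m') ({card Om..<cap} Un {k}) ((SL - nm ` Om) Un {fa m' k})"
 by (rule notIn_Un_bij_betw[OF _ _ bij]) (use k x fk in auto)
 moreover have "{card Om..<cap} Un {k} = {card (Om - {x})..<cap}" unfolding k'(1) using k k'(2) by auto
 moreover have "(SL - nm ` Om) Un {fa m' k} = SL - nm ` (Om - {x})"
 proof -
 have "inj_on nm Om" using rc by (simp add: recs_def)
 hence "nm ` (Om - {x}) = nm ` Om - {nm x}" using x by (subst inj_on_image_set_diff) auto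
 thus ?thesis using fk xS x by auto
 qed
 ultimately have fr: "freeok m' (Om - {x}) nm" unfolding freeok_def by simp
 have bd: "(slot k + off Fr mod 2 ^ w) mod 2 ^ w = slot k + off Fr" using slot_bound[OF slot_SL[OF k'(2)], of Fr] by (simp add: mod_add_right_eq)
 show ?thesis
 unfolding dfree_def stf_def
 apply (rule wp_Cons wp_Nil wp_const wp_bin wp_store Q)+
 subgoal premises pr by (simp add: pr frm_def)
 subgoal premises pr using sm by (simp add: pr Cnt' S bd m'_def)
 subgoal premises pr using fr by (simp add: pr Cnt' S bd m'_def)
 subgoal premises pr unfolding k' using sl by (simp add: pr Cnt')
 subgoal premises pr by (simp add: pr)
 subgoal premises pr by (simp add: pr)
 done
qed

definition dcore :: com where
 "dcore = seqs [dfree, seqs (map dlev [0..<Suc L]), finish, Const (tm 12) 0]"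

lemma wp_dcore:
 assumes c: "core s Om nm" and rg: "regs s Om nm x" and x: "x : Om"
 and Q: "!!s' ws. frm (WR Un {Tm 12, Cnt}) s s' ==> core s' (Om - {x}) nm ==> regs s' (Om - {x}) nm x ==>
 out s' = out s @ ws ==> reported ws (mem s') nm (changed (%i. rp Om i x = x) (Om - {x}) x) ==>
 time s' <= time s + 40 + (L + 1) * 80 +
 cl Om x * (82 + 15 * L + 48 * d) ==> Q s'"
 shows "wp w dcore Q s"
proof -
 let ?O = "Om - {x}"
 have g: "good (mem s) Om nm" using c by (simp add: core_def)
 have rc: "recs (mem s) Om nm" using g by (simp add: good_def)
 have fin: "finite Om" by (rule recs_fin[OF rc])
 have Om: "Om <= grid d D" using rc by (simp add: recs_def)
 have ne: "ce Om i x ~= {}" for i using cell_refl[OF x, of lab i] by auto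
 have S: "rg s (Tm 12) = nm x" using rg x by (simp add: regs_def)
 show ?thesis
 unfolding dcore_def
 proof (rule wp_Cons, rule wp_dfree[OF c x S], rule wp_Cons)
 fix s1 assume s1: "frm {Tm 0, Tm 13, Cnt} s s1" "same {(a, Fr) |a. True} (mem s) (mem s1)" "freeok (mem s1) ?O nm"
 "rg s1 Cnt = slot (card ?O) mod 2 ^ w" "out s1 = out s" "time s1 = time s + 7"
 have g1: "good (mem s1) Om nm" by (rule good_same[OF g s1(2)]) auto
 have rc1: "recs (mem s1) Om nm" and ri1: "rings (mem s1) Om nm" using g1 by (auto simp: good_def)
 have S1: "rg s1 (Tm 12) = nm x" using S s1(1) by (simp add: frm_def)
 have rp1: "rg s1 (Rp i) = nm (rp Om i x)" if "i <= L" for i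
 using rg that s1(1) ne by (simp add: regs_def frm_def)
 have inj: "inj_on nm Om" and SL: "nm ` Om <= SL" using rc recs_SL[OF rc] by (auto simp: recs_def)
 show "wp w (seqs (map dlev [0..<Suc L])) (wp w (seqs [finish, Const (tm 12) 0]) Q) s1"
 proof (rule wp_levels[where Om'="?O" and nm'=nm and b="%i. 40 + of_bool (rp Om i x = x) * card (ce Om i x) * (14 * d + 13)" and
 R="%i r c. r = (if ce ?O i x = {} then 0 else nm (rp ?O i x)) & c = of_bool (rp Om i x = x & ce ?O i x ~= {})", OF ri1], goal_cases)
 case (1 j s2 Q')
 have dgs: "!!z. z : Om ==> dig (mem s2) (nm z) (pi z)" using dig_same[OF _ 1(3)] rc1 by (auto simp: recs_def)
 have t2: "rg s2 (Tm 12) = nm x" using 1(2) S1 by (simp add: frm_def)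
 show ?case
 proof (rule wp_dlev[OF Om x inj 1(1,4) t2 SL dgs], goal_cases)
 case (3 s4)
 show ?case by (rule 1(6)[OF frm_mono[OF 3(1)]]) (use 3 in auto)
 qed (use 1(5) rp1[OF 1(1)] in simp_all)
 next
 case (2 s2)
 note s2 = 2
 have t2: "time s2 <= time s1 + (L + 1) * 40 + cl Om x * (14 * d + 13) + 1"
 using 2(6) by (simp only: sum.distrib sum_distrib_right[symmetric]) simp
 show ?case
 proof (rule wp_Cons)
 have rc2: "recs (mem s2) ?O nm"
 unfolding recs_def
 proof (intro conjI ballI)
 show "?O <= grid d D" using Om by auto
 show "inj_on nm ?O" by (rule inj_on_subset[of nm Om]) (use rc in "auto simp: recs_def")
 show "tabs (mem s2)" using rc1 tabs_same[OF _ s2(2)] by (simp add: recs_def)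
 fix z assume "z : ?O"
 hence "coords (mem s1) (nm z) z" "dig (mem s1) (nm z) (pi z)" using rc1 by (auto simp: recs_def)
 thus "coords (mem s2) (nm z) z" "dig (mem s2) (nm z) (pi z)" using coords_same[OF _ s2(2)] dig_same[OF _ s2(2)] by auto
 qed
 have pre: "pre s2 ?O nm x"
 unfolding pre_def using rc2 s2(3,4) by (auto split: if_splits)
 have old: "mem s2 (nm z + off f) = mem s (nm z + off f)" if z: "z : Om" and f: "vf f" "f ~= Fr" "!!i. f ~= Nx i & f ~= Pv i" for z f
 using sameD[OF s2(2) recs_SL[OF rc z] f(1)] sameD[OF s1(2) recs_SL[OF rc z] f(1)] f by simp
 have chc: "rg s2 (Ch i) ~= 0 & z : ce ?O i x" if "rp Om i x = x" "z : ce ?O i x" "i <= L" for i z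
 using s2(4)[OF that(3)] that by auto
 show "wp w finish (wp w (seqs [Const (tm 12) 0]) Q) s2"
 proof (rule wp_finish[OF pre], goal_cases)
 case (1 z i)
 have "mem s2 (nm z + off (Nf i)) = nm (rp Om i z)" using old[of z "Nf i"] g 1 by (simp add: good_def okN_def)
 hence "okN (mem s2) ?O nm i z" if "rp ?O i z = rp Om i z" by (simp only: okN_def that)
 thus ?case using rp_delete_cases[OF fin Om x 1(1), of i] chc[of i z] 1(2) by blast
 next
 case (2 z i)
 have "mem s2 (nm z + off (Wf i)) = wdist p (rp Om i z) (rp Om (i - 1) z)" using old[of z "Wf i"] g 2 by (simp add: good_def okW_def)
 hence "okW (mem s2) ?O nm i z" if "rp ?O i z = rp Om i z" "rp ?O (i - 1) z = rp Om (i - 1) z" by (simp only: okW_def that)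
 moreover have "i - 1 <= L" using 2(2) by simp
 ultimately show ?case
 using rp_delete_cases[OF fin Om x 2(1), of i] rp_delete_cases[OF fin Om x 2(1), of "i - 1"] chc[of i z] chc[of "i - 1" z] 2(2) by blast
 next
 case (3 s3 ws)
 have fr3: "freeok (mem s3) ?O nm"
 proof -
 have "freeok (mem s2) ?O nm" by (rule freeok_same[OF s1(3) s2(2)]) simp
 thus ?thesis by (rule freeok_same[OF _ 3(2)]) (simp add: FX_def)
 qed
 have f3: "frm WR s1 s3" by (rule frm_trans[OF s2(1) 3(1)]) auto
 have f: "frm (WR Un {Tm 12, Cnt}) s s3" by (rule frm_trans[OF s1(1) f3]) auto
 show ?case
 proof (rule wp_Cons, rule wp_const, rule wp_Nil, rule Q[of _ ws])
 fix s4 s5 assume s4: "!!q. rg s4 q = (if q = Tm 12 then 0 mod 2 ^ w else rg s3 q)" "mem s4 = mem s3" "out s4 = out s3" "inp s4 = inp s3" "time s4 = Suc (time s3)"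
 and s5: "!!q. rg s5 q = rg s4 q" "mem s5 = mem s4" "out s5 = out s4" "inp s5 = inp s4" "time s5 = Suc (time s4)"
 show "frm (WR Un {Tm 12, Cnt}) s s5" using f by (simp add: frm_def s4 s5)
 have "rg s5 Cnt = slot (card ?O) mod 2 ^ w" using s1(4) f3 by (simp add: frm_def s4 s5)
 moreover have "card ?O <= cap" using c fin card_Diff1_le[of Om x] by (simp add: core_def)
 ultimately show "core s5 ?O nm" using 3(3) fr3 by (simp add: core_def s4 s5)
 have "rg s5 (Rp i) = rg s2 (Rp i)" for i using 3(1) by (simp add: frm_def s4 s5)
 thus "regs s5 ?O nm x" using s2(4) by (simp add: regs_def s4 s5)
 show "out s5 = out s @ ws" using 3(4) s2(5) s1(5) by (simp add: s4 s5)
 have "changed (%i. rg s2 (Ch i) ~= 0) ?O x = changed (%i. rp Om i x = x) ?O x"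
 unfolding changed_def using s2(4) by fastforce
 thus "reported ws (mem s5) nm (changed (%i. rp Om i x = x) ?O x)" using 3(5) by (simp add: s4 s5)
 have "chs s2 ?O x <= cl Om x"
 proof (intro sum_mono mult_mono)
 fix i assume "i : {..L}"
 thus "of_bool (rg s2 (Ch i) ~= 0) <= (of_bool (rp Om i x = x) :: nat)" using s2(4)[of i] by auto
 show "card (ce ?O i x) <= card (ce Om i x)" by (rule card_mono) (auto simp: finite_cell fin cell_delete)
 qed auto
 from mult_le_mono1[OF this, of "69 + 15 * L + 34 * d"]
 have t: "time s3 <= time s2 + 20 + 12 * L + cl Om x * (69 + 15 * L + 34 * d)"
 using 3(6) by linarith
 show "time s5 <= time s + 40 + (L + 1) * 80 +
 cl Om x * (82 + 15 * L + 48 * d)"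
 using t t2 s1(6) unfolding s4 s5 by (simp add: algebra_simps)
 qed
 qed
 qed
 qed
 qed
qed

end

section \<open>Decision trees on seed bits and coordinates\<close>

primrec swb where
 "swb 0 pre k = k pre"
| "swb (Suc n) pre k = Cond (rn (Bt (length pre))) (swb n (pre @ [True]) k) (swb n (pre @ [False]) k)"

text \<open>Binary search in the code itself: every leaf is compiled for one value of the register,
  which it may treat as a constant.\<close>

primrec bsw where
 "bsw 0 q lo k = k lo"
| "bsw (Suc h) q lo k = Seq (Const (tm 0) (lo + 2 ^ h)) (Seq (Bin Less (tm 0) (rn q) (tm 0))
 (Cond (tm 0) (bsw h q lo k) (bsw h q (lo + 2 ^ h) k)))"

text \<open>The leaves know the whole vector and may therefore use registers named after it. This
  replaces hashing and indirect access to registers, at 3 h steps per coordinate.\<close>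

primrec swc where
 "swc 0 h pre k = k pre"
| "swc (Suc n) h pre k = bsw h (Crd (length pre)) 1 (%v. swc n h (pre @ [v]) k)"

lemma wp_swb:
 assumes "length bs = n + length pre" "take (length pre) bs = pre" "!!j. j < length bs ==> rg s (Bt j) ~= 0 <-> bs ! j"
 and "!!s'. frm {} s s' ==> mem s' = mem s ==> out s' = out s ==> time s' = time s + n ==> wp w (k bs) Q s'"
 shows "wp w (swb n pre k) Q s"
 using assms
proof (induction n arbitrary: pre s)
 case 0
 thus ?case by (simp add: frm_refl)
next
 case (Suc n)
 define b where "b = bs ! length pre"
 have tk: "take (length (pre @ [b])) bs = pre @ [b]" using Suc.prems(1,2) by (simp add: b_def take_Suc_conv_app_nth)
 have r: "rg s (Bt (length pre)) ~= 0 <-> b" using Suc.prems(1) Suc.prems(3)[of "length pre"] by (simp add: b_def)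
 have main: "wp w (swb n (pre @ [b]) k) Q (tick s)"
 proof (rule Suc.IH[OF _ tk])
 show "length bs = n + length (pre @ [b])" using Suc.prems(1) by simp
 show "rg (tick s) (Bt j) ~= 0 <-> bs ! j" if "j < length bs" for j using Suc.prems(3)[OF that] by simp
 fix s' assume "frm {} (tick s) s'" "mem s' = mem (tick s)" "out s' = out (tick s)" "time s' = time (tick s) + n"
 thus "wp w (k bs) Q s'" by (intro Suc.prems(4)) (simp_all add: frm_def)
 qed
 show ?case unfolding swb.simps
 by (rule wp_Cond) (use main r in "cases b; simp")+
qed

lemma wp_bsw:
 assumes "q ~= Tm 0" "lo <= rg s q" "rg s q < lo + 2 ^ h" "lo + 2 ^ h < 2 ^ w"
 and "!!s'. frm {Tm 0} s s' ==> mem s' = mem s ==> out s' = out s ==> time s' = time s + 3 * h ==> wp w (k (rg s q)) Q s'"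
 shows "wp w (bsw h q lo k) Q s"
 using assms
proof (induction h arbitrary: lo s)
 case 0
 hence "rg s q = lo" by simp
 thus ?case using 0(5)[of s] by (simp add: frm_refl)
next
 case (Suc h)
 have W: "0 < w" using Suc.prems(4) by (cases w) auto
 have lt: "lo + 2 ^ h < 2 ^ w" using Suc.prems(4) by simp
 show ?case
 unfolding bsw.simps
 proof (rule wp_Seq, rule wp_const, rule wp_Seq, rule wp_bin)
 fix s1 s2
 assume s1: "!!qa. rg s1 qa = (if qa = Tm 0 then (lo + 2 ^ h) mod 2 ^ w else rg s qa)" "mem s1 = mem s" "out s1 = out s" "inp s1 = inp s" "time s1 = Suc (time s)"
 and s2: "!!qa. rg s2 qa = (if qa = Tm 0 then binop_word w Less (rg s1 q) (rg s1 (Tm 0)) else rg s1 qa)" "mem s2 = mem s1" "out s2 = out s1" "inp s2 = inp s1" "time s2 = Suc (time s1)"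
 have c: "rg s2 (Tm 0) ~= 0 <-> rg s q < lo + 2 ^ h" using Suc.prems(1) lt W by (simp add: s1 s2)
 have q2: "rg (tick s2) q = rg s q" using Suc.prems(1) by (simp add: s1 s2)
 have k: "wp w (k (rg s q)) Q s'" if "frm {Tm 0} (tick s2) s'" "mem s' = mem (tick s2)" "out s' = out (tick s2)" "time s' = time (tick s2) + 3 * h" for s'
 by (rule Suc.prems(5)) (use that in "simp_all add: frm_def s1 s2")
 show "wp w (Cond (tm 0) (bsw h q lo k) (bsw h q (lo + 2 ^ h) k)) Q s2"
 proof (rule wp_Cond)
 assume "rg s2 (Tm 0) ~= 0"
 thus "wp w (bsw h q lo k) Q (tick s2)"
 by (intro Suc.IH[OF Suc.prems(1)]) (use c q2 Suc.prems lt k in simp_all)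
 next
 assume "rg s2 (Tm 0) = 0"
 thus "wp w (bsw h q (lo + 2 ^ h) k) Q (tick s2)"
 by (intro Suc.IH[OF Suc.prems(1)]) (use c q2 Suc.prems lt k in simp_all)
 qed
 qed
qed

lemma wp_swc:
 assumes "length x = n + length pre" "take (length pre) x = pre"
 "!!t. t < length x ==> rg s (Crd t) = x ! t & 1 <= x ! t & x ! t <= 2 ^ h" "1 + 2 ^ h < (2::nat) ^ w"
 and "!!s'. frm {Tm 0} s s' ==> mem s' = mem s ==> out s' = out s ==> time s' = time s + n * (3 * h) ==> wp w (k x) Q s'"
 shows "wp w (swc n h pre k) Q s"
 using assms
proof (induction n arbitrary: pre s)
 case 0
 thus ?case by (simp add: frm_refl)
next
 case (Suc n)
 define b where "b = x ! length pre"
 have tk: "take (length (pre @ [b])) x = pre @ [b]" using Suc.prems(1,2) by (simp add: b_def take_Suc_conv_app_nth)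
 have r: "rg s (Crd (length pre)) = b" "1 <= b" "b <= 2 ^ h" using Suc.prems(1) Suc.prems(3)[of "length pre"] by (simp_all add: b_def)
 show ?case
 unfolding swc.simps
 proof (rule wp_bsw)
 fix s1 assume s1: "frm {Tm 0} s s1" "mem s1 = mem s" "out s1 = out s" "time s1 = time s + 3 * h"
 have "wp w (swc n h (pre @ [b]) k) Q s1"
 proof (rule Suc.IH[OF _ tk])
 show "length x = n + length (pre @ [b])" using Suc.prems(1) by simp
 show "rg s1 (Crd t) = x ! t & 1 <= x ! t & x ! t <= 2 ^ h" if "t < length x" for t
 using Suc.prems(3)[OF that] s1(1) by (simp add: frm_def)
 fix s' assume "frm {Tm 0} s1 s'" "mem s' = mem s1" "out s' = out s1" "time s' = time s1 + n * (3 * h)"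
 thus "wp w (k x) Q s'" using s1 by (intro Suc.prems(5)) (simp_all add: frm_def)
 qed (use Suc.prems(4) in simp)
 thus "wp w (swc n h (pre @ [rg s (Crd (length pre))]) k) Q s1" by (simp add: r)
 qed (use r Suc.prems(4) in simp_all)
qed

lemma wp_read:
 assumes "!!s'. (!!q. rg s' q = (if q = r then hd (inp s) mod 2 ^ w else rg s q)) ==> mem s' = mem s ==> out s' = out s ==> inp s' = tl (inp s) ==> time s' = Suc (time s) ==> Q s'"
 and "inp s ~= []"
 shows "wp w (Read (rn r)) Q s"
proof -
 obtain n ns where "inp s = n # ns" using assms(2) by (cases "inp s") auto
 thus ?thesis using assms(1)[of "tick (set_reg (rn r) (n mod 2 ^ w) (s\<lparr>inp := ns\<rparr>))"]
 by (simp add: wp_def)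
qed

definition rds :: "nat => com" where "rds d = seqs (map (%t. Read (rn (Crd t))) [0..<d])"

lemma wp_rds:
 assumes i: "inp s = x" "length x = d" "!!t. t < d ==> x ! t < 2 ^ w"
 and Q: "!!s'. (!!q. q ~: range Crd ==> rg s' q = rg s q) ==> (!!t. t < d ==> rg s' (Crd t) = x ! t) ==> mem s' = mem s ==> out s' = out s ==> time s' = time s + d + 1 ==> Q s'"
 shows "wp w (rds d) Q s"
 unfolding rds_def
proof -
 define I where "I t s' <-> inp s' = drop t x & (ALL q. q ~: range Crd --> rg s' q = rg s q) & (ALL u<t. rg s' (Crd u) = x ! u) &
 mem s' = mem s & out s' = out s & time s' = time s + t" for t s'
 show "wp w (seqs (map (%t. Read (rn (Crd t))) [0..<d])) Q s"
 proof (rule wp_loop[of I])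
 show "I 0 s" using i by (simp add: I_def)
 fix t s1 assume t: "t < d" and I: "I t s1"
 have n: "inp s1 ~= []" "hd (inp s1) = x ! t" "tl (inp s1) = drop (Suc t) x"
 using I t i(2) by (simp_all add: I_def hd_drop_conv_nth drop_Suc tl_drop)
 show "wp w (Read (rn (Crd t))) (I (Suc t)) s1"
 by (rule wp_read[OF _ n(1)]) (use I n i(3)[OF t] in "auto simp: I_def less_Suc_eq")
 next
 fix s1 assume "I d s1"
 thus "Q (tick s1)" by (intro Q) (simp_all add: I_def)
 qed
qed

text \<open>For a given seed and vector the labels merely select registers, and the digits of the
  permuted vector are constants of the program.\<close>

definition ldx where
 "ldx d L lab per x = seqs [Bin Or (tm 12) (rn (Slt x)) (rn (Slt x)),
 seqs (map (%i. Bin Or (rn (Rp i)) (rn (Rpr i (lab i x))) (rn (Rpr i (lab i x)))) [0..<Suc L]),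
 seqs (map (%t. Const (rn (Pri t)) (per x ! t)) [0..<d])]"

definition stx where
 "stx L lab x = seqs [Bin Or (rn (Slt x)) (tm 12) (tm 12),
 seqs (map (%i. Bin Or (rn (Rpr i (lab i x))) (rn (Rp i)) (rn (Rp i))) [0..<Suc L])]"

lemma wp_ldx:
 assumes "!!t. t < d ==> per x ! t < 2 ^ w"
 and Q: "!!s'. frm ({Tm 12} Un range Rp Un range Pri) s s' ==> rg s' (Tm 12) = rg s (Slt x) ==> (!!i. i <= L ==> rg s' (Rp i) = rg s (Rpr i (lab i x))) ==>
 (!!t. t < d ==> rg s' (Pri t) = per x ! t) ==> mem s' = mem s ==> out s' = out s ==> time s' = time s + L + d + 5 ==> Q s'"
 shows "wp w (ldx d L lab per x) Q s"
 unfolding ldx_def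
proof (rule wp_Cons, rule wp_mv, rule wp_Cons, goal_cases)
 case s1: (1 s1)
 define I where "I j s' <-> frm ({Tm 12} Un range Rp Un range Pri) s s' & rg s' (Tm 12) = rg s (Slt x) & (ALL i<j. rg s' (Rp i) = rg s (Rpr i (lab i x))) &
 mem s' = mem s & out s' = out s & time s' = time s + 1 + j" for j s'
 define H where "H j s' <-> frm ({Tm 12} Un range Rp Un range Pri) s s' & rg s' (Tm 12) = rg s (Slt x) & (ALL i<=L. rg s' (Rp i) = rg s (Rpr i (lab i x))) &
 (ALL t<j. rg s' (Pri t) = per x ! t) & mem s' = mem s & out s' = out s & time s' = time s + 3 + L + j" for j s'
 show "wp w (seqs (map (%i. Bin Or (rn (Rp i)) (rn (Rpr i (lab i x))) (rn (Rpr i (lab i x)))) [0..<Suc L]))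
 (wp w (seqs [seqs (map (%t. Const (rn (Pri t)) (per x ! t)) [0..<d])]) Q) s1"
 proof (rule wp_loop[of I])
 show "I 0 s1" by (simp add: I_def s1 frm_def)
 fix i s2 assume "i < Suc L" "I i s2"
 thus "wp w (Bin Or (rn (Rp i)) (rn (Rpr i (lab i x))) (rn (Rpr i (lab i x)))) (I (Suc i)) s2"
 by (intro wp_mv) (auto simp: I_def frm_def less_Suc_eq)
 next
 fix s2 assume I: "I (Suc L) s2"
 show "wp w (seqs [seqs (map (%t. Const (rn (Pri t)) (per x ! t)) [0..<d])]) Q (tick s2)"
 proof (rule wp_Cons, rule wp_loop[of H])
 show "H 0 (tick s2)" using I by (simp add: I_def H_def frm_def less_Suc_eq_le)
 fix t s3 assume "t < d" "H t s3"
 thus "wp w (Const (rn (Pri t)) (per x ! t)) (H (Suc t)) s3"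
 using assms(1)[of t] by (intro wp_const) (auto simp: H_def frm_def less_Suc_eq)
 next
 fix s3 assume "H d s3"
 thus "wp w (seqs []) Q (tick s3)" by (intro wp_Nil Q) (simp_all add: H_def frm_def)
 qed
 qed
qed

lemma wp_stx:
 assumes Q: "!!s'. frm (insert (Slt x) {Rpr i (lab i x) |i. i <= L}) s s' ==> rg s' (Slt x) = rg s (Tm 12) ==> (!!i. i <= L ==> rg s' (Rpr i (lab i x)) = rg s (Rp i)) ==>
 mem s' = mem s ==> out s' = out s ==> time s' = time s + L + 4 ==> Q s'"
 shows "wp w (stx L lab x) Q s"
 unfolding stx_def
proof (rule wp_Cons, rule wp_mv, rule wp_Cons, goal_cases)
 case s1: (1 s1)
 define I where "I j s' <-> frm (insert (Slt x) {Rpr i (lab i x) |i. i <= L}) s s' & rg s' (Slt x) = rg s (Tm 12) & (ALL i<j. rg s' (Rpr i (lab i x)) = rg s (Rp i)) &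
 mem s' = mem s & out s' = out s & time s' = time s + 1 + j" for j s'
 show "wp w (seqs (map (%i. Bin Or (rn (Rpr i (lab i x))) (rn (Rp i)) (rn (Rp i))) [0..<Suc L])) (wp w (seqs []) Q) s1"
 proof (rule wp_loop[of I])
 show "I 0 s1" by (simp add: I_def s1 frm_def)
 fix i s2 assume "i < Suc L" "I i s2"
 thus "wp w (Bin Or (rn (Rpr i (lab i x))) (rn (Rp i)) (rn (Rp i))) (I (Suc i)) s2"
 by (intro wp_mv) (auto simp: I_def frm_def less_Suc_eq)
 next
 fix s2 assume "I (Suc L) s2"
 thus "wp w (seqs []) Q (tick s2)" by (intro wp_Nil Q) (simp_all add: I_def frm_def less_Suc_eq_le)
 qed
qed

definition slots :: "state => vec => nat" where "slots s x = rg s (Slt x)"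

definition bits :: "nat => state => bool list" where "bits N s = map (%j. rg s (Bt j) ~= 0) [0..<N]"

text \<open>The update in the middle works on fixed registers and occurs once in the code. Its
  results are stored by a second walk through the decision tree, since the first walk has left the
  leaf that knows the vector.\<close>

definition oprog where
 "oprog N d h L sd c = seqs [rds d, swb N [] (%bs. swc d h [] (ldx d L (fst (sd bs)) (snd (sd bs)))), c,
 swb N [] (%bs. swc d h [] (stx L (fst (sd bs))))]"

lemma bits_props: "length (bits N s) = N" "j < N ==> bits N s ! j <-> rg s (Bt j) ~= 0"
 by (simp_all add: bits_def)

section \<open>The invariant between operations and its preservation by updates\<close>

context store begin

text \<open>With 0 for absence, registers hold the record of every grid vector and the
  representative of every label of a grid vector. Labels of empty cells are included, since later
  insertions consult them.\<close>

definition Inv where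
 "Inv s Om <-> core s Om (slots s) & (ALL x:grid d D - Om. slots s x = 0) &
 (ALL x:grid d D. ALL i<=L. rg s (Rpr i (lab i x)) = (if ce Om i x = {} then 0 else slots s (rp Om i x)))"

lemma rp_in: "finite Om ==> ce Om i x ~= {} ==> rp Om i x : Om"
 using rp_cell[of Om i x] by (auto simp: cell_def)

lemma rp_in': "finite Om ==> x : Om ==> rp Om i x : Om"
 using rp_in[of Om i x] cell_refl[of x Om lab i] by auto

lemma core_cong:
 assumes c: "core s Om nm" and eq: "!!z. z : Om ==> nm' z = nm z" and s': "mem s' = mem s" "rg s' Cnt = rg s Cnt"
 shows "core s' Om nm'"
proof -
 have g: "good (mem s) Om nm" using c by (simp add: core_def)
 have fin: "finite Om" using g recs_fin by (auto simp: good_def)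
 have img: "nm' ` ce Om i z = nm ` ce Om i z" for i z
 by (intro image_cong) (auto simp: eq cell_def)
 have im: "nm' ` Om = nm ` Om" by (intro image_cong) (auto simp: eq)
 have "inj_on nm' Om <-> inj_on nm Om" by (rule inj_on_cong) (rule eq)
 hence "recs (mem s) Om nm'" using g by (simp add: good_def recs_def eq)
 moreover have "rings (mem s) Om nm'" using g by (simp add: good_def rings_def img)
 moreover have "okN (mem s) Om nm' i z <-> okN (mem s) Om nm i z" if "z : Om" for i z
 using rp_in'[OF fin that] that by (simp add: okN_def eq)
 moreover have "okW (mem s) Om nm' i z <-> okW (mem s) Om nm i z" if "z : Om" for i z
 using that by (simp add: okW_def eq)
 ultimately have "good (mem s) Om nm'" using g by (simp add: good_def)
 thus ?thesis using c im by (simp add: core_def freeok_def s')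
qed

lemma core_fin: "core s Om nm ==> finite Om"
 using recs_fin by (auto simp: core_def good_def)

lemma reported_cong:
 assumes "reported ws m nm X" "!!z. z : X ==> nm' z = nm z" shows "reported ws m nm' X"
proof -
 obtain xs where xs: "distinct xs" "set xs = X" "ws = concat (map (%z. z @ pathwords m (nm z)) xs)"
 using assms(1) by (auto simp: reported_def)
 have "map (%z. z @ pathwords m (nm z)) xs = map (%z. z @ pathwords m (nm' z)) xs" using xs assms(2) by (intro map_cong) auto
 thus ?thesis unfolding reported_def using xs by metis
qed

lemma grid_word: "x : grid d D ==> t < d ==> x ! t < 2 ^ w"
proof -
 assume "x : grid d D" "t < d"
 hence "x ! t <= D" using grid_nth[of x d D t] by simp
 thus ?thesis using small_words(1) by linarith
qed

lemma pi_grid: "x : grid d D ==> pi x : grid d D"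
 using pi by (simp add: permutes_in_image)

context
 fixes N h :: nat and sd :: "bool list => seed"
 assumes h: "D <= 2 ^ h" "1 + 2 ^ h < (2::nat) ^ w"
begin

lemma wp_select:
 assumes x: "x : grid d D" and crd: "!!t. t < d ==> rg s (Crd t) = x ! t"
 and k: "!!s'. frm {Tm 0} s s' ==> mem s' = mem s ==> out s' = out s ==> time s' = time s + N + d * (3 * h) ==> wp w (k (bits N s) x) Q s'"
 shows "wp w (swb N [] (%bs. swc d h [] (k bs))) Q s"
proof (rule wp_swb[where bs="bits N s"])
 fix s1 assume s1: "frm {} s s1" "mem s1 = mem s" "out s1 = out s" "time s1 = time s + N"
 show "wp w (swc d h [] (k (bits N s))) Q s1"
 proof (rule wp_swc[where x=x])
 show "rg s1 (Crd t) = x ! t & 1 <= x ! t & x ! t <= 2 ^ h" if "t < length x" for t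
 using that crd[of t] grid_length[OF x] grid_nth[OF x, of t] h(1) s1(1) by (auto simp: frm_def)
 fix s' assume "frm {Tm 0} s1 s'" "mem s' = mem s1" "out s' = out s1" "time s' = time s1 + d * (3 * h)"
 thus "wp w (k (bits N s) x) Q s'" using s1 by (intro k) (simp_all add: frm_def)
 qed (use grid_length[OF x] h in simp_all)
qed (simp_all add: bits_props)

lemma wp_before:
 assumes I: "Inv s Om" and x: "x : grid d D" "inp s = x" and sd: "sd (bits N s) = (lab, pi)"
 and Q: "!!s'. core s' Om (slots s) ==> regs s' Om (slots s) x ==> args s' x ==> (!!q. q : range Bt Un range Slt Un {Rpr i n |i n. True} ==> rg s' q = rg s q) ==>
 out s' = out s ==> time s' <= time s + N + d * (3 * h) + L + 2 * d + 6 ==> wp w (seqs cs) Q s'"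
 shows "wp w (seqs (rds d # swb N [] (%bs. swc d h [] (ldx d L (fst (sd bs)) (snd (sd bs)))) # cs)) Q s"
proof (rule wp_Cons, rule wp_rds[OF x(2)], goal_cases)
 case 1 show ?case by (rule grid_length[OF x(1)])
next
 case (2 t) thus ?case using grid_word[OF x(1)] by blast
next
 case (3 s1)
 have b1: "bits N s1 = bits N s"
 proof -
 have "rg s1 (Bt j) = rg s (Bt j)" for j by (rule 3(1)) auto
 thus ?thesis by (simp add: bits_def)
 qed
 show ?case
 proof (rule wp_Cons, rule wp_select[OF x(1) 3(2)], assumption, goal_cases)
 case s2: (1 s2)
 show "wp w (ldx d L (fst (sd (bits N s1))) (snd (sd (bits N s1))) x) (wp w (seqs cs) Q) s2"
 unfolding b1 sd fst_conv snd_conv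
 proof (rule wp_ldx, goal_cases)
 case (1 t) thus ?case using grid_word[OF pi_grid[OF x(1)]] by blast
 next
 case (2 s3)
 have old: "rg s3 q = rg s q" if "q : range Bt Un range Slt Un {Rpr i n |i n. True} Un {Cnt}" for q
 proof -
 have "q ~: range Crd" "q ~= Tm 0" "q ~: {Tm 12} Un range Rp Un range Pri" using that by auto
 thus ?thesis using 3(1) s2(1) 2(1) by (simp add: frm_def)
 qed
 have s2q: "rg s2 q = rg s q" if "q : range Bt Un range Slt Un {Rpr i n |i n. True} Un {Cnt}" for q
 proof -
 have "q ~: range Crd" "q ~= Tm 0" using that by auto
 thus ?thesis using 3(1) s2(1) by (simp add: frm_def)
 qed
 show ?case
 proof (rule Q)
 have m: "mem s3 = mem s" using 2(5) s2(2) 3(3) by simp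
 have c: "core s Om (slots s)" using I by (simp add: Inv_def)
 show "core s3 Om (slots s)" by (rule core_cong[OF c refl m]) (rule old, simp)
 have r12: "rg s3 (Tm 12) = slots s x" using 2(2) s2q[of "Slt x"] by (simp add: slots_def)
 have "slots s x = 0" if "x ~: Om" using I x(1) that by (simp add: Inv_def)
 moreover have "rg s3 (Rp i) = rg s (Rpr i (lab i x))" if "i <= L" for i using 2(3)[OF that] s2q[of "Rpr i (lab i x)"] by simp
 ultimately show "regs s3 Om (slots s) x" using I x(1) r12 by (simp add: regs_def Inv_def)
 have "rg s3 (Crd t) = rg s1 (Crd t)" for t using s2(1) 2(1) by (auto simp: frm_def)
 thus "args s3 x" using 3(2) 2(4) by (simp add: args_def)
 show "out s3 = out s" using 2(6) s2(3) 3(4) by simp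
 show "time s3 <= time s + N + d * (3 * h) + L + 2 * d + 6" using 2(7) s2(4) 3(5) by simp
 show "rg s3 q = rg s q" if "q : range Bt Un range Slt Un {Rpr i n |i n. True}" for q using old that by blast
 qed
 qed
 qed
qed

text \<open>Only registers of x and of its labels are written back. This suffices because cells with
  other labels are the same before and after the update.\<close>

lemma wp_after:
 assumes c: "core s Om nm" and r: "regs s Om nm x" and x: "x : grid d D" and a: "!!t. t < d ==> rg s (Crd t) = x ! t"
 and sd: "sd (bits N s) = (lab, pi)"
 and S1: "!!y. y : Om ==> y ~= x ==> slots s y = nm y" and S0: "!!y. y : grid d D ==> y ~: Om ==> y ~= x ==> slots s y = 0"
 and Rr: "!!y i. y : grid d D ==> i <= L ==> lab i y ~= lab i x ==> rg s (Rpr i (lab i y)) = (if ce Om i y = {} then 0 else nm (rp Om i y))"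
 and Q: "!!s'. Inv s' Om ==> bits N s' = bits N s ==> (!!y. y : Om ==> slots s' y = nm y) ==> mem s' = mem s ==> out s' = out s ==>
 time s' <= time s + N + d * (3 * h) + L + 5 ==> Q s'"
 shows "wp w (seqs [swb N [] (%bs. swc d h [] (stx L (fst (sd bs))))]) Q s"
proof (rule wp_Cons, rule wp_select[OF x a], assumption, goal_cases)
 case s1: (1 s1)
 have fin: "finite Om" by (rule core_fin[OF c])
 show "wp w (stx L (fst (sd (bits N s))) x) (wp w (seqs []) Q) s1"
 unfolding sd fst_conv
 proof (rule wp_stx, rule wp_Nil, rule Q)
 fix s2 s3 assume s2: "frm (insert (Slt x) {Rpr i (lab i x) |i. i <= L}) s1 s2" "rg s2 (Slt x) = rg s1 (Tm 12)" "!!i. i <= L ==> rg s2 (Rpr i (lab i x)) = rg s1 (Rp i)"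
 "mem s2 = mem s1" "out s2 = out s1" "time s2 = time s1 + L + 4"
 and s3: "!!q. rg s3 q = rg s2 q" "mem s3 = mem s2" "out s3 = out s2" "inp s3 = inp s2" "time s3 = Suc (time s2)"
 have Sx: "slots s3 x = (if x : Om then nm x else 0)" using s2(2) s1(1) r by (simp add: slots_def s3 frm_def regs_def)
 have Sy: "slots s3 y = slots s y" if "y ~= x" for y using s2(1) s1(1) that by (simp add: slots_def s3 frm_def)
 show sl: "slots s3 y = nm y" if "y : Om" for y using Sx Sy[of y] S1[OF that] that by (cases "y = x") auto
 show "mem s3 = mem s" "out s3 = out s" "time s3 <= time s + N + d * (3 * h) + L + 5" using s1 s2 s3 by simp_all
 show "bits N s3 = bits N s" using s1(1) s2(1) by (simp add: bits_def s3 frm_def)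
 show "Inv s3 Om"
 unfolding Inv_def
 proof (intro conjI ballI allI impI)
 show "core s3 Om (slots s3)"
 by (rule core_cong[OF c sl]) (use s1 s2 in "simp_all add: s3 frm_def")
 show "slots s3 y = 0" if "y : grid d D - Om" for y using that Sx Sy[of y] S0[of y] by (cases "y = x") auto
 fix y i assume y: "y : grid d D" and i: "i <= L"
 have cong: "(if ce Om i y = {} then 0 else slots s3 (rp Om i y)) = (if ce Om i y = {} then 0 else nm (rp Om i y))"
 using sl rp_in[OF fin, of i y] by simp
 show "rg s3 (Rpr i (lab i y)) = (if ce Om i y = {} then 0 else slots s3 (rp Om i y))"
 proof (cases "lab i y = lab i x")
 case True
 have "ce Om i y = ce Om i x" "rp Om i y = rp Om i x" by (rule cell_cong[where lab=lab, OF True] rep_cong[where lab=lab and i=i, OF True])+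
 moreover have "rg s3 (Rpr i (lab i x)) = rg s (Rp i)" using s2(3)[OF i] s1(1) by (simp add: s3 frm_def)
 ultimately show ?thesis using r i True cong by (simp add: regs_def)
 next
 case False
 hence "rg s3 (Rpr i (lab i y)) = rg s (Rpr i (lab i y))" using s2(1) s1(1) by (simp add: s3 frm_def)
 thus ?thesis using Rr[OF y i False] cong by simp
 qed
 qed
 qed
qed

text \<open>The frame around both updates: X is the set of vectors reported and b the time of the
  update proper. Registers for seed bits, slots and labels lie outside the reach of the update, so
  they still describe the old set when the results are stored.\<close>

lemma wp_op:
 assumes I: "Inv s Om" and x: "x : grid d D" "inp s = x" and sd: "sd (bits N s) = (lab, pi)"
 and O: "Om' = insert x Om | Om' = Om - {x}" and X: "X <= Om'"
 and c: "!!s1 Q. core s1 Om (slots s) ==> regs s1 Om (slots s) x ==> args s1 x ==>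
 (!!s2 nm ws. frm (WR Un {Tm 12, Cnt}) s1 s2 ==> core s2 Om' nm ==> regs s2 Om' nm x ==> (!!y. y : Om ==> nm y = slots s y) ==>
 out s2 = out s1 @ ws ==> reported ws (mem s2) nm X ==> time s2 <= time s1 + b ==> Q s2) ==> wp w c Q s1"
 and Q: "!!s' ws. Inv s' Om' ==> bits N s' = bits N s ==> (!!y. y : Om ==> y : Om' ==> slots s' y = slots s y) ==> out s' = out s @ ws ==>
 reported ws (mem s') (slots s') X ==> time s' <= time s + 2 * N + 6 * d * h + 2 * L + 2 * d + 11 + b ==> Q s'"
 shows "wp w (oprog N d h L sd c) Q s"
 unfolding oprog_def
proof (rule wp_before[OF I x sd], goal_cases)
 case (1 s1)
 note s1 = 1
 have fin: "finite Om" by (rule core_fin[OF s1(1)])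
 show ?case
 proof (rule wp_Cons, rule c[OF s1(1-3)])
 fix s2 nm ws assume s2: "frm (WR Un {Tm 12, Cnt}) s1 s2" "core s2 Om' nm" "regs s2 Om' nm x" "!!y. y : Om ==> nm y = slots s y"
 "out s2 = out s1 @ ws" "reported ws (mem s2) nm X" "time s2 <= time s1 + b"
 have old: "rg s2 q = rg s q" if "q : range Bt Un range Slt Un {Rpr i n |i n. True}" for q
 proof -
 have "q ~: WR Un {Tm 12, Cnt}" using that by auto
 thus ?thesis using s1(4)[OF that] s2(1) by (simp add: frm_def)
 qed
 have sl2: "slots s2 y = slots s y" for y by (simp add: slots_def old)
 have b2: "bits N s2 = bits N s" by (simp add: bits_def old)
 show "wp w (seqs [swb N [] (%bs. swc d h [] (stx L (fst (sd bs))))]) Q s2"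
 proof (rule wp_after[OF s2(2,3) x(1)], goal_cases)
 case (1 t) thus ?case using s1(3) s2(1) by (simp add: args_def frm_def)
 next
 case 2 show ?case using sd b2 by simp
 next
 case (3 y) thus ?case using O s2(4)[of y] by (auto simp: sl2)
 next
 case (4 y) thus ?case using O I by (auto simp: sl2 Inv_def)
 next
 case (5 y i)
 have e: "ce Om' i y = ce Om i y" using O 5(3) by (auto simp: cell_def)
 hence "rp Om' i y = rp Om i y" by (simp add: rep_def)
 moreover have "rg s2 (Rpr i (lab i y)) = rg s (Rpr i (lab i y))" by (rule old) auto
 ultimately show ?case unfolding e using I 5(1,2) s2(4) rp_in[OF fin, of i y] by (auto simp: Inv_def)
 next
 case (6 s3)
 show ?case
 proof (rule Q[of _ ws])
 show "reported ws (mem s3) (slots s3) X" unfolding 6(4) by (intro reported_cong[OF s2(6)] 6(3)) (use X in blast)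
 show "time s3 <= time s + 2 * N + 6 * d * h + 2 * L + 2 * d + 11 + b" using 6(6) s2(7) s1(6) by (simp add: mult.assoc)
 qed (use 6 s2 s1(5) b2 in simp_all)
 qed
 qed
qed

lemma regs_mem: "core s Om nm ==> regs s Om nm x ==> rg s (Tm 12) = 0 <-> x ~: Om"
 using recs_SL[of "mem s" Om nm x] slot_pos[of "nm x"] by (auto simp: regs_def core_def good_def)

lemma core_tick: "core s Om nm ==> core (tick s) Om nm" "regs s Om nm x ==> regs (tick s) Om nm x" "args s x ==> args (tick s) x"
 by (simp_all add: core_def regs_def args_def)

lemma changed_sub: "changed f Om x <= Om"
 by (auto simp: changed_def cell_def)

text \<open>Covers the insertion of a vector that is present and the deletion of one that is absent;
  the report is then empty.\<close>

lemma wp_nothing: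
 assumes "core s1 Om nm" "regs s1 Om nm x" and Q: "!!s2 ws. frm (WR Un {Tm 12, Cnt}) s1 s2 ==> core s2 Om nm ==> regs s2 Om nm x ==>
 out s2 = out s1 @ ws ==> reported ws (mem s2) nm {} ==> time s2 <= time s1 + 2 ==> Q s2"
 shows "wp w Skip Q (tick s1)"
proof (rule wp_Skip, rule Q[of _ "[]"], goal_cases)
 case (2 s') show ?case by (rule core_cong[OF assms(1) refl]) (use 2 in simp_all)
next
 case (5 s') show ?case by (auto simp: reported_def intro!: exI[of _ "[]"])
qed (use assms(2) in "simp_all add: frm_def regs_def")

lemma wp_insert_op:
 assumes I: "Inv s Om" and x: "x : grid d D" "inp s = x" and sd: "sd (bits N s) = (lab, pi)" and cd: "card (insert x Om) <= cap"
 and Q: "!!s' ws. Inv s' (insert x Om) ==> bits N s' = bits N s ==> (!!y. y : Om ==> slots s' y = slots s y) ==> out s' = out s @ ws ==>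
 reported ws (mem s') (slots s') (if x : Om then {} else changed (%i. rp (insert x Om) i x = x) (insert x Om) x) ==>
 time s' <= time s + 80 + 2 * N + 6 * d * h + 11 * d + 3 * L + (L + 1) * (28 * d + 80) +
 cl (insert x Om) x * (69 + 15 * L + 34 * d) ==> Q s'"
 shows "wp w (oprog N d h L sd (Cond (tm 12) Skip icore)) Q s"
proof -
 let ?X = "if x : Om then {} else changed (%i. rp (insert x Om) i x = x) (insert x Om) x"
 let ?b = "41 + 9 * d + (L + 1) * (28 * d + 80) + cl (insert x Om) x * (69 + 15 * L + 34 * d)"
 show ?thesis
 proof (rule wp_op[where Om'="insert x Om" and X="?X" and b="?b", OF I x sd], goal_cases)
 case (3 s1 Q')
 show ?case
 proof (rule wp_Cond, unfold regs_mem[OF 3(1,2)] not_not)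
 assume xO: "x : Om"
 show "wp w Skip Q' (tick s1)" by (rule wp_nothing[OF 3(1,2)], rule 3(4)) (use xO in "simp_all add: insert_absorb")
 next
 assume xO: "x ~: Om"
 hence n: "card Om < cap" using cd core_fin[OF 3(1)] by simp
 show "wp w icore Q' (tick s1)"
 by (rule wp_icore[OF core_tick(1)[OF 3(1)] core_tick(2)[OF 3(2)] core_tick(3)[OF 3(3)] x(1) xO n], rule 3(4))
 (use xO in "auto simp: frm_def")
 qed
 next
 case (4 s' ws) show ?case by (rule Q[of _ ws]) (use 4 in auto)
 qed (use changed_sub in auto)
qed

lemma wp_delete_op:
 assumes I: "Inv s Om" and x: "x : grid d D" "inp s = x" and sd: "sd (bits N s) = (lab, pi)"
 and Q: "!!s' ws. Inv s' (Om - {x}) ==> bits N s' = bits N s ==> (!!y. y : Om - {x} ==> slots s' y = slots s y) ==> out s' = out s @ ws ==>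
 reported ws (mem s') (slots s') (if x : Om then changed (%i. rp Om i x = x) (Om - {x}) x else {}) ==>
 time s' <= time s + 80 + 2 * N + 6 * d * h + 2 * d + 3 * L + (L + 1) * 80 +
 of_bool (x : Om) * cl Om x * (82 + 15 * L + 48 * d) ==> Q s'"
 shows "wp w (oprog N d h L sd (Cond (tm 12) dcore Skip)) Q s"
proof -
 let ?X = "if x : Om then changed (%i. rp Om i x = x) (Om - {x}) x else {}"
 let ?b = "41 + (L + 1) * 80 + of_bool (x : Om) * cl Om x * (82 + 15 * L + 48 * d)"
 show ?thesis
 proof (rule wp_op[where Om'="Om - {x}" and X="?X" and b="?b", OF I x sd], goal_cases)
 case (3 s1 Q')
 show ?case
 proof (rule wp_Cond, unfold regs_mem[OF 3(1,2)] not_not)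
 assume xO: "x ~: Om"
 show "wp w Skip Q' (tick s1)" by (rule wp_nothing[OF 3(1,2)], rule 3(4)) (use xO in simp_all)
 next
 assume xO: "x : Om"
 show "wp w dcore Q' (tick s1)"
 by (rule wp_dcore[OF core_tick(1)[OF 3(1)] core_tick(2)[OF 3(2)] xO], rule 3(4)) (use xO in "auto simp: frm_def")
 qed
 next
 case (4 s' ws) show ?case by (rule Q[of _ ws]) (use 4 in auto)
 qed (use changed_sub in auto)
qed

end

end

section \<open>Initialisation: random seed bits and tables\<close>

lemma uniform_lists_Suc:
 "spmf_of_set {bs :: bool list. length bs = Suc n} =
 bind_spmf (spmf_of_set UNIV) (%b. map_spmf (Cons b) (spmf_of_set {bs. length bs = n}))"
proof (rule spmf_eqI)
 fix xs :: "bool list"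
 have fin: "finite {bs :: bool list. length bs = n}" "card {bs :: bool list. length bs = n} = 2 ^ n" for n
 using finite_lists_length_eq[of "UNIV :: bool set" n] card_lists_length_eq[of "UNIV :: bool set" n] by (simp_all add: card_UNIV_bool)
 have m: "map_spmf (Cons b) (spmf_of_set {bs. length bs = n}) = spmf_of_set (Cons b ` {bs. length bs = n})" for b :: bool
 by (rule map_spmf_of_set_inj_on) (simp add: inj_on_def)
 have c: "card (Cons b ` {bs. length bs = n}) = 2 ^ n" "finite (Cons b ` {bs. length bs = n})" for b :: bool
 using fin[of n] by (simp_all add: card_image inj_on_def)
 have "spmf (bind_spmf (spmf_of_set UNIV) (%b. map_spmf (Cons b) (spmf_of_set {bs. length bs = n}))) xs =
 (SUM b:UNIV. indicator (Cons b ` {bs. length bs = n}) xs / 2 ^ n) / 2"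
 by (simp add: spmf_bind m integral_spmf_of_set spmf_of_set c sum_divide_distrib mult.commute)
 also have "(SUM b:(UNIV :: bool set). indicator (Cons b ` {bs. length bs = n}) xs :: real) = indicator {bs. length bs = Suc n} xs"
 by (cases xs) (auto simp: UNIV_bool indicator_def image_iff)
 hence "(SUM b:UNIV. indicator (Cons b ` {bs. length bs = n}) xs / 2 ^ n) / 2 = (indicator {bs. length bs = Suc n} xs / 2 ^ Suc n :: real)"
 by (simp only: sum_divide_distrib[symmetric]) simp
 finally show "spmf (spmf_of_set {bs. length bs = Suc n}) xs =
 spmf (bind_spmf (spmf_of_set UNIV) (%b. map_spmf (Cons b) (spmf_of_set {bs. length bs = n}))) xs"
 by (simp add: spmf_of_set fin[of "Suc n"])
qed

text \<open>For w >= 1 the number of words is even, with as many odd words as even ones, so the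
  lowest bit of a random word is fair.\<close>

lemma odd_uniform:
 assumes "1 <= w" shows "map_spmf odd (spmf_of_set {..<(2::nat) ^ w}) = spmf_of_set UNIV"
proof -
 obtain v where v: "w = Suc v" using assms by (cases w) auto
 let ?A = "{..<(2::nat) ^ w}"
 have A: "?A = {..<2 * 2 ^ v}" by (simp add: v)
 have o: "{..<2 * m} Int odd -` {True} = (%k. 2 * k + 1) ` {..<m}" for m :: nat
 proof (intro equalityI subsetI)
 fix n assume "n : {..<2 * m} Int odd -` {True}"
 hence "n = 2 * (n div 2) + 1" "n div 2 < m" by auto
 thus "n : (%k. 2 * k + 1) ` {..<m}" by blast
 qed auto
 have e: "{..<2 * m} Int odd -` {False} = (%k. 2 * k) ` {..<m}" for m :: nat
 proof (intro equalityI subsetI)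
 fix n assume "n : {..<2 * m} Int odd -` {False}"
 hence "n = 2 * (n div 2)" "n div 2 < m" by auto
 thus "n : (%k. 2 * k) ` {..<m}" by blast
 qed auto
 have card: "card (?A Int odd -` {b}) = 2 ^ v" for b
 proof (cases b)
 case True
 have "card (?A Int odd -` {True}) = 2 ^ v" unfolding A o by (simp add: card_image inj_on_def)
 thus ?thesis using True by simp
 next
 case False
 have "card (?A Int odd -` {False}) = 2 ^ v" unfolding A e by (simp add: card_image inj_on_def)
 thus ?thesis using False by simp
 qed
 have "0 : ?A" by simp
 hence ne: "?A ~= {}" "finite ?A" by blast+
 have "map_pmf odd (pmf_of_set ?A) = pmf_of_set UNIV"
 proof (rule pmf_eqI)
 fix b
 have "pmf (map_pmf odd (pmf_of_set ?A)) b = measure (measure_pmf (pmf_of_set ?A)) (odd -` {b})" by (simp add: pmf_map)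
 also have "... = rc (?A Int odd -` {b}) / real (card ?A)" using ne by (simp add: measure_pmf_of_set Int_commute)
 also have "... = 1 / 2" by (simp only: card card_lessThan) (simp add: v)
 finally show "pmf (map_pmf odd (pmf_of_set ?A)) b = pmf (pmf_of_set UNIV) b" by simp
 qed
 moreover have "spmf_of_set ?A = spmf_of_pmf (pmf_of_set ?A)" using ne by (simp add: spmf_of_set_def del: spmf_of_pmf_pmf_of_set)
 ultimately show ?thesis by (simp add: spmf_of_set_def del: spmf_of_pmf_pmf_of_set)
qed

definition rb where
 "rb j = seqs [Rand (rn (Bt j)), Const (tm 0) 1, Bin And (rn (Bt j)) (rn (Bt j)) (tm 0)]"

definition put where
 "put j b s = tick (tick (tick (tick (set_reg (rn (Bt j)) (of_bool b) (set_reg (tm 0) 1 s)))))"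

fun puts :: "vec => bool list => state => state" where
 "puts (j # js) (b # bs) s = puts js bs (put j b s)"
| "puts _ _ s = tick s"

lemma exec_rb:
 assumes w: "1 <= w" shows "exec w (rb j) s = map_spmf (%b. put j b s) (spmf_of_set UNIV)"
proof -
 have one: "1 mod 2 ^ w = (1::nat)" using w one_less_power[of "2::nat" w] by simp
 have "exec w (rb j) s = map_spmf (%n. put j (odd n) s) (spmf_of_set {..<(2::nat) ^ w})"
 proof -
 have "tick (tick (set_reg (rn (Bt j)) (binop_word w And n 1) (tick (set_reg (tm 0) 1 (tick (set_reg (rn (Bt j)) n s)))))) = put j (odd n) s" for n
 by (simp add: put_def tick_def set_reg_def fun_upd_twist and_one_eq mod_2_eq_odd)
 thus ?thesis
 using one by (simp add: rb_def map_spmf_conv_bind_spmf o_def tick_def set_reg_def)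
 qed
 also have "... = map_spmf (%b. put j b s) (map_spmf odd (spmf_of_set {..<(2::nat) ^ w}))" by (simp add: spmf.map_comp o_def)
 finally show ?thesis by (simp add: odd_uniform[OF w])
qed

lemma exec_rbs:
 assumes w: "1 <= w"
 shows "exec w (seqs (map rb js)) s = map_spmf (%bs. puts js bs s) (spmf_of_set {bs. length bs = length js})"
proof (induction js arbitrary: s)
 case Nil
 have "{bs :: bool list. length bs = length ([] :: vec)} = {[]}" by auto
 thus ?case by (simp add: spmf_of_set_singleton del: length_0_conv list.size(3))
next
 case (Cons j js)
 have "exec w (seqs (map rb (j # js))) s =
 bind_spmf (spmf_of_set UNIV) (%b. map_spmf (%bs. puts js bs (put j b s)) (spmf_of_set {bs. length bs = length js}))"
 by (simp add: exec_rb[OF w] Cons bind_map_spmf o_def)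
 also have "... = map_spmf (%bs. puts (j # js) bs s) (spmf_of_set {bs. length bs = length (j # js)})"
 unfolding length_Cons uniform_lists_Suc by (simp add: map_spmf_bind_spmf o_def spmf.map_comp del: map_spmf_of_set_inj_on)
 finally show ?case .
qed

lemma puts_props:
 assumes "length bs = length js" "distinct js"
 shows "mem (puts js bs s) = mem s & (ALL q. q ~: Bt ` set js Un {Tm 0} --> rg (puts js bs s) q = rg s q) &
 (ALL k<length js. rg (puts js bs s) (Bt (js ! k)) = of_bool (bs ! k))"
 using assms
proof (induction js bs s rule: puts.induct)
 case (1 j js b bs s)
 have IH: "mem (puts js bs (put j b s)) = mem (put j b s)" "!!q. q ~: Bt ` set js Un {Tm 0} ==> rg (puts js bs (put j b s)) q = rg (put j b s) q"
 "!!k. k < length js ==> rg (puts js bs (put j b s)) (Bt (js ! k)) = of_bool (bs ! k)" using 1 by auto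
 have "Bt j ~: Bt ` set js Un {Tm 0}" using 1(3) by auto
 from IH(2)[OF this] have "rg (puts js bs (put j b s)) (Bt j) = of_bool b" by (simp add: put_def)
 moreover have "rg (puts (j # js) (b # bs) s) (Bt ((j # js) ! k)) = of_bool ((b # bs) ! k)" if "k < length (j # js)" for k
 using that IH(3) calculation by (cases k) auto
 ultimately show ?case using IH(1,2) by (auto simp: put_def)
qed auto

definition tab :: "real => nat => nat => nat" where
 "tab p D a = (if a <= 2 * D then pow_tab p (nat \<bar>int a - int D\<bar>) else root_tab p (a - (2 * D + 1)))"

definition iprog where
 "iprog p d D N = seqs [seqs (map (%a. seqs [Const (tm 0) a, Const (tm 1) (tab p D a), Store (tm 0) (tm 1)]) [0..<2 * D + 2 + d * D^2]),
 Const (rn Cnt) (2 * D + 2 + d * D^2), seqs (map rb [0..<N])]"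

text \<open>The record of a vector contains its whole path, so a query only has to find the record:
  it branches on the coordinates and not on the seed.\<close>

definition qprog where
 "qprog d h c = seqs [rds d, swc d h [] (%x. Bin Or (tm 12) (rn (Slt x)) (rn (Slt x))), c]"

context layout begin

lemma base_less: "base < 2 ^ w"
proof -
 have "1 * 1 <= cap * (7 * (d + L + 1))" using cap by (intro mult_le_mono) auto
 thus ?thesis using fits unfolding base_def by linarith
qed

lemma wp_tables:
 assumes s: "!!a. mem s a = 0"
 and Q: "!!s'. frm {Tm 0, Tm 1} s s' ==> tabs (mem s') ==> (!!a. base <= a ==> mem s' a = 0) ==> Q s'"
 shows "wp w (seqs (map (%a. seqs [Const (tm 0) a, Const (tm 1) (tab p D a), Store (tm 0) (tm 1)]) [0..<base])) Q s"
proof -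
 define I where "I n s' <-> frm {Tm 0, Tm 1} s s' & (ALL a. mem s' a = (if a < n then tab p D a else 0))" for n s'
 show ?thesis
 proof (rule wp_loop[of I])
 show "I 0 s" using s by (simp add: I_def frm_refl)
 fix a s1 assume a: "a < base" and I: "I a s1"
 have "tab p D a <= d * D^2"
 proof (cases "a <= 2 * D")
 case True
 hence "pow_tab p (nat \<bar>int a - int D\<bar>) <= D^2" by (intro pow_tab_le p) auto
 also have "1 * D^2 <= d * D^2" using d by (intro mult_le_mono1)
 finally show ?thesis using True by (simp add: tab_def)
 next
 case False
 have "root_tab p (a - (2 * D + 1)) <= a - (2 * D + 1)" by (rule root_tab_le[OF p(1)])
 thus ?thesis using False a by (simp add: tab_def base_def)
 qed
 hence t: "tab p D a < 2 ^ w" "a < 2 ^ w" using a base_less by (simp_all add: base_def)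
 show "wp w (seqs [Const (tm 0) a, Const (tm 1) (tab p D a), Store (tm 0) (tm 1)]) (I (Suc a)) s1"
 apply (rule wp_Cons wp_Nil wp_const wp_store)+
 subgoal premises pr using I t by (simp add: I_def frm_def pr less_Suc_eq)
 done
 next
 fix s1 assume I: "I base s1"
 show "Q (tick s1)"
 proof (rule Q)
 show "tabs (mem (tick s1))" using I by (simp add: tabs_def I_def tab_def base_def RT_def)
 qed (use I in "simp_all add: I_def frm_def")
 qed
qed

text \<open>All randomness is consumed here. The state is a function f of a uniform bit list that
  can be read back from the registers, and everything later is deterministic.\<close>

lemma exec_iprog:
 "EX f. exec w (iprog p d D N) init_state = map_spmf f (spmf_of_set {bs. length bs = N}) &
 (ALL bs. length bs = N --> bits N (f bs) = bs & tabs (mem (f bs)) & (ALL a>=base. mem (f bs) a = 0) & rg (f bs) Cnt = base &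
 (ALL q. q ~: range Bt Un range Tm Un {Cnt} --> rg (f bs) q = 0))"
proof -
 define TB where "TB = seqs (map (%a. seqs [Const (tm 0) a, Const (tm 1) (tab p D a), Store (tm 0) (tm 1)]) [0..<base])"
 define RB where "RB = seqs (map rb [0..<N])"
 have "wp w TB
 (wp w (Const (rn Cnt) base) (%s. tabs (mem s) & (ALL a>=base. mem s a = 0) & rg s Cnt = base & (ALL q. q ~: range Tm Un {Cnt} --> rg s q = 0))) init_state"
 unfolding TB_def
 proof (rule wp_tables)
 show "mem init_state a = 0" for a by (simp add: init_state_def)
 fix s' assume s': "frm {Tm 0, Tm 1} init_state s'" "tabs (mem s')" "!!a. base <= a ==> mem s' a = 0"
 have z: "rg s' q = 0" if "q ~: range Tm" for q
 proof -
 have "q ~: {Tm 0, Tm 1}" using that by auto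
 thus ?thesis using s'(1) by (simp add: frm_def init_state_def)
 qed
 show "wp w (Const (rn Cnt) base) (%s. tabs (mem s) & (ALL a>=base. mem s a = 0) & rg s Cnt = base & (ALL q. q ~: range Tm Un {Cnt} --> rg s q = 0)) s'"
 by (rule wp_const) (use s' z base_less in simp)
 qed
 then obtain s1 s2 where s1: "exec w TB init_state = return_spmf s1"
 "exec w (Const (rn Cnt) base) s1 = return_spmf s2" and
 s2: "tabs (mem s2)" "ALL a>=base. mem s2 a = 0" "rg s2 Cnt = base" "ALL q. q ~: range Tm Un {Cnt} --> rg s2 q = 0"
 unfolding wp_def by blast
 define f where "f bs = tick (puts [0..<N] bs s2)" for bs
 show ?thesis
 proof (intro exI[of _ f] conjI allI impI)
 have "iprog p d D N = seqs [TB, Const (rn Cnt) base, RB]"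
 by (simp only: iprog_def TB_def RB_def base_def)
 hence "exec w (iprog p d D N) init_state = bind_spmf (exec w RB s2) (exec w (seqs []))"
 using s1 by (simp del: exec.simps(2))
 also have "... = map_spmf f (spmf_of_set {bs. length bs = N})"
 using small_words(3) by (simp add: RB_def exec_rbs map_spmf_conv_bind_spmf f_def)
 finally show "exec w (iprog p d D N) init_state = map_spmf f (spmf_of_set {bs. length bs = N})" .
 fix bs :: "bool list" assume l: "length bs = N"
 have P: "mem (puts [0..<N] bs s2) = mem s2" "!!q. q ~: Bt ` {0..<N} Un {Tm 0} ==> rg (puts [0..<N] bs s2) q = rg s2 q"
 "!!k. k < N ==> rg (puts [0..<N] bs s2) (Bt k) = of_bool (bs ! k)"
 using puts_props[of bs "[0..<N]" s2] l by auto
 show "bits N (f bs) = bs" using l P(3) by (intro nth_equalityI) (simp_all add: bits_def f_def)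
 show "tabs (mem (f bs))" "rg (f bs) Cnt = base" using s2 P(1) P(2)[of Cnt] by (auto simp: f_def)
 show "mem (f bs) a = 0" if "base <= a" for a using s2 P(1) that by (simp add: f_def)
 show "rg (f bs) q = 0" if "q ~: range Bt Un range Tm Un {Cnt}" for q
 proof -
 have "q ~: Bt ` {0..<N} Un {Tm 0}" using that by auto
 thus ?thesis using P(2)[of q] s2(4) that by (simp add: f_def)
 qed
 qed
qed

end

section \<open>The empty structure and queries\<close>

context store begin

lemma Inv_init:
 assumes "tabs (mem s)" "ALL a>=base. mem s a = 0" "rg s Cnt = base" "ALL q. q ~: range Bt Un range Tm Un {Cnt} --> rg s q = 0"
 shows "Inv s {}"
proof -
 have "fa (mem s) k = slot k" for k using assms(2) by (simp add: fa_def slot_def)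
 hence "bij_betw (fa (mem s)) {0..<cap} SL"
 unfolding SL_def bij_betw_def by (auto simp: inj_on_def slot_inj)
 hence "core s {} (slots s)"
 using assms base_less by (simp add: core_def freeok_def good_def recs_def rings_def slot_def)
 moreover have "rg s (Slt x) = 0" "rg s (Rpr i n) = 0" for x i n using assms(4) by auto
 ultimately show ?thesis by (simp add: Inv_def slots_def cell_def)
qed

lemma wp_query:
 assumes h: "D <= 2 ^ h" "1 + 2 ^ h < (2::nat) ^ w"
 and I: "Inv s Om" and x: "x : Om" "inp s = x"
 and Q: "!!s'. (!!q. q : range Bt Un range Slt ==> rg s' q = rg s q) ==> Inv s' Om ==> out s' = out s @ pathwords (mem s) (slots s x) ==>
 time s' <= time s + d + 3 * d * h + 15 * L + 12 ==> Q s'"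
 shows "wp w (qprog d h (pathprint (Tm 12))) Q s"
proof -
 have c: "core s Om (slots s)" and g: "good (mem s) Om (slots s)" and rc: "recs (mem s) Om (slots s)" using I by (auto simp: Inv_def core_def good_def)
 have fin: "finite Om" by (rule core_fin[OF c])
 have xg: "x : grid d D" using rc x by (auto simp: recs_def)
 show ?thesis
 unfolding qprog_def
 proof (rule wp_Cons, rule wp_rds[OF x(2)], goal_cases)
 case 1 show ?case by (rule grid_length[OF xg])
 next
 case (2 t) thus ?case using grid_word[OF xg] by blast
 next
 case (3 s1)
 have s1q: "rg s1 q = rg s q" if "q : range Bt Un range Slt Un {Rpr i n |i n. True} Un {Cnt}" for q
 by (rule 3(1)) (use that in auto)
 show ?case
 proof (rule wp_Cons, rule wp_swc[where x=x])
 show "rg s1 (Crd t) = x ! t & 1 <= x ! t & x ! t <= 2 ^ h" if "t < length x" for t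
 using that 3(2)[of t] grid_length[OF xg] grid_nth[OF xg, of t] h(1) by auto
 fix s2 assume s2: "frm {Tm 0} s1 s2" "mem s2 = mem s1" "out s2 = out s1" "time s2 = time s1 + d * (3 * h)"
 show "wp w (Bin Or (tm 12) (rn (Slt x)) (rn (Slt x))) (wp w (seqs [pathprint (Tm 12)]) Q) s2"
 proof (rule wp_mv, rule wp_Cons)
 fix s3 assume s3: "!!q. rg s3 q = (if q = Tm 12 then rg s2 (Slt x) else rg s2 q)" "mem s3 = mem s2" "out s3 = out s2" "inp s3 = inp s2" "time s3 = Suc (time s2)"
 have m3: "mem s3 = mem s" using 3(3) s2 s3 by simp
 have r3: "rg s3 (Tm 12) = slots s x" using s1q[of "Slt x"] s2(1) by (simp add: s3 frm_def slots_def)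
 show "wp w (pathprint (Tm 12)) (wp w (seqs []) Q) s3"
 proof (rule wp_pathprint)
 show "rg s3 (Tm 12) : SL" using recs_SL[OF rc x(1)] r3 by simp
 show "mem s3 (rg s3 (Tm 12) + off (Nf i)) : SL" if "i <= L" for i
 using g x(1) that recs_SL[OF rc rp_in'[OF fin x(1), of i]] by (simp add: m3 r3 good_def okN_def)
 fix s4 assume s4: "frm {Tm 0, Tm 1, Tm 9} s3 s4" "mem s4 = mem s3" "out s4 = out s3 @ pathwords (mem s3) (rg s3 (Tm 12))" "time s4 <= time s3 + 9 + 15 * L"
 show "wp w (seqs []) Q s4"
 proof (rule wp_Nil, rule Q)
 fix s5 assume s5: "!!q. rg s5 q = rg s4 q" "mem s5 = mem s4" "out s5 = out s4" "inp s5 = inp s4" "time s5 = Suc (time s4)"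
 have s5q: "rg s5 q = rg s q" if "q : range Bt Un range Slt Un {Rpr i n |i n. True} Un {Cnt}" for q
 proof -
 have "q ~: {Tm 0, Tm 1, Tm 9, Tm 12}" using that by auto
 thus ?thesis using s1q[OF that] s2(1) s4(1) by (simp add: s5 s3 frm_def)
 qed
 thus "rg s5 q = rg s q" if "q : range Bt Un range Slt" for q using that by blast
 have sl: "slots s5 = slots s" by (rule ext) (simp add: slots_def s5q)
 have "rg s5 (Rpr i n) = rg s (Rpr i n)" for i n by (rule s5q) auto
 moreover have "core s5 Om (slots s)" by (rule core_cong[OF c refl]) (use s5q[of Cnt] in "simp_all add: s5 s4 m3")
 ultimately show "Inv s5 Om" using I by (simp add: Inv_def sl)
 show "out s5 = out s @ pathwords (mem s) (slots s x)" 
 proof -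
 have "out s5 = out s3 @ pathwords (mem s3) (rg s3 (Tm 12))" using s4(3) by (simp add: s5)
 thus ?thesis unfolding m3 r3 using 3(4) s2(3) s3(3) by simp
 qed
 show "time s5 <= time s + d + 3 * d * h + 15 * L + 12" using 3(5) s2(4) s3(5) s4(4) by (simp add: s5)
 qed
 qed simp
 qed
 qed (use grid_length[OF xg] h in simp_all)
 qed
qed

end

section \<open>The tree described by a state and the paths that change\<close>

definition the_tree where
 "the_tree p d D L sd s = mk_tree p L (fst sd) (key D o snd sd) {x : grid d D. slots s x ~= 0} (slots s)"

context store begin

abbreviation "wpa s x == weighted_path (the_tree p d D L (lab, pi) s) (slots s x + L)"

lemma Inv_good: "Inv s Om ==> good (mem s) Om (slots s)"
 by (simp add: Inv_def core_def)

lemma Inv_recs: "Inv s Om ==> recs (mem s) Om (slots s)"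
 using Inv_good by (simp add: good_def)

lemma Inv_fin: "Inv s Om ==> finite Om"
 using Inv_recs recs_fin by blast

lemma seed_tree_Inv:
 assumes I: "Inv s Om" shows "seed_tree p d D L lab pr Om (slots s)"
proof
 have rc: "recs (mem s) Om (slots s)" by (rule Inv_recs[OF I])
 show "1 <= p" by (rule p(1))
 show Om: "Om <= grid d D" using rc by (simp add: recs_def)
 show "lab 0 x = lab 0 y" for x y by (rule lab0)
 show "lab i x = lab i y" if "lab (Suc i) x = lab (Suc i) y" for i x y using nested that by blast
 show "x = y" if "lab L x = lab L y" for x y using labL that by blast
 show "inj_on pr Om" by (rule inj_on_subset[OF pr_inj Om])
 fix x y i j assume a: "x : Om" "y : Om" "i <= L" "j <= L" "slots s x + i = slots s y + j"
 have "L < K" by (simp add: K_def)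
 hence "slots s x = slots s y & i = j"
 using slot_add_eq[OF recs_SL[OF rc a(1)] recs_SL[OF rc a(2)], of i j] a by simp
 thus "x = y & i = j" using rc a by (auto simp: recs_def inj_on_def)
qed

lemma Inv_set: "Inv s Om ==> {x : grid d D. slots s x ~= 0} = Om"
proof (intro equalityI subsetI)
 assume I: "Inv s Om"
 show "x : Om" if x: "x : {x : grid d D. slots s x ~= 0}" for x
 proof (rule ccontr)
 assume "x ~: Om"
 hence "slots s x = 0" using I x by (simp add: Inv_def)
 thus False using x by simp
 qed
 show "x : {x : grid d D. slots s x ~= 0}" if "x : Om" for x
 using Inv_recs[OF I] that recs_SL[OF Inv_recs[OF I] that] slot_pos by (auto simp: recs_def)
qed

lemma the_tree_Inv: "Inv s Om ==> the_tree p d D L (lab, pi) s = mk_tree p L lab pr Om (slots s)"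
 using Inv_set by (simp add: the_tree_def)

lemma weighted_path_Inv:
 assumes I: "Inv s Om" and x: "x : Om"
 shows "wpa s x = (slots s (rp Om 0 x),
 map (%j. (slots s (rp Om (Suc j) x) + Suc j, real (wdist p (rp Om (Suc j) x) (rp Om j x)))) [0..<L])"
proof -
 interpret T: seed_tree p d D L lab pr Om "slots s" by (rule seed_tree_Inv[OF I])
 show ?thesis using T.weighted_path_T[OF x order_refl] by (simp add: the_tree_Inv[OF I] T.phi[OF x] node_name_def)
qed

lemma encodes_path_Inv:
 assumes I: "Inv s Om" and x: "x : Om"
 shows "encodes_path (pathwords (mem s) (slots s x)) (wpa s x)"
proof -
 have g: "good (mem s) Om (slots s)" by (rule Inv_good[OF I])
 have N: "mem s (slots s x + off (Nf i)) = slots s (rp Om i x)" if "i <= L" for i using g x that by (simp add: good_def okN_def)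
 have W: "mem s (slots s x + off (Wf (Suc i))) = wdist p (rp Om (Suc i) x) (rp Om i x)" if "i < L" for i
 using g x that by (auto simp: good_def okW_def)
 define es where "es = map (%j. (slots s (rp Om (Suc j) x) + Suc j, wdist p (rp Om (Suc j) x) (rp Om j x), 1 :: nat)) [0..<L]"
 have "pathwords (mem s) (slots s x) = length es # slots s (rp Om 0 x) # concat (map (%(v, a, b). [v, a, b]) es)"
 proof -
 have e: "map (%j. [mem s (slots s x + off (Nf (Suc j))) + Suc j, mem s (slots s x + off (Wf (Suc j))), 1]) [0..<L] = map (%(v, a, b). [v, a, b]) es"
 unfolding es_def map_map using N W by (intro map_cong refl) auto
 show ?thesis unfolding pathwords_def e using N[of 0] by (simp add: es_def)
 qed
 thus ?thesis
 unfolding encodes_path_def weighted_path_Inv[OF I x] by (intro exI[of _ es]) (auto simp: es_def)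
qed

lemma encodes_report_Inv:
 assumes I: "Inv s Om" and r: "reported ws (mem s) (slots s) X" and X: "X <= Om"
 shows "encodes_report ws X (%x. wpa s x)"
proof -
 obtain xs where "distinct xs" "set xs = X" "ws = concat (map (%z. z @ pathwords (mem s) (slots s z)) xs)" using r by (auto simp: reported_def)
 thus ?thesis
 unfolding encodes_report_def using encodes_path_Inv[OF I] X
 by (intro exI[of _ xs] exI[of _ "%z. pathwords (mem s) (slots s z)"]) auto
qed

text \<open>Paths mention addresses, while changes are tracked through vectors. An address alone
  does not identify a vector across two states, so the last hypothesis ties the two notions
  together.\<close>

lemma weighted_path_eq_iff:
 assumes I: "Inv s Om" "Inv s' Om'" and z: "z : Om" "z : Om'"
 and eq: "!!i. i <= L ==> slots s' (rp Om' i z) = slots s (rp Om i z) <-> rp Om' i z = rp Om i z"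
 shows "wpa s' z = wpa s z
 <-> (ALL i<=L. rp Om' i z = rp Om i z)"
proof
 assume a: "ALL i<=L. rp Om' i z = rp Om i z"
 hence "slots s' (rp Om i z) = slots s (rp Om i z)" if "i <= L" for i using eq that by metis
 thus "wpa s' z = wpa s z"
 unfolding weighted_path_Inv[OF I(1) z(1)] weighted_path_Inv[OF I(2) z(2)] using a by auto
next
 assume "wpa s' z = wpa s z"
 hence a: "slots s' (rp Om' 0 z) = slots s (rp Om 0 z)" "!!j. j < L ==> slots s' (rp Om' (Suc j) z) = slots s (rp Om (Suc j) z)"
 unfolding weighted_path_Inv[OF I(1) z(1)] weighted_path_Inv[OF I(2) z(2)] by auto
 show "ALL i<=L. rp Om' i z = rp Om i z"
 proof (intro allI impI)
 fix i assume i: "i <= L"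
 have "slots s' (rp Om' i z) = slots s (rp Om i z)" using a i by (cases i) auto
 thus "rp Om' i z = rp Om i z" using eq[OF i] by blast
 qed
qed

text \<open>The path of an old vector changes exactly if x becomes one of its representatives, which
  is membership in a flagged cell. The vector x itself is covered because it represents its
  singleton cell at level L.\<close>

lemma changed_insert:
 assumes I: "Inv s Om" "Inv s' (insert x Om)" and sl: "!!y. y : Om ==> slots s' y = slots s y" and x: "x ~: Om"
 shows "changed (%i. rp (insert x Om) i x = x) (insert x Om) x = {z : insert x Om. z ~: Om |
 wpa s' z ~= wpa s z}"
proof -
 let ?O = "insert x Om"
 have fin: "finite Om" by (rule Inv_fin[OF I(1)])
 have Og: "Om <= grid d D" "x : grid d D" using Inv_recs[OF I(2)] by (auto simp: recs_def)
 have inj: "inj_on (slots s') ?O" using Inv_recs[OF I(2)] by (simp add: recs_def)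
 have iff: "z : changed (%i. rp ?O i x = x) ?O x <-> (EX i<=L. rp ?O i z ~= rp Om i z)" if z: "z : Om" for z
 proof
 assume "z : changed (%i. rp ?O i x = x) ?O x"
 then obtain i where i: "i <= L" "rp ?O i x = x" "z : ce ?O i x" by (auto simp: changed_def)
 have "rp ?O i z = x" using cell_of[OF i(3)] i(2) by simp
 moreover have "rp Om i z : Om" by (rule rp_in'[OF fin z])
 ultimately show "EX i<=L. rp ?O i z ~= rp Om i z" using i(1) x by metis
 next
 assume "EX i<=L. rp ?O i z ~= rp Om i z"
 thus "z : changed (%i. rp ?O i x = x) ?O x" using rp_insert_cases[OF Og z] unfolding changed_def by blast
 qed
 have w: "wpa s' z = wpa s z
 <-> (ALL i<=L. rp ?O i z = rp Om i z)" if z: "z : Om" for z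
 proof (rule weighted_path_eq_iff[OF I z])
 fix i
 have a: "rp Om i z : Om" "rp ?O i z : ?O" using rp_in'[OF fin z] rp_in'[of ?O z i] fin z by auto
 show "slots s' (rp ?O i z) = slots s (rp Om i z) <-> rp ?O i z = rp Om i z"
 unfolding sl[OF a(1), symmetric] using inj a by (auto dest: inj_onD)
 qed (use z in simp)
 have "x : changed (%i. rp ?O i x = x) ?O x"
 proof -
 have "rp ?O L x = x"
 proof -
 have "lab L (rp ?O L x) = lab L x" using rp_cell[of ?O L x] cell_refl[of x ?O lab L] fin by (auto simp: cell_def)
 thus ?thesis by (rule labL)
 qed
 thus ?thesis using cell_refl[of x ?O lab L] unfolding changed_def by auto
 qed
 moreover have "changed (%i. rp ?O i x = x) ?O x <= ?O" unfolding changed_def by (auto simp: cell_def)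
 ultimately show ?thesis using iff w by blast
qed

text \<open>The affected vectors are those with x among their former representatives. Their new
  representatives differ from x, and addresses of survivors are kept, so these paths do
  change.\<close>

lemma changed_delete:
 assumes I: "Inv s Om" "Inv s' (Om - {x})" and sl: "!!y. y : Om - {x} ==> slots s' y = slots s y" and x: "x : Om"
 shows "changed (%i. rp Om i x = x) (Om - {x}) x = {z : Om - {x}. z ~: Om |
 wpa s' z ~= wpa s z}"
proof -
 let ?O = "Om - {x}"
 have fin: "finite Om" by (rule Inv_fin[OF I(1)])
 have Og: "Om <= grid d D" using Inv_recs[OF I(1)] by (auto simp: recs_def)
 have inj: "inj_on (slots s) Om" using Inv_recs[OF I(1)] by (simp add: recs_def)
 have iff: "z : changed (%i. rp Om i x = x) ?O x <-> (EX i<=L. rp ?O i z ~= rp Om i z)" if z: "z : ?O" for z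
 proof
 assume "z : changed (%i. rp Om i x = x) ?O x"
 then obtain i where i: "i <= L" "rp Om i x = x" "z : ce ?O i x" by (auto simp: changed_def)
 have "z : ce Om i x" using i(3) by (auto simp: cell_def)
 hence "rp Om i z = x" using cell_of i(2) by metis
 moreover have "rp ?O i z : ?O" by (rule rp_in'[OF _ z]) (use fin in simp)
 ultimately show "EX i<=L. rp ?O i z ~= rp Om i z" using i(1) by (metis Diff_iff singletonI)
 next
 assume "EX i<=L. rp ?O i z ~= rp Om i z"
 thus "z : changed (%i. rp Om i x = x) ?O x" using rp_delete_cases[OF fin Og x z] unfolding changed_def by blast
 qed
 have w: "wpa s' z = wpa s z
 <-> (ALL i<=L. rp ?O i z = rp Om i z)" if z: "z : ?O" for z
 proof (rule weighted_path_eq_iff[OF I _ z])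
 show zO: "z : Om" using z by simp
 fix i
 have a: "rp Om i z : Om" "rp ?O i z : ?O" using rp_in'[OF fin zO] rp_in'[of ?O z i] fin z by auto
 show "slots s' (rp ?O i z) = slots s (rp Om i z) <-> rp ?O i z = rp Om i z"
 unfolding sl[OF a(2)] using inj a by (auto dest: inj_onD)
 qed
 have "changed (%i. rp Om i x = x) ?O x <= ?O" unfolding changed_def by (auto simp: cell_def)
 thus ?thesis using iff w by blast
qed

end

section \<open>The data structure on words of a given length\<close>

definition structure_of where
 "structure_of p d D sd = (let h = m0 d D; L = Suc h; N = (2 * d + 6) * h in
 \<lparr>init_prog = iprog p d D N, query_prog = qprog d h (layout.pathprint L (Tm 12)),
 insert_prog = oprog N d h L sd (Cond (tm 12) Skip (store.icore d D L)),
 delete_prog = oprog N d h L sd (Cond (tm 12) (store.dcore d D L) Skip)\<rparr>)"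

lemma (in store) Inv_cong: "mem s' = mem s ==> reg s' = reg s ==> Inv s Om ==> Inv s' Om"
 by (simp add: Inv_def core_def slots_def[abs_def])

text \<open>Tables and records take space at most quadratic in n = M d D. As n >= 2, the bound n^8
  <= 2^w yields 64 n^2 <= 2^w, which leaves room for all constants.\<close>

lemma words_fit:
 fixes n M d D w :: nat
 assumes d: "1 <= d" and D: "2 <= D" and M: "1 <= M" and n: "n = M * d * D" and w: "n ^ 8 <= 2 ^ w"
 shows "2 * D + 2 + d * D^2 + M * (7 * (d + Suc (m0 d D) + 1)) <= 2 ^ w" "1 + 2 ^ m0 d D < (2::nat) ^ w"
proof -
 have n2: "2 <= n" using mult_le_mono[OF mult_le_mono[OF M d] D] by (simp add: n)
 have Dn: "D <= n" using mult_le_mono[OF M d] mult_le_mono1[of 1 "M * d" D] by (simp add: n)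
 have dDn: "d * D <= n" using mult_le_mono1[OF M, of "d * D"] by (simp add: n mult.assoc)
 have Md: "M * d <= n" using mult_le_mono2[of 1 D "M * d"] D by (simp add: n)
 have "M * 1 <= M * d" using d by (rule mult_le_mono2)
 hence M1: "M <= n" using Md by linarith
 have "M * m0 d D <= M * (d * D)" by (intro mult_le_mono2 m0_le_self)
 hence Mm: "M * m0 d D <= n" by (simp add: n mult.assoc)
 have "d * D^2 = (d * D) * D" by (simp add: power2_eq_square)
 also have "... <= n * n" by (intro mult_le_mono dDn Dn)
 finally have sq: "d * D^2 <= n * n" .
 have "2 ^ 6 * (n * n) <= n ^ 6 * (n * n)" by (intro mult_le_mono1 power_mono n2) simp
 also have "... = n ^ 8" by (simp add: eval_nat_numeral)
 finally have n8: "64 * (n * n) <= 2 ^ w" using w by simp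
 have nn: "2 * n <= n * n" using n2 by (intro mult_le_mono1)
 have e: "M * (7 * (d + Suc (m0 d D) + 1)) = 7 * (M * d) + 7 * (M * m0 d D) + 14 * M" by (simp add: algebra_simps)
 show "2 * D + 2 + d * D^2 + M * (7 * (d + Suc (m0 d D) + 1)) <= 2 ^ w"
 unfolding e using Dn n2 sq Md Mm M1 n8 nn by linarith
 have dD2: "2 <= d * D" using mult_le_mono[OF d D] by simp
 have "2 ^ m0 d D = 2 * (2::nat) ^ (m0 d D - 1)" using m0_ge_1[OF dD2] by (metis Suc_diff_le diff_Suc_1 One_nat_def power_Suc)
 hence "2 ^ m0 d D < 2 * n" using m0_less[OF dD2] dDn by linarith
 thus "1 + 2 ^ m0 d D < (2::nat) ^ w" using n2 n8 nn by linarith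
qed

text \<open>Both d and h are positive, so lower-order terms are absorbed into d h or into h + d.
  Writing them as successors reduces the claims to a comparison of coefficients.\<close>

lemma update_time:
 fixes d h :: nat assumes "1 <= d" "1 <= h"
 shows "80 + 2 * ((2 * d + 6) * h) + 6 * d * h + 11 * d + 3 * Suc h + (Suc h + 1) * (28 * d + 80) <= 443 * (d * h)"
 "80 + 2 * ((2 * d + 6) * h) + 6 * d * h + 2 * d + 3 * Suc h + (Suc h + 1) * 80 <= 443 * (d * h)"
 "69 + 15 * Suc h + 34 * d <= 130 * (h + d)" "82 + 15 * Suc h + 48 * d <= 130 * (h + d)"
proof -
 obtain a b where "d = Suc a" "h = Suc b" using assms by (metis Suc_le_D One_nat_def)
 thus "80 + 2 * ((2 * d + 6) * h) + 6 * d * h + 11 * d + 3 * Suc h + (Suc h + 1) * (28 * d + 80) <= 443 * (d * h)"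
 "80 + 2 * ((2 * d + 6) * h) + 6 * d * h + 2 * d + 3 * Suc h + (Suc h + 1) * 80 <= 443 * (d * h)"
 "69 + 15 * Suc h + 34 * d <= 130 * (h + d)" "82 + 15 * Suc h + 48 * d <= 130 * (h + d)"
 by (simp_all add: algebra_simps)
qed

locale machine =
 fixes p :: real and d D w :: nat and sd :: "bool list => seed"
 assumes d: "1 <= d" and D: "2 <= D" and p: "1 <= p" "p <= 2" and seeds: "!!bs. good_seed d D (sd bs)" and room: "(d * D) ^ 8 <= (2::nat) ^ w"
begin

definition h where "h = m0 d D"
definition L where "L = Suc h"
definition N where "N = (2 * d + 6) * h"
text \<open>The largest cardinality for which words are long enough. It occurs in the invariant
  only: the program is fixed before w, hence before the capacity.\<close>

definition cap where "cap = Max {M. (M * d * D) ^ 8 <= (2::nat) ^ w}"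
definition Ds where "Ds = structure_of p d D sd"
definition Tr where "Tr s = the_tree p d D L (sd (bits N s)) s"
definition ph where "ph s x = slots s x + L"
definition Iv where "Iv bs s Om <-> store.Inv p d D L cap w (fst (sd bs)) (snd (sd bs)) s Om"

lemma fin_caps: "finite {M. (M * d * D) ^ 8 <= (2::nat) ^ w}"
proof (rule finite_subset)
 show "{M. (M * d * D) ^ 8 <= (2::nat) ^ w} <= {..2 ^ w}"
 proof
 fix M assume "M : {M. (M * d * D) ^ 8 <= (2::nat) ^ w}"
 hence le: "(M * d * D) ^ 8 <= (2::nat) ^ w" by simp
 have "M * (1 * 1) <= M * (d * D)" using d D by (intro mult_le_mono) auto
 hence "M <= M * d * D" by (simp add: mult.assoc)
 also have "n <= n ^ 8" for n :: nat using self_le_power[of n 8] by (cases "n = 0") auto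
 finally show "M : {..2 ^ w}" using le by simp
 qed
qed simp

lemma cap_ge: "(M * d * D) ^ 8 <= (2::nat) ^ w ==> M <= cap"
 unfolding cap_def using fin_caps by (intro Max_ge) auto

lemma cap_props: "1 <= cap" "(cap * d * D) ^ 8 <= (2::nat) ^ w"
proof -
 show "1 <= cap" using room by (intro cap_ge) simp
 have "cap : {M. (M * d * D) ^ 8 <= (2::nat) ^ w}"
 unfolding cap_def by (rule Max_in[OF fin_caps]) (use room in "auto intro!: exI[of _ 1]")
 thus "(cap * d * D) ^ 8 <= (2::nat) ^ w" by simp
qed

lemma store: "store p d D L cap w (fst (sd bs)) (snd (sd bs))"
proof
 show "1 <= d" "2 <= D" "1 <= p" "p <= 2" "1 <= cap" using d D p cap_props by auto
 show "2 * D + 2 + d * D^2 + cap * (7 * (d + L + 1)) <= 2 ^ w"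
 using words_fit(1)[OF d D cap_props(1) refl cap_props(2)] by (simp add: L_def h_def)
 show "fst (sd bs) 0 x = fst (sd bs) 0 y" for x y using seeds[of bs] unfolding good_seed_def by blast
 show "fst (sd bs) i x = fst (sd bs) i y" if "fst (sd bs) (Suc i) x = fst (sd bs) (Suc i) y" for i x y
 using seeds[of bs] that unfolding good_seed_def by blast
 show "x = y" if "fst (sd bs) L x = fst (sd bs) L y" for x y
 using seeds[of bs] that unfolding good_seed_def L_def h_def by blast
 show "snd (sd bs) permutes grid d D" using seeds[of bs] unfolding good_seed_def by blast
qed

lemma h_props: "D <= 2 ^ h" "1 + 2 ^ h < (2::nat) ^ w" "1 <= h"
proof -
 have "1 * D <= d * D" using d by (intro mult_le_mono1)
 thus "D <= 2 ^ h" using m0_le[of d D] unfolding h_def by linarith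
 show "1 + 2 ^ h < (2::nat) ^ w" using words_fit(2)[OF d D cap_props(1) refl cap_props(2)] by (simp add: h_def)
 show "1 <= h" unfolding h_def using mult_le_mono[OF d D] by (intro m0_ge_1) simp
qed

lemma Ds_simps: "init_prog Ds = iprog p d D N" "query_prog Ds = qprog d h (layout.pathprint L (Tm 12))"
 "insert_prog Ds = oprog N d h L sd (Cond (tm 12) Skip (store.icore d D L))"
 "delete_prog Ds = oprog N d h L sd (Cond (tm 12) (store.dcore d D L) Skip)"
 by (simp_all add: Ds_def structure_of_def Let_def h_def L_def N_def)

lemma load_nat: "load d D Om x (sd bs) = real (SUM i<=L. of_bool (rep (fst (sd bs)) (key D o snd (sd bs)) Om i x = x) * card (cell (fst (sd bs)) Om i x))"
 by (simp add: load_def L_def h_def)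

lemma init_step:
 "EX F. exec w (init_prog Ds) init_state = map_spmf F (spmf_of_set {bs. length bs = N}) &
 (ALL bs. length bs = N --> bits N (F bs) = bs & Iv bs (F bs) {})"
proof -
 interpret S: store p d D L cap w "fst (sd [])" "snd (sd [])" by (rule store)
 obtain F where F: "exec w (iprog p d D N) init_state = map_spmf F (spmf_of_set {bs. length bs = N})"
 "!!bs. length bs = N ==> bits N (F bs) = bs & S.tabs (mem (F bs)) & (ALL a>=S.base. mem (F bs) a = 0) & rg (F bs) Cnt = S.base &
 (ALL q. q ~: range Bt Un range Tm Un {Cnt} --> rg (F bs) q = 0)"
 using S.exec_iprog[of N] by blast
 have "Iv bs (F bs) {}" if "length bs = N" for bs
 proof -
 interpret S': store p d D L cap w "fst (sd bs)" "snd (sd bs)" by (rule store)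
 show ?thesis unfolding Iv_def by (rule S'.Inv_init) (use F(2)[OF that] in blast)+
 qed
 thus ?thesis using F by (intro exI[of _ F]) (auto simp: Ds_simps)
qed

lemma query_step:
 assumes b: "bits N s = bs" and I: "Iv bs s Om" and x: "x : Om"
 shows "EX s'. run_op w Ds (Query x) s = return_spmf s' & bits N s' = bs & Iv bs s' Om & Tr s' = Tr s & (ALL y. ph s' y = ph s y) &
 encodes_path (out s') (weighted_path (Tr s) (ph s x)) & time s' <= 46 * (d * h)"
proof -
 interpret S: store p d D L cap w "fst (sd bs)" "snd (sd bs)" by (rule store)
 let ?s = "s\<lparr>inp := x, out := [], time := 0\<rparr>"
 have I': "S.Inv ?s Om" by (rule S.Inv_cong[of _ s]) (use I in "simp_all add: Iv_def")
 have "wp w (qprog d h (S.pathprint (Tm 12))) (%s'. bits N s' = bs & Iv bs s' Om & Tr s' = Tr s & (ALL y. ph s' y = ph s y) &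
 encodes_path (out s') (weighted_path (Tr s) (ph s x)) & time s' <= 46 * (d * h)) ?s"
 proof (rule S.wp_query[OF h_props(1,2) I' x])
 show "inp ?s = x" by simp
 fix s' assume s': "!!q. q : range Bt Un range Slt ==> rg s' q = rg ?s q" "S.Inv s' Om" "out s' = out ?s @ S.pathwords (mem ?s) (slots ?s x)"
 "time s' <= time ?s + d + 3 * d * h + 15 * L + 12"
 have bs: "bits N s' = bs" using s'(1) b by (simp add: bits_def)
 have sl: "slots s' = slots s" using s'(1) by (auto simp: slots_def)
 have "slots ?s = slots s" by (auto simp: slots_def)
 hence o: "out s' = S.pathwords (mem s) (slots s x)" using s'(3) by simp
 have "d * 1 <= d * h" "1 * h <= d * h" using h_props(3) d by (intro mult_le_mono order_refl; simp)+
 moreover have "time s' <= d + 3 * (d * h) + 15 * h + 27" using s'(4) by (simp add: L_def mult.assoc)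
 ultimately have t: "time s' <= 46 * (d * h)" using d h_props(3) by linarith
 have "encodes_path (out s') (weighted_path (Tr s) (ph s x))"
 unfolding o Tr_def ph_def b using S.encodes_path_Inv[OF _ x, of s] I by (simp add: Iv_def)
 thus "bits N s' = bs & Iv bs s' Om & Tr s' = Tr s & (ALL y. ph s' y = ph s y) &
 encodes_path (out s') (weighted_path (Tr s) (ph s x)) & time s' <= 46 * (d * h)"
 using bs b sl s'(2) t by (simp add: Iv_def Tr_def ph_def the_tree_def)
 qed
 thus ?thesis unfolding wp_def by (simp add: run_op_def Ds_simps) 
qed

definition changes where
 "changes s s' Om Om' = {z : Om'. z ~: Om | weighted_path (Tr s') (ph s' z) ~= weighted_path (Tr s) (ph s z)}"

context fixes bs :: "bool list" begin

interpretation S: store p d D L cap w "fst (sd bs)" "snd (sd bs)" by (rule store)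

text \<open>Passes from the program logic to statements about trees. The second assumption on X
  identifies what is printed with the set of changed paths, or with the empty set if the update has
  no effect.\<close>

lemma op_step:
 fixes s x defines "s0 == s\<lparr>inp := x, out := [], time := 0\<rparr>"
 assumes b: "bits N s = bs" and I: "Iv bs s Om" and t: "A <= 443 * (d * h)" "B <= 130 * (h + d)"
 and wp: "!!Q. S.Inv s0 Om ==> sd (bits N s0) = (fst (sd bs), snd (sd bs)) ==> inp s0 = x ==>
 (!!s' ws. S.Inv s' Om' ==> bits N s' = bits N s0 ==> (!!y. y : Om ==> y : Om' ==> slots s' y = slots s0 y) ==> out s' = out s0 @ ws ==>
 S.reported ws (mem s') (slots s') X ==> time s' <= time s0 + A + Z * B ==> Q s') ==> wp w P Q s0"
 and X: "X <= Om'" "!!s'. S.Inv s Om ==> S.Inv s' Om' ==> ALL y:Om Int Om'. slots s' y = slots s y ==>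
 Om' = Om & X = {} | X = {z : Om'. z ~: Om | S.wpa s' z ~=
 S.wpa s z}"
 shows "EX s'. exec w P s0 = return_spmf s' & bits N s' = bs & Iv bs s' Om' &
 encodes_report (out s') (changes s s' Om Om') (%z. weighted_path (Tr s') (ph s' z)) &
 real (time s') <= 443 * real (d * h) + real Z * (130 * real (h + d))"
proof -
 have Is: "S.Inv s Om" using I by (simp add: Iv_def)
 have bq: "bits N s0 = bs" using b by (simp add: bits_def s0_def)
 have "wp w P (%s'. bits N s' = bs & Iv bs s' Om' &
 encodes_report (out s') (changes s s' Om Om') (%z. weighted_path (Tr s') (ph s' z)) &
 real (time s') <= 443 * real (d * h) + real Z * (130 * real (h + d))) s0"
 proof (rule wp, goal_cases)
 case 1 show ?case by (rule S.Inv_cong[of _ s]) (use Is in "simp_all add: s0_def")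
 next
 case (4 s' ws)
 have b': "bits N s' = bs" using 4(2) bq by simp
 have sl: "ALL y:Om Int Om'. slots s' y = slots s y" using 4(3) by (simp add: s0_def slots_def)
 have Tr: "Tr s = the_tree p d D L (fst (sd bs), snd (sd bs)) s" "Tr s' = the_tree p d D L (fst (sd bs), snd (sd bs)) s'"
 by (simp_all add: Tr_def b b')
 have set: "changes s s' Om Om' = X"
 using X(2)[OF Is 4(1) sl]
 proof (elim disjE, goal_cases)
 case O: 1
 have "weighted_path (Tr s') (ph s' z) = weighted_path (Tr s) (ph s z)" if z: "z : Om" for z
 unfolding Tr ph_def
 using O sl S.weighted_path_eq_iff[OF Is _ z z, of s'] 4(1) S.rp_in'[OF S.Inv_fin[OF Is] z] by simp
 thus ?thesis using O by (simp add: changes_def)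
 next
 case 2 show ?case unfolding changes_def Tr ph_def 2 by simp
 qed
 have rep: "encodes_report (out s') (changes s s' Om Om') (%z. weighted_path (Tr s') (ph s' z))"
 unfolding Tr ph_def set using S.encodes_report_Inv[OF 4(1,5) X(1)] 4(4) by (simp add: s0_def)
 have "time s' <= A + Z * B" using 4(6) by (simp add: s0_def)
 also have "... <= 443 * (d * h) + Z * (130 * (h + d))" by (intro add_mono mult_le_mono2 t)
 finally have "real (time s') <= real (443 * (d * h) + Z * (130 * (h + d)))" by (rule of_nat_mono)
 thus ?case using b' 4(1) rep by (simp add: Iv_def)
 qed (simp_all add: bq, simp add: s0_def)
 thus ?thesis by (simp add: wp_def)
qed

lemma insert_step:
 assumes b: "bits N s = bs" and I: "Iv bs s Om" and x: "x : grid d D" and c: "card (insert x Om) <= cap"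
 shows "EX s'. run_op w Ds (Insert x) s = return_spmf s' & bits N s' = bs & Iv bs s' (insert x Om) &
 encodes_report (out s') (changes s s' Om (insert x Om)) (%z. weighted_path (Tr s') (ph s' z)) &
 real (time s') <= 443 * real (d * h) + load d D (insert x Om) x (sd bs) * (130 * real (h + d))"
 unfolding load_nat run_op_def arg_of.simps prog_of.simps Ds_simps
proof (rule op_step[OF b I update_time(1,3)[OF d h_props(3), folded N_def L_def],
 where X="if x : Om then {} else S.changed (%i. S.rp (insert x Om) i x = x) (insert x Om) x"], goal_cases)
 case (1 Q)
 show ?case by (rule S.wp_insert_op[where N=N and sd=sd, OF h_props(1,2) 1(1) x 1(3,2) c], rule 1(4)) (simp_all add: add.assoc)
next
 case (3 s')
 show ?case using S.changed_insert[OF 3(1,2)] 3(3) by (cases "x : Om") (simp_all add: insert_absorb)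
qed (auto simp: S.changed_def cell_def)

lemma of_bool_real: "of_bool P * real n = real (of_bool P * n)" by simp

lemma delete_step:
 assumes b: "bits N s = bs" and I: "Iv bs s Om" and x: "x : grid d D"
 shows "EX s'. run_op w Ds (Delete x) s = return_spmf s' & bits N s' = bs & Iv bs s' (Om - {x}) &
 encodes_report (out s') (changes s s' Om (Om - {x})) (%z. weighted_path (Tr s') (ph s' z)) &
 real (time s') <= 443 * real (d * h) + of_bool (x : Om) * load d D Om x (sd bs) * (130 * real (h + d))"
 unfolding load_nat run_op_def arg_of.simps prog_of.simps Ds_simps of_bool_real
proof (rule op_step[OF b I update_time(2,4)[OF d h_props(3), folded N_def L_def],
 where X="if x : Om then S.changed (%i. S.rp Om i x = x) (Om - {x}) x else {}"], goal_cases)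
 case (1 Q)
 show ?case by (rule S.wp_delete_op[where N=N and sd=sd, OF h_props(1,2) 1(1) x 1(3,2)], rule 1(4)) (simp_all add: add.assoc)
next
 case (3 s')
 show ?case using S.changed_delete[OF 3(1,2)] 3(3) by (cases "x : Om") simp_all
qed (auto simp: S.changed_def cell_def)

end

end

section \<open>Histories of operations and expectations over the seed\<close>

lemma contents_snoc: "contents (us @ [u]) = apply_op u (contents us)"
 by (simp add: contents_def)

lemma run_ops_snoc: "run_ops w D (us @ [u]) = bind_spmf (run_ops w D us) (run_op w D u)"
 by (simp add: run_ops_def)

lemma admissible_snoc:
 assumes "admissible c w d D (us @ [u])"
 shows "admissible c w d D us" "arg_of u : grid d D" "!!x. u = Query x ==> x : contents us"
 "(max 1 (card (contents (us @ [u]))) * d * D) ^ c <= 2 ^ w"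
proof -
 have a: "!!n. n < length (us @ [u]) ==> arg_of ((us @ [u]) ! n) : grid d D & (ALL x. (us @ [u]) ! n = Query x --> x : contents (take n (us @ [u])))"
 and b: "!!n. n <= length (us @ [u]) ==> (max 1 (card (contents (take n (us @ [u])))) * d * D) ^ c <= 2 ^ w"
 using assms unfolding admissible_def by blast+
 show "admissible c w d D us"
 unfolding admissible_def
 proof (intro conjI allI impI)
 fix n assume n: "n < length us"
 show "arg_of (us ! n) : grid d D" using a[of n] n by (simp add: nth_append)
 show "x : contents (take n us)" if "us ! n = Query x" for x using a[of n] n that by (simp add: nth_append)
 next
 fix n assume "n <= length us"
 thus "(max 1 (card (contents (take n us))) * d * D) ^ c <= 2 ^ w" using b[of n] by simp
 qed
 show "arg_of u : grid d D" "!!x. u = Query x ==> x : contents us" using a[of "length us"] by auto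
 show "(max 1 (card (contents (us @ [u]))) * d * D) ^ c <= 2 ^ w" using b[of "length (us @ [u])"] by simp
qed

lemma admissible_room: "admissible c w d D us ==> (d * D) ^ c <= 2 ^ w"
 unfolding admissible_def by (elim conjE allE[of _ 0]) (simp add: contents_def)

lemma nn_integral_uniform:
 assumes U: "finite U" "U ~= {}" and g: "!!u. u : U ==> 0 <= g (F u) & g (F u) <= G u" and G: "(SUM u:U. G u) <= rc U * B"
 shows "(\<integral>\<^sup>+ s. ennreal (g s) \<partial>measure_spmf (map_spmf F (spmf_of_set U))) <= ennreal B"
proof -
 have c: "0 < rc U" using U by (simp add: card_gt_0_iff)
 have "(\<integral>\<^sup>+ s. ennreal (g s) \<partial>measure_spmf (map_spmf F (spmf_of_set U))) = (SUM u:U. ennreal (g (F u))) / card U"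
 by (simp add: nn_integral_spmf_of_set o_def)
 also have "(SUM u:U. ennreal (g (F u))) = ennreal (SUM u:U. g (F u))" using g by (intro sum_ennreal) auto
 also have "ennreal (SUM u:U. g (F u)) / card U = ennreal ((SUM u:U. g (F u)) / card U)"
 using c g by (simp add: divide_ennreal sum_nonneg ennreal_of_nat_eq_real_of_nat)
 also have "... <= ennreal B"
 proof (rule ennreal_leI)
 have "(SUM u:U. g (F u)) <= rc U * B" using G sum_mono[of U "%u. g (F u)" G] g by fastforce
 thus "(SUM u:U. g (F u)) / card U <= B" using c by (simp add: divide_le_eq mult.commute)
 qed
 finally show ?thesis .
qed

text \<open>As m >= 1, the load factor 2 m + 5 is at most 7 m, and 7 * 130 = 910. Then m <= 3 l
  replaces the number of levels by a logarithm.\<close>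

lemma update_budget:
 fixes d :: nat and l m :: real
 assumes "1 <= d" "1 <= m" "m <= 3 * l" "0 <= l"
 shows "443 * (real d * m) + (2 * m + 5) * (130 * (m + real d)) <= 2 ^ 54 * (real d * l + l^2)"
proof -
 have dm: "real d * m <= real d * (3 * l)" using assms by (intro mult_left_mono) auto
 have mm: "m * m <= (3 * l) * (3 * l)" using assms by (intro mult_mono) auto
 have "(2 * m + 5) * (130 * (m + real d)) <= (7 * m) * (130 * (m + real d))"
 using assms by (intro mult_right_mono) auto
 also have "... = 910 * (m * m) + 910 * (real d * m)" by (simp add: algebra_simps)
 finally have "443 * (real d * m) + (2 * m + 5) * (130 * (m + real d)) <= 4059 * (real d * l) + 8190 * (l * l)"
 using dm mm by (simp add: algebra_simps)
 also have "... <= 2 ^ 54 * (real d * l) + 2 ^ 54 * (l * l)"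
 using assms by (intro add_mono mult_right_mono) auto
 finally show ?thesis by (simp add: power2_eq_square algebra_simps)
qed

context machine begin

abbreviation "U == {bs :: bool list. length bs = N}"

lemma U_fin: "finite U" "U ~= {}" "card U = 2 ^ N"
proof -
 show "finite U" "card U = 2 ^ N" using finite_lists_length_eq[of "UNIV :: bool set" N] card_lists_length_eq[of "UNIV :: bool set" N] by (simp_all add: card_UNIV_bool)
 show "U ~= {}" using Ex_list_of_length by auto
qed

text \<open>After a history the state is a function of the seed bits drawn initially. The history is
  fixed in advance, so the seed remains uniform and all expectations are averages over
  \<open>U\<close>.\<close>

definition ok where
 "ok F us <-> run_ops w Ds us = map_spmf F (spmf_of_set U) & (ALL bs:U. bits N (F bs) = bs & Iv bs (F bs) (contents us))"

lemma ok_snoc: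
 assumes F: "ok F us"
 and st: "!!bs. bs : U ==> EX s'. run_op w Ds u (F bs) = return_spmf s' & bits N s' = bs & Iv bs s' (apply_op u (contents us)) & P bs s'"
 shows "EX F'. ok F' (us @ [u]) & (ALL bs:U. run_op w Ds u (F bs) = return_spmf (F' bs) & P bs (F' bs))"
proof -
 obtain F' where F': "!!bs. bs : U ==> run_op w Ds u (F bs) = return_spmf (F' bs) & bits N (F' bs) = bs & Iv bs (F' bs) (apply_op u (contents us)) & P bs (F' bs)"
 using st by metis
 have "run_ops w Ds (us @ [u]) = bind_spmf (spmf_of_set U) (%bs. run_op w Ds u (F bs))"
 using F by (simp add: ok_def run_ops_snoc bind_map_spmf o_def)
 also have "... = bind_spmf (spmf_of_set U) (%bs. return_spmf (F' bs))"
 using F' U_fin by (intro bind_spmf_cong) auto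
 finally have "ok F' (us @ [u])" using F' by (simp add: ok_def contents_snoc map_spmf_conv_bind_spmf)
 thus ?thesis using F' by blast
qed

lemma cap_contents:
 assumes "(max 1 (card Om) * d * D) ^ 8 <= (2::nat) ^ w" shows "card Om <= cap"
 using cap_ge[OF assms] by simp

lemma ex_ok: "admissible 8 w d D us ==> EX F. ok F us"
proof (induction us rule: rev_induct)
 case Nil
 show ?case using init_step by (auto simp: ok_def run_ops_def contents_def)
next
 case (snoc u us)
 note ad = admissible_snoc[OF snoc.prems]
 obtain F where F: "ok F us" using snoc.IH ad(1) by blast
 have I: "bits N (F bs) = bs" "Iv bs (F bs) (contents us)" if "bs : U" for bs using F that by (auto simp: ok_def)
 have "EX s'. run_op w Ds u (F bs) = return_spmf s' & bits N s' = bs & Iv bs s' (apply_op u (contents us)) & True" if bs: "bs : U" for bs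
 proof (cases u)
 case (Query x)
 show ?thesis using query_step[OF I[OF bs], of x] ad(3)[OF Query] Query by auto
 next
 case (Insert x)
 have "card (insert x (contents us)) <= cap" using cap_contents[OF ad(4)] Insert by (simp add: contents_snoc)
 thus ?thesis using insert_step[OF I[OF bs], of x] ad(2) Insert by auto
 next
 case (Delete x)
 show ?thesis using delete_step[OF I[OF bs], of x] ad(2) Delete by auto
 qed
 from ok_snoc[where P = "%_ _. True", OF F this] show ?case by blast
qed

lemma Tr_mk:
 assumes "bits N s = bs" "Iv bs s Om"
 shows "Tr s = mk_tree p L (fst (sd bs)) (key D o snd (sd bs)) Om (slots s)"
 "seed_tree p d D L (fst (sd bs)) (key D o snd (sd bs)) Om (slots s)"
proof -
 interpret S: store p d D L cap w "fst (sd bs)" "snd (sd bs)" by (rule store)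
 have I: "S.Inv s Om" using assms by (simp add: Iv_def)
 show "Tr s = mk_tree p L (fst (sd bs)) (key D o snd (sd bs)) Om (slots s)"
 using S.the_tree_Inv[OF I] assms(1) by (simp add: Tr_def)
 show "seed_tree p d D L (fst (sd bs)) (key D o snd (sd bs)) Om (slots s)" by (rule S.seed_tree_Inv[OF I])
qed

lemma ph_def': "ph s = (%x. slots s x + L)"
 by (rule ext) (simp add: ph_def)

lemma contents_grid: "admissible c w d D us ==> contents us <= grid d D"
proof (induction us rule: rev_induct)
 case (snoc u us)
 have "contents us <= grid d D" "arg_of u : grid d D" using snoc admissible_snoc by blast+
 thus ?case by (cases u) (auto simp: contents_snoc)
qed (simp add: contents_def)

lemma tree_ok:
 assumes "bits N s = bs" "Iv bs s Om"
 shows "rooted_weighted_tree (Tr s)" "ALL x:Om. leaf (Tr s) (ph s x)" "non_contracting p Om (Tr s) (ph s)"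
 "!!x y. x : Om ==> y : Om ==> 0 <= tree_dist (Tr s) (ph s x) (ph s y) &
 tree_dist (Tr s) (ph s x) (ph s y) <= 8 * stretch p d D Om x y (sd bs) + 8 * stretch p d D Om y x (sd bs)"
proof -
 interpret T: seed_tree p d D L "fst (sd bs)" "key D o snd (sd bs)" Om "slots s" by (rule Tr_mk[OF assms])
 note e = Tr_mk(1)[OF assms] ph_def'
 show "rooted_weighted_tree (Tr s)" unfolding e by (rule T.tree_T)
 show "ALL x:Om. leaf (Tr s) (ph s x)" unfolding e using T.leaf_T T.phi by simp
 show nc: "non_contracting p Om (Tr s) (ph s)" unfolding e by (rule T.non_contracting_T)
 fix x y assume xy: "x : Om" "y : Om"
 have "0 <= lp_dist p x y" by (rule lp_dist_nonneg)
 also have "... <= tree_dist (Tr s) (ph s x) (ph s y)" using nc xy by (auto simp: non_contracting_def)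
 finally show "0 <= tree_dist (Tr s) (ph s x) (ph s y) &
 tree_dist (Tr s) (ph s x) (ph s y) <= 8 * stretch p d D Om x y (sd bs) + 8 * stretch p d D Om y x (sd bs)"
 using T.tree_dist_le[OF xy] unfolding e by (simp add: stretch_def L_def h_def)
qed

text \<open>Two histories with the same contents are coupled through the same seed; for each seed
  their trees differ only in node names.\<close>

lemma iso_eq:
 assumes "ok F us" "ok F' us'" "contents us' = contents us"
 shows "map_spmf (%s. iso_class (contents us) (Tr s, ph s)) (run_ops w Ds us') = map_spmf (%s. iso_class (contents us) (Tr s, ph s)) (run_ops w Ds us)"
proof -
 have "iso_class (contents us) (Tr (F' bs), ph (F' bs)) = iso_class (contents us) (Tr (F bs), ph (F bs))" if "bs : U" for bs
 proof -
 have "bits N (F bs) = bs" "Iv bs (F bs) (contents us)" "bits N (F' bs) = bs" "Iv bs (F' bs) (contents us)"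
 using assms that by (auto simp: ok_def)
 note a = Tr_mk[OF this(1,2)] Tr_mk[OF this(3,4)]
 show ?thesis unfolding a(1,3) ph_def' by (rule iso_class_mk_tree[OF a(4,2)])
 qed
 thus ?thesis using assms U_fin by (auto simp: ok_def spmf.map_comp o_def intro!: map_spmf_cong)
qed

lemma main:
 defines "l == ln (real (d * D))"
 assumes stretch': "!!Om x y. Om <= grid d D ==> x : Om ==> y : Om ==> (SUM bs:U. stretch p d D Om x y (sd bs)) <=
 2 ^ N * (2 ^ 49 * soft 1 (ln (real (card Om * d * D))) * lp_dist p x y)"
 and load': "!!Om x. Om <= grid d D ==> x : Om ==> (SUM bs:U. load d D Om x (sd bs)) <= 2 ^ N * (2 * real (m0 d D) + 5)"
 and ad: "admissible 8 w d D us"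
 shows "lossless_spmf (run_ops w Ds us) &
 (ALL s:set_spmf (run_ops w Ds us).
 rooted_weighted_tree (Tr s) &
 (ALL x:contents us. leaf (Tr s) (ph s x)) &
 non_contracting p (contents us) (Tr s) (ph s)) &
 (ALL us'. admissible 8 w d D us' & contents us' = contents us -->
 map_spmf (%s. iso_class (contents us) (Tr s, ph s)) (run_ops w Ds us') =
 map_spmf (%s. iso_class (contents us) (Tr s, ph s)) (run_ops w Ds us)) &
 (ALL x:contents us. ALL y:contents us.
 (\<integral>\<^sup>+ s. ennreal (tree_dist (Tr s) (ph s x) (ph s y)) \<partial>measure_spmf (run_ops w Ds us))
 <= ennreal (2 ^ 54 * soft 1 (ln (real (card (contents us) * d * D))) * lp_dist p x y)) &
 (ALL x:contents us. ALL s:set_spmf (run_ops w Ds us).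
 lossless_spmf (run_op w Ds (Query x) s) &
 (ALL s':set_spmf (run_op w Ds (Query x) s).
 real (time s') <= 2 ^ 54 * (real d * ln (real (d * D))) &
 encodes_path (out s') (weighted_path (Tr s) (ph s x)) &
 Tr s' = Tr s & (ALL y:contents us. ph s' y = ph s y))) &
 (ALL u. (EX x. u = Insert x | u = Delete x) & admissible 8 w d D (us @ [u]) -->
 (\<integral>\<^sup>+ s'. ennreal (real (time s')) \<partial>measure_spmf (run_ops w Ds (us @ [u])))
 <= ennreal (2 ^ 54 * (real d * ln (real (d * D)) + (ln (real (d * D)))\<^sup>2)) &
 (ALL s:set_spmf (run_ops w Ds us). ALL s':set_spmf (run_op w Ds u s).
 encodes_report (out s')
 {x : contents (us @ [u]). x ~: contents us |
 weighted_path (Tr s') (ph s' x) ~= weighted_path (Tr s) (ph s x)}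
 (%x. weighted_path (Tr s') (ph s' x))))"
proof -
 have dD: "2 <= d * D" using mult_le_mono[OF d D] by simp
 have m: "1 <= real (m0 d D)" "real (m0 d D) <= 3 * l" using m0_ge_1[OF dD] m0_le_ln[OF dD] by (simp_all add: l_def)
 have l0: "0 <= l" using m by linarith
 have h: "real h = real (m0 d D)" by (simp add: h_def)
 obtain F where F: "ok F us" using ex_ok[OF ad] by blast
 let ?Om = "contents us"
 have Om: "?Om <= grid d D" by (rule contents_grid[OF ad])
 have run: "run_ops w Ds us = map_spmf F (spmf_of_set U)" using F by (simp add: ok_def)
 have I: "bits N (F bs) = bs" "Iv bs (F bs) ?Om" if "bs : U" for bs using F that by (auto simp: ok_def)
 have set: "set_spmf (run_ops w Ds us) = F ` U" using U_fin by (simp add: run)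
 have G1: "lossless_spmf (run_ops w Ds us)" using U_fin by (simp add: run)
 have G2: "rooted_weighted_tree (Tr s) & (ALL x:?Om. leaf (Tr s) (ph s x)) & non_contracting p ?Om (Tr s) (ph s)" if "s : set_spmf (run_ops w Ds us)" for s
 using that tree_ok[OF I] unfolding set by blast
 have G3: "map_spmf (%s. iso_class ?Om (Tr s, ph s)) (run_ops w Ds us') = map_spmf (%s. iso_class ?Om (Tr s, ph s)) (run_ops w Ds us)"
 if "admissible 8 w d D us'" "contents us' = ?Om" for us' using ex_ok[OF that(1)] iso_eq[OF F _ that(2)] by blast
 have G4: "(\<integral>\<^sup>+ s. ennreal (tree_dist (Tr s) (ph s x) (ph s y)) \<partial>measure_spmf (run_ops w Ds us))
 <= ennreal (2 ^ 54 * soft 1 (ln (real (card ?Om * d * D))) * lp_dist p x y)" if xy: "x : ?Om" "y : ?Om" for x y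
 unfolding run
 proof (rule nn_integral_uniform[OF U_fin(1,2)])
 show "0 <= tree_dist (Tr (F bs)) (ph (F bs) x) (ph (F bs) y) & tree_dist (Tr (F bs)) (ph (F bs) x) (ph (F bs) y) <=
 8 * stretch p d D ?Om x y (sd bs) + 8 * stretch p d D ?Om y x (sd bs)" if "bs : U" for bs
 by (rule tree_ok(4)[OF I[OF that] xy])
 have f: "finite ?Om" using Om finite_grid finite_subset by blast
 have "1 <= card ?Om" using xy f by (auto simp: card_gt_0_iff Suc_le_eq)
 hence "1 * 2 <= card ?Om * (d * D)" using dD by (intro mult_le_mono)
 hence "1 <= card ?Om * d * D" unfolding mult.assoc by linarith
 hence "real 1 <= real (card ?Om * d * D)" by (rule of_nat_mono)
 hence "0 <= ln (real (card ?Om * d * D))" by (intro ln_ge_zero) (simp only: of_nat_1)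
 hence s0: "0 <= soft 1 (ln (real (card ?Om * d * D)))" by (simp add: soft_def)
 have sym: "lp_dist p y x = lp_dist p x y" using xy Om grid_length by (intro lp_dist_sym) (metis subsetD)
 \<comment> \<open>Each endpoint contributes 8 times its one-sided stretch. Two times 8 times 2^49
   is 2^53, within the constant 2^54 shared by all bounds.\<close>
 have "(SUM bs:U. 8 * stretch p d D ?Om x y (sd bs) + 8 * stretch p d D ?Om y x (sd bs)) =
 8 * (SUM bs:U. stretch p d D ?Om x y (sd bs)) + 8 * (SUM bs:U. stretch p d D ?Om y x (sd bs))"
 by (simp add: sum.distrib sum_distrib_left)
 also have "... <= 8 * (2 ^ N * (2 ^ 49 * soft 1 (ln (real (card ?Om * d * D))) * lp_dist p x y)) +
 8 * (2 ^ N * (2 ^ 49 * soft 1 (ln (real (card ?Om * d * D))) * lp_dist p x y))"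
 using stretch'[OF Om xy] stretch'[OF Om xy(2,1)] unfolding sym by linarith
 also have "... = rc U * (2 ^ 53 * (soft 1 (ln (real (card ?Om * d * D))) * lp_dist p x y))"
 by (simp add: U_fin(3))
 also have "... <= rc U * (2 ^ 54 * (soft 1 (ln (real (card ?Om * d * D))) * lp_dist p x y))"
 using s0 lp_dist_nonneg[of p x y] by (intro mult_left_mono mult_right_mono mult_nonneg_nonneg) auto
 finally show "(SUM bs:U. 8 * stretch p d D ?Om x y (sd bs) + 8 * stretch p d D ?Om y x (sd bs)) <=
 rc U * (2 ^ 54 * soft 1 (ln (real (card ?Om * d * D))) * lp_dist p x y)" by (simp only: mult.assoc)
 qed
 have G5: "lossless_spmf (run_op w Ds (Query x) s) &
 (ALL s':set_spmf (run_op w Ds (Query x) s). real (time s') <= 2 ^ 54 * (real d * l) &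
 encodes_path (out s') (weighted_path (Tr s) (ph s x)) & Tr s' = Tr s & (ALL y:?Om. ph s' y = ph s y))"
 if x: "x : ?Om" and s: "s : set_spmf (run_ops w Ds us)" for x s
 proof -
 obtain bs where bs: "bs : U" "s = F bs" using s unfolding set by blast
 obtain s' where s': "run_op w Ds (Query x) s = return_spmf s'" "Tr s' = Tr s" "ALL y. ph s' y = ph s y"
 "encodes_path (out s') (weighted_path (Tr s) (ph s x))" "time s' <= 46 * (d * h)"
 using query_step[OF I[OF bs(1)] x] bs(2) by blast
 have "real (time s') <= real (46 * (d * h))" using s'(5) by (rule of_nat_mono)
 also have "... = 46 * (real d * real (m0 d D))" by (simp add: h)
 also have "... <= 46 * (real d * (3 * l))" using m by (intro mult_left_mono) auto
 also have "... = 138 * (real d * l)" by simp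
 also have "... <= 2 ^ 54 * (real d * l)" using l0 by (intro mult_right_mono) auto
 finally show ?thesis using s' by simp
 qed
 have G6: "(\<integral>\<^sup>+ s'. ennreal (real (time s')) \<partial>measure_spmf (run_ops w Ds (us @ [u]))) <= ennreal (2 ^ 54 * (real d * l + l^2)) &
 (ALL s:set_spmf (run_ops w Ds us). ALL s':set_spmf (run_op w Ds u s). encodes_report (out s')
 {x : contents (us @ [u]). x ~: ?Om | weighted_path (Tr s') (ph s' x) ~= weighted_path (Tr s) (ph s x)}
 (%x. weighted_path (Tr s') (ph s' x)))"
 if u: "EX x. u = Insert x | u = Delete x" and ad': "admissible 8 w d D (us @ [u])" for u
 proof -
 note adu = admissible_snoc[OF ad']
 obtain x where x: "u = Insert x | u = Delete x" using u by blast
 hence xg: "x : grid d D" using adu(2) by auto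
 \<comment> \<open>An insertion is charged to the set that already contains x, a deletion to the set
   that still contains it; deleting an absent vector has no load.\<close>
 define W where "W bs = (if u = Insert x then load d D (insert x ?Om) x (sd bs) else of_bool (x : ?Om) * load d D ?Om x (sd bs))" for bs
 have W: "(SUM bs:U. W bs) <= 2 ^ N * (2 * real (m0 d D) + 5)"
 proof (cases "u = Insert x")
 case True
 have "insert x ?Om <= grid d D" using Om xg by simp
 from load'[OF this insertI1] True show ?thesis by (simp add: W_def)
 next
 case False
 show ?thesis
 proof (cases "x : ?Om")
 case True
 thus ?thesis using load'[OF Om True] False by (simp add: W_def)
 qed (use False in "simp add: W_def")
 qed
 define P where "P bs s' <-> real (time s') <= 443 * real (d * h) + W bs * (130 * real (h + d)) &
 encodes_report (out s') (changes (F bs) s' ?Om (contents (us @ [u]))) (%z. weighted_path (Tr s') (ph s' z))" for bs s'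
 have "EX s'. run_op w Ds u (F bs) = return_spmf s' & bits N s' = bs & Iv bs s' (apply_op u ?Om) & P bs s'" if bs: "bs : U" for bs
 proof (cases "u = Insert x")
 case True
 have "card (insert x ?Om) <= cap" using cap_contents[OF adu(4)] True by (simp add: contents_snoc)
 from insert_step[OF I[OF bs] xg this] True show ?thesis by (auto simp: P_def W_def contents_snoc)
 next
 case False
 hence "u = Delete x" using x by simp
 thus ?thesis using delete_step[OF I[OF bs] xg] by (auto simp: P_def W_def contents_snoc)
 qed
 from ok_snoc[where P = P, OF F this] obtain F' where F': "ok F' (us @ [u])"
 "!!bs. bs : U ==> run_op w Ds u (F bs) = return_spmf (F' bs) & P bs (F' bs)" by blast
 have "(\<integral>\<^sup>+ s'. ennreal (real (time s')) \<partial>measure_spmf (map_spmf F' (spmf_of_set U))) <= ennreal (2 ^ 54 * (real d * l + l^2))"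
 proof (rule nn_integral_uniform[OF U_fin(1,2)])
 show "0 <= real (time (F' bs)) & real (time (F' bs)) <= 443 * real (d * h) + W bs * (130 * real (h + d))" if "bs : U" for bs
 using F'(2)[OF that] by (simp add: P_def)
 have "(SUM bs:U. 443 * real (d * h) + W bs * (130 * real (h + d))) = 2 ^ N * (443 * real (d * h)) + (SUM bs:U. W bs) * (130 * real (h + d))"
 unfolding sum.distrib sum_distrib_right[symmetric] by (simp add: U_fin(3))
 also have "... <= 2 ^ N * (443 * real (d * h)) + 2 ^ N * (2 * real (m0 d D) + 5) * (130 * real (h + d))"
 using W by (intro add_left_mono mult_right_mono) auto
 also have "... = 2 ^ N * (443 * (real d * real (m0 d D)) + (2 * real (m0 d D) + 5) * (130 * (real (m0 d D) + real d)))"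
 by (simp add: h algebra_simps)
 also have "... <= 2 ^ N * (2 ^ 54 * (real d * l + l^2))"
 by (intro mult_left_mono update_budget d m l0) simp
 finally show "(SUM bs:U. 443 * real (d * h) + W bs * (130 * real (h + d))) <= rc U * (2 ^ 54 * (real d * l + l^2))"
 by (simp add: U_fin(3))
 qed
 moreover have "run_ops w Ds (us @ [u]) = map_spmf F' (spmf_of_set U)" using F'(1) by (simp add: ok_def)
 moreover have "encodes_report (out s')
 {x : contents (us @ [u]). x ~: ?Om | weighted_path (Tr s') (ph s' x) ~= weighted_path (Tr s) (ph s x)}
 (%x. weighted_path (Tr s') (ph s' x))" if s: "s : set_spmf (run_ops w Ds us)" and s': "s' : set_spmf (run_op w Ds u s)" for s s'
 proof -
 obtain bs where bs: "bs : U" "s = F bs" using s unfolding set by blast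
 hence "s' = F' bs" using s' F'(2)[OF bs(1)] by simp
 thus ?thesis using F'(2)[OF bs(1)] bs(2) by (simp add: P_def changes_def)
 qed
 ultimately show ?thesis by simp
 qed
 show ?thesis unfolding l_def[symmetric] using G1 G2 G3 G4 G5 G6 by blast
qed

end

theorem theorem4p1:
  shows "\<exists>(C :: real) (k :: nat) (c :: nat). \<forall>(d :: nat) (\<Delta> :: nat) (p :: real).
    d \<ge> 1 \<and> \<Delta> \<ge> 2 \<and> 1 \<le> p \<and> p \<le> 2 \<longrightarrow>
    (\<exists>D :: data_structure. \<forall>w :: nat.
      \<exists>(T :: state \<Rightarrow> wtree) (\<phi> :: state \<Rightarrow> nat list \<Rightarrow> nat).
      \<forall>us. admissible c w d \<Delta> us \<longrightarrow>
        lossless_spmf (run_ops w D us) \<and>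
        (\<forall>s\<in>set_spmf (run_ops w D us).
           rooted_weighted_tree (T s) \<and>
           (\<forall>x\<in>contents us. leaf (T s) (\<phi> s x)) \<and>
           non_contracting p (contents us) (T s) (\<phi> s)) \<and>
        (\<forall>us'. admissible c w d \<Delta> us' \<and> contents us' = contents us \<longrightarrow>
           map_spmf (\<lambda>s. iso_class (contents us) (T s, \<phi> s)) (run_ops w D us') =
           map_spmf (\<lambda>s. iso_class (contents us) (T s, \<phi> s)) (run_ops w D us)) \<and>
        (\<forall>x\<in>contents us. \<forall>y\<in>contents us.
           (\<integral>\<^sup>+ s. ennreal (tree_dist (T s) (\<phi> s x) (\<phi> s y)) \<partial>measure_spmf (run_ops w D us))
             \<le> ennreal (C * soft k (ln (real (card (contents us) * d * \<Delta>))) * lp_dist p x y)) \<and>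
        (\<forall>x\<in>contents us. \<forall>s\<in>set_spmf (run_ops w D us).
           lossless_spmf (run_op w D (Query x) s) \<and>
           (\<forall>s'\<in>set_spmf (run_op w D (Query x) s).
              real (time s') \<le> C * (real d * ln (real (d * \<Delta>))) \<and>
              encodes_path (out s') (weighted_path (T s) (\<phi> s x)) \<and>
              T s' = T s \<and> (\<forall>y\<in>contents us. \<phi> s' y = \<phi> s y))) \<and>
        (\<forall>u. (\<exists>x. u = Insert x \<or> u = Delete x) \<and> admissible c w d \<Delta> (us @ [u]) \<longrightarrow>
           (\<integral>\<^sup>+ s'. ennreal (real (time s')) \<partial>measure_spmf (run_ops w D (us @ [u])))
             \<le> ennreal (C * (real d * ln (real (d * \<Delta>)) + (ln (real (d * \<Delta>)))\<^sup>2)) \<and>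
           (\<forall>s\<in>set_spmf (run_ops w D us). \<forall>s'\<in>set_spmf (run_op w D u s).
              encodes_report (out s')
                {x \<in> contents (us @ [u]). x \<notin> contents us \<or>
                   weighted_path (T s') (\<phi> s' x) \<noteq> weighted_path (T s) (\<phi> s x)}
                (\<lambda>x. weighted_path (T s') (\<phi> s' x)))))"
\<comment> \<open>One logarithmic factor is enough in the soft bound: it stems from the number of
  halvings, which is logarithmic in log(m d \<Delta>). The 8 is the exponent with which words
  accommodate tables and records.\<close>
proof (rule exI[of _ "2 ^ 54"], rule exI[of _ 1], rule exI[of _ 8], intro allI impI, elim conjE, goal_cases)
 case (1 d D p)
 obtain sd :: "bool list => seed" where
 sd: "ALL bs. good_seed d D (sd bs)"
 "ALL Om x y. Om <= grid d D --> x : Om --> y : Om --> (SUM bs:{bs. length bs = (2 * d + 6) * m0 d D}. stretch p d D Om x y (sd bs)) <=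
 2 ^ ((2 * d + 6) * m0 d D) * (2 ^ 49 * soft 1 (ln (real (card Om * d * D))) * lp_dist p x y)"
 "ALL Om x. Om <= grid d D --> x : Om --> (SUM bs:{bs. length bs = (2 * d + 6) * m0 d D}. load d D Om x (sd bs)) <=
 2 ^ ((2 * d + 6) * m0 d D) * (2 * real (m0 d D) + 5)"
 using ex_seeds[OF 1] by blast
 show ?case
 proof (rule exI[of _ "structure_of p d D sd"], rule allI, goal_cases)
 case (1 w)
 show ?case
 proof (cases "(d * D) ^ 8 <= (2::nat) ^ w")
 \<comment> \<open>Words are too short even for one vector. Since the empty set counts with size 1
   in the word-length condition, not even the empty history is admissible.\<close>
 case False
 hence "~ admissible 8 w d D us" for us using admissible_room by blast
 thus ?thesis by blast
 next
 case True
 interpret machine p d D w sd by unfold_locales (use \<open>1 <= d\<close> \<open>2 <= D\<close> \<open>1 <= p\<close> \<open>p <= 2\<close> sd(1) True in auto)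
 have N: "(2 * d + 6) * m0 d D = N" by (simp add: N_def h_def)
 show ?thesis
 unfolding Ds_def[symmetric]
 by (rule exI[of _ Tr], rule exI[of _ ph], intro allI impI, rule main) (use sd(2,3) in "auto simp only: N")
 qed
 qed
qed

end
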